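(* There exist constants $C>0$ and $\varepsilon_0>0$ such that for every $0<\varepsilon<\varepsilon_0$, $\delta\in(0,1)$, $z\in M$, and every $T\ge C\big(s_0+\kappa_d(\varepsilon)^{-1}(\log N_\varepsilon(M)+\log\frac1\delta)\big)$, with $\mathbb P_z$-probability at least $1-\delta$, $$d_B\big(\mathrm{Dgm}_q(\Gamma_T),\mathrm{Dgm}_q(M)\big)\le C\varepsilon\qquad\text{for every degree }q.$$
   Context: Setting. $d\ge2$; homology has coefficients in a fixed field. $M\subset\mathbb R^d$ is the closure of a bounded connected open set. $d_M(x,y)$ is the infimum of the lengths of rectifiable curves in $M$ joining $x$ to $y$; $B_M(x,\varepsilon)=\{y\in M:d_M(x,y)<\varepsilon\}$; $\mu(A)=|A|/|M|$ is normalized Lebesgue measure on $M$. $M$ satisfies the following assumptions. (1) Positive reach: $\operatorname{reach}(M)>0$, i.e. every $z$ with $0<\operatorname{dist}(z,M)<\operatorname{reach}(M)$ has a unique nearest point in $M$. (2) There are $c_{ie}\ge1$, $\rho_{ie}>0$ with $d_M(x,y)\le c_{ie}|x-y|$ whenever $x,y\in M$, $|x-y|<\rho_{ie}$. (3) There are $c_{vol},C_{vol},\rho_{vol}>0$ with $c_{vol}\varepsilon^d\le\mu(B_M(x,\varepsilon))\le C_{vol}\varepsilon^d$ for all $x\in M$, $0<\varepsilon<\rho_{vol}$. (4) $M$ is an admissible reflecting domain: its boundary is regular enough that reflected Brownian motion in $M$ exists and is unique in law, has a symmetric Neumann heat kernel, the Neumann semigroup on $L^2(M,\mu)$ is compact,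 the Neumann spectrum is discrete with positive spectral gap, and there are $\rho_{ch}>0$, $L_{ch}\ge1$ such that every $x\in M$ has a neighbourhood $U_x\subset M$ and a chart $\Psi_x$ on $U_x$, bi-Lipschitz with constant $L_{ch}$ and with Jacobian determinants of $\Psi_x,\Psi_x^{-1}$ uniformly bounded above and below, mapping $U_x$ onto a Euclidean ball if $\operatorname{dist}(x,\partial M)\ge\rho_{ch}$ and onto a half-ball with $\partial M$ carried into the flat face if $\operatorname{dist}(x,\partial M)<\rho_{ch}$. (A compact connected Lipschitz domain with uniform chart constants suffices for (4).) (5) Heat-kernel domination: there are $s_0>0$, $a_{hk}\ge1$ such that the transition density $p_t(x,y)$ of the process below with respect to $\mu$ satisfies $p_t(x,y)\le a_{hk}$ for all $t\ge s_0$, $x,y\in M$. Process. $X=(X_t)_{t\ge0}$ is reflected Brownian motion in $M$: the conservative $\mu$-symmetric Hunt process with continuous paths associated with the Dirichlet form $\mathcal E(f,g)=\frac12\int_M\nabla f\cdot\nabla g\,d\mu$, $f,g\in H^1(M)$. $\mathbb P_z$ is its law started at $z$. Notation. $\Gamma_T=\{X_t:0\le t\le T\}$. For compact $K\subset\mathbb R^d$, $K^\rho=\{x\in\mathbb R^d:\operatorname{dist}(x,K)\le\rho\}$, and $\mathrm{Dgm}_q(K)$ is the degree-$q$ persistence diagram of the offset filtration $(K^\rho)_{\rho\ge0}$; $d_B$ is the bottleneck distance. $N_\varepsilon(M)$ is the least $N$ for which there are $x_1,\dots,x_N\in M$ with $M\subseteq\bigcup_iB_M(x_i,\varepsilon)$.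 $\kappa_2(\varepsilon)=(\log\varepsilon^{-1})^{-1}$ and $\kappa_d(\varepsilon)=\varepsilon^{d-2}$ for $d\ge3$. Constants may depend on $d$, $M$ and the constants in (1)-(5), but not on $T,\delta,\varepsilon,z$. *)

theory Defs
  imports "HOL-Probability.Probability" "HOL-Homology.Homology" "HOL-Library.Extended_Nat"
begin

section \<open>Geometry of the domain\<close>

text \<open>The supremum of the radii below which nearest points are unique; it is \<open>\<infinity>\<close> for convex closed sets.\<close>

definition reach :: "'a::metric_space set \<Rightarrow> ereal" where
  "reach M = Sup {ereal r | r. 0 \<le> r \<and>
     (\<forall>z. 0 < infdist z M \<and> infdist z M < r \<longrightarrow> (\<exists>!y. y \<in> M \<and> dist z y = infdist z M))}"

definition curve_length :: "(real \<Rightarrow> 'a::metric_space) \<Rightarrow> ennreal" where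
  "curve_length \<gamma> = (SUP ts \<in> {ts. sorted ts \<and> set ts \<subseteq> {0..1}}.
     ennreal (\<Sum>i<length ts - 1. dist (\<gamma> (ts ! i)) (\<gamma> (ts ! Suc i))))"

text \<open>The value is \<open>\<infinity>\<close> if no rectifiable curve in \<open>M\<close> joins the two points.\<close>

definition intrinsic_dist :: "'a::metric_space set \<Rightarrow> 'a \<Rightarrow> 'a \<Rightarrow> ennreal" where
  "intrinsic_dist M x y = Inf {curve_length \<gamma> | \<gamma>. path \<gamma> \<and> path_image \<gamma> \<subseteq> M \<and>
     pathstart \<gamma> = x \<and> pathfinish \<gamma> = y \<and> curve_length \<gamma> < \<infinity>}"

definition intrinsic_ball :: "'a::metric_space set \<Rightarrow> 'a \<Rightarrow> real \<Rightarrow> 'a set" where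
  "intrinsic_ball M x \<epsilon> = {y \<in> M. intrinsic_dist M x y < ennreal \<epsilon>}"

definition covering_number :: "'a::metric_space set \<Rightarrow> real \<Rightarrow> nat" where
  "covering_number M \<epsilon> = (LEAST N. \<exists>x::nat \<Rightarrow> 'a.
     (\<forall>i<N. x i \<in> M) \<and> M \<subseteq> (\<Union>i<N. intrinsic_ball M (x i) \<epsilon>))"

text \<open>Normalized Lebesgue measure on \<open>M\<close>, as a Borel measure on the whole space that is
  concentrated on \<open>M\<close>.\<close>

definition normalized_volume :: "'a::euclidean_space set \<Rightarrow> 'a measure" where
  "normalized_volume M = uniform_measure lborel M"

definition kappa :: "nat \<Rightarrow> real \<Rightarrow> real" where
  "kappa d \<epsilon> = (if d = 2 then inverse (ln (inverse \<epsilon>)) else \<epsilon> ^ (d - 2))"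

section \<open>Sobolev space and Neumann Dirichlet form\<close>

definition L2 :: "(real^'n) set \<Rightarrow> (real^'n \<Rightarrow> real) set" where
  "L2 M = {f. f \<in> borel_measurable borel \<and> integrable (normalized_volume M) (\<lambda>x. (f x)\<^sup>2)}"

definition L2_inner :: "(real^'n) set \<Rightarrow> (real^'n \<Rightarrow> real) \<Rightarrow> (real^'n \<Rightarrow> real) \<Rightarrow> real" where
  "L2_inner M f g = (\<integral>x. f x * g x \<partial>normalized_volume M)"

text \<open>\<open>D\<close> is the family of all iterated partial derivatives of \<open>\<phi>\<close>, indexed by lists of directions.\<close>

definition iterated_partials :: "(real^'n \<Rightarrow> real) \<Rightarrow> ('n list \<Rightarrow> real^'n \<Rightarrow> real) \<Rightarrow> bool" where
  "iterated_partials \<phi> D \<longleftrightarrow> D [] = \<phi> \<and>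
     (\<forall>l x. (D l has_derivative (\<lambda>h. \<Sum>i\<in>UNIV. h $ i * D (i # l) x)) (at x))"

text \<open>The pairs \<open>(\<phi>, D)\<close> range over smooth functions compactly supported in the interior of \<open>M\<close>
  together with their derivatives. The boundary plays no role in \<open>H\<^sup>1\<close>, so weak gradients are
  normalized to vanish off the interior.\<close>

definition is_weak_gradient ::
    "(real^'n) set \<Rightarrow> (real^'n \<Rightarrow> real) \<Rightarrow> (real^'n \<Rightarrow> real^'n) \<Rightarrow> bool" where
  "is_weak_gradient M f G \<longleftrightarrow>
     G \<in> borel_measurable borel \<and> integrable (normalized_volume M) (\<lambda>x. (norm (G x))\<^sup>2) \<and>
     (\<forall>x. x \<notin> interior M \<longrightarrow> G x = 0) \<and>
     (\<forall>\<phi> D K i. iterated_partials \<phi> D \<and> compact K \<and> K \<subseteq> interior M \<and> (\<forall>x. x \<notin> K \<longrightarrow> \<phi> x = 0) \<longrightarrow>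
        (\<integral>x. f x * D [i] x \<partial>normalized_volume M) = - (\<integral>x. G x $ i * \<phi> x \<partial>normalized_volume M))"

definition H1 :: "(real^'n) set \<Rightarrow> (real^'n \<Rightarrow> real) set" where
  "H1 M = {f \<in> L2 M. \<exists>G. is_weak_gradient M f G}"

definition weak_gradient :: "(real^'n) set \<Rightarrow> (real^'n \<Rightarrow> real) \<Rightarrow> real^'n \<Rightarrow> real^'n" where
  "weak_gradient M f = (SOME G. is_weak_gradient M f G)"

definition dirichlet_form :: "(real^'n) set \<Rightarrow> (real^'n \<Rightarrow> real) \<Rightarrow> (real^'n \<Rightarrow> real) \<Rightarrow> real" where
  "dirichlet_form M f g = 1/2 * (\<integral>x. weak_gradient M f x \<bullet> weak_gradient M g x \<partial>normalized_volume M)"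

section \<open>Neumann spectrum\<close>

text \<open>\<open>\<sigma>\<close> is in the resolvent set of the self-adjoint operator \<open>A\<close> of the form if \<open>A u - \<sigma> u = f\<close>
  has exactly one solution for every \<open>f \<in> L\<^sup>2\<close>. The spectrum of \<open>A\<close> is real.\<close>

definition resolvent_equation ::
    "(real^'n) set \<Rightarrow> real \<Rightarrow> (real^'n \<Rightarrow> real) \<Rightarrow> (real^'n \<Rightarrow> real) \<Rightarrow> bool" where
  "resolvent_equation M \<sigma> f u \<longleftrightarrow> u \<in> H1 M \<and>
     (\<forall>v\<in>H1 M. dirichlet_form M u v - \<sigma> * L2_inner M u v = L2_inner M f v)"

definition neumann_spectrum :: "(real^'n) set \<Rightarrow> real set" where
  "neumann_spectrum M = {\<sigma>. \<not> (\<forall>f\<in>L2 M. \<exists>u. resolvent_equation M \<sigma> f u \<and>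
     (\<forall>u'. resolvent_equation M \<sigma> f u' \<longrightarrow> (AE x in normalized_volume M. u' x = u x)))}"

definition neumann_eigenfunctions :: "(real^'n) set \<Rightarrow> real \<Rightarrow> (real^'n \<Rightarrow> real) set" where
  "neumann_eigenfunctions M \<sigma> = {u. resolvent_equation M \<sigma> (\<lambda>_. 0) u}"

definition discrete_neumann_spectrum :: "(real^'n) set \<Rightarrow> bool" where
  "discrete_neumann_spectrum M \<longleftrightarrow>
     (\<forall>\<sigma>\<in>neumann_spectrum M. \<not> \<sigma> islimpt neumann_spectrum M \<and>
        (\<exists>B. finite B \<and> B \<subseteq> neumann_eigenfunctions M \<sigma> \<and>
           (\<forall>u\<in>neumann_eigenfunctions M \<sigma>. \<exists>c. AE x in normalized_volume M. u x = (\<Sum>b\<in>B. c b * b x))))"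

definition positive_spectral_gap :: "(real^'n) set \<Rightarrow> bool" where
  "positive_spectral_gap M \<longleftrightarrow>
     (\<exists>g>0. \<forall>\<sigma>\<in>neumann_spectrum M. \<sigma> = 0 \<or> g \<le> \<sigma>) \<and>
     (\<forall>u\<in>neumann_eigenfunctions M 0. \<exists>c. AE x in normalized_volume M. u x = c)"

section \<open>Reflected Brownian motion\<close>

text \<open>A process consists of a measurable space \<open>N\<close>, random variables \<open>X t\<close> on it for \<open>t \<ge> 0\<close>, and
  probability measures \<open>P z\<close> on it for \<open>z \<in> M\<close>. Values at other \<open>t\<close> and \<open>z\<close> are irrelevant.\<close>

definition past :: "'w measure \<Rightarrow> (real \<Rightarrow> 'w \<Rightarrow> real^'n) \<Rightarrow> real \<Rightarrow> 'w set set" where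
  "past N X t = sigma_sets (space N) {X s -` B \<inter> space N | s B. 0 \<le> s \<and> s \<le> t \<and> B \<in> sets borel}"

text \<open>Stopping times of the right-continuous filtration \<open>t \<mapsto> \<Inter>s>t. past N X s\<close>, and the events
  known at such a time, both expressed through the raw filtration.\<close>

definition optional_time :: "'w measure \<Rightarrow> (real \<Rightarrow> 'w \<Rightarrow> real^'n) \<Rightarrow> ('w \<Rightarrow> ereal) \<Rightarrow> bool" where
  "optional_time N X \<tau> \<longleftrightarrow> (\<forall>\<omega>\<in>space N. 0 \<le> \<tau> \<omega>) \<and>
     (\<forall>t\<ge>0. {\<omega> \<in> space N. \<tau> \<omega> < ereal t} \<in> past N X t)"

definition past_at :: "'w measure \<Rightarrow> (real \<Rightarrow> 'w \<Rightarrow> real^'n) \<Rightarrow> ('w \<Rightarrow> ereal) \<Rightarrow> 'w set set" where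
  "past_at N X \<tau> = {A \<in> sets N. \<forall>t\<ge>0. {\<omega> \<in> A. \<tau> \<omega> < ereal t} \<in> past N X t}"

definition strong_markov ::
    "(real^'n) set \<Rightarrow> 'w measure \<Rightarrow> (real \<Rightarrow> 'w \<Rightarrow> real^'n) \<Rightarrow> (real^'n \<Rightarrow> 'w measure) \<Rightarrow> bool" where
  "strong_markov M N X P \<longleftrightarrow>
     (\<forall>z\<in>M. \<forall>\<tau>. optional_time N X \<tau> \<longrightarrow> (\<forall>A\<in>past_at N X \<tau>. \<forall>s\<ge>0. \<forall>B\<in>sets borel.
        emeasure (P z) {\<omega> \<in> A. \<tau> \<omega> < \<infinity> \<and> X (real_of_ereal (\<tau> \<omega>) + s) \<omega> \<in> B} =
        (\<integral>\<^sup>+\<omega>. indicator {\<omega> \<in> A. \<tau> \<omega> < \<infinity>} \<omega> *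
            emeasure (P (X (real_of_ereal (\<tau> \<omega>)) \<omega>)) {\<omega>' \<in> space N. X s \<omega>' \<in> B} \<partial>P z)))"

text \<open>The process lives in \<open>M\<close> for all times, so that it is conservative and no cemetery state is
  needed; quasi-left-continuity is implied by the continuity of the paths.\<close>

definition continuous_hunt_process ::
    "(real^'n) set \<Rightarrow> 'w measure \<Rightarrow> (real \<Rightarrow> 'w \<Rightarrow> real^'n) \<Rightarrow> (real^'n \<Rightarrow> 'w measure) \<Rightarrow> bool" where
  "continuous_hunt_process M N X P \<longleftrightarrow>
     (\<forall>t\<ge>0. X t \<in> N \<rightarrow>\<^sub>M borel) \<and>
     (\<forall>\<omega>\<in>space N. (\<forall>t\<ge>0. X t \<omega> \<in> M) \<and> continuous_on {0..} (\<lambda>t. X t \<omega>)) \<and>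
     (\<forall>z\<in>M. prob_space (P z) \<and> sets (P z) = sets N) \<and>
     (\<forall>t\<ge>0. \<forall>B\<in>sets borel.
        (\<lambda>z. emeasure (P z) {\<omega> \<in> space N. X t \<omega> \<in> B}) \<in> borel_measurable (restrict_space borel M)) \<and>
     (\<forall>z\<in>M. AE \<omega> in P z. X 0 \<omega> = z) \<and>
     strong_markov M N X P"

definition transition_op ::
    "(real^'n) set \<Rightarrow> (real \<Rightarrow> 'w \<Rightarrow> real^'n) \<Rightarrow> (real^'n \<Rightarrow> 'w measure) \<Rightarrow>
     real \<Rightarrow> (real^'n \<Rightarrow> real) \<Rightarrow> real^'n \<Rightarrow> real" where
  "transition_op M X P t f z = (if z \<in> M then \<integral>\<omega>. f (X t \<omega>) \<partial>P z else 0)"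

definition symmetric_process ::
    "(real^'n) set \<Rightarrow> (real \<Rightarrow> 'w \<Rightarrow> real^'n) \<Rightarrow> (real^'n \<Rightarrow> 'w measure) \<Rightarrow> bool" where
  "symmetric_process M X P \<longleftrightarrow>
     (\<forall>t\<ge>0. \<forall>f\<in>L2 M. \<forall>g\<in>L2 M.
        L2_inner M (transition_op M X P t f) g = L2_inner M f (transition_op M X P t g))"

text \<open>The Dirichlet form of a symmetric process is the limit of the approximating forms
  \<open>(f - P\<^sub>t f, g) / t\<close> as \<open>t \<rightarrow> 0\<close>; its domain consists of the \<open>f \<in> L\<^sup>2\<close> for which the limit with
  \<open>g = f\<close> is finite. Here this form is required to be \<open>(\<E>, H\<^sup>1)\<close>.\<close>

definition approximating_form ::
    "(real^'n) set \<Rightarrow> (real \<Rightarrow> 'w \<Rightarrow> real^'n) \<Rightarrow> (real^'n \<Rightarrow> 'w measure) \<Rightarrow>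
     real \<Rightarrow> (real^'n \<Rightarrow> real) \<Rightarrow> (real^'n \<Rightarrow> real) \<Rightarrow> real" where
  "approximating_form M X P t f g = L2_inner M (\<lambda>x. f x - transition_op M X P t f x) g / t"

definition associated_with_dirichlet_form ::
    "(real^'n) set \<Rightarrow> (real \<Rightarrow> 'w \<Rightarrow> real^'n) \<Rightarrow> (real^'n \<Rightarrow> 'w measure) \<Rightarrow> bool" where
  "associated_with_dirichlet_form M X P \<longleftrightarrow>
     (\<forall>f\<in>L2 M. f \<in> H1 M \<longleftrightarrow> (\<exists>L. ((\<lambda>t. approximating_form M X P t f f) \<longlongrightarrow> L) (at_right 0))) \<and>
     (\<forall>f\<in>H1 M. \<forall>g\<in>H1 M.
        ((\<lambda>t. approximating_form M X P t f g) \<longlongrightarrow> dirichlet_form M f g) (at_right 0))"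

text \<open>A Dirichlet form determines its process only up to an exceptional set of starting points.
  The last condition removes this ambiguity, so that uniqueness in law can be meant for every
  starting point.\<close>

definition reflected_brownian_motion ::
    "(real^'n) set \<Rightarrow> 'w measure \<Rightarrow> (real \<Rightarrow> 'w \<Rightarrow> real^'n) \<Rightarrow> (real^'n \<Rightarrow> 'w measure) \<Rightarrow> bool" where
  "reflected_brownian_motion M N X P \<longleftrightarrow>
     continuous_hunt_process M N X P \<and> symmetric_process M X P \<and>
     associated_with_dirichlet_form M X P \<and>
     (\<forall>z\<in>M. \<forall>t>0. absolutely_continuous (normalized_volume M) (distr (P z) borel (X t)))"

text \<open>Symmetry and the Chapman-Kolmogorov identity at all points single out one version of the
  density, so that pointwise bounds on it are meaningful.\<close>

definition heat_kernel ::
    "(real^'n) set \<Rightarrow> 'w measure \<Rightarrow> (real \<Rightarrow> 'w \<Rightarrow> real^'n) \<Rightarrow> (real^'n \<Rightarrow> 'w measure) \<Rightarrow>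
     (real \<Rightarrow> real^'n \<Rightarrow> real^'n \<Rightarrow> real) \<Rightarrow> bool" where
  "heat_kernel M N X P p \<longleftrightarrow>
     (\<forall>t>0.
        case_prod (p t) \<in> borel_measurable (restrict_space borel M \<Otimes>\<^sub>M restrict_space borel M) \<and>
        (\<forall>x\<in>M. \<forall>y\<in>M. 0 \<le> p t x y \<and> p t x y = p t y x) \<and>
        (\<forall>x\<in>M. \<forall>B\<in>sets borel. emeasure (P x) {\<omega> \<in> space N. X t \<omega> \<in> B} =
           (\<integral>\<^sup>+y. indicator (M \<inter> B) y * ennreal (p t x y) \<partial>normalized_volume M)) \<and>
        (\<forall>s>0. \<forall>x\<in>M. \<forall>y\<in>M. ennreal (p (s + t) x y) =
           (\<integral>\<^sup>+w. indicator M w * ennreal (p s x w * p t w y) \<partial>normalized_volume M)))"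

definition compact_on_L2 ::
    "(real^'n) set \<Rightarrow> ((real^'n \<Rightarrow> real) \<Rightarrow> real^'n \<Rightarrow> real) \<Rightarrow> bool" where
  "compact_on_L2 M T \<longleftrightarrow>
     (\<forall>f::nat \<Rightarrow> _. (\<forall>k. f k \<in> L2 M \<and> L2_inner M (f k) (f k) \<le> 1) \<longrightarrow>
        (\<exists>g\<in>L2 M. \<exists>r::nat \<Rightarrow> nat. strict_mono r \<and>
           (\<forall>k. T (f (r k)) \<in> L2 M) \<and>
           (\<lambda>k. L2_inner M (\<lambda>x. T (f (r k)) x - g x) (\<lambda>x. T (f (r k)) x - g x)) \<longlonglongrightarrow> 0))"

definition path_law ::
    "(real \<Rightarrow> 'w \<Rightarrow> real^'n) \<Rightarrow> 'w measure \<Rightarrow> (real \<Rightarrow> real^'n) measure" where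
  "path_law X Q = distr Q (PiM {0..} (\<lambda>_. borel)) (\<lambda>\<omega>. \<lambda>t\<in>{0..}. X t \<omega>)"

section \<open>Admissible reflecting domains\<close>

definition half_ball :: "'a::euclidean_space \<Rightarrow> real \<Rightarrow> 'a \<Rightarrow> 'a set" where
  "half_ball c r e = {y \<in> ball c r. 0 \<le> (y - c) \<bullet> e}"

definition flat_face :: "'a::euclidean_space \<Rightarrow> real \<Rightarrow> 'a \<Rightarrow> 'a set" where
  "flat_face c r e = {y \<in> ball c r. (y - c) \<bullet> e = 0}"

definition jacobian_bounded :: "(real^'n) set \<Rightarrow> (real^'n \<Rightarrow> real^'n) \<Rightarrow> real \<Rightarrow> bool" where
  "jacobian_bounded U \<Psi> J \<longleftrightarrow> (AE y in lebesgue. y \<in> U \<longrightarrow>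
     (\<exists>D. (\<Psi> has_derivative D) (at y within U) \<and> 1 / J \<le> \<bar>det (matrix D)\<bar> \<and> \<bar>det (matrix D)\<bar> \<le> J))"

definition uniform_charts :: "(real^'n) set \<Rightarrow> real \<Rightarrow> real \<Rightarrow> bool" where
  "uniform_charts M \<rho> L \<longleftrightarrow>
     (\<exists>J\<ge>1. \<forall>x\<in>M. \<exists>U \<Psi>. x \<in> U \<and> openin (top_of_set M) U \<and>
        (\<forall>y\<in>U. \<forall>y'\<in>U. dist y y' / L \<le> dist (\<Psi> y) (\<Psi> y') \<and> dist (\<Psi> y) (\<Psi> y') \<le> L * dist y y') \<and>
        jacobian_bounded U \<Psi> J \<and> jacobian_bounded (\<Psi> ` U) (inv_into U \<Psi>) J \<and>
        (\<exists>c r. 0 < r \<and>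
           (if \<rho> \<le> infdist x (frontier M) then \<Psi> ` U = ball c r
            else \<exists>e. norm e = 1 \<and> \<Psi> ` U = half_ball c r e \<and>
                     \<Psi> ` (U \<inter> frontier M) \<subseteq> flat_face c r e)))"

text \<open>Existence and uniqueness in law are stated for processes defined on a space of functions
  \<open>real \<Rightarrow> real^'n\<close>; every process has a realization on such a space, as its space of paths.\<close>

definition admissible_reflecting_domain :: "(real^'n) set \<Rightarrow> real \<Rightarrow> real \<Rightarrow> bool" where
  "admissible_reflecting_domain M \<rho> L \<longleftrightarrow>
     (\<exists>(N :: (real \<Rightarrow> real^'n) measure) X P. reflected_brownian_motion M N X P \<and>
        (\<exists>p. heat_kernel M N X P p) \<and>
        (\<forall>t>0. compact_on_L2 M (transition_op M X P t))) \<and>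
     (\<forall>(N :: (real \<Rightarrow> real^'n) measure) X P (N' :: (real \<Rightarrow> real^'n) measure) X' P'.
        reflected_brownian_motion M N X P \<and> reflected_brownian_motion M N' X' P' \<longrightarrow>
        (\<forall>z\<in>M. path_law X (P z) = path_law X' (P' z))) \<and>
     discrete_neumann_spectrum M \<and> positive_spectral_gap M \<and>
     uniform_charts M \<rho> L"

section \<open>Persistent homology of offset filtrations\<close>

text \<open>Singular chains with coefficients in a field \<open>'k\<close>; the library's chains are integral.\<close>

type_synonym ('a, 'k) field_chain = "((nat \<Rightarrow> real) \<Rightarrow> 'a) \<Rightarrow>\<^sub>0 'k"

definition field_chain_boundary :: "nat \<Rightarrow> ('a, 'k::field) field_chain \<Rightarrow> ('a, 'k) field_chain" where
  "field_chain_boundary q c = (if q = 0 then 0 else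
     (\<Sum>f\<in>Poly_Mapping.keys c. \<Sum>i\<le>q.
        Poly_Mapping.single (singular_face q i f) ((- 1) ^ i * Poly_Mapping.lookup c f)))"

definition singular_chains :: "nat \<Rightarrow> 'a topology \<Rightarrow> ('a, 'k::field) field_chain set" where
  "singular_chains q X = {c. Poly_Mapping.keys c \<subseteq> singular_simplex_set q X}"

definition singular_cycles :: "nat \<Rightarrow> 'a topology \<Rightarrow> ('a, 'k::field) field_chain set" where
  "singular_cycles q X = {c \<in> singular_chains q X. field_chain_boundary q c = 0}"

definition singular_boundaries :: "nat \<Rightarrow> 'a topology \<Rightarrow> ('a, 'k::field) field_chain set" where
  "singular_boundaries q X = field_chain_boundary (Suc q) ` singular_chains (Suc q) X"

text \<open>Rank of the map \<open>H\<^sub>q(X) \<rightarrow> H\<^sub>q(Y)\<close> induced by an inclusion of \<open>X\<close> into \<open>Y\<close>: its image consists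
  of the classes in \<open>H\<^sub>q(Y)\<close> of the cycles of \<open>X\<close>, and finitely many such classes are linearly
  independent iff no nontrivial combination of the cycles is a boundary in \<open>Y\<close>.\<close>

definition inclusion_rank :: "'k::field itself \<Rightarrow> nat \<Rightarrow> 'a topology \<Rightarrow> 'a topology \<Rightarrow> enat" where
  "inclusion_rank _ q X Y = Sup {enat (card S) | S :: ('a, 'k) field_chain set.
     finite S \<and> S \<subseteq> singular_cycles q X \<and>
     (\<forall>a. (\<Sum>c\<in>S. Poly_Mapping.map ((*) (a c)) c) \<in> singular_boundaries q Y \<longrightarrow> (\<forall>c\<in>S. a c = 0))}"

definition offset :: "'a::metric_space set \<Rightarrow> real \<Rightarrow> 'a set" where
  "offset K \<rho> = {x. infdist x K \<le> \<rho>}"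

text \<open>The persistence module is extended by \<open>0\<close> to negative parameters and to \<open>\<infinity>\<close>.\<close>

definition offset_rank ::
    "'k::field itself \<Rightarrow> nat \<Rightarrow> 'a::metric_space set \<Rightarrow> real \<Rightarrow> ereal \<Rightarrow> enat" where
  "offset_rank k q K s t = (if s < 0 \<or> t = \<infinity> then 0
     else inclusion_rank k q (top_of_set (offset K s)) (top_of_set (offset K (real_of_ereal t))))"

text \<open>Number of diagram points in the rectangle \<open>[a,b] \<times> [c,d]\<close>. For \<open>b < c\<close> all ranks involved are
  finite if \<open>K\<close> is compact.\<close>

definition rectangle_measure ::
    "'k::field itself \<Rightarrow> nat \<Rightarrow> 'a::metric_space set \<Rightarrow> real \<Rightarrow> real \<Rightarrow> real \<Rightarrow> ereal \<Rightarrow> int" where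
  "rectangle_measure k q K a b c d =
     int (the_enat (offset_rank k q K b (ereal c))) - int (the_enat (offset_rank k q K a (ereal c)))
     - int (the_enat (offset_rank k q K b d)) + int (the_enat (offset_rank k q K a d))"

text \<open>A persistence diagram is the multiplicity function of a multiset of points (birth, death)
  above the diagonal; the death time may be \<open>\<infinity>\<close>. The multiplicity of a point is the least measure
  of a rectangle having it in its interior (relative to the extended half-plane).\<close>

type_synonym diagram = "real \<times> ereal \<Rightarrow> nat"

definition persistence_diagram ::
    "'k::field itself \<Rightarrow> nat \<Rightarrow> 'a::metric_space set \<Rightarrow> diagram" where
  "persistence_diagram k q K = (\<lambda>(b, d). if ereal b < d then
     nat (Inf {rectangle_measure k q K a b' c d' | a b' c d'.
        a < b \<and> b < b' \<and> b' < c \<and> ereal c < d \<and> (d < d' \<or> (d = \<infinity> \<and> d' = \<infinity>))}) else 0)"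

definition diagram_points :: "diagram \<Rightarrow> ((real \<times> ereal) \<times> nat) set" where
  "diagram_points D = {(x, i). i < D x}"

text \<open>The case distinction is needed because \<open>\<infinity> - \<infinity>\<close> is not \<open>0\<close> in \<open>ereal\<close>.\<close>

definition linf_dist :: "real \<times> ereal \<Rightarrow> real \<times> ereal \<Rightarrow> ereal" where
  "linf_dist x y = max (ereal \<bar>fst x - fst y\<bar>) (if snd x = snd y then 0 else \<bar>snd x - snd y\<bar>)"

text \<open>A partial matching of cost at most \<open>\<eta>\<close>. The \<open>\<ell>\<^sub>\<infinity>\<close> distance of \<open>(b, d)\<close> to the diagonal is
  \<open>(d - b) / 2\<close>.\<close>

definition diagram_matching ::
    "real \<Rightarrow> diagram \<Rightarrow> diagram \<Rightarrow> bool" where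
  "diagram_matching \<eta> D D' \<longleftrightarrow> (\<exists>A B m. A \<subseteq> diagram_points D \<and> B \<subseteq> diagram_points D' \<and>
     bij_betw m A B \<and> (\<forall>x\<in>A. linf_dist (fst x) (fst (m x)) \<le> ereal \<eta>) \<and>
     (\<forall>((b, d), i) \<in> (diagram_points D - A) \<union> (diagram_points D' - B). d - ereal b \<le> ereal (2 * \<eta>)))"

definition bottleneck_dist :: "diagram \<Rightarrow> diagram \<Rightarrow> ereal" where
  "bottleneck_dist D D' = Inf {ereal \<eta> | \<eta>. 0 \<le> \<eta> \<and> diagram_matching \<eta> D D'}"

end

theory Submission
  imports Defs
begin

text \<open>Suppose that every point of \<open>M\<close> is within \<open>2 * \<epsilon>\<close> of the path up to time \<open>T\<close>. The path runs in \<open>M\<close>,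
  so the stability of offset filtrations bounds the bottleneck distance by \<open>2 * \<epsilon>\<close>. For this it is
  enough that the path hits each of the \<open>N\<close> balls of an optimal covering, and by a union bound that it
  misses each of them with probability at most \<open>\<delta> / N\<close>. Hence the probability to miss a ball of radius
  \<open>\<epsilon>\<close> up to time \<open>T\<close> must decay in \<open>T\<close> at a rate of order \<open>kappa d \<epsilon>\<close>, uniformly over the balls and the
  starting points.

  The rate comes from an inequality \<open>\<parallel>g\<parallel>\<^sup>2 \<le> A / kappa d \<epsilon> * \<E> g g + A' * \<integral>\<^bsub>B\<^esub> g\<^sup>2\<close> for \<open>g\<close> in \<open>H\<^sup>1\<close>, where
  \<open>A\<close> depends neither on \<open>\<epsilon>\<close> nor on the ball \<open>B\<close> (\<open>poincare_with_ball\<close>). The Neumann Poincare inequality,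
  which follows from the compactness of the semigroup and the simplicity of the eigenvalue \<open>0\<close>, reduces
  it to the comparison of a weighted mean of \<open>g\<close> near the centre of \<open>B\<close> with one at a fixed scale. Their
  difference is the integral of the gradient of \<open>g\<close> against an explicit vector field in a cone with
  vertex at the centre of \<open>B\<close> (\<open>weighted_means_difference\<close>). The field is of size \<open>height\<^sup>1\<^sup>-\<^sup>d\<close>, so its
  energy is of order \<open>ln (1 / \<epsilon>)\<close> for \<open>d = 2\<close> and \<open>\<epsilon>\<^sup>2\<^sup>-\<^sup>d\<close> for \<open>d \<ge> 3\<close>, which is \<open>1 / kappa d \<epsilon>\<close>. Cones of
  fixed size in \<open>M\<close> exist at all points because the reach is positive and small balls have
  a definite share of the volume (\<open>uniform_interior_cones\<close>).

  The decay follows from the inequality and two properties of the semigroup. The function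
  \<open>t \<mapsto> (f - P\<^sub>t f, f)\<close> is increasing and concave, and hence \<open>P\<^sub>h\<^sub>/\<^sub>2 f\<close> has energy at most \<open>(f - P\<^sub>h f, f) / h\<close>.
  If \<open>f\<close> vanishes on \<open>B\<close>, the inequality for \<open>P\<^sub>h\<^sub>/\<^sub>2 f\<close> shows that \<open>P\<^sub>h\<close> contracts the quadratic form
  at \<open>f\<close> by a factor \<open>1 - c * h\<close>, provided that \<open>h\<close> is small. The process observed at the multiples of
  \<open>h\<close> therefore avoids \<open>B\<close> with exponentially small probability, first for a start in the invariant
  measure and then, by the bound on the heat kernel at time \<open>s\<^sub>0\<close>, for every starting point
  (\<open>avoid_decay\<close>, \<open>miss_probability\<close>). The factor \<open>a_hk\<close> is absorbed by the constant since \<open>N \<ge> 2\<close> for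
  small \<open>\<epsilon>\<close>.

  Diagrams are given by the ranks of the maps between the homology groups of offsets, so stability is
  proved for ranks. If \<open>K\<close> and \<open>L\<close> have Hausdorff distance at most \<open>\<eta>\<close>, the ranks of the maps from
  \<open>H (K\<^sup>s)\<close> to \<open>H (L\<^sup>t\<^sup>+\<^sup>\<eta>)\<close> form a rank function between those of \<open>K\<close> and \<open>L\<close>, and exchange inequalities between
  the three yield a matching of the points (\<open>diagram_matching_if_ranks\<close>). The ranks are finite because
  cycles can be straightened to simplices with vertices in a finite net (\<open>inclusion_rank_finite\<close>).
  Stability also gives the measurability of the event in question: its defining condition is closed
  for the Hausdorff distance, and a path is approximated by finite sets
  (\<open>diagram_event_measurable\<close>).\<close>

section \<open>Ranks modulo a subspace\<close>

lemma enat_Sup_add_Sup_le: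
  fixes A B :: "enat set"
  assumes "A \<noteq> {}" "B \<noteq> {}" and le: "\<And>x y. x \<in> A \<Longrightarrow> y \<in> B \<Longrightarrow> x + y \<le> c"
  shows "Sup A + Sup B \<le> c"
proof (cases c)
  case (enat n)
  have "x \<le> c" if "x \<in> A \<or> x \<in> B" for x
    using that assms by (metis all_not_in_conv add.commute le_iff_add order_trans)
  then have "finite A" "finite B"
    by (auto intro!: finite_subset[OF _ finite_enat_bounded] simp: enat)
  then show ?thesis
    using assms by (simp add: Sup_enat_def)
qed simp

locale rank_space = vector_space
begin

definition indep_mod :: "'b set \<Rightarrow> 'b set \<Rightarrow> bool" where
  "indep_mod W S \<longleftrightarrow> (\<forall>a. (\<Sum>c\<in>S. scale (a c) c) \<in> W \<longrightarrow> (\<forall>c\<in>S. a c = 0))"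

text \<open>The dimension of the image of \<open>V\<close> in the quotient by \<open>W\<close>, without reference to quotient spaces.\<close>

definition rank_mod :: "'b set \<Rightarrow> 'b set \<Rightarrow> enat" where
  "rank_mod V W = Sup {enat (card S) | S. finite S \<and> S \<subseteq> V \<and> indep_mod W S}"

lemma card_le_rank_mod: "finite S \<Longrightarrow> S \<subseteq> V \<Longrightarrow> indep_mod W S \<Longrightarrow> enat (card S) \<le> rank_mod V W"
  unfolding rank_mod_def by (intro Sup_upper) auto

lemma rank_mod_le:
  "(\<And>S. finite S \<Longrightarrow> S \<subseteq> V \<Longrightarrow> indep_mod W S \<Longrightarrow> enat (card S) \<le> c) \<Longrightarrow> rank_mod V W \<le> c"
  unfolding rank_mod_def by (intro Sup_least) auto

lemma indep_mod_antimono: "indep_mod W' S \<Longrightarrow> W \<subseteq> W' \<Longrightarrow> indep_mod W S"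
  unfolding indep_mod_def by blast

lemma indep_modD: "indep_mod W S \<Longrightarrow> (\<Sum>c\<in>S. scale (a c) c) \<in> W \<Longrightarrow> c \<in> S \<Longrightarrow> a c = 0"
  unfolding indep_mod_def by blast

lemma rank_mod_mono: "Z \<subseteq> Z' \<Longrightarrow> W \<subseteq> W' \<Longrightarrow> rank_mod Z W' \<le> rank_mod Z' W"
  by (intro rank_mod_le card_le_rank_mod) (auto intro: indep_mod_antimono)

text \<open>A family in \<open>Z\<close> that is independent modulo \<open>W\<close> and one that is independent modulo \<open>Z + W\<close> combine
  to a family that is independent modulo \<open>W\<close>. With the reverse inequality below, the rank is additive
  along \<open>W \<subseteq> Z + W \<subseteq> Z' + W\<close>.\<close>

lemma rank_mod_add_ge:
  assumes "subspace Z" "subspace W" "Z \<subseteq> Z'"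
  shows "rank_mod Z W + rank_mod Z' {z + w | z w. z \<in> Z \<and> w \<in> W} \<le> rank_mod Z' W"
proof -
  let ?ZW = "{z + w | z w. z \<in> Z \<and> w \<in> W}"
  have "enat (card S) + enat (card T) \<le> rank_mod Z' W"
    if S: "finite S" "S \<subseteq> Z" "indep_mod W S" and T: "finite T" "T \<subseteq> Z'" "indep_mod ?ZW T" for S T
  proof -
    have 0: "0 \<in> W" "0 \<in> Z" using assms by (auto simp: subspace_0)
    have sumZ: "(\<Sum>c\<in>S'. scale (a c) c) \<in> Z" if "S' \<subseteq> S" for a S'
      using that S assms(1) by (intro subspace_sum subspace_scale) auto
    have disj: "S \<inter> T = {}"
    proof (rule ccontr)
      assume "S \<inter> T \<noteq> {}"
      then obtain v where v: "v \<in> S" "v \<in> T" by blast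
      have "(\<Sum>c\<in>T. scale (if c = v then 1 else 0) c) = (\<Sum>c\<in>T. if c = v then v else 0)"
        by (intro sum.cong) auto
      also have "\<dots> = v" using v T by simp
      finally have "(\<Sum>c\<in>T. scale (if c = v then 1 else 0) c) = v" .
      moreover have "v \<in> ?ZW" using v S 0 by (intro CollectI exI[of _ v] exI[of _ 0]) auto
      ultimately have "(\<Sum>c\<in>T. scale (if c = v then 1 else 0) c) \<in> ?ZW" by simp
      from indep_modD[OF T(3) this v(2)] show False by simp
    qed
    have ind: "indep_mod W (S \<union> T)"
      unfolding indep_mod_def
    proof (intro allI impI)
      fix a assume *: "(\<Sum>c\<in>S \<union> T. scale (a c) c) \<in> W"
      have eq: "(\<Sum>c\<in>S \<union> T. scale (a c) c) = (\<Sum>c\<in>S. scale (a c) c) + (\<Sum>c\<in>T. scale (a c) c)"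
        using S T disj by (intro sum.union_disjoint) auto
      then have "(\<Sum>c\<in>T. scale (a c) c) = - (\<Sum>c\<in>S. scale (a c) c) + (\<Sum>c\<in>S \<union> T. scale (a c) c)"
        by simp
      moreover have "- (\<Sum>c\<in>S. scale (a c) c) \<in> Z"
        using sumZ[of S a] assms(1) by (auto intro: subspace_neg)
      ultimately have "(\<Sum>c\<in>T. scale (a c) c) \<in> ?ZW"
        using * by (intro CollectI exI conjI) auto
      then have T0: "\<forall>c\<in>T. a c = 0" using T(3) unfolding indep_mod_def by blast
      then have "(\<Sum>c\<in>S. scale (a c) c) \<in> W" using * eq by simp
      then show "\<forall>c\<in>S \<union> T. a c = 0" using T0 S(3) unfolding indep_mod_def by blast
    qed
    have "enat (card (S \<union> T)) \<le> rank_mod Z' W"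
      using S T assms ind by (intro card_le_rank_mod) auto
    then show ?thesis using S T disj by (simp add: card_Un_disjoint)
  qed
  then show ?thesis
    unfolding rank_mod_def[of Z W] rank_mod_def[of Z' ?ZW]
    by (intro enat_Sup_add_Sup_le) (auto simp: indep_mod_def)
qed

lemma rank_mod_add_le:
  assumes "subspace Z" "subspace W"
  shows "rank_mod Z' W \<le> rank_mod Z W + rank_mod Z' {z + w | z w. z \<in> Z \<and> w \<in> W}"
proof (rule rank_mod_le)
  let ?ZW = "{z + w | z w. z \<in> Z \<and> w \<in> W}"
  fix S assume S: "finite S" "S \<subseteq> Z'" "indep_mod W S"
  have "finite {T. T \<subseteq> S \<and> indep_mod ?ZW T}" using S by auto
  moreover have "{} \<in> {T. T \<subseteq> S \<and> indep_mod ?ZW T}" by (auto simp: indep_mod_def)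
  ultimately have "\<exists>T\<in>{T. T \<subseteq> S \<and> indep_mod ?ZW T}. {} \<le> T \<and>
      (\<forall>T'\<in>{T. T \<subseteq> S \<and> indep_mod ?ZW T}. T \<le> T' \<longrightarrow> T = T')"
    by (rule finite_has_maximal2)
  then obtain T where T_in: "T \<in> {T. T \<subseteq> S \<and> indep_mod ?ZW T}"
    and T_max: "\<forall>T'\<in>{T. T \<subseteq> S \<and> indep_mod ?ZW T}. T \<le> T' \<longrightarrow> T = T'"
    by (elim bexE conjE)
  have T: "T \<subseteq> S" "indep_mod ?ZW T" using T_in by simp_all
  have max: "T = T'" if "T' \<subseteq> S" "indep_mod ?ZW T'" "T \<subseteq> T'" for T'
    using bspec[OF T_max, of T'] that by simp
  have fT: "finite T" using S T finite_subset by blast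
  \<comment> \<open>by maximality, every further element of \<open>S\<close> is a combination of \<open>T\<close> up to \<open>Z + W\<close>\<close>
  have "\<exists>z w b. z \<in> Z \<and> w \<in> W \<and> s = z + w + (\<Sum>c\<in>T. scale (b c) c)" if s: "s \<in> S - T" for s
  proof -
    have "\<not> indep_mod ?ZW (insert s T)" using max[of "insert s T"] s T by auto
    then obtain a where a: "(\<Sum>c\<in>insert s T. scale (a c) c) \<in> ?ZW" "\<exists>c\<in>insert s T. a c \<noteq> 0"
      unfolding indep_mod_def by blast
    have eq: "(\<Sum>c\<in>insert s T. scale (a c) c) = scale (a s) s + (\<Sum>c\<in>T. scale (a c) c)"
      using s fT by simp
    have nz: "a s \<noteq> 0"
    proof
      assume "a s = 0"
      then have "(\<Sum>c\<in>T. scale (a c) c) \<in> ?ZW" using a eq by simp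
      then have "\<forall>c\<in>T. a c = 0" using T(2) unfolding indep_mod_def by blast
      then show False using a(2) \<open>a s = 0\<close> by auto
    qed
    obtain z w where zw: "z \<in> Z" "w \<in> W" "scale (a s) s + (\<Sum>c\<in>T. scale (a c) c) = z + w"
      using a(1) eq by auto
    then have "scale (a s) s = z + w - (\<Sum>c\<in>T. scale (a c) c)"
      by (simp add: eq_diff_eq)
    then have "scale (inverse (a s)) (scale (a s) s) = scale (inverse (a s)) z + scale (inverse (a s)) w
        - (\<Sum>c\<in>T. scale (inverse (a s)) (scale (a c) c))"
      by (simp add: scale_right_diff_distrib scale_right_distrib scale_sum_right)
    then have "s = scale (inverse (a s)) z + scale (inverse (a s)) w
        + (\<Sum>c\<in>T. scale (- inverse (a s) * a c) c)"
      using nz by (simp add: sum_negf)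
    then show ?thesis using zw assms by (metis subspace_scale)
  qed
  then obtain z w b where zwb: "\<And>s. s \<in> S - T \<Longrightarrow> z s \<in> Z \<and> w s \<in> W \<and> s = z s + w s + (\<Sum>c\<in>T. scale (b s c) c)"
    by metis
  \<comment> \<open>so the \<open>Z\<close>-parts of these elements are independent modulo \<open>W\<close>\<close>
  have key: "\<forall>s\<in>S - T. a s = 0" if *: "(\<Sum>s\<in>S - T. scale (a s) (z s)) \<in> W" for a
  proof -
    have expand: "scale (a s) s = scale (a s) (z s) + scale (a s) (w s) + (\<Sum>c\<in>T. scale (a s * b s c) c)"
      if "s \<in> S - T" for s
    proof -
      have "s = z s + w s + (\<Sum>c\<in>T. scale (b s c) c)" using zwb that by blast
      then have "scale (a s) s = scale (a s) (z s + w s + (\<Sum>c\<in>T. scale (b s c) c))"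
        by (rule arg_cong)
      then show ?thesis by (simp only: scale_right_distrib scale_sum_right scale_scale)
    qed
    let ?a = "\<lambda>c. if c \<in> T then - (\<Sum>s\<in>S - T. a s * b s c) else a c"
    have "(\<Sum>c\<in>S. scale (?a c) c) = (\<Sum>c\<in>T. scale (?a c) c) + (\<Sum>s\<in>S - T. scale (?a s) s)"
      using S T by (metis (no_types, lifting) sum.subset_diff add.commute)
    also have "(\<Sum>s\<in>S - T. scale (?a s) s) = (\<Sum>s\<in>S - T. scale (a s) s)"
      by (intro sum.cong) auto
    also have "\<dots> = (\<Sum>s\<in>S - T. scale (a s) (z s) + scale (a s) (w s) + (\<Sum>c\<in>T. scale (a s * b s c) c))"
      by (intro sum.cong refl expand)
    also have "\<dots> = (\<Sum>s\<in>S - T. scale (a s) (z s)) + (\<Sum>s\<in>S - T. scale (a s) (w s))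
        + (\<Sum>s\<in>S - T. \<Sum>c\<in>T. scale (a s * b s c) c)"
      by (simp only: sum.distrib)
    also have "(\<Sum>s\<in>S - T. \<Sum>c\<in>T. scale (a s * b s c) c) = (\<Sum>c\<in>T. \<Sum>s\<in>S - T. scale (a s * b s c) c)"
      by (rule sum.swap)
    also have "(\<Sum>c\<in>T. scale (?a c) c) = - (\<Sum>c\<in>T. \<Sum>s\<in>S - T. scale (a s * b s c) c)"
      by (simp add: scale_sum_left sum_negf)
    finally have "(\<Sum>c\<in>S. scale (?a c) c) = (\<Sum>s\<in>S - T. scale (a s) (z s)) + (\<Sum>s\<in>S - T. scale (a s) (w s))"
      by simp
    moreover have "(\<Sum>s\<in>S - T. scale (a s) (w s)) \<in> W"
      using zwb assms by (intro subspace_sum subspace_scale) auto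
    ultimately have "(\<Sum>c\<in>S. scale (?a c) c) \<in> W"
      using * assms by (simp add: subspace_add)
    from indep_modD[OF S(3) this] have zero: "?a c = 0" if "c \<in> S" for c
      using that by blast
    show ?thesis
    proof
      fix s assume "s \<in> S - T"
      with zero[of s] show "a s = 0" by simp
    qed
  qed
  have inj: "inj_on z (S - T)"
  proof (rule inj_onI, rule ccontr)
    fix s t assume st: "s \<in> S - T" "t \<in> S - T" "z s = z t" "s \<noteq> t"
    let ?a = "\<lambda>x. if x = s then 1 else if x = t then - 1 else 0"
    have "(\<Sum>x\<in>S - T. scale (?a x) (z x)) = (\<Sum>x\<in>{s, t}. scale (?a x) (z x))"
      using st S by (intro sum.mono_neutral_right) auto
    also have "\<dots> = 0" using st by simp
    finally have "(\<Sum>x\<in>S - T. scale (?a x) (z x)) \<in> W" using assms by (simp add: subspace_0)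
    from bspec[OF key[OF this] st(1)] show False by simp
  qed
  have "indep_mod W (z ` (S - T))"
    unfolding indep_mod_def
  proof (intro allI impI)
    fix a assume "(\<Sum>c\<in>z ` (S - T). scale (a c) c) \<in> W"
    then have "(\<Sum>s\<in>S - T. scale (a (z s)) (z s)) \<in> W"
      using inj by (simp add: sum.reindex)
    from key[OF this] show "\<forall>c\<in>z ` (S - T). a c = 0" by auto
  qed
  then have "enat (card (z ` (S - T))) \<le> rank_mod Z W"
    using S zwb by (intro card_le_rank_mod) auto
  moreover have "enat (card T) \<le> rank_mod Z' ?ZW"
    using S T fT by (intro card_le_rank_mod) auto
  ultimately have "enat (card (z ` (S - T))) + enat (card T) \<le> rank_mod Z W + rank_mod Z' ?ZW"
    by (rule add_mono)
  moreover have "card (z ` (S - T)) + card T = card S"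
    using card_image[OF inj] card_Diff_subset[OF fT T(1)] card_mono[OF S(1) T(1)] by simp
  ultimately show "enat (card S) \<le> rank_mod Z W + rank_mod Z' ?ZW" by simp
qed

text \<open>By additivity the difference of the ranks of \<open>Z'\<close> and \<open>Z\<close> modulo \<open>W\<close> is the rank of \<open>Z'\<close> modulo \<open>Z + W\<close>,
  which decreases when \<open>W\<close> grows. Sums replace differences because ranks may be infinite.\<close>

lemma rank_mod_exchange:
  assumes "subspace Z" "subspace W" "subspace W'" "Z \<subseteq> Z'" "W \<subseteq> W'"
  shows "rank_mod Z' W' + rank_mod Z W \<le> rank_mod Z' W + rank_mod Z W'"
proof -
  have "rank_mod Z' W' \<le> rank_mod Z W' + rank_mod Z' {z + w | z w. z \<in> Z \<and> w \<in> W'}"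
    using assms by (intro rank_mod_add_le)
  also have "\<dots> \<le> rank_mod Z W' + rank_mod Z' {z + w | z w. z \<in> Z \<and> w \<in> W}"
    using assms by (intro add_left_mono rank_mod_mono) auto
  finally have "rank_mod Z' W' + rank_mod Z W
      \<le> rank_mod Z W' + (rank_mod Z W + rank_mod Z' {z + w | z w. z \<in> Z \<and> w \<in> W})"
    by (simp add: add_mono add.commute add.left_commute)
  also have "\<dots> \<le> rank_mod Z W' + rank_mod Z' W"
    using assms by (intro add_left_mono rank_mod_add_ge)
  finally show ?thesis by (simp add: add.commute)
qed

lemma rank_mod_finite:
  assumes "subspace W" "finite F" "\<And>v. v \<in> V \<Longrightarrow> \<exists>u\<in>span F. v - u \<in> W"
  shows "rank_mod V W \<le> enat (card F)"
proof (rule rank_mod_le)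
  fix S assume S: "finite S" "S \<subseteq> V" "indep_mod W S"
  obtain u where u: "\<And>v. v \<in> S \<Longrightarrow> u v \<in> span F \<and> v - u v \<in> W"
    using assms(3) S by (metis subsetD)
  have key: "\<forall>c\<in>S. a c = 0" if *: "(\<Sum>c\<in>S. scale (a c) (u c)) = 0" for a
  proof -
    have "(\<Sum>c\<in>S. scale (a c) c) = (\<Sum>c\<in>S. scale (a c) (c - u c))"
      using * by (simp add: scale_right_diff_distrib sum_subtractf)
    also have "\<dots> \<in> W" using u assms by (intro subspace_sum subspace_scale) auto
    finally show ?thesis using indep_modD[OF S(3)] by blast
  qed
  have inj: "inj_on u S"
  proof (rule inj_onI, rule ccontr)
    fix s t assume st: "s \<in> S" "t \<in> S" "u s = u t" "s \<noteq> t"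
    let ?a = "\<lambda>x. if x = s then 1 else if x = t then - 1 else 0"
    have "(\<Sum>x\<in>S. scale (?a x) (u x)) = (\<Sum>x\<in>{s, t}. scale (?a x) (u x))"
      using st S by (intro sum.mono_neutral_right) auto
    also have "\<dots> = 0" using st by simp
    finally have "(\<Sum>x\<in>S. scale (?a x) (u x)) = 0" .
    from bspec[OF key[OF this] st(1)] show False by simp
  qed
  have "independent (u ` S)"
    unfolding dependent_finite[OF finite_imageI[OF S(1)]]
  proof clarsimp
    fix a c assume c: "c \<in> S" "a (u c) \<noteq> 0" "(\<Sum>v\<in>u ` S. scale (a v) v) = 0"
    then have "(\<Sum>c\<in>S. scale (a (u c)) (u c)) = 0" using inj by (simp add: sum.reindex)
    from key[OF this] c show False by blast
  qed
  then have "card (u ` S) \<le> card F"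
    using independent_span_bound[OF assms(2), of "u ` S"] u by auto
  then show "enat (card S) \<le> enat (card F)" using inj by (simp add: card_image)
qed

end

section \<open>Homology ranks of nested spaces\<close>

abbreviation "support \<equiv> Poly_Mapping.keys"

lemma lookup_map_mult:
  "Poly_Mapping.lookup (Poly_Mapping.map ((*) (a::'k::field)) c) x = a * Poly_Mapping.lookup c x"
  by (simp add: Poly_Mapping.map.rep_eq when_def)

interpretation chains: rank_space "\<lambda>a (c :: 'x \<Rightarrow>\<^sub>0 'k::field). Poly_Mapping.map ((*) a) c"
  by standard (auto intro!: poly_mapping_eqI simp: lookup_map_mult lookup_add algebra_simps)

text \<open>The formula of \<open>field_chain_boundary\<close> sums over the support; over any larger finite set it
  gives the same value, which makes it visibly linear.\<close>

lemma field_chain_boundary_superset: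
  fixes c :: "('a, 'k::field) field_chain"
  assumes "finite A" "support c \<subseteq> A"
  shows "field_chain_boundary q c = (if q = 0 then 0 else
     (\<Sum>f\<in>A. \<Sum>i\<le>q. Poly_Mapping.single (singular_face q i f) ((- 1) ^ i * Poly_Mapping.lookup c f)))"
proof -
  have "(\<Sum>f\<in>A. \<Sum>i\<le>q. Poly_Mapping.single (singular_face q i f) ((- 1) ^ i * Poly_Mapping.lookup c f))
      = (\<Sum>f\<in>support c. \<Sum>i\<le>q. Poly_Mapping.single (singular_face q i f) ((- 1) ^ i * Poly_Mapping.lookup c f))"
    using assms by (intro sum.mono_neutral_right) (auto simp: in_keys_iff)
  then show ?thesis by (simp add: field_chain_boundary_def)
qed

lemma field_chain_boundary_add:
  fixes c d :: "('a, 'k::field) field_chain"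
  shows "field_chain_boundary q (c + d) = field_chain_boundary q c + field_chain_boundary q d"
proof -
  let ?A = "support c \<union> support d"
  have "support (c + d) \<subseteq> ?A" by (rule keys_add)
  then show ?thesis
    by (simp add: field_chain_boundary_superset[of ?A] lookup_add distrib_left single_add sum.distrib)
qed

lemma field_chain_boundary_scale:
  fixes c :: "('a, 'k::field) field_chain"
  shows "field_chain_boundary q (Poly_Mapping.map ((*) a) c) = Poly_Mapping.map ((*) a) (field_chain_boundary q c)"
proof -
  have "support (Poly_Mapping.map ((*) a) c) \<subseteq> support c"
    by (auto simp: in_keys_iff lookup_map_mult)
  moreover have "Poly_Mapping.map ((*) a) (Poly_Mapping.single f b) = Poly_Mapping.single f (a * b)"
    for f :: "(nat \<Rightarrow> real) \<Rightarrow> 'a" and b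
    by (rule poly_mapping_eqI) (simp add: lookup_map_mult lookup_single when_def)
  ultimately show ?thesis
    by (simp add: field_chain_boundary_superset[of "support c"] chains.scale_sum_right
        lookup_map_mult mult.left_commute)
qed

lemma subspace_singular_chains: "chains.subspace (singular_chains q X :: ('a, 'k::field) field_chain set)"
  unfolding chains.subspace_def singular_chains_def
proof -
  have "support (x + y) \<subseteq> singular_simplex_set q X"
    if "support x \<subseteq> singular_simplex_set q X" "support y \<subseteq> singular_simplex_set q X"
    for x y :: "('a, 'k) field_chain"
    using that keys_add[of x y] by blast
  moreover have "support (Poly_Mapping.map ((*) a) x) \<subseteq> singular_simplex_set q X"
    if "support x \<subseteq> singular_simplex_set q X" for x :: "('a, 'k) field_chain" and a
    using that by (auto simp: in_keys_iff lookup_map_mult)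
  ultimately show "0 \<in> {c :: ('a, 'k) field_chain. support c \<subseteq> singular_simplex_set q X} \<and>
    (\<forall>x\<in>{c :: ('a, 'k) field_chain. support c \<subseteq> singular_simplex_set q X}.
     \<forall>y\<in>{c. support c \<subseteq> singular_simplex_set q X}.
        x + y \<in> {c. support c \<subseteq> singular_simplex_set q X}) \<and>
    (\<forall>a. \<forall>x\<in>{c. support c \<subseteq> singular_simplex_set q X}.
        Poly_Mapping.map ((*) a) x \<in> {c :: ('a, 'k) field_chain. support c \<subseteq> singular_simplex_set q X})"
    by simp
qed

lemma subspace_singular_cycles: "chains.subspace (singular_cycles q X :: ('a, 'k::field) field_chain set)"
  using subspace_singular_chains[of q X, where 'k='k]
  by (auto simp: chains.subspace_def singular_cycles_def field_chain_boundary_add field_chain_boundary_scale)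
     (simp_all add: field_chain_boundary_def)

lemma subspace_singular_boundaries: "chains.subspace (singular_boundaries q X :: ('a, 'k::field) field_chain set)"
proof -
  note sub = subspace_singular_chains[of "Suc q" X, where 'k='k]
  have "field_chain_boundary (Suc q) (0 :: ('a, 'k) field_chain) = 0"
    by (simp add: field_chain_boundary_def)
  then have "(0 :: ('a, 'k) field_chain) \<in> singular_boundaries q X"
    using chains.subspace_0[OF sub] unfolding singular_boundaries_def by (rule image_eqI[OF sym])
  moreover have "x + y \<in> singular_boundaries q X"
    if "x \<in> singular_boundaries q X" "y \<in> singular_boundaries q X" for x y :: "('a, 'k) field_chain"
    using that chains.subspace_add[OF sub] unfolding singular_boundaries_def
    by (force simp flip: field_chain_boundary_add)
  moreover have "Poly_Mapping.map ((*) a) x \<in> singular_boundaries q X"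
    if "x \<in> singular_boundaries q X" for x :: "('a, 'k) field_chain" and a
    using that chains.subspace_scale[OF sub] unfolding singular_boundaries_def
    by (force simp flip: field_chain_boundary_scale)
  ultimately show ?thesis unfolding chains.subspace_def by blast
qed

lemma inclusion_rank_eq_rank_mod:
  "inclusion_rank (k :: 'k::field itself) q X Y
    = chains.rank_mod (singular_cycles q X :: ('a, 'k) field_chain set) (singular_boundaries q Y)"
  unfolding inclusion_rank_def chains.rank_mod_def chains.indep_mod_def ..

lemma singular_simplex_top_mono:
  "A \<subseteq> B \<Longrightarrow> singular_simplex q (top_of_set A) f \<Longrightarrow> singular_simplex q (top_of_set B) f"
  using singular_simplex_mono by blast

lemma singular_cycles_mono: "A \<subseteq> B \<Longrightarrow> singular_cycles q (top_of_set A) \<subseteq> singular_cycles q (top_of_set B)"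
  by (auto simp: singular_cycles_def singular_chains_def intro: singular_simplex_top_mono)

lemma singular_boundaries_mono:
  "A \<subseteq> B \<Longrightarrow> singular_boundaries q (top_of_set A) \<subseteq> singular_boundaries q (top_of_set B)"
  unfolding singular_boundaries_def singular_chains_def
  by (intro image_mono) (auto intro: singular_simplex_top_mono)

lemma inclusion_rank_mono:
  assumes "A \<subseteq> B" "C \<subseteq> D"
  shows "inclusion_rank k q (top_of_set A) (top_of_set D) \<le> inclusion_rank k q (top_of_set B) (top_of_set C)"
  using assms by (simp add: inclusion_rank_eq_rank_mod chains.rank_mod_mono
      singular_cycles_mono singular_boundaries_mono)

text \<open>This is the nonnegativity of the number of classes that are born between \<open>A\<close> and \<open>B\<close> and die
  between \<open>C\<close> and \<open>D\<close>. It carries the whole comparison of diagrams.\<close>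

lemma inclusion_rank_exchange:
  assumes "A \<subseteq> B" "C \<subseteq> D"
  shows "inclusion_rank k q (top_of_set B) (top_of_set D) + inclusion_rank k q (top_of_set A) (top_of_set C)
    \<le> inclusion_rank k q (top_of_set B) (top_of_set C) + inclusion_rank k q (top_of_set A) (top_of_set D)"
  by (simp add: inclusion_rank_eq_rank_mod assms chains.rank_mod_exchange subspace_singular_cycles
      subspace_singular_boundaries singular_cycles_mono singular_boundaries_mono)

lemma inclusion_rank_empty:
  "inclusion_rank (k :: 'k::field itself) q (top_of_set ({} :: 'a::topological_space set)) Y = 0"
proof -
  have 0: "singular_cycles q (top_of_set {}) \<subseteq> {0 :: ('a, 'k) field_chain}"
  proof
    fix c :: "('a, 'k) field_chain" assume "c \<in> singular_cycles q (top_of_set {})"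
    moreover have "\<not> singular_simplex q (top_of_set ({} :: 'a set)) f" for f
      by (rule singular_simplex_empty) simp
    ultimately have "support c = {}" unfolding singular_cycles_def singular_chains_def by blast
    then show "c \<in> {0}" by simp
  qed
  have "inclusion_rank k q (top_of_set ({}::'a set)) Y \<le> 0"
    unfolding inclusion_rank_eq_rank_mod
  proof (rule chains.rank_mod_le)
    fix S :: "('a, 'k) field_chain set"
    assume S: "finite S" "S \<subseteq> singular_cycles q (top_of_set {})" "chains.indep_mod (singular_boundaries q Y) S"
    have "(\<Sum>c\<in>S. Poly_Mapping.map ((*) 1) c) = 0" using S 0 by (intro sum.neutral) auto
    then have "(\<Sum>c\<in>S. Poly_Mapping.map ((*) 1) c) \<in> singular_boundaries q Y"
      using chains.subspace_0[OF subspace_singular_boundaries[of q Y, where 'k='k]] by simp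
    then have "\<forall>c\<in>S. (1::'k) = 0"
      using chains.indep_modD[OF S(3), of "\<lambda>_. 1"] by blast
    then show "enat (card S) \<le> 0" by (cases "S = {}") (auto simp: zero_enat_def)
  qed
  then show ?thesis by simp
qed

section \<open>Finite homology ranks of offsets\<close>

text \<open>Natural operators on integral chains are extended linearly to chains over a field, so that
  subdivision and its chain homotopy become available there.\<close>

definition field_lift :: "('b \<Rightarrow> 'a \<Rightarrow>\<^sub>0 int) \<Rightarrow> ('b \<Rightarrow>\<^sub>0 'k::field) \<Rightarrow> ('a \<Rightarrow>\<^sub>0 'k)" where
  "field_lift T c = (\<Sum>f\<in>support c. Poly_Mapping.map (\<lambda>n. Poly_Mapping.lookup c f * of_int n) (T f))"

lemma lookup_field_lift:
  assumes "finite A" "support c \<subseteq> A"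
  shows "Poly_Mapping.lookup (field_lift T c) x
    = (\<Sum>f\<in>A. Poly_Mapping.lookup c f * of_int (Poly_Mapping.lookup (T f) x))"
proof -
  have "Poly_Mapping.lookup (field_lift T c) x
      = (\<Sum>f\<in>support c. Poly_Mapping.lookup c f * of_int (Poly_Mapping.lookup (T f) x))"
    unfolding field_lift_def lookup_sum
    by (intro sum.cong refl) (simp add: Poly_Mapping.map.rep_eq when_def)
  also have "\<dots> = (\<Sum>f\<in>A. Poly_Mapping.lookup c f * of_int (Poly_Mapping.lookup (T f) x))"
    using assms by (intro sum.mono_neutral_left) (auto simp: in_keys_iff)
  finally show ?thesis .
qed

lemma keys_field_lift: "support (field_lift T c) \<subseteq> (\<Union>f\<in>support c. support (T f))"
proof
  fix x assume "x \<in> support (field_lift T c)"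
  then have "(\<Sum>f\<in>support c. Poly_Mapping.lookup c f * of_int (Poly_Mapping.lookup (T f) x)) \<noteq> 0"
    unfolding in_keys_iff by (subst (asm) lookup_field_lift[OF finite_keys order_refl])
  then obtain f where "f \<in> support c" "Poly_Mapping.lookup (T f) x \<noteq> 0"
    by (metis (no_types, lifting) mult_zero_right of_int_0 sum.neutral)
  then show "x \<in> (\<Union>f\<in>support c. support (T f))" by (auto simp: in_keys_iff)
qed

lemma field_lift_cong: "(\<And>f. f \<in> support c \<Longrightarrow> T f = S f) \<Longrightarrow> field_lift T c = field_lift S c"
  unfolding field_lift_def by (rule sum.cong) auto

lemma field_lift_add: "field_lift (\<lambda>f. T f + S f) c = field_lift T c + field_lift S c"
  by (rule poly_mapping_eqI)
     (simp add: lookup_field_lift[OF finite_keys order_refl] lookup_add distrib_left sum.distrib)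

lemma field_lift_diff: "field_lift (\<lambda>f. T f - S f) c = field_lift T c - field_lift S c"
  by (rule poly_mapping_eqI)
     (simp add: lookup_field_lift[OF finite_keys order_refl] lookup_minus right_diff_distrib sum_subtractf)

lemma field_lift_zero: "field_lift (\<lambda>_. 0) c = 0"
  by (rule poly_mapping_eqI) (simp add: lookup_field_lift[OF finite_keys order_refl])

lemma field_lift_of: "field_lift frag_of c = c"
proof (rule poly_mapping_eqI)
  fix x
  have "(\<Sum>f\<in>support c. Poly_Mapping.lookup c f * of_int (Poly_Mapping.lookup (frag_of f) x))
     = (\<Sum>f\<in>support c. if f = x then Poly_Mapping.lookup c x else 0)"
    by (intro sum.cong) auto
  also have "\<dots> = Poly_Mapping.lookup c x" by (simp add: in_keys_iff)
  finally show "Poly_Mapping.lookup (field_lift frag_of c) x = Poly_Mapping.lookup c x"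
    by (simp add: lookup_field_lift[OF finite_keys order_refl])
qed

lemma lookup_frag_extend:
  "Poly_Mapping.lookup (frag_extend T s) x
    = (\<Sum>g\<in>support s. Poly_Mapping.lookup s g * Poly_Mapping.lookup (T g) x)"
  unfolding frag_extend_def lookup_sum by (intro sum.cong) auto

lemma field_lift_comp: "field_lift T (field_lift S c) = field_lift (\<lambda>f. frag_extend T (S f)) c"
proof (rule poly_mapping_eqI)
  fix x
  let ?G = "\<Union>f\<in>support c. support (S f)"
  have "Poly_Mapping.lookup (field_lift T (field_lift S c)) x
    = (\<Sum>g\<in>?G. Poly_Mapping.lookup (field_lift S c) g * of_int (Poly_Mapping.lookup (T g) x))"
    by (rule lookup_field_lift[OF _ keys_field_lift]) auto
  also have "\<dots> = (\<Sum>g\<in>?G. \<Sum>f\<in>support c.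
      Poly_Mapping.lookup c f * of_int (Poly_Mapping.lookup (S f) g * Poly_Mapping.lookup (T g) x))"
    by (simp add: lookup_field_lift[OF finite_keys order_refl] sum_distrib_right mult.assoc)
  also have "\<dots> = (\<Sum>f\<in>support c. \<Sum>g\<in>?G.
      Poly_Mapping.lookup c f * of_int (Poly_Mapping.lookup (S f) g * Poly_Mapping.lookup (T g) x))"
    by (rule sum.swap)
  also have "\<dots> = (\<Sum>f\<in>support c. \<Sum>g\<in>support (S f).
      Poly_Mapping.lookup c f * of_int (Poly_Mapping.lookup (S f) g * Poly_Mapping.lookup (T g) x))"
    by (intro sum.cong refl sum.mono_neutral_right) (auto simp: in_keys_iff)
  also have "\<dots> = Poly_Mapping.lookup (field_lift (\<lambda>f. frag_extend T (S f)) c) x"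
    by (simp add: lookup_field_lift[OF finite_keys order_refl] lookup_frag_extend sum_distrib_left)
  finally show "Poly_Mapping.lookup (field_lift T (field_lift S c)) x
    = Poly_Mapping.lookup (field_lift (\<lambda>f. frag_extend T (S f)) c) x" .
qed

lemma field_chain_boundary_eq_lift: "field_chain_boundary q c = field_lift (\<lambda>f. chain_boundary q (frag_of f)) c"
proof (rule poly_mapping_eqI)
  fix x
  show "Poly_Mapping.lookup (field_chain_boundary q c) x
    = Poly_Mapping.lookup (field_lift (\<lambda>f. chain_boundary q (frag_of f)) c) x"
  proof (cases "q = 0")
    case True
    then show ?thesis
      by (simp add: field_chain_boundary_def chain_boundary_def lookup_field_lift[OF finite_keys order_refl])
  next
    case False
    have "(\<Sum>f\<in>support c. \<Sum>i\<le>q. Poly_Mapping.lookup (Poly_Mapping.single (singular_face q i f) ((- 1) ^ i * Poly_Mapping.lookup c f)) x)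
        = (\<Sum>f\<in>support c. \<Sum>i\<le>q. Poly_Mapping.lookup c f * of_int (Poly_Mapping.lookup (frag_cmul ((- 1) ^ i) (frag_of (singular_face q i f))) x))"
      by (intro sum.cong refl) (auto simp: lookup_single when_def)
    then show ?thesis
      using False
      by (simp add: field_chain_boundary_def chain_boundary_of lookup_field_lift[OF finite_keys order_refl]
          lookup_sum sum_distrib_left)
  qed
qed

lemma additive_eq_frag_extend:
  assumes "h 0 = 0" "\<And>a b. h (a - b) = h a - h b"
  shows "h c = frag_extend (\<lambda>f. h (frag_of f)) c"
proof -
  have "support c \<subseteq> UNIV" by simp
  then show ?thesis
    by (induction c rule: frag_induction) (auto simp: assms frag_extend_diff)
qed

text \<open>A chain homotopy of integral chain operators stays one after extension to a field.\<close>

lemma field_lift_homotopy: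
  fixes c :: "('a, 'k::field) field_chain" and H H' T S :: "((nat \<Rightarrow> real) \<Rightarrow> 'a) \<Rightarrow> 'a chain"
  assumes hom: "\<And>f. f \<in> support c \<Longrightarrow>
      chain_boundary (Suc q) (H f) + frag_extend H' (chain_boundary q (frag_of f)) = T f - S f"
    and cycle: "field_chain_boundary q c = 0"
  shows "field_chain_boundary (Suc q) (field_lift H c) = field_lift T c - field_lift S c"
proof -
  have ext: "frag_extend (\<lambda>f. chain_boundary (Suc q) (frag_of f)) c = chain_boundary (Suc q) c" for c :: "'a chain"
    by (rule additive_eq_frag_extend[symmetric]) (auto simp: chain_boundary_diff)
  have "field_chain_boundary (Suc q) (field_lift H c) = field_lift (\<lambda>f. chain_boundary (Suc q) (H f)) c"
    unfolding field_chain_boundary_eq_lift field_lift_comp ext ..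
  moreover have "field_lift (\<lambda>f. frag_extend H' (chain_boundary q (frag_of f))) c = 0"
    using cycle by (simp add: field_chain_boundary_eq_lift flip: field_lift_comp) (simp add: field_lift_def)
  ultimately have "field_chain_boundary (Suc q) (field_lift H c)
      = field_lift (\<lambda>f. chain_boundary (Suc q) (H f) + frag_extend H' (chain_boundary q (frag_of f))) c"
    by (simp add: field_lift_add)
  also have "\<dots> = field_lift (\<lambda>f. T f - S f) c" by (rule field_lift_cong) (rule hom)
  finally show ?thesis by (simp add: field_lift_diff)
qed

lemma singular_chains_field_lift:
  assumes "\<And>f. f \<in> support c \<Longrightarrow> singular_chain q X (T f)"
  shows "field_lift T c \<in> singular_chains q X"
  using keys_field_lift[of T c] assms unfolding singular_chains_def singular_chain_def by blast

lemma keys_of_singular_chains: "c \<in> singular_chains q X \<Longrightarrow> f \<in> support c \<Longrightarrow> singular_simplex q X f"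
  unfolding singular_chains_def by auto

text \<open>Iterated subdivision is chain homotopic to the identity, and the homotopy lifts to coefficients
  in a field.\<close>

lemma cycle_homologous_to_small_cycle:
  fixes z :: "('a::metric_space, 'k::field) field_chain"
  assumes z: "z \<in> singular_cycles q (top_of_set A)" and e: "0 < e"
  obtains z' where "z' \<in> singular_cycles q (top_of_set A)" "z - z' \<in> singular_boundaries q (top_of_set A)"
    "\<And>f. f \<in> support z' \<Longrightarrow> \<exists>a\<in>A. f ` standard_simplex q \<subseteq> ball a e"
proof -
  let ?X = "top_of_set A"
  have zc: "z \<in> singular_chains q ?X" "field_chain_boundary q z = 0"
    using z by (auto simp: singular_cycles_def)
  define \<C> where "\<C> = (\<lambda>a. A \<inter> ball a e) ` A"
  have op: "\<And>U. U \<in> \<C> \<Longrightarrow> openin ?X U" by (auto simp: \<C>_def openin_open)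
  have cov: "topspace ?X \<subseteq> \<Union>\<C>" using e by (auto simp: \<C>_def)
  have "\<exists>n. \<forall>m g. n \<le> m \<longrightarrow> g \<in> support ((singular_subdivision q ^^ m) (frag_of f)) \<longrightarrow>
      (\<exists>V\<in>\<C>. g \<in> standard_simplex q \<rightarrow> V)" if "f \<in> support z" for f
  proof -
    have "singular_chain q ?X (frag_of f)"
      using keys_of_singular_chains[OF zc(1) that] by (simp add: singular_chain_of)
    from sufficient_iterated_singular_subdivision_exists[OF op cov this] show ?thesis by metis
  qed
  then obtain n where n: "\<And>f m g. f \<in> support z \<Longrightarrow> n f \<le> m \<Longrightarrow>
      g \<in> support ((singular_subdivision q ^^ m) (frag_of f)) \<Longrightarrow> (\<exists>V\<in>\<C>. g \<in> standard_simplex q \<rightarrow> V)"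
    by metis
  define m where "m = Max (insert 0 (n ` support z))"
  have m: "n f \<le> m" if "f \<in> support z" for f
    unfolding m_def using that by (intro Max_ge) auto
  obtain h where h: "\<And>p. h p 0 = (0 :: 'a chain)"
        "\<And>p c1 c2. h p (c1-c2) = h p c1 - h p c2"
        "\<And>p X c. singular_chain p X c \<Longrightarrow> singular_chain (Suc p) X (h p c)"
        "\<And>p X c. singular_chain p X c
                 \<Longrightarrow> chain_boundary (Suc p) (h p c) + h (p - Suc 0) (chain_boundary p c)
                   = (singular_subdivision p ^^ m) c - c"
    using chain_homotopic_iterated_singular_subdivision[of m] by metis
  define S where "S = (\<lambda>f. (singular_subdivision q ^^ m) (frag_of f :: 'a chain))"
  define z' where "z' = field_lift S z"
  have iter: "singular_chain q ?X ((singular_subdivision q ^^ k) c)" if "singular_chain q ?X c" for k c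
    using that by (induction k) (auto intro: singular_chain_singular_subdivision)
  have sc: "singular_chain q ?X (frag_of f)" if "f \<in> support z" for f
    using keys_of_singular_chains[OF zc(1) that] by (simp add: singular_chain_of)
  have z'c: "z' \<in> singular_chains q ?X"
    unfolding z'_def S_def by (rule singular_chains_field_lift, rule iter, rule sc)
  have "field_chain_boundary (Suc q) (field_lift (\<lambda>f. h q (frag_of f)) z) = field_lift S z - field_lift frag_of z"
  proof (rule field_lift_homotopy[where H' = "\<lambda>f. h (q - Suc 0) (frag_of f)", OF _ zc(2)])
    fix f assume f: "f \<in> support z"
    show "chain_boundary (Suc q) (h q (frag_of f)) + frag_extend (\<lambda>f. h (q - Suc 0) (frag_of f)) (chain_boundary q (frag_of f))
       = S f - frag_of f"
      using h(4)[OF sc[OF f]] additive_eq_frag_extend[of "h (q - Suc 0)" "chain_boundary q (frag_of f)", OF h(1,2)]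
      unfolding S_def by (simp only:)
  qed
  then have bd: "field_chain_boundary (Suc q) (field_lift (\<lambda>f. h q (frag_of f)) z) = z' - z"
    by (simp add: z'_def field_lift_of)
  have hz: "field_lift (\<lambda>f. h q (frag_of f)) z \<in> singular_chains (Suc q) ?X"
    by (rule singular_chains_field_lift, rule h(3), rule sc)
  have diff: "z' - z \<in> singular_boundaries q ?X"
    unfolding singular_boundaries_def bd[symmetric] by (rule imageI) (rule hz)
  show ?thesis
  proof (rule that[of z'])
    have "singular_boundaries q ?X \<subseteq> (singular_cycles q ?X :: ('a, 'k) field_chain set)"
    proof
      fix x :: "('a, 'k) field_chain" assume "x \<in> singular_boundaries q ?X"
      then obtain y where y: "y \<in> singular_chains (Suc q) ?X" "x = field_chain_boundary (Suc q) y"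
        unfolding singular_boundaries_def by blast
      have ys: "singular_chain (Suc q) ?X (frag_of f)" if "f \<in> support y" for f
        using keys_of_singular_chains[OF y(1) that] by (simp add: singular_chain_of)
      have ext: "frag_extend (\<lambda>f. chain_boundary q (frag_of f)) (c :: 'a chain) = chain_boundary q c" for c
        by (rule additive_eq_frag_extend[symmetric]) (auto simp: chain_boundary_diff)
      have "field_chain_boundary q x = field_lift (\<lambda>f. chain_boundary q (chain_boundary (Suc q) (frag_of f))) y"
        unfolding y(2) field_chain_boundary_eq_lift field_lift_comp ext ..
      also have "\<dots> = field_lift (\<lambda>f. 0) y"
        by (intro field_lift_cong) (use chain_boundary_boundary[OF ys] in simp)
      finally have "field_chain_boundary q x = 0" by (simp add: field_lift_zero)
      moreover have "x \<in> singular_chains q ?X"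
        unfolding y(2) field_chain_boundary_eq_lift
        by (rule singular_chains_field_lift) (use singular_chain_boundary[OF ys] in simp)
      ultimately show "x \<in> singular_cycles q ?X" by (simp add: singular_cycles_def)
    qed
    then have "z' - z \<in> singular_cycles q ?X" using diff by blast
    then have "z + (z' - z) \<in> singular_cycles q ?X"
      using z by (intro chains.subspace_add[OF subspace_singular_cycles])
    then show "z' \<in> singular_cycles q ?X" by simp
    have "- (z' - z) \<in> singular_boundaries q ?X"
      by (rule chains.subspace_neg[OF subspace_singular_boundaries diff])
    then show "z - z' \<in> singular_boundaries q ?X" by simp
    fix g assume "g \<in> support z'"
    then obtain f where f: "f \<in> support z" "g \<in> support (S f)"
      unfolding z'_def using keys_field_lift by fastforce
    then obtain V where "V \<in> \<C>" "g \<in> standard_simplex q \<rightarrow> V"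
      using n[OF f(1) m[OF f(1)]] unfolding S_def by blast
    then show "\<exists>a\<in>A. g ` standard_simplex q \<subseteq> ball a e" by (force simp: \<C>_def)
  qed
qed

text \<open>A convex set contracts onto a point, and a point has no homology in positive degree. In
  degree \<open>0\<close> only chains of total weight \<open>0\<close> bound.\<close>

lemma convex_cycle_bounds:
  fixes S :: "'a::euclidean_space set"
  assumes S: "convex S" "a \<in> S" and z: "singular_chain q (top_of_set S) z" "chain_boundary q z = 0"
    and aug: "q = 0 \<Longrightarrow> chain_map q (\<lambda>_. a) z = 0"
  obtains w where "singular_chain (Suc q) (top_of_set S) w" "chain_boundary (Suc q) w = z"
proof -
  let ?X = "top_of_set S"
  have hom: "homotopic_with (\<lambda>h. h \<in> {} \<rightarrow> {}) ?X ?X (\<lambda>_. a) id"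
  proof -
    have "homotopic_with_canon (\<lambda>z. True) S S (\<lambda>_. a) id"
      using S by (intro homotopic_with_linear) (auto simp: convex_contains_segment)
    then show ?thesis by (rule homotopic_with_mono) auto
  qed
  have cyc: "singular_relcycle q ?X {} z"
    using z by (simp add: singular_cycle)
  have "homologous_rel q ?X {} (chain_map q (\<lambda>_. a) z) (chain_map q id z)"
    by (rule homotopic_imp_homologous_rel_chain_maps[OF hom cyc])
  moreover have "chain_map q id z = z" by (rule chain_map_id_gen[OF z(1)]) simp
  moreover have "homologous_rel q ?X {} (chain_map q (\<lambda>_. a) z) 0"
  proof (cases "q = 0")
    case True
    then show ?thesis using aug[OF True] by simp
  next
    case False
    let ?Y = "subtopology ?X {a}"
    have "continuous_map ?X ?Y (\<lambda>_. a)" using S by (simp add: continuous_map_in_subtopology)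
    then have "singular_relcycle q ?Y {} (chain_map q (\<lambda>_. a) z)"
      using singular_relcycle_chain_map[OF cyc, of ?Y "\<lambda>_. a" "{}"] by simp
    moreover have "topspace ?Y = {a}" using S by auto
    ultimately have "singular_relboundary q ?Y {} (chain_map q (\<lambda>_. a) z)"
      using False singular_boundary_eq_cycle_singleton[of ?Y a q] by simp
    then have "singular_relboundary q ?X {} (chain_map q (\<lambda>_. a) z)"
      unfolding singular_boundary using singular_chain_subtopology by blast
    then show ?thesis by (simp add: homologous_rel_def)
  qed
  ultimately have "homologous_rel q ?X {} z 0"
    by (metis homologous_rel_sym homologous_rel_trans)
  then show ?thesis
    using that by (auto simp: homologous_rel_def singular_boundary)
qed

definition simplex_vertex :: "nat \<Rightarrow> nat \<Rightarrow> real" where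
  "simplex_vertex j = (\<lambda>i. if i = j then 1 else 0)"

lemma simplex_vertex_in: "j \<le> q \<Longrightarrow> simplex_vertex j \<in> standard_simplex q"
  by (auto simp: simplex_vertex_def standard_simplex_def)

lemma simplical_face_vertex: "simplical_face k (simplex_vertex j) = simplex_vertex (if j < k then j else Suc j)"
  by (auto simp: simplical_face_def simplex_vertex_def fun_eq_iff)

text \<open>The affine simplex whose vertices are the images under \<open>g\<close> of the vertices of a given one.\<close>

definition straighten :: "('a::euclidean_space \<Rightarrow> 'a) \<Rightarrow> nat \<Rightarrow> ((nat \<Rightarrow> real) \<Rightarrow> 'a) \<Rightarrow> (nat \<Rightarrow> real) \<Rightarrow> 'a" where
  "straighten g q f = (\<lambda>x\<in>standard_simplex q. \<Sum>j\<le>q. x j *\<^sub>R g (f (simplex_vertex j)))"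

text \<open>The convex set in which the homotopy between a simplex and its straightening takes place.\<close>

definition carrier_hull :: "('a::euclidean_space \<Rightarrow> 'a) \<Rightarrow> nat \<Rightarrow> ((nat \<Rightarrow> real) \<Rightarrow> 'a) \<Rightarrow> 'a set" where
  "carrier_hull g q f = convex hull (f ` standard_simplex q \<union> (\<lambda>j. g (f (simplex_vertex j))) ` {..q})"

lemma face_vertex:
  assumes "1 \<le> q" "k \<le> q" "j \<le> q - 1"
  shows "singular_face q k f (simplex_vertex j) = f (simplex_vertex (if j < k then j else Suc j))"
  using assms simplex_vertex_in[of j "q - 1"] by (simp add: singular_face_def simplical_face_vertex)

lemma straighten_face:
  assumes "1 \<le> q" "k \<le> q"
  shows "singular_face q k (straighten g q f) = straighten g (q - 1) (singular_face q k f)"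
proof
  fix x
  show "singular_face q k (straighten g q f) x = straighten g (q - 1) (singular_face q k f) x"
  proof (cases "x \<in> standard_simplex (q - 1)")
    case True
    then have "simplical_face k x \<in> standard_simplex q" using assms simplical_face_in_standard_simplex by simp
    then have "singular_face q k (straighten g q f) x
        = (\<Sum>j\<le>q. simplical_face k x j *\<^sub>R g (f (simplex_vertex j)))"
      using True by (simp add: singular_face_def straighten_def)
    also have "\<dots> = (\<Sum>j\<in>{..q} - {k}. simplical_face k x j *\<^sub>R g (f (simplex_vertex j)))"
      by (rule sum.mono_neutral_right) (auto simp: simplical_face_def)
    also have "\<dots> = (\<Sum>j\<le>q - 1. x j *\<^sub>R g (f (simplex_vertex (if j < k then j else Suc j))))"
      by (rule sum.reindex_bij_witness[where i = "\<lambda>j. if j < k then j else Suc j" and j = "\<lambda>j. if j < k then j else j - 1"])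
         (use assms in \<open>auto simp: simplical_face_def split: if_splits\<close>)
    also have "\<dots> = (\<Sum>j\<le>q - 1. x j *\<^sub>R g (singular_face q k f (simplex_vertex j)))"
      using assms by (intro sum.cong refl) (simp add: face_vertex)
    finally show ?thesis using True by (simp add: straighten_def)
  next
    case False
    then show ?thesis by (simp add: singular_face_def straighten_def)
  qed
qed

lemma straighten_image: "straighten g q f ` standard_simplex q \<subseteq> convex hull ((\<lambda>j. g (f (simplex_vertex j))) ` {..q})"
proof clarsimp
  fix x assume x: "x \<in> standard_simplex q"
  show "straighten g q f x \<in> convex hull ((\<lambda>j. g (f (simplex_vertex j))) ` {..q})"
  proof -
    have "(\<Sum>j\<le>q. x j *\<^sub>R g (f (simplex_vertex j))) \<in> convex hull ((\<lambda>j. g (f (simplex_vertex j))) ` {..q})"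
      using x by (intro convex_sum convex_convex_hull) (auto simp: standard_simplex_def intro: hull_inc)
    then show ?thesis using x by (simp add: straighten_def)
  qed
qed

lemma straighten_simplex: "singular_simplex q (top_of_set (convex hull ((\<lambda>j. g (f (simplex_vertex j))) ` {..q}))) (straighten g q f)"
proof -
  have "continuous_map (subtopology (powertop_real UNIV) (standard_simplex q)) euclidean
      (\<lambda>x. \<Sum>j\<le>q. x j *\<^sub>R g (f (simplex_vertex j)))"
  proof (rule continuous_map_sum)
    fix j
    have "continuous_map (subtopology (powertop_real UNIV) (standard_simplex q)) euclideanreal (\<lambda>x. x j)"
      by (intro continuous_map_from_subtopology continuous_map_product_projection) simp
    moreover have "continuous_map euclideanreal euclidean (\<lambda>t. t *\<^sub>R g (f (simplex_vertex j)))"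
      by (simp add: continuous_intros)
    ultimately show "continuous_map (subtopology (powertop_real UNIV) (standard_simplex q)) euclidean
        (\<lambda>x. x j *\<^sub>R g (f (simplex_vertex j)))"
      using continuous_map_compose[unfolded o_def] by blast
  qed simp
  then have "continuous_map (subtopology (powertop_real UNIV) (standard_simplex q)) euclidean (straighten g q f)"
    by (rule continuous_map_eq) (simp add: straighten_def)
  then show ?thesis
    using straighten_image[of g q f]
    by (auto simp: singular_simplex_def continuous_map_in_subtopology straighten_def)
qed

lemma carrier_hull_face:
  assumes "1 \<le> q" "k \<le> q"
  shows "carrier_hull g (q - 1) (singular_face q k f) \<subseteq> carrier_hull g q f"
proof -
  have "singular_face q k f ` standard_simplex (q - 1) \<subseteq> f ` standard_simplex q"
    using simplical_face_in_standard_simplex[OF assms] by (auto simp: singular_face_def)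
  moreover have "(\<lambda>j. g (singular_face q k f (simplex_vertex j))) ` {..q - 1} \<subseteq> (\<lambda>j. g (f (simplex_vertex j))) ` {..q}"
    using assms by (auto simp: face_vertex)
  ultimately show ?thesis unfolding carrier_hull_def by (intro hull_mono) blast
qed

text \<open>The method of acyclic carriers: since the simplex and its straightening lie in a common
  convex set that contains the convex sets of the faces, a chain homotopy between the identity and
  straightening can be chosen degree by degree.\<close>

primrec straightening_homotopy :: "('a::euclidean_space \<Rightarrow> 'a) \<Rightarrow> nat \<Rightarrow> ((nat \<Rightarrow> real) \<Rightarrow> 'a) \<Rightarrow> 'a chain" where
  "straightening_homotopy g 0 = (\<lambda>f. SOME w. singular_chain 1 (top_of_set (carrier_hull g 0 f)) w \<and>
      chain_boundary 1 w = frag_of f - frag_of (straighten g 0 f))"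
| "straightening_homotopy g (Suc q) = (\<lambda>f. SOME w. singular_chain (Suc (Suc q)) (top_of_set (carrier_hull g (Suc q) f)) w \<and>
      chain_boundary (Suc (Suc q)) w = frag_of f - frag_of (straighten g (Suc q) f)
        - frag_extend (straightening_homotopy g q) (chain_boundary (Suc q) (frag_of f)))"

lemma keys_chain_boundary_of:
  "support (chain_boundary (Suc q) (frag_of f)) \<subseteq> (\<lambda>k. singular_face (Suc q) k f) ` {..Suc q}"
proof -
  have "support (chain_boundary (Suc q) (frag_of f))
      \<subseteq> (\<Union>k\<in>{..Suc q}. support (frag_cmul ((- 1) ^ k) (frag_of (singular_face (Suc q) k f))))"
    unfolding chain_boundary_of by (simp del: sum.atMost_Suc) (rule keys_sum)
  then show ?thesis by fastforce
qed

lemma straightening_chain_map: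
  "frag_extend (\<lambda>f. frag_of (straighten g q f)) (chain_boundary (Suc q) (frag_of f))
    = chain_boundary (Suc q) (frag_of (straighten g (Suc q) f))"
  by (simp add: chain_boundary_of frag_extend_sum frag_extend_cmul straighten_face o_def del: sum.atMost_Suc)

lemma singular_simplex_carrier:
  assumes "singular_simplex q euclidean f"
  shows "singular_simplex q (top_of_set (carrier_hull g q f)) f"
    "singular_simplex q (top_of_set (carrier_hull g q f)) (straighten g q f)"
proof -
  have sub: "f ` standard_simplex q \<subseteq> carrier_hull g q f"
    "convex hull ((\<lambda>j. g (f (simplex_vertex j))) ` {..q}) \<subseteq> carrier_hull g q f"
    unfolding carrier_hull_def using hull_subset[of "f ` standard_simplex q \<union> (\<lambda>j. g (f (simplex_vertex j))) ` {..q}" convex]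
    by (blast, intro hull_mono) auto
  show "singular_simplex q (top_of_set (carrier_hull g q f)) f"
    using assms sub by (simp add: singular_simplex_subtopology)
  show "singular_simplex q (top_of_set (carrier_hull g q f)) (straighten g q f)"
    by (rule singular_simplex_top_mono[OF sub(2)], rule straighten_simplex)
qed

lemma straightening_homotopy_0:
  assumes f: "singular_simplex 0 euclidean f"
  shows "singular_chain 1 (top_of_set (carrier_hull g 0 f)) (straightening_homotopy g 0 f)"
    "chain_boundary 1 (straightening_homotopy g 0 f) = frag_of f - frag_of (straighten g 0 f)"
proof -
  let ?S = "carrier_hull g 0 f" and ?z = "frag_of f - frag_of (straighten g 0 f)"
  have "f (simplex_vertex 0) \<in> ?S" unfolding carrier_hull_def by (intro hull_inc UnI1 imageI simplex_vertex_in) simp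
  moreover have "singular_chain 0 (top_of_set ?S) ?z"
    using singular_simplex_carrier[OF f] by (intro singular_chain_diff) (simp_all add: singular_chain_of)
  moreover have "chain_boundary 0 ?z = 0" by (simp add: chain_boundary_def)
  moreover have "chain_map 0 (\<lambda>_. f (simplex_vertex 0)) ?z = 0"
    by (simp add: chain_map_diff simplex_map_def o_def)
  ultimately obtain w where "singular_chain (Suc 0) (top_of_set ?S) w" "chain_boundary (Suc 0) w = ?z"
    using convex_cycle_bounds[of ?S "f (simplex_vertex 0)" 0 ?z] by (auto simp: carrier_hull_def)
  then have "\<exists>w. singular_chain 1 (top_of_set ?S) w \<and> chain_boundary 1 w = ?z" by auto
  from someI_ex[OF this] show "singular_chain 1 (top_of_set ?S) (straightening_homotopy g 0 f)"
    "chain_boundary 1 (straightening_homotopy g 0 f) = ?z" by simp_all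
qed

lemma straightening_homotopy_Suc:
  assumes faces: "\<And>k. k \<le> Suc q \<Longrightarrow> singular_chain (Suc q) (top_of_set (carrier_hull g q (singular_face (Suc q) k f)))
        (straightening_homotopy g q (singular_face (Suc q) k f))"
    and bd: "frag_extend (\<lambda>f. chain_boundary (Suc q) (straightening_homotopy g q f)) (chain_boundary (Suc q) (frag_of f))
      = chain_boundary (Suc q) (frag_of f) - chain_boundary (Suc q) (frag_of (straighten g (Suc q) f))"
    and f: "singular_simplex (Suc q) euclidean f"
  shows "singular_chain (Suc (Suc q)) (top_of_set (carrier_hull g (Suc q) f)) (straightening_homotopy g (Suc q) f)"
    "chain_boundary (Suc (Suc q)) (straightening_homotopy g (Suc q) f) = frag_of f - frag_of (straighten g (Suc q) f)
        - frag_extend (straightening_homotopy g q) (chain_boundary (Suc q) (frag_of f))"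
proof -
  let ?S = "carrier_hull g (Suc q) f"
  let ?D = "frag_extend (straightening_homotopy g q) (chain_boundary (Suc q) (frag_of f))"
  let ?z = "frag_of f - frag_of (straighten g (Suc q) f) - ?D"
  have "f (simplex_vertex 0) \<in> ?S" unfolding carrier_hull_def by (intro hull_inc UnI1 imageI simplex_vertex_in) simp
  moreover have "singular_chain (Suc q) (top_of_set ?S) ?z"
  proof (intro singular_chain_diff)
    show "singular_chain (Suc q) (top_of_set ?S) ?D"
    proof (rule singular_chain_extend)
      fix c assume "c \<in> support (chain_boundary (Suc q) (frag_of f))"
      then obtain k where k: "k \<le> Suc q" "c = singular_face (Suc q) k f" using keys_chain_boundary_of by blast
      have "singular_chain (Suc q) (top_of_set (carrier_hull g q c)) (straightening_homotopy g q c)"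
        using faces k by simp
      moreover have "carrier_hull g q c \<subseteq> ?S" using carrier_hull_face[of "Suc q" k g f] k by simp
      ultimately show "singular_chain (Suc q) (top_of_set ?S) (straightening_homotopy g q c)"
        using singular_chain_mono by blast
    qed
  qed (use singular_simplex_carrier[OF f] in \<open>simp_all add: singular_chain_of\<close>)
  moreover have "chain_boundary (Suc q) ?z = 0"
  proof -
    have "chain_boundary (Suc q) (frag_extend H c) = frag_extend (\<lambda>f. chain_boundary (Suc q) (H f)) c"
      for H :: "((nat \<Rightarrow> real) \<Rightarrow> 'a) \<Rightarrow> 'a chain" and c
      using additive_eq_frag_extend[of "\<lambda>c. chain_boundary (Suc q) (frag_extend H c)" c]
      by (simp add: frag_extend_diff chain_boundary_diff)
    then show ?thesis using bd by (simp add: chain_boundary_diff)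
  qed
  ultimately obtain w where "singular_chain (Suc (Suc q)) (top_of_set ?S) w" "chain_boundary (Suc (Suc q)) w = ?z"
    using convex_cycle_bounds[of ?S "f (simplex_vertex 0)" "Suc q" ?z] by (auto simp: carrier_hull_def)
  then have "\<exists>w. singular_chain (Suc (Suc q)) (top_of_set ?S) w \<and> chain_boundary (Suc (Suc q)) w = ?z" by auto
  from someI_ex[OF this] show "singular_chain (Suc (Suc q)) (top_of_set ?S) (straightening_homotopy g (Suc q) f)"
    "chain_boundary (Suc (Suc q)) (straightening_homotopy g (Suc q) f) = ?z" by simp_all
qed

lemma straightening_homotopy:
  assumes f: "singular_simplex q euclidean f"
  shows "singular_chain (Suc q) (top_of_set (carrier_hull g q f)) (straightening_homotopy g q f) \<and>
    chain_boundary (Suc q) (straightening_homotopy g q f)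
      + frag_extend (straightening_homotopy g (q - Suc 0)) (chain_boundary q (frag_of f))
      = frag_of f - frag_of (straighten g q f)"
  using f
proof (induction q arbitrary: f)
  case 0
  show ?case using straightening_homotopy_0[OF 0] by (simp add: chain_boundary_of del: straightening_homotopy.simps)
next
  case (Suc q)
  have face: "singular_simplex q euclidean (singular_face (Suc q) k f)" if "k \<le> Suc q" for k
    using singular_simplex_singular_face[OF Suc.prems, of k] that by simp
  have 1: "singular_chain (Suc q) (top_of_set (carrier_hull g q (singular_face (Suc q) k f)))
        (straightening_homotopy g q (singular_face (Suc q) k f))" if "k \<le> Suc q" for k
    using Suc.IH[OF face[OF that]] by blast
  let ?c = "chain_boundary (Suc q) (frag_of f)"
  have "frag_extend (\<lambda>f. chain_boundary (Suc q) (straightening_homotopy g q f)) ?c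
      = frag_extend (\<lambda>f. frag_of f - frag_of (straighten g q f)
          - frag_extend (straightening_homotopy g (q - Suc 0)) (chain_boundary q (frag_of f))) ?c"
  proof (rule frag_extend_eq)
    fix c assume "c \<in> support ?c"
    then obtain k where k: "k \<le> Suc q" "c = singular_face (Suc q) k f" using keys_chain_boundary_of by blast
    then show "chain_boundary (Suc q) (straightening_homotopy g q c) = frag_of c - frag_of (straighten g q c)
          - frag_extend (straightening_homotopy g (q - Suc 0)) (chain_boundary q (frag_of c))"
      using Suc.IH[OF face[OF k(1)]] by (metis add_diff_cancel_right')
  qed
  also have "\<dots> = ?c - chain_boundary (Suc q) (frag_of (straighten g (Suc q) f))"
  proof -
    let ?H = "straightening_homotopy g (q - Suc 0)"
    have "frag_extend (\<lambda>f. frag_of f - frag_of (straighten g q f) - frag_extend ?H (chain_boundary q (frag_of f))) c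
      = c - frag_extend (\<lambda>f. frag_of (straighten g q f)) c - frag_extend ?H (chain_boundary q c)" for c
      using additive_eq_frag_extend[of "\<lambda>c. c - frag_extend (\<lambda>f. frag_of (straighten g q f)) c - frag_extend ?H (chain_boundary q c)" c]
      by (simp add: frag_extend_diff chain_boundary_diff)
    moreover have "chain_boundary q ?c = 0"
      using chain_boundary_boundary[of "Suc q" euclidean "frag_of f"] Suc.prems by (simp add: singular_chain_of)
    ultimately show ?thesis by (simp add: straightening_chain_map)
  qed
  finally show ?case
    using straightening_homotopy_Suc[OF 1 _ Suc.prems] by (simp del: straightening_homotopy.simps)
qed

text \<open>After subdivision the simplices of a cycle of \<open>A\<close> are so small that straightening them to simplices
  with vertices in a finite net of \<open>A\<close> happens within distance \<open>e\<close> of \<open>A\<close>. So finitely many simplices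
  span all classes of cycles of \<open>A\<close> in the homology of \<open>B\<close>.\<close>

lemma inclusion_rank_finite:
  fixes A B :: "'a::euclidean_space set" and k :: "'k::field itself"
  assumes A: "compact A" and e: "0 < e" and AB: "{x. infdist x A \<le> e} \<subseteq> B"
  shows "inclusion_rank k q (top_of_set A) (top_of_set B) \<noteq> \<infinity>"
proof -
  obtain N where N: "finite N" "N \<subseteq> A" "A \<subseteq> (\<Union>a\<in>N. ball a (e / 2))"
    using compactE_image[OF A, of A "\<lambda>a. ball a (e / 2)"] e by (metis (no_types, lifting) UN_iff centre_in_ball half_gt_zero open_ball subsetI)
  define g where "g = (\<lambda>x. SOME a. a \<in> N \<and> dist a x < e / 2)"
  have g: "g x \<in> N \<and> dist (g x) x < e / 2" if x: "x \<in> A" for x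
  proof -
    obtain a where "a \<in> N" "x \<in> ball a (e / 2)" using N(3) x by blast
    then have "\<exists>a. a \<in> N \<and> dist a x < e / 2" by (intro exI[of _ a]) simp
    then show ?thesis unfolding g_def by (rule someI_ex)
  qed
  define F where "F = (\<lambda>v. \<lambda>x\<in>standard_simplex q. \<Sum>j\<le>q. x j *\<^sub>R v j) ` (PiE {..q} (\<lambda>_. N))"
  have finF: "finite F" unfolding F_def using N(1) by (intro finite_imageI finite_PiE) auto
  let ?single = "\<lambda>f. Poly_Mapping.single f (1 :: 'k)"
  have "chains.rank_mod (singular_cycles q (top_of_set A) :: ('a, 'k) field_chain set) (singular_boundaries q (top_of_set B)) \<le> enat (card (?single ` F))"
  proof (rule chains.rank_mod_finite[OF subspace_singular_boundaries finite_imageI[OF finF]])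
    fix z :: "('a, 'k) field_chain" assume "z \<in> singular_cycles q (top_of_set A)"
    then obtain z' where z': "z' \<in> singular_cycles q (top_of_set A)" "z - z' \<in> singular_boundaries q (top_of_set A)"
      "\<And>f. f \<in> support z' \<Longrightarrow> \<exists>a\<in>A. f ` standard_simplex q \<subseteq> ball a (e / 2)"
      using cycle_homologous_to_small_cycle[of z q A "e / 2"] e by (metis half_gt_zero)
    have "infdist a A = 0" if "a \<in> A" for a using that by simp
    then have "A \<subseteq> B" using AB e by fastforce
    have simplex: "singular_simplex q (top_of_set A) f" if "f \<in> support z'" for f
      using z'(1) that by (auto simp: singular_cycles_def singular_chains_def)
    have fA: "f ` standard_simplex q \<subseteq> A" "singular_simplex q euclidean f" if "f \<in> support z'" for f
      using simplex[OF that] by (auto simp: singular_simplex_subtopology)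
    have hullB: "carrier_hull g q f \<subseteq> B" if f: "f \<in> support z'" for f
    proof -
      obtain a where a: "a \<in> A" "f ` standard_simplex q \<subseteq> ball a (e / 2)" using z'(3)[OF f] by blast
      have "g (f (simplex_vertex j)) \<in> ball a e" if "j \<le> q" for j
      proof -
        have "f (simplex_vertex j) \<in> A" "f (simplex_vertex j) \<in> ball a (e / 2)"
          using simplex_vertex_in[OF that] fA(1)[OF f] a by auto
        then have "dist (g (f (simplex_vertex j))) (f (simplex_vertex j)) < e / 2" "dist a (f (simplex_vertex j)) < e / 2"
          using g by auto
        then show ?thesis using dist_triangle2[of a "g (f (simplex_vertex j))" "f (simplex_vertex j)"] by simp
      qed
      moreover have "ball a (e / 2) \<subseteq> ball a e" using e by (intro subset_ball) simp
      ultimately have "carrier_hull g q f \<subseteq> ball a e"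
        unfolding carrier_hull_def using a(2) by (intro hull_minimal convex_ball) auto
      moreover have "ball a e \<subseteq> {x. infdist x A \<le> e}"
      proof
        fix x assume "x \<in> ball a e"
        then show "x \<in> {x. infdist x A \<le> e}" using infdist_le[OF a(1), of x] by (simp add: dist_commute)
      qed
      ultimately show ?thesis using AB by blast
    qed
    let ?H = "field_lift (straightening_homotopy g q) z'"
    let ?u = "field_lift (\<lambda>f. frag_of (straighten g q f)) z'"
    have "field_chain_boundary (Suc q) ?H = field_lift frag_of z' - ?u"
    proof (rule field_lift_homotopy[where H' = "straightening_homotopy g (q - Suc 0)"])
      show "field_chain_boundary q z' = 0" using z'(1) by (simp add: singular_cycles_def)
    qed (use straightening_homotopy[OF fA(2)] in blast)
    then have bd: "z' - ?u = field_chain_boundary (Suc q) ?H" by (simp add: field_lift_of)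
    have "?H \<in> singular_chains (Suc q) (top_of_set B)"
    proof (rule singular_chains_field_lift)
      fix f assume f: "f \<in> support z'"
      have "singular_chain (Suc q) (top_of_set (carrier_hull g q f)) (straightening_homotopy g q f)"
        using straightening_homotopy[OF fA(2)[OF f]] by blast
      then show "singular_chain (Suc q) (top_of_set B) (straightening_homotopy g q f)"
        by (rule singular_chain_mono) (rule hullB[OF f])
    qed
    then have "z' - ?u \<in> singular_boundaries q (top_of_set B)"
      unfolding singular_boundaries_def bd by (rule imageI)
    moreover have "z - z' \<in> singular_boundaries q (top_of_set B)"
      using z'(2) singular_boundaries_mono[OF \<open>A \<subseteq> B\<close>] by blast
    ultimately have "(z - z') + (z' - ?u) \<in> singular_boundaries q (top_of_set B)"
      by (intro chains.subspace_add[OF subspace_singular_boundaries])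
    then have diff: "z - ?u \<in> singular_boundaries q (top_of_set B)" by simp
    have keys: "support ?u \<subseteq> F"
    proof
      fix s assume "s \<in> support ?u"
      then obtain f where f: "f \<in> support z'" "s = straighten g q f"
        using keys_field_lift[of "\<lambda>f. frag_of (straighten g q f)" z'] by auto
      have "s = (\<lambda>x\<in>standard_simplex q. \<Sum>j\<le>q. x j *\<^sub>R (\<lambda>j\<in>{..q}. g (f (simplex_vertex j))) j)"
        by (auto simp: f straighten_def fun_eq_iff intro!: sum.cong)
      moreover have "(\<lambda>j\<in>{..q}. g (f (simplex_vertex j))) \<in> PiE {..q} (\<lambda>_. N)"
      proof (rule PiE_I)
        fix j assume "j \<in> {..q}"
        then have "f (simplex_vertex j) \<in> A" using simplex_vertex_in[of j q] fA(1)[OF f(1)] by auto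
        then show "(\<lambda>j\<in>{..q}. g (f (simplex_vertex j))) j \<in> N" using g \<open>j \<in> {..q}\<close> by simp
      qed simp
      ultimately show "s \<in> F" unfolding F_def by blast
    qed
    have "?u = (\<Sum>f\<in>support ?u. Poly_Mapping.map ((*) (Poly_Mapping.lookup ?u f)) (?single f))"
      by (rule poly_mapping_eqI) (simp add: lookup_sum lookup_map_mult lookup_single when_def in_keys_iff)
    also have "\<dots> \<in> chains.span (?single ` F)"
      using keys by (intro chains.span_sum chains.span_scale chains.span_base) auto
    finally show "\<exists>u\<in>chains.span (?single ` F). z - u \<in> singular_boundaries q (top_of_set B)"
      using diff by blast
  qed
  from enat_ile[OF this] show ?thesis by (auto simp: inclusion_rank_eq_rank_mod)
qed

section \<open>Counting functions and their thresholds\<close>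

text \<open>The deaths of the diagram points with a given birth are encoded by the decreasing function that
  counts the points dying after \<open>t\<close>, for \<open>t\<close> beyond the birth \<open>b\<close>; similarly for points with a given
  death. A threshold recovers the position of the \<open>j\<close>-th point, counted from the far end.\<close>

definition left_limit :: "(real \<Rightarrow> nat) \<Rightarrow> ereal \<Rightarrow> ereal \<Rightarrow> nat" where
  "left_limit n b d = Inf {n c | c. b < ereal c \<and> ereal c < d}"

definition right_limit :: "(real \<Rightarrow> nat) \<Rightarrow> ereal \<Rightarrow> nat" where
  "right_limit n d = Sup {n c | c. d < ereal c}"

definition threshold :: "(real \<Rightarrow> nat) \<Rightarrow> ereal \<Rightarrow> nat \<Rightarrow> ereal" where
  "threshold n b j = Sup {ereal t | t. b < ereal t \<and> j \<le> n t}"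

definition counting :: "(real \<Rightarrow> nat) \<Rightarrow> ereal \<Rightarrow> bool" where
  "counting n b \<longleftrightarrow> (\<forall>s t. b < ereal s \<longrightarrow> s \<le> t \<longrightarrow> n t \<le> n s)"

lemma countingD: "counting n b \<Longrightarrow> b < ereal s \<Longrightarrow> s \<le> t \<Longrightarrow> n t \<le> n s"
  by (auto simp: counting_def)

lemma ereal_between: "b < d \<Longrightarrow> \<exists>c. b < ereal c \<and> ereal c < d" for b d :: ereal
  using ereal_dense2 by blast

lemma ne_if_mem: "x \<in> A \<Longrightarrow> A \<noteq> {}" by auto

lemma left_limit_attained:
  assumes "b < d" obtains c where "b < ereal c" "ereal c < d" "left_limit n b d = n c"
proof -
  have "{n c | c. b < ereal c \<and> ereal c < d} \<noteq> {}" using ereal_between[OF assms] by blast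
  from Inf_nat_def1[OF this] show ?thesis using that unfolding left_limit_def by blast
qed

lemma left_limit_le: "b < ereal c \<Longrightarrow> ereal c < d \<Longrightarrow> left_limit n b d \<le> n c"
  unfolding left_limit_def by (intro wellorder_Inf_le1) auto

lemma right_limit_bdd:
  assumes "counting n b" "b < d" shows "finite {n c | c. d < ereal c}"
proof -
  obtain s where s: "b < ereal s" "ereal s < d" using ereal_between[OF assms(2)] by blast
  have "n c \<le> n s" if "d < ereal c" for c
  proof -
    have "ereal s < ereal c" using s(2) that by (rule less_trans)
    then show ?thesis using countingD[OF assms(1) s(1), of c] by simp
  qed
  then have "{n c | c. d < ereal c} \<subseteq> {..n s}" by auto
  then show ?thesis by (rule finite_subset) simp
qed

lemma le_right_limit:
  assumes "counting n b" "b < d" "d < ereal c" shows "n c \<le> right_limit n d"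
  unfolding right_limit_def
  by (intro cSup_upper bdd_above_finite right_limit_bdd[OF assms(1,2)]) (use assms in auto)

lemma right_limit_attained:
  assumes "counting n b" "b < d" "right_limit n d \<noteq> 0"
  obtains c where "d < ereal c" "right_limit n d = n c"
proof -
  have fin: "finite {n c | c. d < ereal c}" by (rule right_limit_bdd[OF assms(1,2)])
  have ne: "{n c | c. d < ereal c} \<noteq> {}"
  proof
    assume "{n c | c. d < ereal c} = {}"
    then have "right_limit n d = 0" unfolding right_limit_def by (simp add: Sup_nat_def)
    then show False using assms(3) by simp
  qed
  have "Sup {n c | c. d < ereal c} = Max {n c | c. d < ereal c}"
    by (rule cSup_eq_Max[OF fin ne])
  then have "right_limit n d \<in> {n c | c. d < ereal c}"
    unfolding right_limit_def using Max_in[OF fin ne] by simp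
  then show ?thesis using that by blast
qed

lemma right_limit_less_iff:
  assumes "counting n b" "b < d" "1 \<le> j"
  shows "right_limit n d < j \<longleftrightarrow> (\<forall>c. d < ereal c \<longrightarrow> n c < j)"
proof
  assume "right_limit n d < j"
  then show "\<forall>c. d < ereal c \<longrightarrow> n c < j" using le_right_limit[OF assms(1,2)] by fastforce
next
  assume *: "\<forall>c. d < ereal c \<longrightarrow> n c < j"
  show "right_limit n d < j"
  proof (cases "right_limit n d = 0")
    case False
    then obtain c where "d < ereal c" "right_limit n d = n c"
      using right_limit_attained[OF assms(1,2)] by blast
    then show ?thesis using * by auto
  qed (use assms in auto)
qed

lemma le_left_limit_iff:
  assumes "b < d"
  shows "j \<le> left_limit n b d \<longleftrightarrow> (\<forall>c. b < ereal c \<longrightarrow> ereal c < d \<longrightarrow> j \<le> n c)"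
proof
  assume "j \<le> left_limit n b d"
  then show "\<forall>c. b < ereal c \<longrightarrow> ereal c < d \<longrightarrow> j \<le> n c"
    using left_limit_le[of b _ d n] by (meson order_trans)
next
  assume "\<forall>c. b < ereal c \<longrightarrow> ereal c < d \<longrightarrow> j \<le> n c"
  then show "j \<le> left_limit n b d" by (metis left_limit_attained[OF assms])
qed

lemma le_threshold: "b < ereal t \<Longrightarrow> j \<le> n t \<Longrightarrow> ereal t \<le> threshold n b j"
  unfolding threshold_def by (intro Sup_upper) auto

lemma threshold_le: "(\<And>t. b < ereal t \<Longrightarrow> j \<le> n t \<Longrightarrow> ereal t \<le> e) \<Longrightarrow> threshold n b j \<le> e"
  unfolding threshold_def by (intro Sup_least) auto

lemma less_threshold:
  assumes "counting n b" "b < ereal c" "ereal c < threshold n b j" shows "j \<le> n c"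
proof -
  obtain t where t: "b < ereal t" "j \<le> n t" "c < t"
    using assms(3) unfolding threshold_def less_Sup_iff by auto
  then show ?thesis using countingD[OF assms(1,2), of t] by auto
qed

text \<open>The points at \<open>d\<close> correspond to the levels that the counting function skips at \<open>d\<close>.\<close>

lemma threshold_eq_iff:
  assumes n: "counting n b" and bd: "b < d" and j: "1 \<le> j"
  shows "(\<exists>t. b < ereal t \<and> j \<le> n t) \<and> threshold n b j = d
    \<longleftrightarrow> right_limit n d < j \<and> j \<le> left_limit n b d"
  unfolding right_limit_less_iff[OF n bd j] le_left_limit_iff[OF bd]
proof (intro iffI conjI allI impI; (elim conjE)?)
  fix c
  show "n c < j" if "threshold n b j = d" "d < ereal c"
    using le_threshold[of b c j n] that bd by (metis not_le not_less_iff_gr_or_eq less_trans)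
  show "j \<le> n c" if "threshold n b j = d" "b < ereal c" "ereal c < d"
    using less_threshold[OF n that(2)] that by simp
next
  assume r: "\<forall>c. d < ereal c \<longrightarrow> n c < j" and l: "\<forall>c. b < ereal c \<longrightarrow> ereal c < d \<longrightarrow> j \<le> n c"
  show "\<exists>t. b < ereal t \<and> j \<le> n t" using ereal_between[OF bd] l by blast
  show "threshold n b j = d"
  proof (rule antisym)
    show "threshold n b j \<le> d" using r by (intro threshold_le) (meson leD linorder_not_le)
    show "d \<le> threshold n b j"
    proof (rule dense_le_bounded[OF bd])
      fix w assume w: "b < w" "w < d"
      then obtain c where c: "w < ereal c" "ereal c < d" using ereal_between by blast
      then have "b < ereal c" using w(1) less_trans by blast
      then show "w \<le> threshold n b j"
        using le_threshold[of b c j n] l c by (meson less_imp_le order_trans)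
    qed
  qed
qed

text \<open>Counting functions that are interleaved with shifts \<open>\<alpha>\<close> and \<open>\<beta>\<close> have the \<open>j\<close>-th points of their
  multisets close to each other, for every \<open>j\<close> at once. This makes a matching by labels possible.\<close>

lemma threshold_shift:
  assumes n: "counting n b" and n': "counting n' (b - ereal \<alpha>)" and "0 \<le> \<alpha>" "0 \<le> \<beta>"
    and le: "\<And>t. b < ereal t \<Longrightarrow> n t \<le> n' (t - \<alpha>)"
    and ge: "\<And>t. b < ereal t \<Longrightarrow> n' (t + \<beta>) \<le> n t"
    and ex: "\<exists>t. b < ereal t \<and> j \<le> n t"
  shows "\<exists>t. b - ereal \<alpha> < ereal t \<and> j \<le> n' t"
    "threshold n b j \<le> threshold n' (b - ereal \<alpha>) j + ereal \<alpha>"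
    "threshold n' (b - ereal \<alpha>) j \<le> threshold n b j + ereal \<beta>"
proof -
  have sh: "b - ereal \<alpha> < ereal (t - \<alpha>) \<longleftrightarrow> b < ereal t" for t by (cases b) auto
  have 1: "b - ereal \<alpha> < ereal (t - \<alpha>) \<and> j \<le> n' (t - \<alpha>)" if "b < ereal t" "j \<le> n t" for t
    using that sh le by (meson order_trans)
  then show "\<exists>t. b - ereal \<alpha> < ereal t \<and> j \<le> n' t" using ex by blast
  show "threshold n b j \<le> threshold n' (b - ereal \<alpha>) j + ereal \<alpha>"
  proof (rule threshold_le)
    fix t assume "b < ereal t" "j \<le> n t"
    then have "ereal (t - \<alpha>) \<le> threshold n' (b - ereal \<alpha>) j" using 1 le_threshold by blast
    then show "ereal t \<le> threshold n' (b - ereal \<alpha>) j + ereal \<alpha>"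
      by (metis add_right_mono diff_add_cancel plus_ereal.simps(1))
  qed
  show "threshold n' (b - ereal \<alpha>) j \<le> threshold n b j + ereal \<beta>"
  proof (rule threshold_le)
    fix t assume t: "b - ereal \<alpha> < ereal t" "j \<le> n' t"
    obtain u where u: "b < ereal u" "j \<le> n u" using ex by blast
    have u': "ereal u \<le> threshold n b j" using le_threshold u by blast
    show "ereal t \<le> threshold n b j + ereal \<beta>"
    proof (cases "b < ereal (t - \<beta>)")
      case True
      then have "j \<le> n (t - \<beta>)" using ge[of "t - \<beta>"] t by simp
      then have "ereal (t - \<beta>) \<le> threshold n b j" using True le_threshold by blast
      then show ?thesis by (metis add_right_mono diff_add_cancel plus_ereal.simps(1))
    next
      case False
      then have "ereal (t - \<beta>) \<le> ereal u" using u by (meson le_less_trans not_le less_imp_le)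
      then have "ereal (t - \<beta>) \<le> threshold n b j" using u' by (rule order_trans)
      then show ?thesis by (metis add_right_mono diff_add_cancel plus_ereal.simps(1))
    qed
  qed
qed

text \<open>A level that the smaller counting function never reaches is left soon by the larger one.\<close>

lemma threshold_short:
  assumes ge: "\<And>t. b < ereal t \<Longrightarrow> n' (t + \<beta>) \<le> n t"
    and ex: "\<not> (\<exists>t. b < ereal t \<and> j \<le> n t)"
  shows "threshold n' b' j \<le> b + ereal \<beta>"
proof (rule threshold_le, rule ccontr)
  fix t assume t: "b' < ereal t" "j \<le> n' t" "\<not> ereal t \<le> b + ereal \<beta>"
  then have "b < ereal (t - \<beta>)" by (cases b) auto
  then show False using ge[of "t - \<beta>"] ex t by auto
qed

section \<open>Rows and columns of a persistence diagram\<close>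

text \<open>What is left of a persistence module when only the ranks of its maps at distinct parameters are
  kept. These properties are enough to relate its diagram to counting functions.\<close>

locale rank_function =
  fixes r :: "real \<Rightarrow> real \<Rightarrow> nat"
  assumes mono: "a \<le> b \<Longrightarrow> b < c \<Longrightarrow> c \<le> d \<Longrightarrow> r a d \<le> r b c"
    and exchange: "a \<le> b \<Longrightarrow> b < c \<Longrightarrow> c \<le> d \<Longrightarrow> r b d + r a c \<le> r b c + r a d"
    and negative: "s < 0 \<Longrightarrow> s < t \<Longrightarrow> r s t = 0"
begin

definition rank_upto :: "real \<Rightarrow> ereal \<Rightarrow> nat" where
  "rank_upto s e = (if e = \<infinity> then 0 else r s (real_of_ereal e))"

definition rect :: "real \<Rightarrow> real \<Rightarrow> real \<Rightarrow> ereal \<Rightarrow> int" where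
  "rect a b c d = int (r b c) - int (r a c) - int (rank_upto b d) + int (rank_upto a d)"

definition beyond :: "ereal \<Rightarrow> ereal \<Rightarrow> bool" where
  "beyond d d' \<longleftrightarrow> d < d' \<or> (d = \<infinity> \<and> d' = \<infinity>)"

definition diagram :: diagram where
  "diagram = (\<lambda>(b, d). if ereal b < d then
     nat (Inf {rect a b' c d' | a b' c d'. a < b \<and> b < b' \<and> b' < c \<and> ereal c < d \<and>
       (d < d' \<or> (d = \<infinity> \<and> d' = \<infinity>))}) else 0)"

text \<open>The number of diagram points with birth \<open>b\<close> that are still alive at \<open>t\<close>, and the number of
  those with death \<open>d\<close> that are already born at \<open>- t\<close>; the sign makes both decreasing.\<close>

definition row :: "real \<Rightarrow> real \<Rightarrow> nat" where
  "row b t = Inf {r b' t - r a t | a b'. a < b \<and> b < b' \<and> b' < t}"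

definition column :: "ereal \<Rightarrow> real \<Rightarrow> nat" where
  "column d t = Inf {r (- t) c - rank_upto (- t) d' | c d'. - t < c \<and> ereal c < d \<and> beyond d d'}"

lemma row_le: "a < b \<Longrightarrow> b < b' \<Longrightarrow> b' < t \<Longrightarrow> row b t \<le> r b' t - r a t"
  unfolding row_def by (intro wellorder_Inf_le1 CollectI exI conjI) (rule refl)

lemma column_le:
  "- t < c \<Longrightarrow> ereal c < d \<Longrightarrow> beyond d d' \<Longrightarrow> column d t \<le> r (- t) c - rank_upto (- t) d'"
  unfolding column_def by (intro wellorder_Inf_le1 CollectI exI conjI) (rule refl)

lemma beyond_trans: "ereal c < d \<Longrightarrow> beyond d d' \<Longrightarrow> ereal c < d'"
  by (auto simp: beyond_def dest: less_trans)

lemma rank_upto_le: "s < c \<Longrightarrow> ereal c \<le> e \<Longrightarrow> rank_upto s e \<le> r s c"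
  by (cases e) (auto simp: rank_upto_def intro: mono)

lemma rank_upto_antimono: "ereal s < e \<Longrightarrow> e \<le> e' \<Longrightarrow> rank_upto s e' \<le> rank_upto s e"
  by (cases e; cases e') (auto simp: rank_upto_def intro: mono)

lemma exchange_upto:
  "a \<le> b \<Longrightarrow> b < c \<Longrightarrow> ereal c \<le> e \<Longrightarrow> rank_upto b e + r a c \<le> r b c + rank_upto a e"
  by (cases e) (auto simp: rank_upto_def intro: exchange mono)

lemma exchange_upto2:
  "a \<le> b \<Longrightarrow> ereal b < e \<Longrightarrow> e \<le> e' \<Longrightarrow> rank_upto b e' + rank_upto a e \<le> rank_upto b e + rank_upto a e'"
  by (cases e; cases e') (auto simp: rank_upto_def intro: exchange mono)

lemma rect_mono:
  assumes "a \<le> a1" "a1 \<le> b1" "b1 \<le> b" "b < c" "c \<le> c1" "ereal c1 \<le> d1" "d1 \<le> d"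
  shows "rect a1 b1 c1 d1 \<le> rect a b c d"
proof -
  have c: "ereal b < ereal c1" "ereal c1 \<le> d" using assms by auto
  have 1: "ereal b < d1" by (rule less_le_trans[OF c(1) assms(6)])
  have 2: "ereal b < d" by (rule less_le_trans[OF c])
  have 3: "ereal b1 < d1" using assms(3) by (intro le_less_trans[OF _ 1]) simp
  note bd = 1 2 3
  have "rect a1 b1 c1 d1 \<le> rect a b1 c1 d1"
    using exchange_upto[of a a1 c1 d1] assms unfolding rect_def by linarith
  also have "\<dots> \<le> rect a b c1 d1"
    using exchange_upto[of b1 b c1 d1] assms unfolding rect_def by linarith
  also have "\<dots> \<le> rect a b c d1"
    using exchange[of a b c c1] assms unfolding rect_def by linarith
  also have "\<dots> \<le> rect a b c d"
    using exchange_upto2[of a b d1 d] assms bd unfolding rect_def by linarith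
  finally show ?thesis .
qed

text \<open>As infimum of a set of natural numbers a row count is attained, and monotonicity in both corners
  makes the value constant for all closer parameters.\<close>

lemma row_attained:
  assumes "b < t"
  obtains a b' where "a < b" "b < b'" "b' < t"
    "\<And>a1 b1. a \<le> a1 \<Longrightarrow> a1 < b \<Longrightarrow> b < b1 \<Longrightarrow> b1 \<le> b' \<Longrightarrow> r b1 t = r a1 t + row b t"
proof -
  let ?S = "{r b' t - r a t | a b'. a < b \<and> b < b' \<and> b' < t}"
  have "r ((b + t)/2) t - r (b - 1) t \<in> ?S" using assms by (intro CollectI exI[of _ "b - 1"] exI[of _ "(b+t)/2"]) auto
  then have "?S \<noteq> {}" by (rule ne_if_mem)
  then have "Inf ?S \<in> ?S" by (rule Inf_nat_def1)
  then obtain a b' where ab: "a < b" "b < b'" "b' < t" "row b t = r b' t - r a t"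
    unfolding row_def by blast
  show ?thesis
  proof (rule that[OF ab(1-3)])
    fix a1 b1 assume 1: "a \<le> a1" "a1 < b" "b < b1" "b1 \<le> b'"
    have "row b t \<le> r b1 t - r a1 t"
      using 1 ab by (intro row_le) auto
    moreover have "r a1 t \<le> r b1 t" "r a t \<le> r a1 t" "r b1 t \<le> r b' t"
      using 1 ab assms by (auto intro: mono)
    ultimately show "r b1 t = r a1 t + row b t" using ab(4) by linarith
  qed
qed

lemma column_attained:
  assumes "ereal (- t) < d"
  obtains c d' where "- t < c" "ereal c < d" "beyond d d'"
    "\<And>c1 d1. c \<le> c1 \<Longrightarrow> ereal c1 < d \<Longrightarrow> beyond d d1 \<Longrightarrow> d1 \<le> d' \<Longrightarrow> r (- t) c1 = rank_upto (- t) d1 + column d t"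
proof -
  let ?S = "{r (- t) c - rank_upto (- t) d' | c d'. - t < c \<and> ereal c < d \<and> beyond d d'}"
  obtain c0 where c0: "ereal (- t) < ereal c0" "ereal c0 < d" using ereal_between[OF assms] by blast
  have "r (- t) c0 - rank_upto (- t) \<infinity> \<in> ?S"
    using c0 by (intro CollectI exI[of _ c0] exI[of _ \<infinity>]) (cases d; auto simp: beyond_def)
  then have "?S \<noteq> {}" by (rule ne_if_mem)
  then have "Inf ?S \<in> ?S" by (rule Inf_nat_def1)
  then obtain c d' where cd: "- t < c" "ereal c < d" "beyond d d'" "column d t = r (- t) c - rank_upto (- t) d'"
    unfolding column_def by blast
  show ?thesis
  proof (rule that[OF cd(1-3)])
    fix c1 d1 assume 1: "c \<le> c1" "ereal c1 < d" "beyond d d1" "d1 \<le> d'"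
    have "column d t \<le> r (- t) c1 - rank_upto (- t) d1"
      using 1 cd by (intro column_le) auto
    moreover have "ereal c1 < d1" by (rule beyond_trans[OF 1(2,3)])
    moreover have "ereal (- t) < d1"
      using cd(1) 1(1) by (intro less_trans[OF _ \<open>ereal c1 < d1\<close>]) simp
    moreover have "r (- t) c1 \<le> r (- t) c" using 1 cd by (intro mono) auto
    moreover have "rank_upto (- t) d1 \<le> r (- t) c1"
      using 1 cd \<open>ereal c1 < d1\<close> by (intro rank_upto_le) auto
    moreover have "rank_upto (- t) d' \<le> rank_upto (- t) d1"
      by (rule rank_upto_antimono) fact+
    ultimately show "r (- t) c1 = rank_upto (- t) d1 + column d t"
      using cd(4) by linarith
  qed
qed

lemma counting_row: "counting (row b) (ereal b)"
  unfolding counting_def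
proof (intro allI impI)
  fix s t assume st: "ereal b < ereal s" "s \<le> t"
  obtain a b' where s: "a < b" "b < b'" "b' < s"
    "\<And>a1 b1. a \<le> a1 \<Longrightarrow> a1 < b \<Longrightarrow> b < b1 \<Longrightarrow> b1 \<le> b' \<Longrightarrow> r b1 s = r a1 s + row b s"
    using row_attained[of b s] st by auto
  have "row b t \<le> r b' t - r a t"
    using s st by (intro row_le) auto
  moreover have "r b' t + r a s \<le> r b' s + r a t" using s st by (intro exchange) auto
  ultimately show "row b t \<le> row b s" using s(4)[of a b'] s by linarith
qed

lemma counting_column: "counting (column d) (- d)"
  unfolding counting_def
proof (intro allI impI)
  fix s t assume st: "- d < ereal s" "s \<le> t"
  have sd: "ereal (- s) < d" using st(1) by (metis ereal_uminus_less_reorder uminus_ereal.simps(1))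
  obtain c d' where s: "- s < c" "ereal c < d" "beyond d d'"
    "\<And>c1 d1. c \<le> c1 \<Longrightarrow> ereal c1 < d \<Longrightarrow> beyond d d1 \<Longrightarrow> d1 \<le> d' \<Longrightarrow> r (- s) c1 = rank_upto (- s) d1 + column d s"
    using column_attained[OF sd] by auto
  have "column d t \<le> r (- t) c - rank_upto (- t) d'"
    using s st by (intro column_le) auto
  moreover have "rank_upto (- s) d' + r (- t) c \<le> r (- s) c + rank_upto (- t) d'"
    using s st beyond_trans[OF s(2,3)] by (intro exchange_upto) auto
  ultimately show "column d t \<le> column d s" using s(4)[of c d'] s by auto
qed

text \<open>The multiplicity of a point can be computed along any family of shrinking rectangles.\<close>

lemma diagram_eqI:
  assumes bd: "ereal b < d"
    and shrink: "\<And>a b' c d'. a < b \<Longrightarrow> b < b' \<Longrightarrow> b' < c \<Longrightarrow> ereal c < d \<Longrightarrow> beyond d d' \<Longrightarrow>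
      \<exists>a1 b1 c1 d1. a \<le> a1 \<and> a1 < b \<and> b < b1 \<and> b1 \<le> b' \<and> c \<le> c1 \<and> ereal c1 < d \<and> beyond d d1 \<and> d1 \<le> d'
        \<and> rect a1 b1 c1 d1 = k"
  shows "diagram (b, d) = nat k"
proof -
  let ?S = "{rect a b' c d' | a b' c d'. a < b \<and> b < b' \<and> b' < c \<and> ereal c < d \<and> beyond d d'}"
  have lower: "k \<le> rect a b' c d'"
    if *: "a < b" "b < b'" "b' < c" "ereal c < d" "beyond d d'" for a b' c d'
  proof -
    obtain a1 b1 c1 d1 where 1: "a \<le> a1" "a1 < b" "b < b1" "b1 \<le> b'" "c \<le> c1" "ereal c1 < d" "beyond d d1" "d1 \<le> d'"
      "rect a1 b1 c1 d1 = k" using shrink[OF *] by blast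
    have "rect a1 b1 c1 d1 \<le> rect a b' c d'"
      using * 1 beyond_trans[OF 1(6,7)] by (intro rect_mono) auto
    then show ?thesis using 1 by simp
  qed
  obtain c where c: "ereal b < ereal c" "ereal c < d" using ereal_between[OF bd] by blast
  have "b - 1 < b" "b < (b + c) / 2" "(b + c) / 2 < c" "beyond d \<infinity>"
    using c by (auto simp: beyond_def)
  from shrink[OF this(1-3) c(2) this(4)]
  obtain a1 b1 c1 d1 where 1: "b - 1 \<le> a1" "a1 < b" "b < b1" "b1 \<le> (b + c) / 2" "c \<le> c1"
     "ereal c1 < d" "beyond d d1" "rect a1 b1 c1 d1 = k" by blast
  have "b1 < c1" using 1 c by auto
  then have "k \<in> ?S" using 1 by blast
  then have "Inf ?S = k" by (rule cInf_eq_minimum) (use lower in blast)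
  then show ?thesis using bd unfolding diagram_def beyond_def by simp
qed

lemma left_limit_near:
  assumes n: "counting n b" and bd: "b < d" "c < d" "c \<noteq> \<infinity>"
  obtains t where "b < ereal t" "c < ereal t" "ereal t < d" "n t = left_limit n b d"
proof -
  obtain t where t: "b < ereal t" "ereal t < d" "left_limit n b d = n t"
    using left_limit_attained[OF bd(1)] by blast
  obtain u where u: "max c (ereal t) < ereal u" "ereal u < d"
    using ereal_between[of "max c (ereal t)" d] t bd by auto
  have "n u \<le> n t" using countingD[OF n t(1)] u by auto
  moreover have bu: "b < ereal u" using t(1) u by (auto intro: less_trans)
  moreover have "left_limit n b d \<le> n u" using left_limit_le[OF bu u(2)] .
  ultimately show ?thesis using that[of u] t u by auto
qed

lemma right_limit_near:
  assumes n: "counting n b" and bd: "b < d" "d < e"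
  obtains t where "d < ereal t" "ereal t < e" "n t = right_limit n d"
proof (cases "right_limit n d = 0")
  case True
  obtain t where t: "d < ereal t" "ereal t < e" using ereal_between[OF bd(2)] by blast
  then show ?thesis using that[of t] le_right_limit[OF n bd(1) t(1)] True by simp
next
  case False
  then obtain u where u: "d < ereal u" "right_limit n d = n u"
    using right_limit_attained[OF n bd(1)] by blast
  obtain t where t: "d < ereal t" "ereal t < min e (ereal u)"
    using ereal_between[of d "min e (ereal u)"] bd u by auto
  have "b < ereal t" using bd(1) t(1) by (rule less_trans)
  then have "n u \<le> n t" using countingD[OF n, of t u] t by auto
  then show ?thesis using that[of t] le_right_limit[OF n bd(1) t(1)] u t by auto
qed

text \<open>In a small rectangle about \<open>(b, d)\<close> the measure is the difference of the row counts just before and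
  just after \<open>d\<close>.\<close>

lemma diagram_row:
  assumes bd: "ereal b < d"
  shows "diagram (b, d) = left_limit (row b) (ereal b) d - right_limit (row b) d"
proof -
  let ?k = "int (left_limit (row b) (ereal b) d) - int (right_limit (row b) d)"
  have "diagram (b, d) = nat ?k"
  proof (rule diagram_eqI[OF bd])
    fix a b' c d' assume *: "a < b" "b < b'" "b' < c" "ereal c < d" "beyond d d'"
    obtain c1 where c1: "ereal b < ereal c1" "ereal c < ereal c1" "ereal c1 < d"
      "row b c1 = left_limit (row b) (ereal b) d"
      using left_limit_near[OF counting_row bd *(4)] by auto
    obtain a1 b1 where ab: "a1 < b" "b < b1" "b1 < c1"
      "\<And>a2 b2. a1 \<le> a2 \<Longrightarrow> a2 < b \<Longrightarrow> b < b2 \<Longrightarrow> b2 \<le> b1 \<Longrightarrow> r b2 c1 = r a2 c1 + row b c1"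
      using row_attained[of b c1] c1(1) by auto
    show "\<exists>a1 b1 c1 d1. a \<le> a1 \<and> a1 < b \<and> b < b1 \<and> b1 \<le> b' \<and> c \<le> c1 \<and> ereal c1 < d \<and> beyond d d1 \<and> d1 \<le> d'
        \<and> rect a1 b1 c1 d1 = ?k"
    proof (cases "d = \<infinity>")
      case True
      have d': "d' = \<infinity>" using *(5) True by (simp add: beyond_def)
      have R: "right_limit (row b) d = 0" unfolding right_limit_def True by (simp add: Sup_nat_def)
      have "r (min b1 b') c1 = r (max a a1) c1 + row b c1"
        by (rule ab(4)) (use * ab(1-3) in auto)
      then have "rect (max a a1) (min b1 b') c1 d' = ?k"
        unfolding R rect_def rank_upto_def d' c1(4)[symmetric] by simp
      then show ?thesis
        using * ab(1-3) c1(2,3)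
        by (intro exI[of _ "max a a1"] exI[of _ "min b1 b'"] exI[of _ c1] exI[of _ d']) auto
    next
      case False
      then have "d < d'" using * by (auto simp: beyond_def)
      then obtain d1 where d1: "d < ereal d1" "ereal d1 < d'" "row b d1 = right_limit (row b) d"
        using right_limit_near[OF counting_row bd] by blast
      have "ereal b < ereal d1" using bd d1(1) by (rule less_trans)
      then obtain a2 b2 where ab2: "a2 < b" "b < b2" "b2 < d1"
        "\<And>a3 b3. a2 \<le> a3 \<Longrightarrow> a3 < b \<Longrightarrow> b < b3 \<Longrightarrow> b3 \<le> b2 \<Longrightarrow> r b3 d1 = r a3 d1 + row b d1"
        using row_attained[of b d1] by auto
      let ?a = "max a (max a1 a2)" and ?b = "min b' (min b1 b2)"
      have "r ?b c1 = r ?a c1 + row b c1" "r ?b d1 = r ?a d1 + row b d1"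
        by (rule ab(4) ab2(4); use * ab(1-3) ab2(1-3) in auto)+
      then have "rect ?a ?b c1 (ereal d1) = ?k"
        unfolding rect_def rank_upto_def c1(4)[symmetric] d1(3)[symmetric] by simp
      moreover have "a \<le> ?a" "?a < b" "b < ?b" "?b \<le> b'" "c \<le> c1" "ereal d1 \<le> d'"
        using *(1,2) ab(1,2) ab2(1,2) c1(2) d1(2) by (simp_all add: less_imp_le)
      moreover have "beyond d (ereal d1)" using d1(1) by (simp add: beyond_def)
      ultimately show ?thesis using c1(3) by (intro exI conjI)
    qed
  qed
  then show ?thesis by simp
qed

lemma diagram_column:
  assumes bd: "ereal b < d"
  shows "diagram (b, d) = left_limit (column d) (- d) (ereal (- b)) - right_limit (column d) (ereal (- b))"
proof -
  have bd': "- d < ereal (- b)" using bd by (metis ereal_minus_less_minus uminus_ereal.simps(1))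
  let ?k = "int (left_limit (column d) (- d) (ereal (- b))) - int (right_limit (column d) (ereal (- b)))"
  have "diagram (b, d) = nat ?k"
  proof (rule diagram_eqI[OF bd])
    fix a b' c d' assume *: "a < b" "b < b'" "b' < c" "ereal c < d" "beyond d d'"
    obtain t where t: "- d < ereal t" "ereal (- b') < ereal t" "ereal t < ereal (- b)"
      "column d t = left_limit (column d) (- d) (ereal (- b))"
      using left_limit_near[OF counting_column bd', of "ereal (- b')"] * by auto
    obtain u where u: "ereal (- b) < ereal u" "ereal u < ereal (- a)"
      "column d u = right_limit (column d) (ereal (- b))"
      using right_limit_near[OF counting_column bd', of "ereal (- a)"] * by auto
    have td: "ereal (- t) < d" using t(1) by (metis ereal_uminus_less_reorder uminus_ereal.simps(1))
    have "ereal (- u) < ereal b" using u by simp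
    then have ud: "ereal (- u) < d" using bd by (rule less_trans)
    obtain c1 d1 where 1: "- t < c1" "ereal c1 < d" "beyond d d1"
      "\<And>c2 d2. c1 \<le> c2 \<Longrightarrow> ereal c2 < d \<Longrightarrow> beyond d d2 \<Longrightarrow> d2 \<le> d1 \<Longrightarrow> r (- t) c2 = rank_upto (- t) d2 + column d t"
      using column_attained[OF td] by metis
    obtain c2 d2 where 2: "- u < c2" "ereal c2 < d" "beyond d d2"
      "\<And>c3 d3. c2 \<le> c3 \<Longrightarrow> ereal c3 < d \<Longrightarrow> beyond d d3 \<Longrightarrow> d3 \<le> d2 \<Longrightarrow> r (- u) c3 = rank_upto (- u) d3 + column d u"
      using column_attained[OF ud] by metis
    let ?c = "max c (max c1 c2)" and ?d = "min d' (min d1 d2)"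
    have cd: "ereal ?c < d" "beyond d ?d"
      using * 1 2 by (auto simp: max_def beyond_def min_def)
    have "r (- t) ?c = rank_upto (- t) ?d + column d t" "r (- u) ?c = rank_upto (- u) ?d + column d u"
      by (rule 1(4) 2(4); use cd in \<open>auto simp: min.coboundedI1 min.coboundedI2\<close>)+
    then have "rect (- u) (- t) ?c ?d = ?k" using t(4) u(3) by (simp add: rect_def)
    moreover have "a \<le> - u" "- u < b" "b < - t" "- t \<le> b'" "c \<le> ?c" "?d \<le> d'"
      using t(2,3) u(1,2) by simp_all
    ultimately show "\<exists>a1 b1 c1 d1. a \<le> a1 \<and> a1 < b \<and> b < b1 \<and> b1 \<le> b' \<and> c \<le> c1 \<and> ereal c1 < d \<and> beyond d d1 \<and> d1 \<le> d'
        \<and> rect a1 b1 c1 d1 = ?k" using cd by (intro exI conjI)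
  qed
  then show ?thesis by simp
qed

text \<open>The points with a given birth are numbered by the levels of the counting function of their
  row, in the order of decreasing death; likewise for the points with a given death.\<close>

definition row_label :: "(real \<times> ereal) \<times> nat \<Rightarrow> real \<times> nat" where
  "row_label = (\<lambda>((b, d), i). (b, right_limit (row b) d + i + 1))"

definition row_labels :: "(real \<times> nat) set" where
  "row_labels = {(b, j). 1 \<le> j \<and> (\<exists>t. ereal b < ereal t \<and> j \<le> row b t)}"

definition row_point :: "real \<times> nat \<Rightarrow> (real \<times> ereal) \<times> nat" where
  "row_point = (\<lambda>(b, j). let d = threshold (row b) (ereal b) j in ((b, d), j - 1 - right_limit (row b) d))"

definition column_label :: "(real \<times> ereal) \<times> nat \<Rightarrow> ereal \<times> nat" where
  "column_label = (\<lambda>((b, d), i). (d, right_limit (column d) (ereal (- b)) + i + 1))"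

definition column_labels :: "(ereal \<times> nat) set" where
  "column_labels = {(d, j). 1 \<le> j \<and> (\<exists>t. - d < ereal t \<and> j \<le> column d t)}"

definition column_point :: "ereal \<times> nat \<Rightarrow> (real \<times> ereal) \<times> nat" where
  "column_point = (\<lambda>(d, j). let b = - real_of_ereal (threshold (column d) (- d) j)
     in ((b, d), j - 1 - right_limit (column d) (ereal (- b))))"

lemma diagram_pointsD: "((b, d), i) \<in> diagram_points diagram \<Longrightarrow> ereal b < d"
  by (auto simp: diagram_points_def diagram_def split: if_splits)

lemma row_label_point:
  assumes "x \<in> diagram_points diagram"
  shows "row_label x \<in> row_labels" "row_point (row_label x) = x"
proof -
  obtain b d i where x: "x = ((b, d), i)" by (metis surj_pair)
  have bd: "ereal b < d" using assms diagram_pointsD x by blast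
  let ?j = "right_limit (row b) d + i + 1"
  have "right_limit (row b) d < ?j \<and> ?j \<le> left_limit (row b) (ereal b) d"
    using assms x diagram_row[OF bd] by (auto simp: diagram_points_def)
  then have "(\<exists>t. ereal b < ereal t \<and> ?j \<le> row b t) \<and> threshold (row b) (ereal b) ?j = d"
    using threshold_eq_iff[OF counting_row bd, of ?j] by simp
  then show "row_label x \<in> row_labels" "row_point (row_label x) = x"
    by (auto simp: x row_label_def row_labels_def row_point_def Let_def)
qed

lemma row_point_label:
  assumes "y \<in> row_labels"
  shows "row_point y \<in> diagram_points diagram" "row_label (row_point y) = y"
proof -
  obtain b j where y: "y = (b, j)" by (metis surj_pair)
  let ?d = "threshold (row b) (ereal b) j"
  have j: "1 \<le> j" "\<exists>t. ereal b < ereal t \<and> j \<le> row b t" using assms by (auto simp: y row_labels_def)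
  then have bd: "ereal b < ?d" using le_threshold less_le_trans by blast
  have 1: "right_limit (row b) ?d < j \<and> j \<le> left_limit (row b) (ereal b) ?d"
    using threshold_eq_iff[OF counting_row bd j(1)] j(2) by simp
  show "row_point y \<in> diagram_points diagram"
    using 1 diagram_row[OF bd] by (simp add: y row_point_def Let_def diagram_points_def) linarith
  show "row_label (row_point y) = y"
    using 1 by (simp add: y row_point_def row_label_def Let_def)
qed

lemma column_label_point:
  assumes "x \<in> diagram_points diagram"
  shows "column_label x \<in> column_labels" "column_point (column_label x) = x"
proof -
  obtain b d i where x: "x = ((b, d), i)" by (metis surj_pair)
  have bd: "ereal b < d" using assms diagram_pointsD x by blast
  then have bd': "- d < ereal (- b)" by (metis ereal_minus_less_minus uminus_ereal.simps(1))
  let ?j = "right_limit (column d) (ereal (- b)) + i + 1"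
  have "right_limit (column d) (ereal (- b)) < ?j \<and> ?j \<le> left_limit (column d) (- d) (ereal (- b))"
    using assms x diagram_column[OF bd] by (auto simp: diagram_points_def)
  then have "(\<exists>t. - d < ereal t \<and> ?j \<le> column d t) \<and> threshold (column d) (- d) ?j = ereal (- b)"
    using threshold_eq_iff[OF counting_column bd', of ?j] by simp
  then show "column_label x \<in> column_labels" "column_point (column_label x) = x"
    by (auto simp: x column_label_def column_labels_def column_point_def Let_def)
qed

lemma column_threshold:
  assumes j: "1 \<le> j" and ex: "\<exists>t. - d < ereal t \<and> j \<le> column d t"
  obtains b where "threshold (column d) (- d) j = ereal (- b)" "ereal b < d"
proof -
  have "t \<le> 0" if t: "- d < ereal t" "j \<le> column d t" for t
  proof (rule ccontr)
    assume neg: "\<not> t \<le> 0"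
    have "ereal (- t) < d" using t(1) by (metis ereal_uminus_less_reorder uminus_ereal.simps(1))
    then obtain c d' where c: "- t < c" "ereal c < d" "beyond d d'" using column_attained by metis
    then have "column d t \<le> r (- t) c - rank_upto (- t) d'" by (rule column_le)
    also have "r (- t) c = 0" using neg c by (intro negative) auto
    finally show False using j t by simp
  qed
  then have le: "threshold (column d) (- d) j \<le> ereal 0" by (intro threshold_le) simp
  obtain t where t: "- d < ereal t" "j \<le> column d t" using ex by blast
  then have ge: "ereal t \<le> threshold (column d) (- d) j" by (rule le_threshold)
  obtain x where x: "threshold (column d) (- d) j = ereal x"
    using le ge by (cases "threshold (column d) (- d) j") auto
  have "- d < ereal x" using t(1) ge unfolding x by (rule less_le_trans)
  then have "ereal (- x) < d" by (metis ereal_uminus_less_reorder uminus_ereal.simps(1))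
  then show ?thesis using that[of "- x"] x by simp
qed

lemma column_point_label:
  assumes "y \<in> column_labels"
  shows "column_point y \<in> diagram_points diagram" "column_label (column_point y) = y"
proof -
  obtain d j where y: "y = (d, j)" by (metis surj_pair)
  have j: "1 \<le> j" "\<exists>t. - d < ereal t \<and> j \<le> column d t" using assms by (auto simp: y column_labels_def)
  obtain b where b: "threshold (column d) (- d) j = ereal (- b)" "ereal b < d"
    using column_threshold[OF j] by blast
  have bd': "- d < ereal (- b)" using b(2) by (metis ereal_minus_less_minus uminus_ereal.simps(1))
  have 1: "right_limit (column d) (ereal (- b)) < j \<and> j \<le> left_limit (column d) (- d) (ereal (- b))"
    using threshold_eq_iff[OF counting_column bd' j(1)] j(2) b by simp
  show "column_point y \<in> diagram_points diagram"
    using 1 diagram_column[OF b(2)] by (simp add: y b column_point_def Let_def diagram_points_def) linarith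
  show "column_label (column_point y) = y"
    using 1 by (simp add: y b column_point_def column_label_def Let_def)
qed

end

text \<open>Two rank functions \<open>rK\<close> and \<open>rL\<close> with a third one \<open>rI\<close> between them, which in the application
  belongs to the images of the maps from one filtration to the other. The image module is a quotient
  of the first module, so births agree and deaths come earlier; it is a submodule of the second
  module shifted by \<open>\<eta>\<close>, so deaths agree and births come later. In both comparisons points are
  matched by their labels in rows or columns.\<close>

lemma diagram_matching_if_ranks:
  fixes rK rI rL :: "real \<Rightarrow> real \<Rightarrow> nat" and \<eta> :: real
  assumes rf: "rank_function rK" "rank_function rI" "rank_function rL" and \<eta>: "0 \<le> \<eta>"
    and KI: "\<And>a b t. a \<le> b \<Longrightarrow> b < t \<Longrightarrow> rI b t + rK a t \<le> rK b t + rI a t"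
    and IK: "\<And>a b t. a \<le> b \<Longrightarrow> b < t \<Longrightarrow> rK b (t + 2 * \<eta>) + rI a t \<le> rI b t + rK a (t + 2 * \<eta>)"
    and IL: "\<And>s c d. s < c \<Longrightarrow> c \<le> d \<Longrightarrow> rI s c + rL (s + \<eta>) (d + \<eta>) \<le> rL (s + \<eta>) (c + \<eta>) + rI s d"
      "\<And>s c. s < c \<Longrightarrow> rI s c \<le> rL (s + \<eta>) (c + \<eta>)"
    and LI: "\<And>s c d. s < c \<Longrightarrow> c \<le> d \<Longrightarrow> rL (s - \<eta>) (c + \<eta>) + rI s d \<le> rI s c + rL (s - \<eta>) (d + \<eta>)"
      "\<And>s c. s < c \<Longrightarrow> rL (s - \<eta>) (c + \<eta>) \<le> rI s c"
  shows "diagram_matching \<eta> (rank_function.diagram rK) (rank_function.diagram rL)"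
proof -
  interpret K: rank_function rK by fact
  interpret I: rank_function rI by fact
  interpret L: rank_function rL by fact
  let ?e = "ereal \<eta>"
  have row_le: "I.row b t \<le> K.row b t" if bt: "b < t" for b t
  proof -
    obtain a b' where ab: "a < b" "b < b'" "b' < t" "rK b' t = rK a t + K.row b t"
      using K.row_attained[OF bt] by (metis order_refl)
    have "I.row b t \<le> rI b' t - rI a t" by (rule I.row_le) (use ab in auto)
    then show ?thesis using KI[of a b' t] ab by linarith
  qed
  have row_ge: "K.row b (t + 2 * \<eta>) \<le> I.row b t" if bt: "b < t" for b t
  proof -
    obtain a b' where ab: "a < b" "b < b'" "b' < t" "rI b' t = rI a t + I.row b t"
      using I.row_attained[OF bt] by (metis order_refl)
    have "K.row b (t + 2 * \<eta>) \<le> rK b' (t + 2 * \<eta>) - rK a (t + 2 * \<eta>)" by (rule K.row_le) (use ab \<eta> in auto)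
    then show ?thesis using IK[of a b' t] ab by linarith
  qed
  have column_le: "I.column d t \<le> L.column (d + ?e) (t - \<eta>)" if dt: "- d < ereal t" for d t
  proof -
    have "ereal (- (t - \<eta>)) < d + ?e" using dt by (cases d) auto
    then obtain c d' where cd: "- (t - \<eta>) < c" "ereal c < d + ?e" "L.beyond (d + ?e) d'"
      "rL (- (t - \<eta>)) c = L.rank_upto (- (t - \<eta>)) d' + L.column (d + ?e) (t - \<eta>)"
      using L.column_attained[of "t - \<eta>" "d + ?e"] by (metis order_refl)
    have "- t < c - \<eta>" "ereal (c - \<eta>) < d" using cd by (auto, cases d, auto)
    moreover have "I.beyond d (d' - ?e)"
      using cd by (cases d; cases d') (auto simp: I.beyond_def L.beyond_def)
    ultimately have "I.column d t \<le> rI (- t) (c - \<eta>) - I.rank_upto (- t) (d' - ?e)" by (rule I.column_le)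
    also have "\<dots> \<le> L.column (d + ?e) (t - \<eta>)"
    proof (cases d')
      case (real x)
      have "ereal c < d'" using cd(2,3) by (rule L.beyond_trans)
      then show ?thesis
        using IL(1)[of "- t" "c - \<eta>" "x - \<eta>"] cd(4) real \<open>- t < c - \<eta>\<close>
        by (simp add: L.rank_upto_def I.rank_upto_def add.commute)
    next
      case PInf
      then show ?thesis
        using IL(2)[of "- t" "c - \<eta>"] cd(4) \<open>- t < c - \<eta>\<close>
        by (simp add: L.rank_upto_def I.rank_upto_def add.commute)
    next
      case MInf
      then show ?thesis using cd(2,3) L.beyond_trans by force
    qed
    finally show ?thesis .
  qed
  have column_ge: "L.column (d + ?e) (t + \<eta>) \<le> I.column d t" if dt: "- d < ereal t" for d t
  proof -
    have "ereal (- t) < d" using dt by (metis ereal_uminus_less_reorder uminus_ereal.simps(1))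
    then obtain c d' where cd: "- t < c" "ereal c < d" "I.beyond d d'"
      "rI (- t) c = I.rank_upto (- t) d' + I.column d t"
      using I.column_attained[of t d] by (metis order_refl)
    have "- (t + \<eta>) < c + \<eta>" "ereal (c + \<eta>) < d + ?e" using cd \<eta> by (auto, cases d, auto)
    moreover have "L.beyond (d + ?e) (d' + ?e)"
      using cd by (cases d; cases d') (auto simp: I.beyond_def L.beyond_def)
    ultimately have "L.column (d + ?e) (t + \<eta>) \<le> rL (- (t + \<eta>)) (c + \<eta>) - L.rank_upto (- (t + \<eta>)) (d' + ?e)"
      by (rule L.column_le)
    also have "\<dots> \<le> I.column d t"
    proof (cases d')
      case (real x)
      have "ereal c < d'" using cd(2,3) by (rule I.beyond_trans)
      then show ?thesis
        using LI(1)[of "- t" c x] cd real unfolding minus_add_distrib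
        by (simp add: L.rank_upto_def I.rank_upto_def)
    next
      case PInf
      then show ?thesis
        using LI(2)[of "- t" c] cd unfolding minus_add_distrib
        by (simp add: L.rank_upto_def I.rank_upto_def)
    next
      case MInf
      then show ?thesis using cd(2,3) I.beyond_trans by force
    qed
    finally show ?thesis .
  qed
  have shift: "- (d + ?e) = - d - ?e" for d by (cases d) auto
  have row0: "ereal b - ereal 0 = ereal b" for b by simp
  have rows: "\<exists>t. ereal b < ereal t \<and> j \<le> K.row b t"
      "threshold (I.row b) (ereal b) j \<le> threshold (K.row b) (ereal b) j"
      "threshold (K.row b) (ereal b) j \<le> threshold (I.row b) (ereal b) j + ereal (2 * \<eta>)"
    if "\<exists>t. ereal b < ereal t \<and> j \<le> I.row b t" for b j
    using threshold_shift[of "I.row b" "ereal b" "K.row b" 0 "2 * \<eta>" j, unfolded row0]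
      I.counting_row K.counting_row that row_le row_ge \<eta> by auto
  have columns: "\<exists>t. - (d + ?e) < ereal t \<and> j \<le> L.column (d + ?e) t"
      "threshold (I.column d) (- d) j \<le> threshold (L.column (d + ?e)) (- (d + ?e)) j + ?e"
      "threshold (L.column (d + ?e)) (- (d + ?e)) j \<le> threshold (I.column d) (- d) j + ?e"
    if "\<exists>t. - d < ereal t \<and> j \<le> I.column d t" for d j
    using threshold_shift[of "I.column d" "- d" "L.column (d + ?e)" \<eta> \<eta> j] I.counting_column[of d]
      L.counting_column[of "d + ?e"] that column_le column_ge \<eta> unfolding shift by auto
  have rowsub: "I.row_labels \<subseteq> K.row_labels"
    using rows(1) by (auto simp: I.row_labels_def K.row_labels_def)
  define sh where "sh = (\<lambda>(d :: ereal, j :: nat). (d + ?e, j))"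
  have sh_inj: "inj sh" unfolding sh_def inj_def by (auto simp: ereal_add_cancel_right)
  have colsub: "sh ` I.column_labels \<subseteq> L.column_labels"
    using columns(1) by (auto simp: I.column_labels_def L.column_labels_def sh_def)
  define A where "A = K.row_point ` I.row_labels"
  define B where "B = L.column_point ` sh ` I.column_labels"
  define m where "m = L.column_point \<circ> sh \<circ> I.column_label \<circ> I.row_point \<circ> K.row_label"
  have AK: "A \<subseteq> diagram_points K.diagram" using rowsub K.row_point_label by (auto simp: A_def)
  have BL: "B \<subseteq> diagram_points L.diagram"
  proof
    fix x assume "x \<in> B"
    then obtain y where "y \<in> sh ` I.column_labels" "x = L.column_point y" unfolding B_def by (rule imageE)
    then show "x \<in> diagram_points L.diagram"
      using L.column_point_label(1)[OF subsetD[OF colsub]] by simp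
  qed
  have 1: "bij_betw K.row_label A I.row_labels"
  proof (rule bij_betwI[where g = K.row_point])
    show "K.row_label \<in> A \<rightarrow> I.row_labels"
      unfolding A_def by (rule Pi_I, elim imageE) (simp add: K.row_point_label(2)[OF subsetD[OF rowsub]])
    show "K.row_point \<in> I.row_labels \<rightarrow> A" unfolding A_def by (rule Pi_I) (rule imageI)
    show "K.row_point (K.row_label x) = x" if "x \<in> A" for x
      using AK that K.row_label_point(2) by blast
    show "K.row_label (K.row_point y) = y" if "y \<in> I.row_labels" for y
      by (rule K.row_point_label(2)[OF subsetD[OF rowsub that]])
  qed
  have 2: "bij_betw I.row_point I.row_labels (diagram_points I.diagram)"
    by (rule bij_betwI[where g = I.row_label], rule Pi_I, erule I.row_point_label(1), rule Pi_I,
        erule I.row_label_point(1), erule I.row_point_label(2), erule I.row_label_point(2))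
  have 3: "bij_betw I.column_label (diagram_points I.diagram) I.column_labels"
    by (rule bij_betwI[where g = I.column_point], rule Pi_I, erule I.column_label_point(1), rule Pi_I,
        erule I.column_point_label(1), erule I.column_label_point(2), erule I.column_point_label(2))
  have 4: "bij_betw sh I.column_labels (sh ` I.column_labels)"
    using sh_inj by (meson inj_on_imp_bij_betw inj_on_subset subset_UNIV)
  have 5: "bij_betw L.column_point (sh ` I.column_labels) B"
    unfolding B_def
    by (rule inj_on_imp_bij_betw, rule inj_on_inverseI[where g = L.column_label],
        rule L.column_point_label(2)[OF subsetD[OF colsub]])
  have bij: "bij_betw m A B"
    unfolding m_def
    by (rule bij_betw_trans[OF 1 bij_betw_trans[OF 2 bij_betw_trans[OF 3 bij_betw_trans[OF 4 5]]]])
  have near: "linf_dist (fst x) (fst (m x)) \<le> ?e" if "x \<in> A" for x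
  proof -
    obtain b j where y: "(b, j) \<in> I.row_labels" "x = K.row_point (b, j)" using \<open>x \<in> A\<close> by (auto simp: A_def)
    have lab: "K.row_label x = (b, j)" using y rowsub K.row_point_label by auto
    have j: "\<exists>t. ereal b < ereal t \<and> j \<le> I.row b t" using y by (auto simp: I.row_labels_def)
    define d where "d = threshold (I.row b) (ereal b) j"
    define d1 where "d1 = threshold (K.row b) (ereal b) j"
    obtain i where p: "I.row_point (b, j) = ((b, d), i)" by (auto simp: I.row_point_def Let_def d_def)
    have pI: "((b, d), i) \<in> diagram_points I.diagram" using I.row_point_label[OF y(1)] p by simp
    have bd: "ereal b < d" using I.diagram_pointsD[OF pI] .
    have d1: "d \<le> d1" "d1 \<le> d + ereal (2 * \<eta>)" using rows(2,3)[OF j] by (auto simp: d_def d1_def)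
    have x1: "fst x = (b, d1)" by (simp add: y K.row_point_def Let_def d1_def)
    obtain j' where j': "I.column_label ((b, d), i) = (d, j')" by (auto simp: I.column_label_def)
    have lab': "(d, j') \<in> I.column_labels" and pt: "I.column_point (d, j') = ((b, d), i)"
      using I.column_label_point[OF pI] j' by auto
    have j'1: "1 \<le> j'" "\<exists>t. - d < ereal t \<and> j' \<le> I.column d t" using lab' by (auto simp: I.column_labels_def)
    obtain b0 where b0: "threshold (I.column d) (- d) j' = ereal (- b0)" using I.column_threshold[OF j'1] .
    have "b0 = b" using pt b0 by (simp add: I.column_point_def Let_def)
    obtain b2 where b2: "threshold (L.column (d + ?e)) (- (d + ?e)) j' = ereal (- b2)"
      using L.column_threshold[OF j'1(1) columns(1)[OF j'1(2)]] .
    have "m x = L.column_point (d + ?e, j')" by (simp add: m_def lab p j' sh_def)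
    then have mx: "fst (m x) = (b2, d + ?e)" using b2 by (simp add: L.column_point_def Let_def)
    have "\<bar>b - b2\<bar> \<le> \<eta>"
      using columns(2,3)[OF j'1(2)] unfolding b0 b2 \<open>b0 = b\<close> by simp
    then show ?thesis
      using d1 bd \<eta> unfolding x1 mx linf_dist_def by (cases d; cases d1) auto
  qed
  have unK: "d - ereal b \<le> ereal (2 * \<eta>)" if x: "((b, d), i) \<in> diagram_points K.diagram - A" for b d i
  proof -
    have xK: "((b, d), i) \<in> diagram_points K.diagram" using x by simp
    obtain j where lab: "K.row_label ((b, d), i) = (b, j)" by (auto simp: K.row_label_def)
    have "(b, j) \<in> K.row_labels" and pt: "K.row_point (b, j) = ((b, d), i)"
      using K.row_label_point[OF xK] lab by auto
    then have "1 \<le> j" by (auto simp: K.row_labels_def)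
    moreover have "(b, j) \<notin> I.row_labels" using x pt A_def by (metis DiffD2 image_eqI)
    ultimately have "\<not> (\<exists>t. ereal b < ereal t \<and> j \<le> I.row b t)" by (auto simp: I.row_labels_def)
    then have "threshold (K.row b) (ereal b) j \<le> ereal b + ereal (2 * \<eta>)"
      using row_ge by (intro threshold_short) auto
    then have "d \<le> ereal (b + 2 * \<eta>)" using pt by (simp add: K.row_point_def Let_def)
    then show ?thesis by (cases d) auto
  qed
  have unL: "d - ereal b \<le> ereal (2 * \<eta>)" if x: "((b, d), i) \<in> diagram_points L.diagram - B" for b d i
  proof -
    have xL: "((b, d), i) \<in> diagram_points L.diagram" using x by simp
    obtain j where lab: "L.column_label ((b, d), i) = (d, j)" by (auto simp: L.column_label_def)
    have labs: "(d, j) \<in> L.column_labels" and pt: "L.column_point (d, j) = ((b, d), i)"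
      using L.column_label_point[OF xL] lab by auto
    have j: "1 \<le> j" "\<exists>t. - d < ereal t \<and> j \<le> L.column d t" using labs by (auto simp: L.column_labels_def)
    have de: "d - ?e + ?e = d" by (cases d) auto
    then have "(d - ?e, j) \<notin> I.column_labels"
      using x pt unfolding B_def sh_def by (auto simp: image_iff)
    then have "\<not> (\<exists>t. - (d - ?e) < ereal t \<and> j \<le> I.column (d - ?e) t)" using j by (auto simp: I.column_labels_def)
    then have "threshold (L.column d) (- d) j \<le> - (d - ?e) + ?e"
      using column_ge[of "d - ?e"] unfolding de by (intro threshold_short) auto
    moreover obtain b0 where b0: "threshold (L.column d) (- d) j = ereal (- b0)" using L.column_threshold[OF j] .
    moreover have "b0 = b" using pt b0 by (simp add: L.column_point_def Let_def)
    ultimately show ?thesis by (cases d) auto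
  qed
  show ?thesis
    unfolding diagram_matching_def
    by (rule exI[of _ A], rule exI[of _ B], rule exI[of _ m]) (use AK BL bij near unK unL in auto)
qed

lemma diagram_matching_alt:
  "diagram_matching \<eta> D D' \<longleftrightarrow> (\<exists>A B m. A \<subseteq> diagram_points D \<and> B \<subseteq> diagram_points D' \<and>
     bij_betw m A B \<and> (\<forall>x\<in>A. linf_dist (fst x) (fst (m x)) \<le> ereal \<eta>) \<and>
     (\<forall>x \<in> (diagram_points D - A) \<union> (diagram_points D' - B). snd (fst x) - ereal (fst (fst x)) \<le> ereal (2 * \<eta>)))"
  unfolding diagram_matching_def split_def ..

lemma linf_dist_triangle:
  "linf_dist x y \<le> ereal \<eta>1 \<Longrightarrow> linf_dist y z \<le> ereal \<eta>2 \<Longrightarrow> linf_dist x z \<le> ereal (\<eta>1 + \<eta>2)"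
  by (cases "snd x"; cases "snd y"; cases "snd z") (auto simp: linf_dist_def split: if_splits)

lemma linf_dist_commute: "linf_dist x y = linf_dist y x"
  by (cases "snd x"; cases "snd y") (auto simp: linf_dist_def abs_minus_commute)

lemma linf_dist_gap:
  "linf_dist x y \<le> ereal \<eta> \<Longrightarrow> snd y - ereal (fst y) \<le> ereal (2 * \<zeta>) \<Longrightarrow> snd x - ereal (fst x) \<le> ereal (2 * (\<eta> + \<zeta>))"
  by (cases "snd x"; cases "snd y") (auto simp: linf_dist_def split: if_splits)

text \<open>The matchings are composed where both are defined. A point whose partner remains unmatched is
  itself close to the diagonal, as its partner is.\<close>

lemma diagram_matching_trans:
  assumes m1: "diagram_matching \<eta>1 D D'" and m2: "diagram_matching \<eta>2 D' D''" and nn: "0 \<le> \<eta>1" "0 \<le> \<eta>2"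
  shows "diagram_matching (\<eta>1 + \<eta>2) D D''"
proof -
  let ?gap = "\<lambda>\<eta> x. snd (fst x) - ereal (fst (fst x)) \<le> ereal (2 * \<eta>)"
  obtain A B m where 1: "A \<subseteq> diagram_points D" "B \<subseteq> diagram_points D'" "bij_betw m A B"
    "\<forall>x\<in>A. linf_dist (fst x) (fst (m x)) \<le> ereal \<eta>1"
    "\<forall>x \<in> (diagram_points D - A) \<union> (diagram_points D' - B). ?gap \<eta>1 x"
    using m1 unfolding diagram_matching_alt by blast
  obtain B' C m' where 2: "B' \<subseteq> diagram_points D'" "C \<subseteq> diagram_points D''" "bij_betw m' B' C"
    "\<forall>x\<in>B'. linf_dist (fst x) (fst (m' x)) \<le> ereal \<eta>2"
    "\<forall>x \<in> (diagram_points D' - B') \<union> (diagram_points D'' - C). ?gap \<eta>2 x"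
    using m2 unfolding diagram_matching_alt by blast
  have gap_mono: "?gap \<zeta>' x" if "?gap \<zeta> x" "\<zeta> \<le> \<zeta>'" for \<zeta> \<zeta>' and x :: "(real \<times> ereal) \<times> nat"
    using that(1) by (rule order_trans) (use that(2) in simp)
  define A0 where "A0 = {x \<in> A. m x \<in> B'}"
  have A0: "A0 \<subseteq> A" "m ` A0 \<subseteq> B'" by (auto simp: A0_def)
  have bij: "bij_betw (m' \<circ> m) A0 (m' ` m ` A0)"
    using A0 1(3) 2(3) by (auto simp: bij_betw_def image_comp intro!: comp_inj_on intro: inj_on_subset)
  show ?thesis
    unfolding diagram_matching_alt
  proof (intro exI conjI ballI)
    show "A0 \<subseteq> diagram_points D" using A0 1 by auto
    show "m' ` m ` A0 \<subseteq> diagram_points D''" 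
      using image_mono[OF A0(2), of m'] 2(2,3) unfolding bij_betw_def by simp
    show "bij_betw (m' \<circ> m) A0 (m' ` m ` A0)" by (rule bij)
    show "linf_dist (fst x) (fst ((m' \<circ> m) x)) \<le> ereal (\<eta>1 + \<eta>2)" if "x \<in> A0" for x
      using that A0 1(4) 2(4) linf_dist_triangle[of "fst x" "fst (m x)" \<eta>1 "fst (m' (m x))" \<eta>2] by auto
    fix x assume "x \<in> (diagram_points D - A0) \<union> (diagram_points D'' - m' ` m ` A0)"
    then show "?gap (\<eta>1 + \<eta>2) x"
    proof
      assume x: "x \<in> diagram_points D - A0"
      show ?thesis
      proof (cases "x \<in> A")
        case True
        then have "m x \<in> diagram_points D' - B'" using x 1(2,3) by (auto simp: A0_def bij_betw_def)
        then have "?gap \<eta>2 (m x)" using 2(5) by blast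
        moreover have "linf_dist (fst x) (fst (m x)) \<le> ereal \<eta>1" using True 1(4) by blast
        ultimately show ?thesis by (rule linf_dist_gap[rotated])
      next
        case False
        then have "?gap \<eta>1 x" using x 1(5) by blast
        then show ?thesis by (rule gap_mono) (use nn in simp)
      qed
    next
      assume x: "x \<in> diagram_points D'' - m' ` m ` A0"
      show ?thesis
      proof (cases "x \<in> C")
        case True
        then obtain y where y: "y \<in> B'" "x = m' y" using 2(3) by (auto simp: bij_betw_def)
        have "y \<notin> B"
        proof
          assume "y \<in> B"
          then obtain w where "w \<in> A" "y = m w" using 1(3) by (auto simp: bij_betw_def)
          then show False using x y by (auto simp: A0_def)
        qed
        then have "?gap \<eta>1 y" using y 2(1) 1(5) by blast
        moreover have "linf_dist (fst x) (fst y) \<le> ereal \<eta>2"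
          using y 2(4) linf_dist_commute[of "fst x" "fst y"] by auto
        ultimately show ?thesis by (subst add.commute) (rule linf_dist_gap[rotated])
      next
        case False
        then have "?gap \<eta>2 x" using x 2(5) by blast
        then show ?thesis by (rule gap_mono) (use nn in simp)
      qed
    qed
  qed
qed

section \<open>Stability of offset filtrations\<close>

definition homology_rank :: "'k::field itself \<Rightarrow> nat \<Rightarrow> 'a::topological_space set \<Rightarrow> 'a set \<Rightarrow> nat" where
  "homology_rank k q A B = the_enat (inclusion_rank k q (top_of_set A) (top_of_set B))"

definition finite_rank :: "'k::field itself \<Rightarrow> nat \<Rightarrow> 'a::topological_space set \<Rightarrow> 'a set \<Rightarrow> bool" where
  "finite_rank k q A B \<longleftrightarrow> inclusion_rank k q (top_of_set A) (top_of_set B) \<noteq> \<infinity>"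

lemma finite_rank_mono:
  assumes "finite_rank k q B C" "A \<subseteq> B" "C \<subseteq> D" shows "finite_rank k q A D"
proof -
  obtain n where "inclusion_rank k q (top_of_set B) (top_of_set C) = enat n"
    using assms(1) by (auto simp: finite_rank_def)
  then show ?thesis
    using inclusion_rank_mono[OF assms(2,3), of k q] enat_ile by (fastforce simp: finite_rank_def)
qed

lemma homology_rank_mono:
  assumes "finite_rank k q B C" "A \<subseteq> B" "C \<subseteq> D"
  shows "homology_rank k q A D \<le> homology_rank k q B C"
  using inclusion_rank_mono[OF assms(2,3), of k q] assms(1) finite_rank_mono[OF assms]
  by (auto simp: homology_rank_def finite_rank_def)

lemma homology_rank_exchange:
  assumes "finite_rank k q B C" "A \<subseteq> B" "C \<subseteq> D"
  shows "homology_rank k q B D + homology_rank k q A C \<le> homology_rank k q B C + homology_rank k q A D"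
  using inclusion_rank_exchange[OF assms(2,3), of k q] assms(1) finite_rank_mono[OF assms]
    finite_rank_mono[OF assms(1) order_refl assms(3)] finite_rank_mono[OF assms(1,2) order_refl]
  by (auto simp: homology_rank_def finite_rank_def)

lemma homology_rank_empty: "homology_rank k q {} B = 0"
  unfolding homology_rank_def inclusion_rank_empty by (simp add: zero_enat_def)

lemma finite_rank_empty: "finite_rank k q {} B"
  unfolding finite_rank_def inclusion_rank_empty by simp

lemma offset_negative: "s < 0 \<Longrightarrow> offset K s = {}"
  unfolding offset_def using infdist_nonneg by (auto simp: not_le intro: less_le_trans)

lemma offset_mono: "s \<le> t \<Longrightarrow> offset K s \<subseteq> offset K t"
  by (auto simp: offset_def)

lemma infdist_le_add:
  fixes K L :: "'a::euclidean_space set"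
  assumes "compact K" "K \<noteq> {}" "\<And>y. y \<in> K \<Longrightarrow> infdist y L \<le> \<eta>"
  shows "infdist x L \<le> infdist x K + \<eta>"
proof -
  obtain y where y: "y \<in> K" "infdist x K = dist x y"
    using infdist_attains_inf[of K x] compact_imp_closed[OF assms(1)] assms(2) by auto
  then show ?thesis using infdist_triangle[of x L y] assms(3)[of y] by simp
qed

lemma compact_offset:
  fixes K :: "'a::euclidean_space set"
  assumes "compact K" "K \<noteq> {}" shows "compact (offset K s)"
proof -
  obtain a e where ae: "K \<subseteq> cball a e" using bounded_subset_cball compact_imp_bounded[OF assms(1)] by blast
  have "offset K s \<subseteq> cball a (e + s)"
  proof
    fix x assume "x \<in> offset K s"
    moreover obtain y where y: "y \<in> K" "infdist x K = dist x y"
      using infdist_attains_inf[of K x] compact_imp_closed[OF assms(1)] assms(2) by auto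
    ultimately have "dist x y \<le> s" "dist a y \<le> e" using ae by (auto simp: offset_def)
    then show "x \<in> cball a (e + s)" using dist_triangle2[of a x y] by simp
  qed
  then have "bounded (offset K s)" using bounded_cball bounded_subset by blast
  moreover have "closed (offset K s)" unfolding offset_def
    by (intro closed_Collect_le continuous_intros)
  ultimately show ?thesis by (simp add: compact_eq_bounded_closed)
qed

lemma finite_rank_offset:
  fixes K :: "'a::euclidean_space set"
  assumes "compact K" "K \<noteq> {}" "s < t" shows "finite_rank k q (offset K s) (offset K t)"
proof (cases "s < 0")
  case True
  then show ?thesis by (simp add: offset_negative finite_rank_empty)
next
  case False
  obtain x where "x \<in> K" using assms(2) by blast
  then have "x \<in> offset K s" using False by (simp add: offset_def)
  then have ne: "offset K s \<noteq> {}" by blast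
  have "infdist x K \<le> infdist x (offset K s) + s" for x
    by (rule infdist_le_add[OF compact_offset[OF assms(1,2)] ne]) (simp add: offset_def)
  then have "{x. infdist x (offset K s) \<le> t - s} \<subseteq> offset K t"
    unfolding offset_def[of K t] by (intro Collect_mono impI) (metis add.commute add_left_mono diff_add_cancel order_trans)
  then show ?thesis
    using inclusion_rank_finite[OF compact_offset[OF assms(1,2)], of "t - s" s "offset K t" k q] assms(3)
    by (simp add: finite_rank_def)
qed

definition offset_function :: "'k::field itself \<Rightarrow> nat \<Rightarrow> 'a::metric_space set \<Rightarrow> real \<Rightarrow> real \<Rightarrow> nat" where
  "offset_function k q K s t = homology_rank k q (offset K s) (offset K t)"

lemma offset_rank_eq:
  "the_enat (offset_rank k q K s e) = (if e = \<infinity> then 0 else offset_function k q K s (real_of_ereal e))"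
proof (cases "s < 0")
  case True
  then show ?thesis
    unfolding offset_rank_def offset_function_def offset_negative[OF True] homology_rank_empty
    by (simp add: zero_enat_def)
next
  case False
  then show ?thesis unfolding offset_rank_def offset_function_def homology_rank_def by (simp add: zero_enat_def)
qed

lemma rank_function_offset:
  fixes K :: "'a::euclidean_space set"
  assumes "compact K" "K \<noteq> {}" shows "rank_function (offset_function k q K)"
proof
  fix a b c d :: real assume *: "a \<le> b" "b < c" "c \<le> d"
  note sub = finite_rank_offset[OF assms *(2), of k q] offset_mono[OF *(1), of K] offset_mono[OF *(3), of K]
  show "offset_function k q K a d \<le> offset_function k q K b c"
    unfolding offset_function_def by (rule homology_rank_mono[OF sub])
  show "offset_function k q K b d + offset_function k q K a c \<le> offset_function k q K b c + offset_function k q K a d"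
    unfolding offset_function_def by (rule homology_rank_exchange[OF sub])
next
  fix s t :: real assume "s < 0" "s < t"
  then show "offset_function k q K s t = 0" by (simp add: offset_function_def offset_negative homology_rank_empty)
qed

lemma persistence_diagram_eq:
  fixes K :: "'a::euclidean_space set"
  assumes "compact K" "K \<noteq> {}"
  shows "persistence_diagram k q K = rank_function.diagram (offset_function k q K)"
proof -
  interpret rank_function "offset_function k q K" by (rule rank_function_offset[OF assms])
  have "rectangle_measure k q K = rect"
    by (intro ext) (simp add: rectangle_measure_def rect_def rank_upto_def offset_rank_eq)
  then show ?thesis unfolding persistence_diagram_def diagram_def by (simp only:)
qed

text \<open>The hypothesis means \<open>K\<^sup>s \<subseteq> L\<^sup>s\<^sup>+\<^sup>\<eta> \<subseteq> K\<^sup>s\<^sup>+\<^sup>2\<^sup>\<eta>\<close>. The middle rank function belongs to the inclusions of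
  \<open>K\<^sup>s\<close> into \<open>L\<^sup>t\<^sup>+\<^sup>\<eta>\<close>.\<close>

lemma diagram_matching_offsets:
  fixes K L :: "'a::euclidean_space set"
  assumes K: "compact K" "K \<noteq> {}" and L: "compact L" "L \<noteq> {}" and \<eta>: "0 \<le> \<eta>"
    and KL: "\<And>x. x \<in> K \<Longrightarrow> infdist x L \<le> \<eta>" and LK: "\<And>x. x \<in> L \<Longrightarrow> infdist x K \<le> \<eta>"
  shows "diagram_matching \<eta> (persistence_diagram k q K) (persistence_diagram k q L)"
proof -
  have KLs: "offset K s \<subseteq> offset L (s + \<eta>)" for s
    using infdist_le_add[OF K KL] by (auto simp: offset_def intro: order_trans add_right_mono)
  have LKs: "offset L s \<subseteq> offset K (s + \<eta>)" for s
    using infdist_le_add[OF L LK] by (auto simp: offset_def intro: order_trans add_right_mono)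
  define rI where "rI = (\<lambda>s t. homology_rank k q (offset K s) (offset L (t + \<eta>)))"
  have fK: "finite_rank k q (offset K s) (offset K t)" and fL: "finite_rank k q (offset L s) (offset L t)"
    if "s < t" for s t by (rule finite_rank_offset[OF K that] finite_rank_offset[OF L that])+
  have fI: "finite_rank k q (offset K s) (offset L (t + \<eta>))" if "s < t" for s t
    by (rule finite_rank_mono[OF fK[OF that] order_refl KLs])
  have LsK: "offset L (s - \<eta>) \<subseteq> offset K s" for s using LKs[of "s - \<eta>"] by simp
  have LK2: "offset L (t + \<eta>) \<subseteq> offset K (t + 2 * \<eta>)" for t using LKs[of "t + \<eta>"] by (simp add: algebra_simps)
  have I: "rank_function rI"
  proof
    fix a b c d :: real assume *: "a \<le> b" "b < c" "c \<le> d"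
    note sub = fI[OF *(2)] offset_mono[OF *(1), of K] offset_mono[OF add_right_mono[OF *(3)], of L \<eta>]
    show "rI a d \<le> rI b c" unfolding rI_def by (rule homology_rank_mono[OF sub])
    show "rI b d + rI a c \<le> rI b c + rI a d" unfolding rI_def by (rule homology_rank_exchange[OF sub])
  qed (simp add: rI_def offset_negative homology_rank_empty)
  show ?thesis
    unfolding persistence_diagram_eq[OF K] persistence_diagram_eq[OF L]
  proof (rule diagram_matching_if_ranks[OF rank_function_offset[OF K] I rank_function_offset[OF L] \<eta>],
      unfold offset_function_def rI_def)
    fix a b t :: real assume *: "a \<le> b" "b < t"
    show "homology_rank k q (offset K b) (offset L (t + \<eta>)) + homology_rank k q (offset K a) (offset K t)
        \<le> homology_rank k q (offset K b) (offset K t) + homology_rank k q (offset K a) (offset L (t + \<eta>))"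
      by (rule homology_rank_exchange[OF fK[OF *(2)] offset_mono[OF *(1)] KLs])
    show "homology_rank k q (offset K b) (offset K (t + 2 * \<eta>)) + homology_rank k q (offset K a) (offset L (t + \<eta>))
        \<le> homology_rank k q (offset K b) (offset L (t + \<eta>)) + homology_rank k q (offset K a) (offset K (t + 2 * \<eta>))"
      by (rule homology_rank_exchange[OF fI[OF *(2)] offset_mono[OF *(1)] LK2])
  next
    fix s c d :: real assume *: "s < c" "c \<le> d"
    have cd: "offset L (c + \<eta>) \<subseteq> offset L (d + \<eta>)" using *(2) by (intro offset_mono) simp
    have f: "finite_rank k q (offset L (s + \<eta>)) (offset L (c + \<eta>))" using *(1) by (intro fL) simp
    show "homology_rank k q (offset K s) (offset L (c + \<eta>)) + homology_rank k q (offset L (s + \<eta>)) (offset L (d + \<eta>))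
        \<le> homology_rank k q (offset L (s + \<eta>)) (offset L (c + \<eta>)) + homology_rank k q (offset K s) (offset L (d + \<eta>))"
      using homology_rank_exchange[OF f KLs cd] by simp
    show "homology_rank k q (offset L (s - \<eta>)) (offset L (c + \<eta>)) + homology_rank k q (offset K s) (offset L (d + \<eta>))
        \<le> homology_rank k q (offset K s) (offset L (c + \<eta>)) + homology_rank k q (offset L (s - \<eta>)) (offset L (d + \<eta>))"
      using homology_rank_exchange[OF fI[OF *(1)] LsK cd] by simp
  next
    fix s c :: real assume *: "s < c"
    have f: "finite_rank k q (offset L (s + \<eta>)) (offset L (c + \<eta>))" using * by (intro fL) simp
    show "homology_rank k q (offset K s) (offset L (c + \<eta>)) \<le> homology_rank k q (offset L (s + \<eta>)) (offset L (c + \<eta>))"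
      by (rule homology_rank_mono[OF f KLs order_refl])
    show "homology_rank k q (offset L (s - \<eta>)) (offset L (c + \<eta>)) \<le> homology_rank k q (offset K s) (offset L (c + \<eta>))"
      by (rule homology_rank_mono[OF fI[OF *] LsK order_refl])
  qed
qed

lemma bottleneck_dist_le:
  "diagram_matching \<eta> D D' \<Longrightarrow> 0 \<le> \<eta> \<Longrightarrow> bottleneck_dist D D' \<le> ereal \<eta>"
  unfolding bottleneck_dist_def by (intro Inf_lower) auto

lemma bottleneck_dist_matching:
  assumes "diagram_matching \<eta> D D'" "0 \<le> \<eta>"
  shows "bottleneck_dist D D'' \<le> ereal \<eta> + bottleneck_dist D' D''"
proof -
  have "bottleneck_dist D D'' - ereal \<eta> \<le> bottleneck_dist D' D''"
    unfolding bottleneck_dist_def[of D' D'']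
  proof (rule Inf_greatest)
    fix x assume "x \<in> {ereal \<eta> | \<eta>. 0 \<le> \<eta> \<and> diagram_matching \<eta> D' D''}"
    then obtain \<zeta> where \<zeta>: "x = ereal \<zeta>" "0 \<le> \<zeta>" "diagram_matching \<zeta> D' D''" by blast
    have "bottleneck_dist D D'' \<le> ereal (\<eta> + \<zeta>)"
      by (rule bottleneck_dist_le[OF diagram_matching_trans[OF assms(1) \<zeta>(3) assms(2) \<zeta>(2)]]) (use assms \<zeta> in simp)
    then show "bottleneck_dist D D'' - ereal \<eta> \<le> x"
      unfolding \<zeta>(1) by (cases "bottleneck_dist D D''") auto
  qed
  then show ?thesis by (cases "bottleneck_dist D D''"; cases "bottleneck_dist D' D''") auto
qed

section \<open>Interior cones in sets of positive reach\<close>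

text \<open>Moving \<open>u\<close> straight away from its nearest point, the nearest points of the moved points converge to
  the old one because it is unique. So the direction of motion is almost the direction away from them.\<close>

lemma infdist_strict_growth:
  fixes M :: "'a::euclidean_space set"
  assumes M: "compact M" "M \<noteq> {}" and pos: "0 < infdist u M"
    and unique: "\<exists>!y. y \<in> M \<and> dist u y = infdist u M" and \<theta>: "\<theta> < 1" and \<delta>: "0 < \<delta>"
  shows "\<exists>v t. 0 < t \<and> t < \<delta> \<and> dist u v = t \<and> infdist u M + \<theta> * t < infdist v M"
proof -
  obtain y where y: "y \<in> M" "dist u y = infdist u M" using unique by blast
  define n where "n = (u - y) /\<^sub>R norm (u - y)"
  have nz: "norm (u - y) > 0" using y pos by (simp add: dist_norm)
  have n1: "norm n = 1" using nz by (simp add: n_def)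
  define t where "t k = 1 / real (Suc k)" for k
  have t0: "t \<longlonglongrightarrow> 0" unfolding t_def by (intro LIMSEQ_Suc lim_1_over_n)
  have tpos: "0 < t k" for k by (simp add: t_def)
  define v where "v k = u + t k *\<^sub>R n" for k
  have "\<forall>k. \<exists>q. q \<in> M \<and> infdist (v k) M = dist (v k) q"
    using infdist_attains_inf[OF compact_imp_closed[OF M(1)] M(2)] by blast
  then have "\<exists>p. \<forall>k. p k \<in> M \<and> infdist (v k) M = dist (v k) (p k)" by (rule choice)
  then obtain p where p: "\<And>k. p k \<in> M" "\<And>k. infdist (v k) M = dist (v k) (p k)" by blast
  obtain l r where l: "l \<in> M" "strict_mono r" "(p \<circ> r) \<longlonglongrightarrow> l"
    using M(1) p(1) unfolding compact_def by metis
  have tr: "(t \<circ> r) \<longlonglongrightarrow> 0" using LIMSEQ_subseq_LIMSEQ[OF t0 l(2)] .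
  have "(\<lambda>k. u + (t \<circ> r) k *\<^sub>R n) \<longlonglongrightarrow> u + 0 *\<^sub>R n" by (intro tendsto_intros tr)
  then have vr: "(v \<circ> r) \<longlonglongrightarrow> u" by (simp add: v_def o_def)
  have "(\<lambda>k. infdist ((v \<circ> r) k) M) \<longlonglongrightarrow> infdist u M" by (intro tendsto_infdist vr)
  moreover have "(\<lambda>k. dist ((v \<circ> r) k) ((p \<circ> r) k)) \<longlonglongrightarrow> dist u l" by (intro tendsto_intros vr l)
  ultimately have "dist u l = infdist u M"
    using p(2) by (simp add: o_def) (metis LIMSEQ_unique)
  then have ly: "l = y" using unique y l(1) by blast
  have "(\<lambda>k. n \<bullet> ((u - (p \<circ> r) k) /\<^sub>R norm (u - (p \<circ> r) k))) \<longlonglongrightarrow> n \<bullet> ((u - l) /\<^sub>R norm (u - l))"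
    using nz unfolding ly[symmetric] by (intro tendsto_intros l) auto
  moreover have "n \<bullet> ((u - l) /\<^sub>R norm (u - l)) = 1" using n1 by (simp add: ly flip: n_def) (simp add: norm_eq_1)
  ultimately have "\<forall>\<^sub>F k in sequentially. \<theta> < n \<bullet> ((u - (p \<circ> r) k) /\<^sub>R norm (u - (p \<circ> r) k))"
    using \<theta> by (auto intro: order_tendstoD)
  moreover have "\<forall>\<^sub>F k in sequentially. (t \<circ> r) k < \<delta>" using order_tendstoD(2)[OF tr \<delta>] .
  ultimately have "\<forall>\<^sub>F k in sequentially. \<theta> < n \<bullet> ((u - (p \<circ> r) k) /\<^sub>R norm (u - (p \<circ> r) k)) \<and> (t \<circ> r) k < \<delta>"
    by (rule eventually_conj)
  then obtain k where k: "\<theta> < n \<bullet> ((u - (p \<circ> r) k) /\<^sub>R norm (u - (p \<circ> r) k))" "(t \<circ> r) k < \<delta>"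
    by (auto simp: eventually_sequentially)
  define q e where "q = p (r k)" and "e = (u - q) /\<^sub>R norm (u - q)"
  have qM: "q \<in> M" using p by (simp add: q_def)
  have uq: "infdist u M \<le> norm (u - q)" using infdist_le[OF qM, of u] by (simp add: dist_norm)
  then have uq0: "norm (u - q) > 0" using pos by linarith
  have e1: "norm e = 1" using uq0 by (simp add: e_def)
  have "infdist (v (r k)) M = norm (v (r k) - q)" using p by (simp add: q_def dist_norm)
  also have "\<dots> \<ge> (v (r k) - q) \<bullet> e" using Cauchy_Schwarz_ineq2[of "v (r k) - q" e] e1 by simp
  also have "(v (r k) - q) \<bullet> e = norm (u - q) + t (r k) * (n \<bullet> e)"
  proof -
    have "(u - q) \<bullet> e = norm (u - q)"
      unfolding e_def inner_scaleR_right dot_square_norm power2_eq_square using uq0 by simp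
    moreover have "v (r k) - q = (u - q) + t (r k) *\<^sub>R n" by (simp add: v_def)
    ultimately show ?thesis by (simp only: inner_add_left inner_scaleR_left)
  qed
  finally have "norm (u - q) + t (r k) * (n \<bullet> e) \<le> infdist (v (r k)) M" .
  moreover have "t (r k) * \<theta> < t (r k) * (n \<bullet> e)" using k(1) tpos by (simp add: q_def e_def)
  ultimately have "infdist u M + \<theta> * t (r k) < infdist (v (r k)) M" using uq by (simp add: mult.commute)
  moreover have "dist u (v (r k)) = t (r k)" using n1 tpos[of "r k"] by (simp add: v_def dist_norm)
  ultimately show ?thesis
    using tpos[of "r k"] k(2) by (intro exI[of _ "v (r k)"] exI[of _ "t (r k)"]) (simp add: o_def)
qed

text \<open>Within the reach the distance to \<open>M\<close> grows at full speed in some direction. This replaces the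
  classical statement that normal segments can be prolonged: a maximizer of
  \<open>infdist u M - \<theta> * dist z u\<close> on a ball cannot lie in its interior.\<close>

lemma infdist_grows_within_reach:
  fixes M :: "'a::euclidean_space set"
  assumes M: "compact M" "M \<noteq> {}"
    and unique: "\<And>z. 0 < infdist z M \<Longrightarrow> infdist z M < \<rho> \<Longrightarrow> \<exists>!y. y \<in> M \<and> dist z y = infdist z M"
    and z: "0 < infdist z M" "0 \<le> R" "infdist z M + R < \<rho>"
  shows "\<exists>u. dist z u = R \<and> infdist u M = infdist z M + R"
proof -
  have lip: "infdist u M \<le> infdist z M + dist z u" for u
    using infdist_triangle[of u M z] by (simp add: dist_commute)
  have cont: "continuous_on S (\<lambda>u. infdist u M - \<theta> * dist z u)" for S \<theta> by (intro continuous_intros)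
  have near: "\<exists>u \<in> sphere z R. infdist z M + \<theta> * R \<le> infdist u M" if \<theta>: "0 \<le> \<theta>" "\<theta> < 1" for \<theta>
  proof -
    have "cball z R \<noteq> {}" using z by simp
    then obtain u where u: "u \<in> cball z R"
      "\<And>v. v \<in> cball z R \<Longrightarrow> infdist v M - \<theta> * dist z v \<le> infdist u M - \<theta> * dist z u"
      using continuous_attains_sup[OF compact_cball _ cont, of z R \<theta>] by metis
    have "infdist z M \<le> infdist u M - \<theta> * dist z u" using u(2)[of z] z by simp
    then have uz: "infdist z M + \<theta> * dist z u \<le> infdist u M" by simp
    have "dist z u = R"
    proof (rule ccontr)
      assume "dist z u \<noteq> R"
      then have "0 < R - dist z u" using u(1) by simp
      moreover have "0 \<le> \<theta> * dist z u" using \<theta> by simp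
      then have pu: "0 < infdist u M" using uz z by linarith
      moreover have "infdist u M < \<rho>" using lip[of u] u(1) z by simp
      ultimately obtain v t where v: "0 < t" "t < R - dist z u" "dist u v = t" "infdist u M + \<theta> * t < infdist v M"
        using infdist_strict_growth[OF M pu unique \<theta>(2)] by blast
      have dv: "dist z v \<le> dist z u + t" using v(3) dist_triangle[of z v u] by simp
      then have "infdist v M - \<theta> * dist z v \<le> infdist u M - \<theta> * dist z u" using v by (intro u(2)) simp
      moreover have "\<theta> * dist z v \<le> \<theta> * (dist z u + t)" using dv \<theta> by (intro mult_left_mono) auto
      ultimately show False using v(4) by (simp add: algebra_simps)
    qed
    then show ?thesis using uz by (intro bexI[of _ u]) auto
  qed
  have "sphere z R \<noteq> {}" using near[of 0] by auto
  then have "\<exists>u\<in>sphere z R. \<forall>v\<in>sphere z R. infdist v M \<le> infdist u M"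
    by (intro continuous_attains_sup compact_sphere continuous_intros)
  then obtain u where u: "u \<in> sphere z R" "\<forall>v\<in>sphere z R. infdist v M \<le> infdist u M" by blast
  have "infdist z M + \<theta> * R \<le> infdist u M" if "0 \<le> \<theta>" "\<theta> < 1" for \<theta>
    using near[OF that] u(2) by (blast intro: order_trans)
  then have *: "\<forall>\<^sub>F \<theta> in at_left 1. infdist z M + \<theta> * R \<le> infdist u M"
    by (auto simp: eventually_at_left[of 0 1] intro!: exI[of _ "0::real"])
  have "((\<lambda>\<theta>. infdist z M + \<theta> * R) \<longlongrightarrow> infdist z M + 1 * R) (at_left 1)" by (intro tendsto_intros)
  from tendsto_upperbound[OF this *] have "infdist z M + R \<le> infdist u M" by simp
  then show ?thesis using u(1) lip[of u] by (intro exI[of _ u]) auto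
qed

text \<open>Sets of positive reach are convex up to an error that is quadratic in the size. If a convex
  combination of points of \<open>M\<close> lies off \<open>M\<close>, it can be moved by \<open>R\<close> to a point \<open>u\<close> whose distance to \<open>M\<close>
  grows by \<open>R\<close>; averaging the squared distances of the points from \<open>u\<close> limits this distance.\<close>

lemma almost_convex:
  fixes M :: "'a::euclidean_space set"
  assumes M: "compact M" and x: "x \<in> M"
    and unique: "\<And>z. 0 < infdist z M \<Longrightarrow> infdist z M < \<rho> \<Longrightarrow> \<exists>!y. y \<in> M \<and> dist z y = infdist z M"
    and v: "v \<in> convex hull (M \<inter> cball x \<epsilon>)" and s: "0 \<le> s" "s \<le> 1" and R: "0 \<le> R" "\<epsilon> + R < \<rho>"
  shows "2 * R * infdist (x + s *\<^sub>R (v - x)) M \<le> s * \<epsilon>\<^sup>2"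
proof (cases "infdist (x + s *\<^sub>R (v - x)) M = 0")
  case True
  then show ?thesis using s by simp
next
  case False
  define m where "m = x + s *\<^sub>R (v - x)"
  have d: "0 < infdist m M" using False infdist_nonneg[of m M] by (simp add: m_def)
  have "convex hull (M \<inter> cball x \<epsilon>) \<subseteq> cball x \<epsilon>" by (intro hull_minimal) auto
  then have vx: "norm (v - x) \<le> \<epsilon>" using v by (auto simp: dist_norm norm_minus_commute)
  have "infdist m M \<le> dist m x" by (rule infdist_le[OF x])
  also have "\<dots> = s * norm (v - x)" using s by (simp add: m_def dist_norm)
  also have "\<dots> \<le> 1 * \<epsilon>" using s vx by (intro mult_mono) auto
  finally have "infdist m M + R < \<rho>" using R by simp
  then obtain u where u: "dist m u = R" "infdist u M = infdist m M + R"
    using infdist_grows_within_reach[OF M _ unique d R(1)] x by blast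
  obtain S c where S: "finite S" "S \<subseteq> M \<inter> cball x \<epsilon>" "\<And>p. p \<in> S \<Longrightarrow> 0 \<le> c p" "sum c S = 1" "(\<Sum>p\<in>S. c p *\<^sub>R p) = v"
    using v unfolding convex_hull_explicit by blast
  let ?r = "infdist m M + R"
  have far: "?r\<^sup>2 \<le> (norm (p - u))\<^sup>2" if "p \<in> M" for p
    using infdist_le[OF that, of u] u(2) d R by (intro power_mono) (auto simp: dist_norm norm_minus_commute)
  have expand: "(norm (p - u))\<^sup>2 = (norm (p - x))\<^sup>2 + 2 * ((p - x) \<bullet> (x - u)) + (norm (x - u))\<^sup>2" for p
    by (simp add: power2_norm_eq_inner inner_diff inner_commute algebra_simps)
  have "?r\<^sup>2 = (1 - s) * ?r\<^sup>2 + s * (\<Sum>p\<in>S. c p * ?r\<^sup>2)"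
    using S(4) by (simp add: algebra_simps flip: sum_distrib_right)
  also have "\<dots> \<le> (1 - s) * (norm (x - u))\<^sup>2 + s * (\<Sum>p\<in>S. c p * (norm (p - u))\<^sup>2)"
    using s S far x by (intro add_mono mult_left_mono sum_mono) auto
  also have "(\<Sum>p\<in>S. c p * (norm (p - u))\<^sup>2)
      = (\<Sum>p\<in>S. c p * (norm (p - x))\<^sup>2) + 2 * ((v - x) \<bullet> (x - u)) + (norm (x - u))\<^sup>2"
  proof -
    have "(\<Sum>p\<in>S. c p * ((p - x) \<bullet> (x - u))) = (\<Sum>p\<in>S. c p *\<^sub>R (p - x)) \<bullet> (x - u)"
      by (simp add: inner_sum_left)
    also have "(\<Sum>p\<in>S. c p *\<^sub>R (p - x)) = v - x"
      using S(4,5) by (simp add: scaleR_right_diff_distrib sum_subtractf flip: scaleR_sum_left)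
    finally have 1: "(\<Sum>p\<in>S. c p * ((p - x) \<bullet> (x - u))) = (v - x) \<bullet> (x - u)" .
    have "(\<Sum>p\<in>S. c p * (norm (p - u))\<^sup>2)
        = (\<Sum>p\<in>S. c p * (norm (p - x))\<^sup>2 + 2 * (c p * ((p - x) \<bullet> (x - u))) + c p * (norm (x - u))\<^sup>2)"
    proof (rule sum.cong[OF refl])
      fix p
      show "c p * (norm (p - u))\<^sup>2
          = c p * (norm (p - x))\<^sup>2 + 2 * (c p * ((p - x) \<bullet> (x - u))) + c p * (norm (x - u))\<^sup>2"
        unfolding expand[of p] by (simp only: distrib_left mult.left_commute)
    qed
    also have "\<dots> = (\<Sum>p\<in>S. c p * (norm (p - x))\<^sup>2) + 2 * (\<Sum>p\<in>S. c p * ((p - x) \<bullet> (x - u))) + (norm (x - u))\<^sup>2"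
      using S(4) by (simp add: sum.distrib flip: sum_distrib_left sum_distrib_right)
    finally show ?thesis unfolding 1 .
  qed
  also have "(\<Sum>p\<in>S. c p * (norm (p - x))\<^sup>2) \<le> (\<Sum>p\<in>S. c p * \<epsilon>\<^sup>2)"
    using S by (intro sum_mono mult_left_mono power_mono) (auto simp: dist_norm norm_minus_commute)
  also have "(\<Sum>p\<in>S. c p * \<epsilon>\<^sup>2) = \<epsilon>\<^sup>2" using S(4) by (simp flip: sum_distrib_right)
  finally have 1: "?r\<^sup>2 \<le> (1 - s) * (norm (x - u))\<^sup>2 + s * (\<epsilon>\<^sup>2 + 2 * ((v - x) \<bullet> (x - u)) + (norm (x - u))\<^sup>2)"
    using s by (simp add: mult_left_mono)
  have "R\<^sup>2 = (norm (m - u))\<^sup>2" using u(1) by (simp add: dist_norm)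
  also have "\<dots> = s\<^sup>2 * (norm (v - x))\<^sup>2 + 2 * s * ((v - x) \<bullet> (x - u)) + (norm (x - u))\<^sup>2"
    unfolding expand[of m] by (simp add: m_def power_mult_distrib)
  finally have 2: "R\<^sup>2 = s\<^sup>2 * (norm (v - x))\<^sup>2 + 2 * s * ((v - x) \<bullet> (x - u)) + (norm (x - u))\<^sup>2" .
  have "(1 - s) * (norm (x - u))\<^sup>2 + s * (\<epsilon>\<^sup>2 + 2 * ((v - x) \<bullet> (x - u)) + (norm (x - u))\<^sup>2)
      = (norm (x - u))\<^sup>2 + 2 * s * ((v - x) \<bullet> (x - u)) + s * \<epsilon>\<^sup>2" by (simp add: algebra_simps)
  moreover have "0 \<le> s\<^sup>2 * (norm (v - x))\<^sup>2" by simp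
  ultimately have "?r\<^sup>2 \<le> R\<^sup>2 + s * \<epsilon>\<^sup>2" using 1 2 by linarith
  then have "(infdist m M)\<^sup>2 + 2 * R * infdist m M \<le> s * \<epsilon>\<^sup>2" by (simp add: power2_eq_square algebra_simps)
  moreover have "0 \<le> (infdist m M)\<^sup>2" by simp
  ultimately show ?thesis unfolding m_def[symmetric] by linarith
qed

lemma compact_fmeasurable: "compact S \<Longrightarrow> S \<in> fmeasurable lborel" for S :: "'a::euclidean_space set"
  using emeasure_bounded_finite[OF compact_imp_bounded] by (intro fmeasurableI) (auto intro: borel_compact)

text \<open>Translates of the slab by multiples of \<open>3 * \<epsilon> / n\<close> along its normal are disjoint and stay in the
  larger ball.\<close>

lemma slab_measure_le:
  fixes x e w :: "'a::euclidean_space"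
  assumes e: "norm e = 1" and n: "1 \<le> n" and \<epsilon>: "0 < \<epsilon>"
  defines "S \<equiv> {y \<in> cball x \<epsilon>. \<bar>(y - w) \<bullet> e\<bar> \<le> \<epsilon> / real n}"
  shows "real n * measure lborel S \<le> measure lborel (cball x (4 * \<epsilon>))"
proof -
  have "closed {y. \<bar>(y - w) \<bullet> e\<bar> \<le> \<epsilon> / real n}" by (intro closed_Collect_le continuous_intros)
  then have "compact (cball x \<epsilon> \<inter> {y. \<bar>(y - w) \<bullet> e\<bar> \<le> \<epsilon> / real n})" by (intro compact_Int_closed compact_cball)
  moreover have "S = cball x \<epsilon> \<inter> {y. \<bar>(y - w) \<bullet> e\<bar> \<le> \<epsilon> / real n}" by (auto simp: S_def)
  ultimately have S: "compact S" by simp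
  define h where "h = 3 * \<epsilon> / real n"
  define T where "T k = (+) ((real k * h) *\<^sub>R e) ` S" for k :: nat
  have cT: "compact (T k)" for k unfolding T_def by (rule compact_translation[OF S])
  have bT: "T k \<in> sets borel" for k using cT by (intro borel_compact)
  have mT: "measure lborel (T k) = measure lborel S" for k
    using measure_translation[of "(real k * h) *\<^sub>R e" S] bT[of k] S
    unfolding T_def by (simp add: measure_completion borel_compact)
  have disj: "disjoint_family_on T {..<n}"
    unfolding disjoint_family_on_def
  proof (intro ballI impI)
    fix k l assume kl: "k \<in> {..<n}" "l \<in> {..<n}" "k \<noteq> l"
    have np: "0 < \<epsilon> / real n" using n \<epsilon> by simp
    show "T k \<inter> T l = {}"
    proof (rule ccontr)
      assume "T k \<inter> T l \<noteq> {}"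
      then obtain y z where yz: "y \<in> S" "z \<in> S" "(real k * h) *\<^sub>R e + y = (real l * h) *\<^sub>R e + z"
        unfolding T_def by auto
      have "((real k * h) *\<^sub>R e + y) \<bullet> e = ((real l * h) *\<^sub>R e + z) \<bullet> e" using yz(3) by simp
      moreover have "e \<bullet> e = 1" using e by (simp add: norm_eq_1)
      ultimately have "(real k - real l) * h = (z - w) \<bullet> e - (y - w) \<bullet> e"
        by (simp add: inner_add_left inner_diff_left algebra_simps)
      moreover have "\<bar>(z - w) \<bullet> e - (y - w) \<bullet> e\<bar> \<le> 2 * (\<epsilon> / real n)"
        using yz(1,2) unfolding S_def by auto
      moreover have "\<bar>(real k - real l) * h\<bar> \<ge> 1 * h"
        using kl(3) np \<epsilon> by (simp only: abs_mult) (intro mult_mono; simp add: h_def)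
      ultimately show False using np by (simp add: h_def)
    qed
  qed
  have "real n * measure lborel S = (\<Sum>k<n. measure lborel (T k))" by (simp add: mT)
  also have "\<dots> = measure lborel (\<Union>k<n. T k)"
    by (rule measure_finite_Union[symmetric]) (use disj bT emeasure_bounded_finite[OF compact_imp_bounded[OF cT]] in \<open>auto simp: less_top\<close>)
  also have "\<dots> \<le> measure lborel (cball x (4 * \<epsilon>))"
  proof (rule measure_mono_fmeasurable)
    show "(\<Union>k<n. T k) \<subseteq> cball x (4 * \<epsilon>)"
    proof (intro UN_least subsetI)
      fix k y assume k: "k \<in> {..<n}" "y \<in> T k"
      then obtain z where z: "z \<in> S" "y = (real k * h) *\<^sub>R e + z" by (auto simp: T_def)
      have "real k * h \<le> real n * h" using k(1) \<epsilon> by (intro mult_right_mono) (auto simp: h_def)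
      also have "\<dots> = 3 * \<epsilon>" using n by (simp add: h_def)
      finally have "norm ((real k * h) *\<^sub>R e) \<le> 3 * \<epsilon>" using e \<epsilon> by (simp add: h_def)
      moreover have "norm (x - z) \<le> \<epsilon>" using z by (simp add: S_def dist_norm)
      ultimately have "norm (x - y) \<le> 4 * \<epsilon>"
        using norm_triangle_ineq4[of "x - z" "(real k * h) *\<^sub>R e"] z(2) by (simp add: algebra_simps)
      then show "y \<in> cball x (4 * \<epsilon>)" by (simp add: dist_norm)
    qed
  qed (use bT compact_fmeasurable[OF compact_cball] in auto)
  finally show ?thesis .
qed

text \<open>The centroid of a set whose volume is a fixed fraction of that of its ball lies well inside the
  convex hull: in each direction half of the excess mass must be on either side, and a thin slab
  carries only little mass.\<close>

lemma ball_in_convex_hull: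
  fixes A :: "'a::euclidean_space set"
  assumes A: "compact A" "A \<subseteq> cball x \<epsilon>" and \<epsilon>: "0 < \<epsilon>" and n: "1 \<le> n"
    and vol: "2 * measure lborel (cball x (4 * \<epsilon>)) < real n * measure lborel A"
  obtains w where "cball w (\<epsilon> / real n) \<subseteq> convex hull A"
proof -
  define V where "V = measure lborel A"
  have "0 \<le> 2 * measure lborel (cball x (4 * \<epsilon>))" by simp
  then have "0 < real n * V" unfolding V_def using vol by (rule le_less_trans)
  then have V: "0 < V" using n by (simp add: zero_less_mult_iff)
  have bA: "A \<in> sets borel" using A(1) by (rule borel_compact)
  have fA: "emeasure lborel A < \<infinity>" using emeasure_bounded_finite[OF compact_imp_bounded[OF A(1)]] .
  have intid: "integrable lborel (\<lambda>y. indicator A y *\<^sub>R y)"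
    using borel_integrable_compact[OF A(1), of "\<lambda>y. y"] by simp
  define w where "w = (1 / V) *\<^sub>R (\<integral>y. indicator A y *\<^sub>R y \<partial>lborel)"
  define \<eta> where "\<eta> = \<epsilon> / real n"
  have \<eta>: "0 < \<eta>" using \<epsilon> n by (simp add: \<eta>_def)
  have dir: "\<exists>y\<in>A. \<eta> \<le> (y - w) \<bullet> e" if e: "norm e = 1" for e
  proof (rule ccontr)
    assume "\<not> ?thesis"
    then have less: "\<And>y. y \<in> A \<Longrightarrow> (y - w) \<bullet> e < \<eta>" by force
    define B where "B = {y \<in> A. (y - w) \<bullet> e < - \<eta>}"
    have "B = A \<inter> {y. (y - w) \<bullet> e < - \<eta>}" by (auto simp: B_def)
    moreover have "open {y. (y - w) \<bullet> e < - \<eta>}" by (intro open_Collect_less continuous_intros)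
    ultimately have bB: "B \<in> sets borel" using bA by simp
    have iA: "integrable lborel (indicator A :: 'a \<Rightarrow> real)" using bA fA by (intro integrable_real_indicator) auto
    have "emeasure lborel B \<le> emeasure lborel A" using bA by (intro emeasure_mono) (auto simp: B_def)
    then have fB: "emeasure lborel B < \<infinity>" using fA by (rule le_less_trans)
    have iB: "integrable lborel (indicator B :: 'a \<Rightarrow> real)" using bB fB by (intro integrable_real_indicator) auto
    have eq: "indicator A y * ((y - w) \<bullet> e) = (indicator A y *\<^sub>R y) \<bullet> e - (w \<bullet> e) * indicator A y" for y
      by (simp add: inner_diff_left algebra_simps)
    have i1: "integrable lborel (\<lambda>y. (indicator A y *\<^sub>R y) \<bullet> e)" by (rule integrable_inner_left) (rule intid)
    have i2: "integrable lborel (\<lambda>y. (w \<bullet> e) * indicator A y)" using iA by simp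
    have "(\<integral>y. indicator A y * ((y - w) \<bullet> e) \<partial>lborel) = (\<integral>y. (indicator A y *\<^sub>R y) \<bullet> e \<partial>lborel) - (w \<bullet> e) * V"
      unfolding eq Bochner_Integration.integral_diff[OF i1 i2] using iA by (simp add: V_def)
    also have "(\<integral>y. (indicator A y *\<^sub>R y) \<bullet> e \<partial>lborel) = (V *\<^sub>R w) \<bullet> e"
      using V by (subst integral_inner_left[OF intid]) (simp add: w_def)
    finally have zero: "(\<integral>y. indicator A y * ((y - w) \<bullet> e) \<partial>lborel) = 0" by simp
    have "(\<integral>y. indicator A y * ((y - w) \<bullet> e) \<partial>lborel) \<le> (\<integral>y. \<eta> * indicator A y - 2 * \<eta> * indicator B y \<partial>lborel)"
    proof (rule integral_mono)
      show "integrable lborel (\<lambda>y. indicator A y * ((y - w) \<bullet> e))"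
        unfolding eq by (rule Bochner_Integration.integrable_diff[OF i1 i2])
      show "integrable lborel (\<lambda>y. \<eta> * indicator A y - 2 * \<eta> * indicator B y)" using iA iB by auto
      fix y show "indicator A y * ((y - w) \<bullet> e) \<le> \<eta> * indicator A y - 2 * \<eta> * indicator B y"
        using less[of y] by (auto simp: B_def indicator_def)
    qed
    also have "\<dots> = \<eta> * V - 2 * \<eta> * measure lborel B"
      using iA iB by (simp add: V_def)
    finally have "\<eta> * (2 * measure lborel B) \<le> \<eta> * V" using zero by simp
    then have half: "2 * measure lborel B \<le> V" using \<eta> by simp
    define S where "S = {y \<in> cball x \<epsilon>. \<bar>(y - w) \<bullet> e\<bar> \<le> \<epsilon> / real n}"
    have "measure lborel (A - B) = V - measure lborel B"
      unfolding V_def using bA bB fA by (intro measure_Diff) (auto simp: B_def)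
    moreover have "measure lborel (A - B) \<le> measure lborel S"
    proof (rule measure_mono_fmeasurable)
      show "A - B \<subseteq> S" using A(2) less by (force simp: B_def S_def \<eta>_def)
      show "A - B \<in> sets lborel" using bA bB by simp
      have "closed {y. \<bar>(y - w) \<bullet> e\<bar> \<le> \<epsilon> / real n}" by (intro closed_Collect_le continuous_intros)
      then have "compact (cball x \<epsilon> \<inter> {y. \<bar>(y - w) \<bullet> e\<bar> \<le> \<epsilon> / real n})" by (intro compact_Int_closed compact_cball)
      moreover have "S = cball x \<epsilon> \<inter> {y. \<bar>(y - w) \<bullet> e\<bar> \<le> \<epsilon> / real n}" by (auto simp: S_def)
      ultimately show "S \<in> fmeasurable lborel"
        by (simp add: compact_fmeasurable)
    qed
    ultimately have "V \<le> 2 * measure lborel S" using half by simp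
    then have "real n * V \<le> 2 * (real n * measure lborel S)" using mult_left_mono[of V "2 * measure lborel S" "real n"] by simp
    also have "\<dots> \<le> 2 * measure lborel (cball x (4 * \<epsilon>))"
      using slab_measure_le[OF e n \<epsilon>, of x w] by (simp add: S_def)
    finally show False using vol by (simp add: V_def)
  qed
  have "cball w \<eta> \<subseteq> convex hull A"
  proof
    fix v assume v: "v \<in> cball w \<eta>"
    show "v \<in> convex hull A"
    proof (rule ccontr)
      assume "v \<notin> convex hull A"
      then obtain a b where ab: "a \<bullet> v < b" "\<And>x. x \<in> convex hull A \<Longrightarrow> b < a \<bullet> x"
        using separating_hyperplane_closed_point[OF convex_convex_hull, of A v]
          compact_imp_closed[OF compact_convex_hull[OF A(1)]] by blast
      have "A \<noteq> {}" using V by (auto simp: V_def)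
      then obtain y0 where y0: "y0 \<in> A" by blast
      have "a \<bullet> v < a \<bullet> y0" using ab(1) ab(2)[OF hull_inc[OF y0]] by simp
      then have a: "a \<noteq> 0" by auto
      define e where "e = - a /\<^sub>R norm a"
      have "norm e = 1" using a by (simp add: e_def)
      from dir[OF this] obtain y where y: "y \<in> A" "\<eta> \<le> (y - w) \<bullet> e" by blast
      have "a \<bullet> v < a \<bullet> y" using ab(1) ab(2)[OF hull_inc[OF y(1)]] by simp
      then have "0 < a \<bullet> (y - v)" by (simp add: inner_diff_right)
      then have "(y - v) \<bullet> e < 0" using a by (simp add: e_def inner_commute)
      then have "\<eta> < (v - w) \<bullet> e" using y(2) by (simp add: inner_diff_left)
      also have "\<dots> \<le> norm (v - w) * norm e" by (rule Cauchy_Schwarz_ineq2[THEN abs_le_D1])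
      also have "\<dots> \<le> \<eta>" using v \<open>norm e = 1\<close> by (simp add: dist_norm norm_minus_commute)
      finally show False by simp
    qed
  qed
  then show ?thesis using that by (simp add: \<eta>_def)
qed

text \<open>The convex hull of \<open>M \<inter> cball x \<epsilon>\<close> contains a ball about some \<open>w\<close> whose radius is a fixed multiple of
  \<open>\<epsilon>\<close>, hence a cone with vertex \<open>x\<close>. At relative height \<open>s\<close> the hull is within a distance of order
  \<open>s * \<epsilon>\<^sup>2\<close> of \<open>M\<close>. For small \<open>\<epsilon>\<close> this is less than half the radius of the cone at that height, so no
  point of the cone with half the radius lies off \<open>M\<close>: moving it away from \<open>M\<close> would leave the error
  bound while still in the hull.\<close>

theorem uniform_interior_cones:
  fixes M :: "'a::euclidean_space set"
  assumes M: "compact M" and \<rho>: "0 < \<rho>" "0 < c" "0 < \<rho>v"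
    and unique: "\<And>z. 0 < infdist z M \<Longrightarrow> infdist z M < \<rho> \<Longrightarrow> \<exists>!y. y \<in> M \<and> dist z y = infdist z M"
    and vol: "\<And>x \<epsilon>. x \<in> M \<Longrightarrow> 0 < \<epsilon> \<Longrightarrow> \<epsilon> < \<rho>v \<Longrightarrow> c * \<epsilon> ^ DIM('a) \<le> measure lborel (M \<inter> cball x \<epsilon>)"
  obtains \<epsilon> r where "0 < \<epsilon>" "0 < r"
    "\<And>x. x \<in> M \<Longrightarrow> \<exists>w\<in>cball x \<epsilon>. \<forall>s. 0 < s \<longrightarrow> s \<le> 1 \<longrightarrow> cball (x + s *\<^sub>R (w - x)) (s * r) \<subseteq> M"
proof -
  define u where "u = unit_ball_vol (real DIM('a))"
  obtain n :: nat where n: "2 * (u * 4 ^ DIM('a)) / c < real n" using reals_Archimedean2 by blast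
  have "0 \<le> u" by (simp add: u_def)
  then have "0 \<le> 2 * (u * 4 ^ DIM('a)) / c" using \<rho>(2) by simp
  then have n1: "1 \<le> n" using n by (cases n) auto
  define R where "R = \<rho> / 4"
  define \<epsilon> where "\<epsilon> = min (\<rho>v / 2) (min (\<rho> / 4) (R / (2 * real n)))"
  have R: "0 < R" using \<rho> by (simp add: R_def)
  have \<epsilon>: "0 < \<epsilon>" "\<epsilon> < \<rho>v" "\<epsilon> \<le> \<rho> / 4" "\<epsilon> \<le> R / (2 * real n)" using \<rho> R n1 by (auto simp: \<epsilon>_def min_def)
  define \<eta> where "\<eta> = \<epsilon> / real n"
  have \<eta>: "0 < \<eta>" "\<eta> \<le> \<epsilon>" using \<epsilon>(1) n1 by (auto simp: \<eta>_def divide_le_eq)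
  have small: "\<epsilon>\<^sup>2 < R * \<eta>"
  proof -
    have "\<epsilon> * (2 * real n) \<le> R" using \<epsilon>(4) n1 by (simp add: pos_le_divide_eq)
    then have "\<epsilon> * real n < R" using \<epsilon>(1) n1 by (simp add: algebra_simps) (use R in linarith)
    then have "\<epsilon> < R / real n" using n1 by (simp add: pos_less_divide_eq)
    then have "\<epsilon> * \<epsilon> < \<epsilon> * (R / real n)" using \<epsilon>(1) by (intro mult_strict_left_mono)
    then show ?thesis by (simp add: power2_eq_square \<eta>_def mult.commute)
  qed
  show ?thesis
  proof (rule that[OF \<epsilon>(1), of "\<eta> / 2"])
    show "0 < \<eta> / 2" using \<eta> by simp
    fix x assume x: "x \<in> M"
    let ?A = "M \<inter> cball x \<epsilon>"
    have cA: "compact ?A" using M by (intro compact_Int compact_cball)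
    have "2 * measure lborel (cball x (4 * \<epsilon>)) = 2 * (u * 4 ^ DIM('a)) * \<epsilon> ^ DIM('a)"
      using \<epsilon>(1) by (simp add: content_cball u_def power_mult_distrib)
    also have "\<dots> < (real n * c) * \<epsilon> ^ DIM('a)"
      using n \<rho>(2) \<epsilon>(1) by (intro mult_strict_right_mono) (auto simp: pos_divide_less_eq)
    also have "\<dots> \<le> real n * measure lborel ?A"
      using vol[OF x \<epsilon>(1,2)] by (simp add: mult.assoc mult_left_mono)
    finally obtain w where w: "cball w \<eta> \<subseteq> convex hull ?A"
      using ball_in_convex_hull[OF cA _ \<epsilon>(1) n1, of x] unfolding \<eta>_def by blast
    have "convex hull ?A \<subseteq> cball x \<epsilon>" by (intro hull_minimal) auto
    moreover have "w \<in> cball w \<eta>" using \<eta>(1) by simp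
    ultimately have "w \<in> cball x \<epsilon>" using w by blast
    moreover have "cball (x + s *\<^sub>R (w - x)) (s * (\<eta> / 2)) \<subseteq> M" if s: "0 < s" "s \<le> 1" for s
    proof
      have inhull: "\<exists>v \<in> convex hull ?A. p = x + s *\<^sub>R (v - x)" if p: "dist (x + s *\<^sub>R (w - x)) p \<le> s * \<eta>" for p
      proof -
        define v where "v = x + (1 / s) *\<^sub>R (p - x)"
        have px: "p = x + s *\<^sub>R (v - x)" using s by (simp add: v_def)
        have "(x + s *\<^sub>R (w - x)) - p = s *\<^sub>R (w - v)" unfolding px by (simp add: algebra_simps)
        then have "s * norm (w - v) \<le> s * \<eta>" using p s by (simp add: dist_norm)
        then have "v \<in> cball w \<eta>" using s by (simp add: dist_norm)
        then show ?thesis using w px by blast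
      qed
      fix m assume m: "m \<in> cball (x + s *\<^sub>R (w - x)) (s * (\<eta> / 2))"
      show "m \<in> M"
      proof (rule ccontr)
        assume "m \<notin> M"
        then have d: "0 < infdist m M"
          using x compact_imp_closed[OF M] infdist_nonneg[of m M] in_closed_iff_infdist_zero[of M m] by force
        have sm: "s * (\<eta> / 2) \<le> s * \<eta>" using s \<eta> by simp
        have "dist (x + s *\<^sub>R (w - x)) m \<le> s * (\<eta> / 2)" using m by (simp only: mem_cball)
        then obtain v where v: "v \<in> convex hull ?A" "m = x + s *\<^sub>R (v - x)"
          using inhull[OF order_trans[OF _ sm]] by blast
        have "norm (v - x) \<le> \<epsilon>" using v(1) hull_minimal[of ?A "cball x \<epsilon>" convex] by (auto simp: dist_norm norm_minus_commute)
        then have "dist m x \<le> 1 * \<epsilon>" unfolding v(2) using s by (simp add: dist_norm) (metis mult_left_le_one_le norm_ge_zero order_trans less_imp_le)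
        then have dm: "infdist m M \<le> \<epsilon>" using infdist_le[OF x, of m] by simp
        have "s * (\<eta> / 2) \<le> 1 * \<epsilon>" using s \<eta> by (intro mult_mono) auto
        then have s\<eta>: "s * (\<eta> / 2) \<le> \<epsilon>" by simp
        then have lt: "infdist m M + s * (\<eta> / 2) < \<rho>" using dm \<epsilon>(3) \<rho>(1) by simp
        have ne: "M \<noteq> {}" using x by blast
        have nn: "0 \<le> s * (\<eta> / 2)" using s \<eta> by simp
        obtain u where u: "dist m u = s * (\<eta> / 2)" "infdist u M = infdist m M + s * (\<eta> / 2)"
          using infdist_grows_within_reach[OF M ne unique d nn lt] by blast
        have "dist (x + s *\<^sub>R (w - x)) u \<le> s * \<eta>"
          using dist_triangle[of "x + s *\<^sub>R (w - x)" u m] u(1) m by simp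
        then obtain v' where v': "v' \<in> convex hull ?A" "u = x + s *\<^sub>R (v' - x)" using inhull by blast
        have "2 * R * infdist u M \<le> s * \<epsilon>\<^sup>2"
          unfolding v'(2) using s R \<epsilon>(3) \<rho>(1) by (intro almost_convex[OF M x unique v'(1)]) (auto simp: R_def)
        moreover have "2 * R * (s * (\<eta> / 2)) \<le> 2 * R * infdist u M" using u(2) d R by (intro mult_left_mono) auto
        ultimately have "s * (R * \<eta>) \<le> s * \<epsilon>\<^sup>2" by (simp add: mult.left_commute)
        then show False using small s by simp
      qed
    qed
    ultimately show "\<exists>w\<in>cball x \<epsilon>. \<forall>s. 0 < s \<longrightarrow> s \<le> 1 \<longrightarrow> cball (x + s *\<^sub>R (w - x)) (s * (\<eta> / 2)) \<subseteq> M"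
      by blast
  qed
qed

section \<open>Normalized volume and square integrable functions\<close>

lemma space_normalized_volume: "space (normalized_volume M) = UNIV"
  by (simp add: normalized_volume_def)

lemma sets_normalized_volume [measurable_cong]: "sets (normalized_volume M) = sets borel"
  by (simp add: normalized_volume_def)

lemma measurable_normalized_volume: "measurable (normalized_volume M) N = measurable borel N"
  by (rule measurable_cong_sets[OF sets_normalized_volume refl])

lemma prob_space_normalized_volume:
  "emeasure lborel M \<noteq> 0 \<Longrightarrow> emeasure lborel M \<noteq> \<infinity> \<Longrightarrow> prob_space (normalized_volume M)"
  unfolding normalized_volume_def by (rule prob_space_uniform_measure) auto

lemma measure_lborel_pos: "emeasure lborel M \<noteq> 0 \<Longrightarrow> emeasure lborel M \<noteq> \<infinity> \<Longrightarrow> 0 < measure lborel M"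
  by (simp add: measure_def enn2real_positive_iff top.not_eq_extremum zero_less_iff_neq_zero)

definition sq_integrable :: "'a measure \<Rightarrow> ('a \<Rightarrow> real) \<Rightarrow> bool" where
  "sq_integrable M f \<longleftrightarrow> f \<in> borel_measurable M \<and> integrable M (\<lambda>x. (f x)\<^sup>2)"

lemma sq_integrable_mult:
  assumes "sq_integrable M f" "sq_integrable M g" shows "integrable M (\<lambda>x. f x * g x)"
proof (rule Bochner_Integration.integrable_bound)
  show "integrable M (\<lambda>x. (f x)\<^sup>2 + (g x)\<^sup>2)" using assms by (auto simp: sq_integrable_def)
  show "(\<lambda>x. f x * g x) \<in> borel_measurable M" using assms by (auto simp: sq_integrable_def)
  have "\<bar>f x * g x\<bar> \<le> (f x)\<^sup>2 + (g x)\<^sup>2" for x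
  proof -
    have "0 \<le> (\<bar>f x\<bar> - \<bar>g x\<bar>)\<^sup>2" by simp
    then have "2 * (\<bar>f x\<bar> * \<bar>g x\<bar>) \<le> (f x)\<^sup>2 + (g x)\<^sup>2" by (simp add: power2_diff)
    moreover have "0 \<le> \<bar>f x\<bar> * \<bar>g x\<bar>" by simp
    ultimately show ?thesis unfolding abs_mult by linarith
  qed
  then show "AE x in M. norm (f x * g x) \<le> norm ((f x)\<^sup>2 + (g x)\<^sup>2)" by auto
qed

lemma sq_integrable_scale: "sq_integrable M f \<Longrightarrow> sq_integrable M (\<lambda>x. c * f x)"
  by (auto simp: sq_integrable_def power_mult_distrib)

lemma sq_integrable_add:
  assumes "sq_integrable M f" "sq_integrable M g" shows "sq_integrable M (\<lambda>x. f x + g x)"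
proof -
  have "integrable M (\<lambda>x. (f x)\<^sup>2 + 2 * (f x * g x) + (g x)\<^sup>2)"
    using assms sq_integrable_mult[OF assms] by (auto simp: sq_integrable_def)
  then show ?thesis using assms by (auto simp: sq_integrable_def power2_sum algebra_simps)
qed

lemma sq_integrable_diff: "sq_integrable M f \<Longrightarrow> sq_integrable M g \<Longrightarrow> sq_integrable M (\<lambda>x. f x - g x)"
  using sq_integrable_add[of M f "\<lambda>x. (- 1) * g x"] sq_integrable_scale[of M g "- 1"] by simp

lemma (in finite_measure) sq_integrable_bounded:
  assumes "f \<in> borel_measurable M" "\<And>x. x \<in> space M \<Longrightarrow> \<bar>f x\<bar> \<le> C" shows "sq_integrable M f"
proof -
  have "integrable M (\<lambda>x. (f x)\<^sup>2)"
  proof (rule integrable_const_bound)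
    have "\<bar>(f x)\<^sup>2\<bar> \<le> C\<^sup>2" if "x \<in> space M" for x
      using power_mono[OF assms(2)[OF that], of 2] by simp
    then show "AE x in M. norm ((f x)\<^sup>2) \<le> C\<^sup>2" by (intro AE_I2) simp
  qed (use assms in simp)
  then show ?thesis using assms by (simp add: sq_integrable_def)
qed

lemma (in finite_measure) sq_integrable_const: "sq_integrable M (\<lambda>_. c)"
  by (simp add: sq_integrable_def)

lemma (in finite_measure) sq_integrable_integrable: "sq_integrable M f \<Longrightarrow> integrable M f"
  using sq_integrable_mult[OF _ sq_integrable_const[of 1], of f] by simp

lemma quadratic_discriminant_le:
  fixes a b c :: real
  assumes nn: "\<And>s. 0 \<le> a - 2 * s * b + s\<^sup>2 * c" and c: "0 \<le> c" shows "b\<^sup>2 \<le> a * c"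
proof (cases "c = 0")
  case True
  have "b = 0"
  proof (rule ccontr)
    assume "b \<noteq> 0"
    have "0 \<le> a - 2 * ((a + 1) / (2 * b)) * b" using nn[of "(a + 1) / (2 * b)"] True by simp
    also have "a - 2 * ((a + 1) / (2 * b)) * b = - 1" using \<open>b \<noteq> 0\<close> by (simp add: field_simps)
    finally show False by simp
  qed
  then show ?thesis using True by simp
next
  case False
  then have "0 < c" using c by simp
  have "0 \<le> a - 2 * (b / c) * b + (b / c)\<^sup>2 * c" by (rule nn)
  also have "\<dots> = a - b\<^sup>2 / c" using \<open>0 < c\<close> by (simp add: power2_eq_square field_simps)
  finally show ?thesis using \<open>0 < c\<close> by (simp add: divide_le_eq)
qed

lemma cauchy_schwarz_integral:
  assumes f: "sq_integrable M f" and g: "sq_integrable M g"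
  shows "(\<integral>x. f x * g x \<partial>M)\<^sup>2 \<le> (\<integral>x. (f x)\<^sup>2 \<partial>M) * (\<integral>x. (g x)\<^sup>2 \<partial>M)"
proof (rule quadratic_discriminant_le)
  fix s
  have "0 \<le> (\<integral>x. (f x - s * g x)\<^sup>2 \<partial>M)" by simp
  also have "(\<integral>x. (f x - s * g x)\<^sup>2 \<partial>M) = (\<integral>x. (f x)\<^sup>2 - 2 * s * (f x * g x) + s\<^sup>2 * (g x)\<^sup>2 \<partial>M)"
    by (rule Bochner_Integration.integral_cong) (auto simp: power2_diff power_mult_distrib)
  also have "\<dots> = (\<integral>x. (f x)\<^sup>2 \<partial>M) - 2 * s * (\<integral>x. f x * g x \<partial>M) + s\<^sup>2 * (\<integral>x. (g x)\<^sup>2 \<partial>M)"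
    using f g sq_integrable_mult[OF f g] by (simp add: sq_integrable_def)
  finally show "0 \<le> (\<integral>x. (f x)\<^sup>2 \<partial>M) - 2 * s * (\<integral>x. f x * g x \<partial>M) + s\<^sup>2 * (\<integral>x. (g x)\<^sup>2 \<partial>M)" .
qed simp

section \<open>Smooth cutoffs\<close>

text \<open>Functions are given with all their derivatives since test functions are.\<close>

definition derivative_sequence :: "(nat \<Rightarrow> real \<Rightarrow> real) \<Rightarrow> bool" where
  "derivative_sequence D \<longleftrightarrow> (\<forall>k t. (D k has_real_derivative D (Suc k) t) (at t))"

definition flat_exp :: "nat \<Rightarrow> real \<Rightarrow> real" where
  "flat_exp m t = (if 0 < t then exp (- (1 / t)) / t ^ m else 0)"

lemma power_div_fact_le_exp:
  fixes x :: real assumes "0 \<le> x" shows "x ^ k / fact k \<le> exp x"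
proof -
  have "(\<Sum>n\<in>{k}. inverse (fact n) * x ^ n) \<le> suminf (\<lambda>n. inverse (fact n) * x ^ n)"
    using assms by (intro sum_le_suminf summable_exp) auto
  then show ?thesis by (simp add: exp_def divide_inverse mult.commute)
qed

text \<open>Comparing \<open>exp (1 / t)\<close> with one term of its series shows that the functions vanish to second order
  at \<open>0\<close>, which is what differentiability there needs.\<close>

lemma flat_exp_le: "\<bar>flat_exp m t\<bar> \<le> fact (m + 2) * t\<^sup>2"
proof (cases "0 < t")
  case True
  define k where "k = m + 2"
  have "(1 / t) ^ k / fact k \<le> exp (1 / t)" by (rule power_div_fact_le_exp) (use True in simp)
  then have "1 \<le> (fact k * t ^ k) * exp (1 / t)"
    using True by (simp add: power_divide divide_le_eq mult.commute mult.left_commute)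
  then have "exp (- (1 / t)) \<le> fact k * t ^ k" by (simp add: exp_minus inverse_eq_divide divide_le_eq)
  also have "fact k * t ^ k = (fact k * t\<^sup>2) * t ^ m" by (simp add: k_def power_add power2_eq_square del: fact_Suc)
  finally show ?thesis using True by (simp add: flat_exp_def divide_le_eq k_def del: fact_Suc)
qed (simp add: flat_exp_def)

lemma flat_exp_derivative:
  "(flat_exp m has_real_derivative flat_exp (m + 2) t - real m * flat_exp (m + 1) t) (at t)"
proof (cases "t = 0")
  case False
  have 1: "((\<lambda>t. exp (- (1 / t)) / t ^ m) has_real_derivative flat_exp (m + 2) t - real m * flat_exp (m + 1) t) (at t)"
    if t: "0 < t"
  proof -
    have "((\<lambda>t. exp (- (1 / t)) / t ^ m) has_real_derivative
        ((exp (- (1 / t)) * (1 / (t * t))) * t ^ m - exp (- (1 / t)) * (real m * t ^ (m - 1))) / (t ^ m * t ^ m)) (at t)"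
      using t by (auto intro!: derivative_eq_intros simp: field_simps)
    also have "((exp (- (1 / t)) * (1 / (t * t))) * t ^ m - exp (- (1 / t)) * (real m * t ^ (m - 1))) / (t ^ m * t ^ m)
        = flat_exp (m + 2) t - real m * flat_exp (m + 1) t"
      using t by (cases m) (auto simp: flat_exp_def field_simps)
    finally show ?thesis .
  qed
  show ?thesis
  proof (cases "0 < t")
    case True
    show ?thesis
      by (rule has_field_derivative_transform_within_open[OF 1[OF True], of "{0<..}"]) (use True in \<open>auto simp: flat_exp_def\<close>)
  next
    case neg: False
    have "((\<lambda>_. 0) has_real_derivative flat_exp (m + 2) t - real m * flat_exp (m + 1) t) (at t)"
      using neg by (simp add: flat_exp_def)
    then show ?thesis
      by (rule has_field_derivative_transform_within_open[of _ _ _ "{..<0}"]) (use neg False in \<open>auto simp: flat_exp_def\<close>)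
  qed
next
  case True
  have "((\<lambda>h. flat_exp m h / h) \<longlongrightarrow> 0) (at 0)"
  proof (rule Lim_null_comparison)
    show "\<forall>\<^sub>F h in at 0. norm (flat_exp m h / h) \<le> fact (m + 2) * \<bar>h\<bar>"
    proof (intro always_eventually allI)
      fix h :: real
      have "\<bar>flat_exp m h\<bar> \<le> (fact (m + 2) * \<bar>h\<bar>) * \<bar>h\<bar>"
        using flat_exp_le[of m h] by (simp add: power2_eq_square mult.assoc del: fact_Suc)
      then show "norm (flat_exp m h / h) \<le> fact (m + 2) * \<bar>h\<bar>"
        by (cases "h = 0") (simp_all add: divide_le_eq del: fact_Suc)
    qed
    show "((\<lambda>h::real. fact (m + 2) * \<bar>h\<bar>) \<longlongrightarrow> 0) (at 0)"
      by (auto intro!: tendsto_eq_intros)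
  qed
  then show ?thesis using True by (simp add: has_field_derivative_iff flat_exp_def)
qed

text \<open>Products of the two families are closed under differentiation, which yields all derivatives
  of a bump function without computing them.\<close>

inductive_set bump_algebra :: "(real \<Rightarrow> real) set" where
  left: "(\<lambda>t. flat_exp m (t - 1/2)) \<in> bump_algebra"
| right: "(\<lambda>t. flat_exp m (1 - t)) \<in> bump_algebra"
| mult: "f \<in> bump_algebra \<Longrightarrow> g \<in> bump_algebra \<Longrightarrow> (\<lambda>t. f t * g t) \<in> bump_algebra"
| add: "f \<in> bump_algebra \<Longrightarrow> g \<in> bump_algebra \<Longrightarrow> (\<lambda>t. f t + g t) \<in> bump_algebra"
| scale: "f \<in> bump_algebra \<Longrightarrow> (\<lambda>t. c * f t) \<in> bump_algebra"

lemma bump_algebra_derivative: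
  "f \<in> bump_algebra \<Longrightarrow> \<exists>g\<in>bump_algebra. \<forall>t. (f has_real_derivative g t) (at t)"
proof (induction rule: bump_algebra.induct)
  case (left m)
  have "((\<lambda>t. flat_exp m (t - 1/2)) has_real_derivative
      flat_exp (m + 2) (t - 1/2) + (- real m) * flat_exp (m + 1) (t - 1/2)) (at t)" for t
  proof -
    have "((\<lambda>t. flat_exp m (t - 1/2)) has_real_derivative
        (flat_exp (m + 2) (t - 1/2) - real m * flat_exp (m + 1) (t - 1/2)) * 1) (at t)"
      by (rule DERIV_chain2[where f = "flat_exp m", OF flat_exp_derivative]) (auto intro!: derivative_eq_intros)
    then show ?thesis by simp
  qed
  then have "\<forall>t. ((\<lambda>t. flat_exp m (t - 1/2)) has_real_derivative
      flat_exp (m + 2) (t - 1/2) + (- real m) * flat_exp (m + 1) (t - 1/2)) (at t)" by blast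
  then show ?case
    by (rule bexI[where x = "\<lambda>t. flat_exp (m + 2) (t - 1/2) + (- real m) * flat_exp (m + 1) (t - 1/2)"])
       (intro bump_algebra.intros)
next
  case (right m)
  have "((\<lambda>t. flat_exp m (1 - t)) has_real_derivative
      (- 1) * flat_exp (m + 2) (1 - t) + real m * flat_exp (m + 1) (1 - t)) (at t)" for t
  proof -
    have "((\<lambda>t. flat_exp m (1 - t)) has_real_derivative
        (flat_exp (m + 2) (1 - t) - real m * flat_exp (m + 1) (1 - t)) * (- 1)) (at t)"
      by (rule DERIV_chain2[where f = "flat_exp m", OF flat_exp_derivative]) (auto intro!: derivative_eq_intros)
    then show ?thesis by simp
  qed
  then have "\<forall>t. ((\<lambda>t. flat_exp m (1 - t)) has_real_derivative
      (- 1) * flat_exp (m + 2) (1 - t) + real m * flat_exp (m + 1) (1 - t)) (at t)" by blast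
  then show ?case
    by (rule bexI[where x = "\<lambda>t. (- 1) * flat_exp (m + 2) (1 - t) + real m * flat_exp (m + 1) (1 - t)"])
       (intro bump_algebra.intros)
next
  case (mult f g)
  then obtain f' g' where "f' \<in> bump_algebra" "g' \<in> bump_algebra"
    "\<And>t. (f has_real_derivative f' t) (at t)" "\<And>t. (g has_real_derivative g' t) (at t)" by blast
  then show ?case using mult
    by (intro bexI[of _ "\<lambda>t. f' t * g t + g' t * f t"]) (auto intro!: bump_algebra.intros DERIV_mult)
next
  case (add f g)
  then obtain f' g' where "f' \<in> bump_algebra" "g' \<in> bump_algebra"
    "\<And>t. (f has_real_derivative f' t) (at t)" "\<And>t. (g has_real_derivative g' t) (at t)" by blast
  then show ?case
    by (intro bexI[of _ "\<lambda>t. f' t + g' t"]) (auto intro!: bump_algebra.intros DERIV_add)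
next
  case (scale f c)
  then obtain f' where "f' \<in> bump_algebra" "\<And>t. (f has_real_derivative f' t) (at t)" by blast
  then show ?case
    by (intro bexI[of _ "\<lambda>t. c * f' t"]) (auto intro!: bump_algebra.intros DERIV_cmult)
qed

lemma derivative_sequence_exists:
  assumes "f \<in> bump_algebra"
  obtains D where "derivative_sequence D" "D 0 = f"
proof -
  obtain d where d: "\<And>f. f \<in> bump_algebra \<Longrightarrow> d f \<in> bump_algebra \<and> (\<forall>t. (f has_real_derivative d f t) (at t))"
    using bump_algebra_derivative by metis
  define D where "D k = (d ^^ k) f" for k
  have "D k \<in> bump_algebra" for k by (induction k) (auto simp: D_def assms d)
  then have "derivative_sequence D" using d by (auto simp: derivative_sequence_def D_def)
  then show ?thesis using that[of D] by (simp add: D_def)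
qed

lemma derivative_sequence_affine:
  assumes "derivative_sequence D"
  shows "derivative_sequence (\<lambda>k t. a ^ k * D k (a * t + b))"
  unfolding derivative_sequence_def
proof (intro allI)
  fix k t
  have "(D k has_real_derivative D (Suc k) (a * t + b)) (at (a * t + b))"
    using assms by (auto simp: derivative_sequence_def)
  moreover have "((\<lambda>t. a * t + b) has_real_derivative a) (at t)" by (auto intro!: derivative_eq_intros)
  ultimately have "((\<lambda>t. D k (a * t + b)) has_real_derivative D (Suc k) (a * t + b) * a) (at t)"
    by (rule DERIV_chain2)
  from DERIV_cmult[OF this, of "a ^ k"]
  show "((\<lambda>t. a ^ k * D k (a * t + b)) has_real_derivative a ^ Suc k * D (Suc k) (a * t + b)) (at t)"
    by (simp add: algebra_simps)
qed

lemma derivative_sequence_diff: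
  "derivative_sequence D \<Longrightarrow> derivative_sequence E \<Longrightarrow> derivative_sequence (\<lambda>k t. D k t - E k t)"
  unfolding derivative_sequence_def by (auto intro: DERIV_diff)

lemma derivative_sequence_zero:
  assumes D: "derivative_sequence D" and S: "open S" and zero: "\<And>t. t \<in> S \<Longrightarrow> D 0 t = 0" and t: "t \<in> S"
  shows "D k t = 0"
  using t
proof (induction k arbitrary: t)
  case (Suc k)
  have "((\<lambda>_. 0) has_real_derivative D (Suc k) t) (at t)"
    by (rule has_field_derivative_transform_within_open[OF _ S Suc.prems, of "D k"])
       (use D Suc.IH in \<open>auto simp: derivative_sequence_def\<close>)
  then show ?case using DERIV_const DERIV_unique by blast
qed (use zero in auto)

text \<open>A smooth bump on \<open>[1/2, 1]\<close> together with its antiderivative, a smooth step.\<close>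

lemma smooth_bump_and_step:
  obtains D B :: "nat \<Rightarrow> real \<Rightarrow> real" and m :: real where
    "derivative_sequence D" "\<And>t. 0 \<le> D 0 t" "\<And>t. t \<le> 1/2 \<or> 1 \<le> t \<Longrightarrow> D 0 t = 0" "\<And>t. 1/2 < t \<Longrightarrow> t < 1 \<Longrightarrow> 0 < D 0 t"
    "derivative_sequence B" "B 1 = D 0" "\<And>t. t \<le> 1/2 \<Longrightarrow> B 0 t = 0" "\<And>t. 1 \<le> t \<Longrightarrow> B 0 t = m"
proof -
  define \<beta> where "\<beta> t = flat_exp 0 (t - 1/2) * flat_exp 0 (1 - t)" for t
  have "\<beta> \<in> bump_algebra" unfolding \<beta>_def by (intro bump_algebra.intros)
  then obtain D where D: "derivative_sequence D" "D 0 = \<beta>" using derivative_sequence_exists by metis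
  have cont: "continuous_on S \<beta>" for S
    using D unfolding derivative_sequence_def
    by (metis DERIV_isCont continuous_at_imp_continuous_on)
  define B0 where "B0 u = (LBINT y=0..u. \<beta> y)" for u :: real
  have B0: "(B0 has_real_derivative \<beta> t) (at t)" for t
  proof -
    let ?a = "- \<bar>t\<bar> - 1" and ?b = "\<bar>t\<bar> + 1"
    have "((\<lambda>u. LBINT y=ereal 0..ereal u. \<beta> y) has_vector_derivative (\<beta> t)) (at t within {?a..?b})"
      by (rule interval_integral_FTC2) (auto intro: cont)
    then have "(B0 has_vector_derivative \<beta> t) (at t within {?a..?b})"
      unfolding B0_def by (simp add: zero_ereal_def)
    moreover have "t \<in> interior {?a..?b}" by auto
    ultimately show ?thesis
      by (metis at_within_interior has_real_derivative_iff_has_vector_derivative)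
  qed
  define B where "B k = (case k of 0 \<Rightarrow> B0 | Suc k \<Rightarrow> D k)" for k
  have B: "derivative_sequence B"
    using D B0 by (auto simp: derivative_sequence_def B_def split: nat.split)
  have zero: "\<beta> t = 0" if "t \<le> 1/2 \<or> 1 \<le> t" for t using that by (auto simp: \<beta>_def flat_exp_def)
  have const: "(B0 has_real_derivative 0) (at s)" if "s \<le> 1/2 \<or> 1 \<le> s" for s
    using B0[of s] zero[OF that] by simp
  show ?thesis
  proof (rule that[of D B "B0 1"])
    show "B 1 = D 0" by (simp add: B_def)
    have "B0 0 = 0" by (simp add: B0_def zero_ereal_def)
    show "B 0 t = 0" if "t \<le> 1/2" for t
    proof -
      have "\<exists>c. \<forall>s\<in>{..1/2}. B0 s = c"
        by (rule has_field_derivative_zero_constant) (auto intro!: has_field_derivative_at_within[OF const])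
      then show ?thesis using that \<open>B0 0 = 0\<close> by (force simp: B_def)
    qed
    show "B 0 t = B0 1" if "1 \<le> t" for t
    proof -
      have "\<exists>c. \<forall>s\<in>{1..}. B0 s = c"
        by (rule has_field_derivative_zero_constant) (auto intro!: has_field_derivative_at_within[OF const])
      then show ?thesis using that by (force simp: B_def)
    qed
  qed (use D B zero in \<open>auto simp: \<beta>_def flat_exp_def\<close>)
qed

section \<open>A smooth vector field in a cone\<close>

lemma iterated_partials_if_closed:
  fixes f :: "real^'n \<Rightarrow> real"
  assumes closed: "\<And>g. g \<in> S \<Longrightarrow> \<exists>p. \<forall>i. p i \<in> S \<and>
      (\<forall>y. (g has_derivative (\<lambda>v. \<Sum>i\<in>UNIV. v $ i * p i y)) (at y))" and f: "f \<in> S"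
  shows "\<exists>D. iterated_partials f D"
proof -
  have "\<forall>g\<in>S. \<exists>p. \<forall>i. p i \<in> S \<and> (\<forall>y. (g has_derivative (\<lambda>v. \<Sum>i\<in>UNIV. v $ i * p i y)) (at y))"
    using closed by blast
  from bchoice[OF this] obtain p where p: "\<forall>g\<in>S. \<forall>i. p g i \<in> S \<and>
      (\<forall>y. (g has_derivative (\<lambda>v. \<Sum>i\<in>UNIV. v $ i * p g i y)) (at y))" ..
  define D where "D l = foldr (\<lambda>i g. p g i) l f" for l
  have D_Cons: "D (i # l) = p (D l) i" for i l by (simp add: D_def)
  have D_in: "D l \<in> S" for l
  proof (induction l)
    case Nil
    then show ?case using f by (simp add: D_def)
  next
    case (Cons i l)
    then show ?case using p unfolding D_Cons by blast
  qed
  have "iterated_partials f D"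
    unfolding iterated_partials_def D_Cons using p D_in by (auto simp: D_def)
  then show ?thesis by blast
qed

locale cone_field =
  fixes b h :: "nat \<Rightarrow> real \<Rightarrow> real" and x e :: "real^'n" and \<tau> :: real
  assumes b: "derivative_sequence b" and h: "derivative_sequence h"
    and \<tau>: "0 < \<tau>" and h_zero: "\<And>t. t < \<tau> \<Longrightarrow> h 0 t = 0"
begin

definition height :: "real^'n \<Rightarrow> real" where "height y = (y - x) \<bullet> e"

text \<open>The terms that arise by differentiation of \<open>b (\<bar>Y\<bar>\<^sup>2 / height\<^sup>2) * h height / height\<^sup>m\<close>, where \<open>Y = y - x\<close>. The
  factor \<open>h\<close> removes the singularity at height \<open>0\<close>.\<close>

definition gen :: "nat \<Rightarrow> nat \<Rightarrow> nat \<Rightarrow> real^'n \<Rightarrow> real" where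
  "gen j k m y = b j ((norm (y - x))\<^sup>2 / (height y)\<^sup>2) * h k (height y) / height y ^ m"

definition gen_partial :: "nat \<Rightarrow> nat \<Rightarrow> nat \<Rightarrow> 'n \<Rightarrow> real^'n \<Rightarrow> real" where
  "gen_partial j k m i y = 2 * ((y - x) $ i * gen (Suc j) k (m + 2) y)
     - 2 * (e $ i * ((norm (y - x))\<^sup>2 * gen (Suc j) k (m + 3) y))
     + e $ i * gen j (Suc k) m y - real m * (e $ i * gen j k (Suc m) y)"

lemma h_zero_all: "t < \<tau> \<Longrightarrow> h k t = 0"
  using derivative_sequence_zero[OF h, of "{..<\<tau>}"] h_zero by auto

lemma gen_zero: "height y < \<tau> \<Longrightarrow> gen j k m y = 0"
  by (simp add: gen_def h_zero_all)

lemma height_gen: "height y * gen j k (Suc m) y = gen j k m y"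
  using \<tau> by (cases "height y = 0") (auto simp: gen_zero, simp add: gen_def)

lemma continuous_height: "continuous_on S height"
  unfolding height_def by (intro continuous_intros)

lemma gen_has_derivative:
  "(gen j k m has_derivative (\<lambda>v. \<Sum>i\<in>UNIV. v $ i * gen_partial j k m i y)) (at y)"
proof -
  have inner: "(\<Sum>i\<in>UNIV. v $ i * (w $ i * c)) = (v \<bullet> w) * c" for v w :: "real^'n" and c
    by (simp add: inner_vec_def sum_distrib_right mult.assoc)
  have sums: "(\<Sum>i\<in>UNIV. v $ i * gen_partial j k m i y) = 2 * ((v \<bullet> (y - x)) * gen (Suc j) k (m + 2) y)
     - 2 * ((v \<bullet> e) * ((norm (y - x))\<^sup>2 * gen (Suc j) k (m + 3) y))
     + (v \<bullet> e) * gen j (Suc k) m y - real m * ((v \<bullet> e) * gen j k (Suc m) y)" for v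
  proof -
    have "(\<Sum>i\<in>UNIV. v $ i * gen_partial j k m i y)
      = (\<Sum>i\<in>UNIV. 2 * (v $ i * ((y - x) $ i * gen (Suc j) k (m + 2) y))
     - 2 * (v $ i * (e $ i * ((norm (y - x))\<^sup>2 * gen (Suc j) k (m + 3) y)))
     + v $ i * (e $ i * gen j (Suc k) m y) - real m * (v $ i * (e $ i * gen j k (Suc m) y)))"
      unfolding gen_partial_def by (intro sum.cong refl) (simp only: distrib_left right_diff_distrib mult.left_commute)
    then show ?thesis
      by (simp only: sum.distrib sum_subtractf sum_distrib_left[symmetric] inner)
  qed
  show ?thesis
  proof (cases "height y < \<tau>")
    case True
    have "((\<lambda>_. 0) has_derivative (\<lambda>v. \<Sum>i\<in>UNIV. v $ i * gen_partial j k m i y)) (at y)"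
      using True by (simp add: gen_partial_def gen_zero)
    moreover have "open {y. height y < \<tau>}" by (intro open_Collect_less continuous_height continuous_intros)
    ultimately show ?thesis
      by (rule has_derivative_transform_within_open[where s = "{y. height y < \<tau>}"]) (use True in \<open>auto simp: gen_zero\<close>)
  next
    case False
    define t N where "t = height y" and "N = (norm (y - x))\<^sup>2"
    have t: "0 < t" using False \<tau> by (simp add: t_def)
    have dt: "(height has_derivative (\<lambda>v. v \<bullet> e)) (at y)"
      unfolding height_def by (auto intro!: derivative_eq_intros)
    have dN: "((\<lambda>y. (norm (y - x))\<^sup>2) has_derivative (\<lambda>v. 2 * (v \<bullet> (y - x)))) (at y)"
      unfolding power2_norm_eq_inner by (auto intro!: derivative_eq_intros simp: inner_commute)
    have du: "((\<lambda>y. (norm (y - x))\<^sup>2 / (height y)\<^sup>2) has_derivative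
        (\<lambda>v. 2 * (v \<bullet> (y - x)) / t\<^sup>2 - 2 * N * (v \<bullet> e) / t ^ 3)) (at y)"
    proof -
      have "((\<lambda>y. inverse ((height y)\<^sup>2)) has_derivative (\<lambda>v. (v \<bullet> e) * (- 2 * inverse (t ^ 3)))) (at y)"
      proof (rule DERIV_compose_FDERIV[of "\<lambda>s. inverse (s\<^sup>2)", OF _ dt])
        show "((\<lambda>s. inverse (s\<^sup>2)) has_real_derivative - 2 * inverse (t ^ 3)) (at (height y))"
          using t unfolding t_def[symmetric]
          by (auto intro!: derivative_eq_intros simp: field_simps power2_eq_square power3_eq_cube)
      qed
      from has_derivative_mult[OF dN this] show ?thesis
        unfolding divide_inverse t_def[symmetric] N_def[symmetric]
        by (rule has_derivative_eq_rhs) (simp add: fun_eq_iff algebra_simps)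
    qed
    have db: "((\<lambda>y. b j ((norm (y - x))\<^sup>2 / (height y)\<^sup>2)) has_derivative
        (\<lambda>v. (2 * (v \<bullet> (y - x)) / t\<^sup>2 - 2 * N * (v \<bullet> e) / t ^ 3) * b (Suc j) (N / t\<^sup>2))) (at y)"
      unfolding t_def N_def by (rule DERIV_compose_FDERIV[OF _ du[unfolded t_def N_def]]) (use b in \<open>auto simp: derivative_sequence_def\<close>)
    have dh: "((\<lambda>y. h k (height y)) has_derivative (\<lambda>v. (v \<bullet> e) * h (Suc k) t)) (at y)"
      unfolding t_def by (rule DERIV_compose_FDERIV[OF _ dt]) (use h in \<open>auto simp: derivative_sequence_def\<close>)
    have dp: "((\<lambda>y. inverse (height y ^ m)) has_derivative (\<lambda>v. (v \<bullet> e) * (- real m * inverse (t ^ Suc m)))) (at y)"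
    proof (rule DERIV_compose_FDERIV[of "\<lambda>s. inverse (s ^ m)", OF _ dt])
      show "((\<lambda>s. inverse (s ^ m)) has_real_derivative - real m * inverse (t ^ Suc m)) (at (height y))"
      proof -
        have "((\<lambda>s. s ^ m) has_real_derivative real m * t ^ (m - 1)) (at t)"
          by (auto intro!: derivative_eq_intros)
        from DERIV_inverse_fun[OF this]
        have "((\<lambda>s. inverse (s ^ m)) has_real_derivative - (real m * t ^ (m - 1) * inverse ((t ^ m) ^ Suc (Suc 0)))) (at t)"
          using t by simp
        moreover have "- (real m * t ^ (m - 1) * inverse ((t ^ m) ^ Suc (Suc 0))) = - real m * inverse (t ^ Suc m)"
          using t by (cases m) (auto simp: field_simps)
        ultimately show ?thesis unfolding t_def[symmetric] by (simp only:)
      qed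
    qed
    have "(gen j k m has_derivative (\<lambda>v. (b j (N / t\<^sup>2) * h k t) * ((v \<bullet> e) * (- real m * inverse (t ^ Suc m)))
        + (b j (N / t\<^sup>2) * ((v \<bullet> e) * h (Suc k) t) + (2 * (v \<bullet> (y - x)) / t\<^sup>2 - 2 * N * (v \<bullet> e) / t ^ 3) * b (Suc j) (N / t\<^sup>2) * h k t)
          * inverse (t ^ m))) (at y)"
      unfolding gen_def[abs_def] divide_inverse[of _ "height _ ^ m"]
      using has_derivative_mult[OF has_derivative_mult[OF db dh] dp] by (simp add: t_def N_def)
    then show ?thesis
      unfolding sums gen_def t_def[symmetric] N_def[symmetric] divide_inverse
      by (rule has_derivative_eq_rhs)
         (simp add: fun_eq_iff power_add power2_eq_square power3_eq_cube inverse_mult_distrib algebra_simps)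
  qed
qed

inductive_set cone_algebra :: "(real^'n \<Rightarrow> real) set" where
  const: "(\<lambda>_. c) \<in> cone_algebra"
| coord: "(\<lambda>y. (y - x) $ i) \<in> cone_algebra"
| gen: "gen j k m \<in> cone_algebra"
| add: "f \<in> cone_algebra \<Longrightarrow> g \<in> cone_algebra \<Longrightarrow> (\<lambda>y. f y + g y) \<in> cone_algebra"
| mult: "f \<in> cone_algebra \<Longrightarrow> g \<in> cone_algebra \<Longrightarrow> (\<lambda>y. f y * g y) \<in> cone_algebra"

lemma cone_algebra_diff: "f \<in> cone_algebra \<Longrightarrow> g \<in> cone_algebra \<Longrightarrow> (\<lambda>y. f y - g y) \<in> cone_algebra"
  using cone_algebra.add[OF _ cone_algebra.mult[OF cone_algebra.const[of "- 1"]], of f g] by simp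

lemma cone_algebra_sum: "finite I \<Longrightarrow> (\<And>i. i \<in> I \<Longrightarrow> f i \<in> cone_algebra) \<Longrightarrow> (\<lambda>y. \<Sum>i\<in>I. f i y) \<in> cone_algebra"
  by (induction I rule: finite_induct) (auto intro: cone_algebra.const cone_algebra.add)

lemma cone_algebra_norm: "(\<lambda>y. (norm (y - x))\<^sup>2) \<in> cone_algebra"
proof -
  have "(\<lambda>y. \<Sum>i\<in>UNIV. (y - x) $ i * (y - x) $ i) \<in> cone_algebra"
    by (intro cone_algebra_sum cone_algebra.mult cone_algebra.coord) simp
  then show ?thesis by (simp add: power2_norm_eq_inner inner_vec_def)
qed

lemma gen_partial_in: "gen_partial j k m i \<in> cone_algebra"
  unfolding gen_partial_def
  by (intro cone_algebra_diff cone_algebra.add cone_algebra.mult cone_algebra.const cone_algebra.coord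
      cone_algebra.gen cone_algebra_norm)

lemma coordinate_derivative: "((\<lambda>y. (y - x) $ i) has_derivative (\<lambda>v. v $ i)) (at y)"
proof -
  have "((\<lambda>y. y - x) has_derivative (\<lambda>v. v)) (at y)" by (auto intro!: derivative_eq_intros)
  from bounded_linear.has_derivative[OF bounded_linear_vec_nth this] show ?thesis .
qed

lemma cone_algebra_partials:
  "f \<in> cone_algebra \<Longrightarrow> \<exists>p. \<forall>i. p i \<in> cone_algebra \<and>
     (\<forall>y. (f has_derivative (\<lambda>v. \<Sum>i\<in>UNIV. v $ i * p i y)) (at y))"
proof (induction rule: cone_algebra.induct)
  case (const c)
  show ?case by (rule exI[of _ "\<lambda>_ _. 0"]) (auto intro: cone_algebra.const)
next
  case (coord i)
  have eq: "v $ i = (\<Sum>j\<in>UNIV. v $ j * (if j = i then 1 else 0))" for v :: "real^'n"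
    by (simp add: if_distrib[of "\<lambda>c. _ * c"] cong: if_cong)
  have "((\<lambda>y. (y - x) $ i) has_derivative (\<lambda>v. \<Sum>j\<in>UNIV. v $ j * (if j = i then 1 else 0))) (at y)" for y
    unfolding eq[symmetric] by (rule coordinate_derivative)
  then show ?case
    by (intro exI[of _ "\<lambda>j _. if j = i then 1 else 0"]) (auto intro: cone_algebra.const)
next
  case (gen j k m)
  show ?case using gen_has_derivative gen_partial_in by (intro exI[of _ "gen_partial j k m"]) auto
next
  case (add f g)
  from add.IH(1) obtain p where P: "\<forall>i. p i \<in> cone_algebra \<and>
      (\<forall>y. (f has_derivative (\<lambda>v. \<Sum>i\<in>UNIV. v $ i * p i y)) (at y))" ..
  from add.IH(2) obtain q where Q: "\<forall>i. q i \<in> cone_algebra \<and>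
      (\<forall>y. (g has_derivative (\<lambda>v. \<Sum>i\<in>UNIV. v $ i * q i y)) (at y))" ..
  have p: "p i \<in> cone_algebra" "(f has_derivative (\<lambda>v. \<Sum>i\<in>UNIV. v $ i * p i y)) (at y)"
    and q: "q i \<in> cone_algebra" "(g has_derivative (\<lambda>v. \<Sum>i\<in>UNIV. v $ i * q i y)) (at y)" for i y
    using P Q by blast+
  have "((\<lambda>y. f y + g y) has_derivative (\<lambda>v. \<Sum>i\<in>UNIV. v $ i * (p i y + q i y))) (at y)" for y
    using has_derivative_add[OF p(2) q(2), of y] by (simp add: distrib_left sum.distrib)
  moreover have "(\<lambda>y. p i y + q i y) \<in> cone_algebra" for i
    by (intro cone_algebra.add p(1) q(1))
  ultimately show ?case by (intro exI[of _ "\<lambda>i y. p i y + q i y"]) blast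
next
  case (mult f g)
  from mult.IH(1) obtain p where P: "\<forall>i. p i \<in> cone_algebra \<and>
      (\<forall>y. (f has_derivative (\<lambda>v. \<Sum>i\<in>UNIV. v $ i * p i y)) (at y))" ..
  from mult.IH(2) obtain q where Q: "\<forall>i. q i \<in> cone_algebra \<and>
      (\<forall>y. (g has_derivative (\<lambda>v. \<Sum>i\<in>UNIV. v $ i * q i y)) (at y))" ..
  have p: "p i \<in> cone_algebra" "(f has_derivative (\<lambda>v. \<Sum>i\<in>UNIV. v $ i * p i y)) (at y)"
    and q: "q i \<in> cone_algebra" "(g has_derivative (\<lambda>v. \<Sum>i\<in>UNIV. v $ i * q i y)) (at y)" for i y
    using P Q by blast+
  have "((\<lambda>y. f y * g y) has_derivative (\<lambda>v. \<Sum>i\<in>UNIV. v $ i * (f y * q i y + p i y * g y))) (at y)" for y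
    using has_derivative_mult[OF p(2) q(2), of y]
    by (simp add: distrib_left sum.distrib sum_distrib_left sum_distrib_right mult.assoc mult.left_commute)
  moreover have "(\<lambda>y. f y * q i y + p i y * g y) \<in> cone_algebra" for i
    by (intro cone_algebra.add cone_algebra.mult mult.hyps p(1) q(1))
  ultimately show ?case by (intro exI[of _ "\<lambda>i y. f y * q i y + p i y * g y"]) blast
qed

text \<open>The field \<open>Y * height\<^sup>-\<^sup>d * b * h\<close>, where \<open>Y\<close> is the position relative to the vertex. The factor
  \<open>b\<close> is homogeneous of degree \<open>0\<close> and the power of the height makes the field divergence free apart
  from the derivative of \<open>h\<close>.\<close>

definition field_component :: "'n \<Rightarrow> real^'n \<Rightarrow> real" where
  "field_component i y = (y - x) $ i * gen 0 0 (CARD('n)) y"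

definition component_partial :: "'n \<Rightarrow> 'n \<Rightarrow> real^'n \<Rightarrow> real" where
  "component_partial i j y = (y - x) $ i * gen_partial 0 0 (CARD('n)) j y + (if j = i then 1 else 0) * gen 0 0 (CARD('n)) y"

lemma field_component_derivative:
  "(field_component i has_derivative (\<lambda>v. \<Sum>j\<in>UNIV. v $ j * component_partial i j y)) (at y)"
proof -
  have "(\<Sum>j\<in>UNIV. v $ j * component_partial i j y)
      = (y - x) $ i * (\<Sum>j\<in>UNIV. v $ j * gen_partial 0 0 (CARD('n)) j y) + v $ i * gen 0 0 (CARD('n)) y" for v
  proof -
    have "(\<Sum>j\<in>UNIV. v $ j * component_partial i j y)
      = (\<Sum>j\<in>UNIV. (y - x) $ i * (v $ j * gen_partial 0 0 (CARD('n)) j y)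
          + (if j = i then v $ j * gen 0 0 (CARD('n)) y else 0))"
      unfolding component_partial_def by (intro sum.cong refl) (simp add: distrib_left mult.left_commute)
    also have "\<dots> = (y - x) $ i * (\<Sum>j\<in>UNIV. v $ j * gen_partial 0 0 (CARD('n)) j y) + v $ i * gen 0 0 (CARD('n)) y"
      by (simp only: sum.distrib sum_distrib_left sum.delta' sum.delta finite UNIV_I if_True)
    finally show ?thesis .
  qed
  then show ?thesis
    unfolding field_component_def[abs_def] using has_derivative_mult[OF coordinate_derivative gen_has_derivative[of 0 0 "CARD('n)" y]] by simp
qed

lemma divergence: "(\<Sum>i\<in>UNIV. component_partial i i y) = height y * gen 0 1 (CARD('n)) y"
proof -
  let ?d = "CARD('n)" and ?Y = "y - x"
  have "(\<Sum>i\<in>UNIV. component_partial i i y)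
     = (\<Sum>i\<in>UNIV. 2 * ((?Y $ i * ?Y $ i) * gen 1 0 (?d + 2) y) - 2 * ((?Y $ i * e $ i) * ((norm ?Y)\<^sup>2 * gen 1 0 (?d + 3) y))
       + (?Y $ i * e $ i) * gen 0 1 ?d y - real ?d * ((?Y $ i * e $ i) * gen 0 0 (Suc ?d) y) + gen 0 0 ?d y)"
    unfolding component_partial_def gen_partial_def by (intro sum.cong refl) (simp add: algebra_simps)
  also have "\<dots> = 2 * ((norm ?Y)\<^sup>2 * gen 1 0 (?d + 2) y) - 2 * (height y * ((norm ?Y)\<^sup>2 * gen 1 0 (?d + 3) y))
       + height y * gen 0 1 ?d y - real ?d * (height y * gen 0 0 (Suc ?d) y) + real ?d * gen 0 0 ?d y"
  proof -
    have "(\<Sum>i\<in>UNIV. ?Y $ i * ?Y $ i) = (norm ?Y)\<^sup>2" by (simp add: power2_norm_eq_inner inner_vec_def)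
    moreover have "(\<Sum>i\<in>UNIV. ?Y $ i * e $ i) = height y" by (simp add: height_def inner_vec_def)
    ultimately show ?thesis
      by (simp only: sum.distrib sum_subtractf sum_distrib_left[symmetric] sum_distrib_right[symmetric]) simp
  qed
  also have "\<dots> = height y * gen 0 1 ?d y"
  proof -
    have "height y * ((norm ?Y)\<^sup>2 * gen 1 0 (?d + 3) y) = (norm ?Y)\<^sup>2 * (height y * gen 1 0 (Suc (?d + 2)) y)"
      by (simp add: mult.left_commute numeral_3_eq_3)
    then show ?thesis by (simp only: height_gen)
  qed
  finally show ?thesis .
qed

text \<open>The components of the field are test functions; the sum of the defining identities of the weak
  gradient over the components is the divergence theorem.\<close>

lemma weak_gradient_tested_by_field:
  assumes M: "M \<in> sets borel" "emeasure lborel M \<noteq> 0" "emeasure lborel M \<noteq> \<infinity>"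
    and g: "g \<in> L2 M" "is_weak_gradient M g G"
    and K: "compact K" "K \<subseteq> interior M" "\<And>y. y \<notin> K \<Longrightarrow> gen 0 0 (CARD('n)) y = 0"
  shows "(\<integral>y. g y * (height y * gen 0 1 (CARD('n)) y) \<partial>normalized_volume M)
    = - (\<integral>y. G y \<bullet> (gen 0 0 (CARD('n)) y *\<^sub>R (y - x)) \<partial>normalized_volume M)"
proof -
  let ?\<mu> = "normalized_volume M"
  interpret \<mu>: prob_space ?\<mu>
    by (rule prob_space_normalized_volume[OF M(2,3)])
  have sets: "sets ?\<mu> = sets borel" by (simp add: normalized_volume_def)
  have zero: "field_component i y = 0" if "y \<notin> K" for i y using K(3)[OF that] by (simp add: field_component_def)
  have opK: "open (- K)" using K(1) compact_imp_closed by blast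
  have part_zero: "component_partial i j y = 0" if y: "y \<notin> K" for i j y
  proof -
    have "((\<lambda>_. 0) has_derivative (\<lambda>v. \<Sum>j\<in>UNIV. v $ j * component_partial i j y)) (at y)"
      by (rule has_derivative_transform_within_open[OF field_component_derivative opK]) (use y zero in auto)
    then have "(\<lambda>v. \<Sum>j\<in>UNIV. v $ j * component_partial i j y) = (\<lambda>_. 0)"
      using has_derivative_unique has_derivative_const by blast
    then have "(\<Sum>k\<in>UNIV. axis j 1 $ k * component_partial i k y) = 0" by (rule fun_cong)
    then show ?thesis by (simp add: axis_def if_distrib[of "\<lambda>c. c * _"] cong: if_cong)
  qed
  have alg: "field_component i \<in> cone_algebra" for i
    unfolding field_component_def[abs_def] by (intro cone_algebra.mult cone_algebra.coord cone_algebra.gen)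
  have cont: "continuous_on S f" if "f \<in> cone_algebra" for f S
    using cone_algebra_partials[OF that] by (meson has_derivative_continuous continuous_at_imp_continuous_on)
  have part_alg: "component_partial i j \<in> cone_algebra" for i j
    unfolding component_partial_def[abs_def]
    by (intro cone_algebra.add cone_algebra.mult cone_algebra.coord cone_algebra.gen cone_algebra.const gen_partial_in)
  have bounded: "\<exists>C. \<forall>y. \<bar>f y\<bar> \<le> C" if "f \<in> cone_algebra" "\<And>y. y \<notin> K \<Longrightarrow> f y = 0" for f
  proof -
    have "bounded (f ` K)" by (rule compact_imp_bounded[OF compact_continuous_image[OF cont[OF that(1)] K(1)]])
    then obtain C where C: "\<And>y. y \<in> K \<Longrightarrow> \<bar>f y\<bar> \<le> C" by (auto simp: bounded_iff)
    have "\<bar>f y\<bar> \<le> max C 0" for y by (cases "y \<in> K") (use C that(2) in \<open>auto simp: le_max_iff_disj\<close>)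
    then show ?thesis by blast
  qed
  have meas: "f \<in> borel_measurable ?\<mu>" if "f \<in> cone_algebra" for f
    unfolding measurable_cong_sets[OF sets refl] using cont[OF that] by (rule borel_measurable_continuous_onI)
  have int_mult: "integrable ?\<mu> (\<lambda>y. u y * f y)"
    if u: "integrable ?\<mu> u" and f: "f \<in> cone_algebra" "\<And>y. y \<notin> K \<Longrightarrow> f y = 0" for u f
  proof -
    obtain C where C: "\<And>y. \<bar>f y\<bar> \<le> C" using bounded[OF f] by blast
    show ?thesis
    proof (rule Bochner_Integration.integrable_bound)
      show "integrable ?\<mu> (\<lambda>y. C * \<bar>u y\<bar>)" using u by simp
      show "(\<lambda>y. u y * f y) \<in> borel_measurable ?\<mu>"
        using borel_measurable_integrable[OF u] meas[OF f(1)] by simp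
      have "\<bar>u y * f y\<bar> \<le> C * \<bar>u y\<bar>" for y
        using mult_right_mono[OF C[of y], of "\<bar>u y\<bar>"] by (simp add: abs_mult mult.commute)
      then show "AE y in ?\<mu>. norm (u y * f y) \<le> norm (C * \<bar>u y\<bar>)"
        by (auto intro!: AE_I2 order_trans[OF _ abs_ge_self])
    qed
  qed
  have G_meas: "G \<in> borel_measurable borel" and G_int: "integrable ?\<mu> (\<lambda>y. (norm (G y))\<^sup>2)"
    and G_test: "\<And>\<phi> D K i. iterated_partials \<phi> D \<Longrightarrow> compact K \<Longrightarrow> K \<subseteq> interior M \<Longrightarrow> (\<forall>x. x \<notin> K \<longrightarrow> \<phi> x = 0) \<Longrightarrow>
        (\<integral>x. g x * D [i] x \<partial>?\<mu>) = - (\<integral>x. G x $ i * \<phi> x \<partial>?\<mu>)"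
    using g(2) unfolding is_weak_gradient_def by blast+
  have g_meas: "g \<in> borel_measurable borel" and g_int2: "integrable ?\<mu> (\<lambda>y. (g y)\<^sup>2)"
    using g(1) by (auto simp: L2_def)
  have square: "\<bar>a\<bar> \<le> 1 + a\<^sup>2" for a :: real
    using zero_le_power2[of "\<bar>a\<bar> - 1"] by (simp add: power2_diff)
  have g_int: "integrable ?\<mu> g"
  proof (rule Bochner_Integration.integrable_bound)
    show "integrable ?\<mu> (\<lambda>y. 1 + (g y)\<^sup>2)" using g_int2 by simp
    show "g \<in> borel_measurable ?\<mu>" using g_meas measurable_cong_sets[OF sets refl] by blast
  qed (use square in auto)
  have Gi_int: "integrable ?\<mu> (\<lambda>y. G y $ i)" for i
  proof (rule Bochner_Integration.integrable_bound)
    show "integrable ?\<mu> (\<lambda>y. 1 + (norm (G y))\<^sup>2)" using G_int by simp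
    have "(\<lambda>v :: real^'n. v $ i) \<in> borel_measurable borel"
      by (intro borel_measurable_continuous_onI continuous_intros)
    from measurable_compose[OF G_meas this] have "(\<lambda>y. G y $ i) \<in> borel_measurable borel" .
    then show "(\<lambda>y. G y $ i) \<in> borel_measurable ?\<mu>" using measurable_cong_sets[OF sets refl] by blast
    have "\<bar>G y $ i\<bar> \<le> 1 + (norm (G y))\<^sup>2" for y
      using component_le_norm_cart[of "G y" i] square[of "norm (G y)"] by simp
    then show "AE y in ?\<mu>. norm (G y $ i) \<le> norm (1 + (norm (G y))\<^sup>2)" by simp
  qed
  have test: "(\<integral>y. g y * component_partial i i y \<partial>?\<mu>) = - (\<integral>y. G y $ i * field_component i y \<partial>?\<mu>)" for i
  proof -
    obtain D where D: "iterated_partials (field_component i) D"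
      using iterated_partials_if_closed[of cone_algebra "field_component i", OF cone_algebra_partials alg] by blast
    have "D [i] y = component_partial i i y" for y
    proof -
      have "(field_component i has_derivative (\<lambda>v. \<Sum>j\<in>UNIV. v $ j * D [j] y)) (at y)"
        using conjunct2[OF D[unfolded iterated_partials_def], rule_format, of "[]" y]
        unfolding conjunct1[OF D[unfolded iterated_partials_def]] .
      from fun_cong[OF has_derivative_unique[OF this field_component_derivative], of "axis i 1"]
      have "(\<Sum>j\<in>UNIV. axis i 1 $ j * D [j] y) = (\<Sum>j\<in>UNIV. axis i 1 $ j * component_partial i j y)" .
      then show ?thesis by (simp add: axis_def if_distrib[of "\<lambda>c. c * _"] cong: if_cong)
    qed
    then show ?thesis using G_test[OF D K(1,2), of i] zero by simp
  qed
  have "(\<integral>y. g y * (height y * gen 0 1 (CARD('n)) y) \<partial>?\<mu>) = (\<integral>y. (\<Sum>i\<in>UNIV. g y * component_partial i i y) \<partial>?\<mu>)"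
    by (simp add: divergence flip: sum_distrib_left)
  also have "\<dots> = (\<Sum>i\<in>UNIV. \<integral>y. g y * component_partial i i y \<partial>?\<mu>)"
    by (rule Bochner_Integration.integral_sum) (rule int_mult[OF g_int part_alg part_zero])
  also have "\<dots> = - (\<Sum>i\<in>UNIV. \<integral>y. G y $ i * field_component i y \<partial>?\<mu>)"
    by (simp add: test sum_negf)
  also have "(\<Sum>i\<in>UNIV. \<integral>y. G y $ i * field_component i y \<partial>?\<mu>) = (\<integral>y. (\<Sum>i\<in>UNIV. G y $ i * field_component i y) \<partial>?\<mu>)"
    by (rule Bochner_Integration.integral_sum[symmetric]) (rule int_mult[OF Gi_int alg zero])
  also have "\<dots> = (\<integral>y. G y \<bullet> (gen 0 0 (CARD('n)) y *\<^sub>R (y - x)) \<partial>?\<mu>)"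
    by (simp add: inner_vec_def field_component_def mult.commute mult.left_commute)
  finally show ?thesis .
qed

end

section \<open>Comparison of averages at two scales\<close>

locale bump_step =
  fixes D B :: "nat \<Rightarrow> real \<Rightarrow> real" and m Kb :: real
  assumes D: "derivative_sequence D" and D_nonneg: "\<And>t. 0 \<le> D 0 t"
    and D_zero: "\<And>t. t \<le> 1/2 \<or> 1 \<le> t \<Longrightarrow> D 0 t = 0" and D_pos: "\<And>t. 1/2 < t \<Longrightarrow> t < 1 \<Longrightarrow> 0 < D 0 t"
    and B: "derivative_sequence B" and B_1: "B 1 = D 0"
    and B_zero: "\<And>t. t \<le> 1/2 \<Longrightarrow> B 0 t = 0" and B_const: "\<And>t. 1 \<le> t \<Longrightarrow> B 0 t = m"
    and D_le: "\<And>t. D 0 t \<le> Kb" and B_le: "\<And>t. \<bar>B 0 t\<bar> \<le> Kb"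

lemma bump_step_exists: "\<exists>D B m Kb. bump_step D B m Kb"
proof -
  obtain D B m where *: "derivative_sequence D" "\<And>t. 0 \<le> D 0 t" "\<And>t. t \<le> 1/2 \<or> 1 \<le> t \<Longrightarrow> D 0 t = 0"
    "\<And>t. 1/2 < t \<Longrightarrow> t < 1 \<Longrightarrow> 0 < D 0 t"
    "derivative_sequence B" "B 1 = D 0" "\<And>t. t \<le> 1/2 \<Longrightarrow> B 0 t = 0" "\<And>t. 1 \<le> t \<Longrightarrow> B 0 t = m"
    using smooth_bump_and_step by blast
  have bdd: "\<exists>C. \<forall>t\<in>{1/2..1}. \<bar>E 0 t\<bar> \<le> C" if "derivative_sequence E" for E
  proof -
    have "continuous_on {1/2..1} (E 0)"
      using that unfolding derivative_sequence_def by (blast intro: DERIV_isCont continuous_at_imp_continuous_on)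
    then have "bounded (E 0 ` {1/2..1})" by (intro compact_imp_bounded compact_continuous_image compact_Icc)
    then show ?thesis by (auto simp: bounded_iff)
  qed
  obtain C1 where C1: "\<forall>t\<in>{1/2..1}. \<bar>D 0 t\<bar> \<le> C1" using bdd[OF *(1)] by blast
  obtain C2 where C2: "\<forall>t\<in>{1/2..1}. \<bar>B 0 t\<bar> \<le> C2" using bdd[OF *(5)] by blast
  have "D 0 t \<le> max C1 0 + max C2 \<bar>m\<bar>" for t
  proof (cases "t \<in> {1/2..1}")
    case True
    then have "\<bar>D 0 t\<bar> \<le> C1" using C1 by blast
    then show ?thesis by linarith
  next
    case False
    then have "D 0 t = 0" by (intro *(3)) auto
    then show ?thesis by simp
  qed
  moreover have "\<bar>B 0 t\<bar> \<le> max C1 0 + max C2 \<bar>m\<bar>" for t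
  proof (cases "t \<in> {1/2..1}")
    case True
    then have "\<bar>B 0 t\<bar> \<le> C2" using C2 by blast
    then show ?thesis by linarith
  next
    case False
    then have "B 0 t = 0 \<or> B 0 t = m" using *(7,8)[of t] by auto
    then show ?thesis by auto
  qed
  ultimately have "bump_step D B m (max C1 0 + max C2 \<bar>m\<bar>)"
    using * by unfold_locales auto
  then show ?thesis by blast
qed

lemma dyadic_level:
  fixes t R :: real
  assumes "R / 2 ^ (Suc N) \<le> t" "t \<le> R"
  shows "\<exists>k\<le>N. R / 2 ^ Suc k \<le> t \<and> t \<le> R / 2 ^ k"
  using assms
proof (induction N)
  case (Suc N)
  show ?case
  proof (cases "R / 2 ^ Suc N \<le> t")
    case True
    then show ?thesis using Suc by (meson le_SucI)
  next
    case False
    then show ?thesis using Suc.prems by (intro exI[of _ "Suc N"]) auto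
  qed
qed auto

context bump_step
begin

lemma Kb: "0 \<le> Kb" using D_le[of 0] D_nonneg[of 0] by linarith

text \<open>As a function of \<open>u = \<bar>Y\<bar>\<^sup>2 / height\<^sup>2\<close> it is concentrated on \<open>u < 1 + c\<^sup>2\<close>, the cone in which the component
  of \<open>Y\<close> orthogonal to the axis is less than \<open>c * height\<close>. On the axis, where \<open>u = 1\<close>, the argument of
  the bump is \<open>3/4\<close>.\<close>

definition angular :: "real \<Rightarrow> nat \<Rightarrow> real \<Rightarrow> real" where
  "angular c j u = (1 / (4 * c\<^sup>2)) ^ j * D j (1 / (4 * c\<^sup>2) * u + (3/4 - 1 / (4 * c\<^sup>2)))"

definition radial :: "real \<Rightarrow> real \<Rightarrow> nat \<Rightarrow> real \<Rightarrow> real" where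
  "radial r R k t = (1 / r) ^ k * B k (1 / r * t + 0) - (1 / R) ^ k * B k (1 / R * t + 0)"

lemma angular_sequence: "derivative_sequence (angular c)"
  unfolding angular_def[abs_def] by (rule derivative_sequence_affine[OF D])

lemma radial_sequence: "derivative_sequence (radial r R)"
  unfolding radial_def[abs_def] by (intro derivative_sequence_diff derivative_sequence_affine[OF B])

lemma radial_zero:
  assumes "0 < r" "r \<le> R" "t < r / 2 \<or> R \<le> t" shows "radial r R 0 t = 0"
proof (cases "R \<le> t")
  case True
  then have "1 \<le> t / r" "1 \<le> t / R" using assms by (auto simp: le_divide_eq)
  then show ?thesis by (simp add: radial_def B_const)
next
  case False
  then have "t < r / 2" "t < R / 2" using assms by auto
  then have "t / r \<le> 1/2" "t / R \<le> 1/2" using assms by (auto simp: divide_le_eq)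
  then show ?thesis by (simp add: radial_def B_zero)
qed

lemma angular_zero:
  assumes c: "0 < c" and u: "1 + c\<^sup>2 \<le> u" shows "angular c 0 u = 0"
proof -
  have "1 / (4 * c\<^sup>2) * (1 + c\<^sup>2) \<le> 1 / (4 * c\<^sup>2) * u" using u by (intro mult_left_mono) auto
  moreover have "1 / (4 * c\<^sup>2) * (1 + c\<^sup>2) = 1 / (4 * c\<^sup>2) + 1/4" using c by (simp add: field_simps)
  ultimately have "1 \<le> 1 / (4 * c\<^sup>2) * u + (3/4 - 1 / (4 * c\<^sup>2))" by linarith
  then show ?thesis unfolding angular_def by (simp add: D_zero)
qed

lemma angular_bounds: "0 \<le> angular c 0 u" "angular c 0 u \<le> Kb"
  by (auto simp: angular_def D_nonneg D_le)

lemma radial_bound: "\<bar>radial r R 0 t\<bar> \<le> 2 * Kb"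
proof -
  have "\<bar>radial r R 0 t\<bar> \<le> \<bar>B 0 (t / r)\<bar> + \<bar>B 0 (t / R)\<bar>"
    by (simp add: radial_def abs_triangle_ineq4)
  then show ?thesis using B_le[of "t / r"] B_le[of "t / R"] by linarith
qed

text \<open>A density on the part of the cone at heights between \<open>r / 2\<close> and \<open>r\<close>. The divergence of the field for
  the radial profile \<open>radial r R\<close> is the difference of two such densities.\<close>

definition weight :: "real^'n \<Rightarrow> real^'n \<Rightarrow> real \<Rightarrow> real \<Rightarrow> real^'n \<Rightarrow> real" where
  "weight x e c r y = angular c 0 ((norm (y - x))\<^sup>2 / ((y - x) \<bullet> e)\<^sup>2) * (D 0 (((y - x) \<bullet> e) / r) / r)
     / ((y - x) \<bullet> e) ^ (CARD('n) - 1)"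

lemma weight_support:
  assumes c: "0 < c" and r: "0 < r" and nz: "weight x e c r y \<noteq> 0"
  shows "r / 2 < (y - x) \<bullet> e" "(y - x) \<bullet> e < r" "(norm (y - x))\<^sup>2 < (1 + c\<^sup>2) * ((y - x) \<bullet> e)\<^sup>2"
proof -
  have 1: "D 0 (((y - x) \<bullet> e) / r) \<noteq> 0" "angular c 0 ((norm (y - x))\<^sup>2 / ((y - x) \<bullet> e)\<^sup>2) \<noteq> 0"
    using nz by (auto simp: weight_def)
  then have "1/2 < ((y - x) \<bullet> e) / r" "((y - x) \<bullet> e) / r < 1"
    using D_zero[of "((y - x) \<bullet> e) / r"] by (auto simp: not_le[symmetric])
  then show 2: "r / 2 < (y - x) \<bullet> e" "(y - x) \<bullet> e < r" using r by (auto simp: less_divide_eq divide_less_eq)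
  have "(norm (y - x))\<^sup>2 / ((y - x) \<bullet> e)\<^sup>2 < 1 + c\<^sup>2" using angular_zero[OF c] 1(2) by (meson not_le)
  moreover have "0 < ((y - x) \<bullet> e)\<^sup>2" using 2(1) r by simp
  ultimately show "(norm (y - x))\<^sup>2 < (1 + c\<^sup>2) * ((y - x) \<bullet> e)\<^sup>2" by (simp add: divide_less_eq)
qed

lemma weight_bounds:
  fixes x e y :: "real^'n"
  assumes r: "0 < r" shows "0 \<le> weight x e c r y" "weight x e c r y \<le> Kb * (Kb / r) * (2 / r) ^ (CARD('n) - 1)"
proof -
  let ?t = "(y - x) \<bullet> e"
  have "0 \<le> weight x e c r y \<and> weight x e c r y \<le> Kb * (Kb / r) * (2 / r) ^ (CARD('n) - 1)"
  proof (cases "?t / r \<le> 1/2")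
    case True
    then have "weight x e c r y = 0" by (simp add: weight_def D_zero)
    then show ?thesis using Kb r by simp
  next
    case False
    then have t: "r / 2 < ?t" using r by (simp add: divide_le_eq not_le)
    then have t0: "0 < ?t" using r by simp
    have "1 / ?t \<le> 2 / r" using t t0 r by (simp add: field_simps)
    then have p: "(1 / ?t) ^ (CARD('n) - 1) \<le> (2 / r) ^ (CARD('n) - 1)" using t0 by (intro power_mono) auto
    have "weight x e c r y = angular c 0 ((norm (y - x))\<^sup>2 / ?t\<^sup>2) * (D 0 (?t / r) / r) * (1 / ?t) ^ (CARD('n) - 1)"
      by (simp add: weight_def power_divide)
    also have "\<dots> \<le> Kb * (Kb / r) * (2 / r) ^ (CARD('n) - 1)"
      using p angular_bounds Kb r t0 D_nonneg D_le by (intro mult_mono divide_right_mono) auto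
    finally have "weight x e c r y \<le> Kb * (Kb / r) * (2 / r) ^ (CARD('n) - 1)" .
    moreover have "0 \<le> weight x e c r y" using t0 r angular_bounds D_nonneg by (simp add: weight_def)
    ultimately show ?thesis by blast
  qed
  then show "0 \<le> weight x e c r y" "weight x e c r y \<le> Kb * (Kb / r) * (2 / r) ^ (CARD('n) - 1)" by auto
qed

lemma weight_measurable: "weight x e c r \<in> borel_measurable borel"
proof -
  have cont: "continuous_on UNIV (D 0)"
    using D unfolding derivative_sequence_def by (blast intro: DERIV_isCont continuous_at_imp_continuous_on)
  then have 1: "D 0 \<in> borel_measurable borel" by (rule borel_measurable_continuous_onI)
  have 2: "angular c 0 \<in> borel_measurable borel"
    unfolding angular_def by (intro borel_measurable_times borel_measurable_const measurable_compose[OF _ 1]) auto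
  have i: "(\<lambda>y. (y - x) \<bullet> e) \<in> borel_measurable borel"
    by (intro borel_measurable_continuous_onI continuous_intros)
  have n: "(\<lambda>y. (norm (y - x))\<^sup>2) \<in> borel_measurable borel"
    by (intro borel_measurable_continuous_onI continuous_intros)
  show ?thesis unfolding weight_def[abs_def]
    by (intro borel_measurable_divide borel_measurable_times borel_measurable_power borel_measurable_const i n
        measurable_compose[OF _ 1] measurable_compose[OF _ 2])
qed

text \<open>The difference is the integral of \<open>g\<close> against the divergence of the field, hence of the weak gradient
  against the field, to which the Cauchy-Schwarz inequality applies. The field is of size \<open>height\<^sup>1\<^sup>-\<^sup>d\<close> on
  a cone, so the dyadic shell at height \<open>R / 2 ^ k\<close> contributes a multiple of \<open>(2 ^ k)\<^sup>d\<^sup>-\<^sup>2\<close> to its energy.\<close>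

theorem weighted_means_difference:
  fixes x e :: "real^'n" and M :: "(real^'n) set"
  assumes dim: "2 \<le> CARD('n)"
    and M: "M \<in> sets borel" "emeasure lborel M \<noteq> 0" "emeasure lborel M \<noteq> \<infinity>"
    and c: "0 < c" "c \<le> 1" and r: "0 < r" "r \<le> R" "R \<le> r * 2 ^ N"
    and cone: "{y. r / 2 \<le> (y - x) \<bullet> e \<and> (y - x) \<bullet> e \<le> R \<and> (norm (y - x))\<^sup>2 \<le> (1 + c\<^sup>2) * ((y - x) \<bullet> e)\<^sup>2} \<subseteq> interior M"
    and g: "g \<in> L2 M" "is_weak_gradient M g G"
  shows "((\<integral>y. g y * weight x e c r y \<partial>normalized_volume M) - (\<integral>y. g y * weight x e c R y \<partial>normalized_volume M))\<^sup>2
    \<le> (\<integral>y. (norm (G y))\<^sup>2 \<partial>normalized_volume M) *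
      ((4 * Kb\<^sup>2)\<^sup>2 * (4 / R\<^sup>2) ^ (CARD('n) - 1) * (unit_ball_vol (real CARD('n)) * (2 * R) ^ CARD('n) / measure lborel M)
        * (\<Sum>k\<le>N. (2 ^ k) ^ (CARD('n) - 2)))"
proof -
  let ?d = "CARD('n)" and ?\<mu> = "normalized_volume M"
  have d: "Suc (?d - 1) = ?d" using dim by simp
  have pw: "a ^ ?d = a * a ^ (?d - 1)" for a :: real using power_Suc[of a "?d - 1"] unfolding d .
  have R: "0 < R" using r by simp
  interpret F: cone_field "angular c" "radial r R" x e "r / 2"
    using angular_sequence radial_sequence r radial_zero by unfold_locales auto
  interpret \<mu>: prob_space ?\<mu>
    by (rule prob_space_normalized_volume[OF M(2,3)])
  note sets = sets_normalized_volume[of M] and meas = measurable_normalized_volume[of M]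
  define K where "K = {y. r / 2 \<le> (y - x) \<bullet> e \<and> (y - x) \<bullet> e \<le> R \<and> (norm (y - x))\<^sup>2 \<le> (1 + c\<^sup>2) * ((y - x) \<bullet> e)\<^sup>2}"
  have c2: "c\<^sup>2 \<le> 1" using power_mono[of c 1 2] c by simp
  have K_norm: "norm (y - x) \<le> 2 * ((y - x) \<bullet> e)" if "y \<in> K" for y
  proof (rule power2_le_imp_le)
    have "(norm (y - x))\<^sup>2 \<le> (1 + c\<^sup>2) * ((y - x) \<bullet> e)\<^sup>2" using that by (simp add: K_def)
    also have "\<dots> \<le> 4 * ((y - x) \<bullet> e)\<^sup>2" using c2 by (intro mult_right_mono) auto
    finally show "(norm (y - x))\<^sup>2 \<le> (2 * ((y - x) \<bullet> e))\<^sup>2" by (simp add: power_mult_distrib)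
    show "0 \<le> 2 * ((y - x) \<bullet> e)" using that r by (simp add: K_def)
  qed
  have "closed K" unfolding K_def by (intro closed_Collect_conj closed_Collect_le continuous_intros)
  moreover have "K \<subseteq> cball x (2 * R)"
  proof
    fix y assume y: "y \<in> K"
    have "norm (y - x) \<le> 2 * R" using K_norm[OF y] y by (simp add: K_def)
    then show "y \<in> cball x (2 * R)" by (simp add: dist_norm norm_minus_commute)
  qed
  ultimately have K: "compact K" using compact_eq_bounded_closed bounded_cball bounded_subset by blast
  have zero: "F.gen 0 0 ?d y = 0" if "y \<notin> K" for y
  proof (rule ccontr)
    assume "F.gen 0 0 ?d y \<noteq> 0"
    then have 1: "angular c 0 ((norm (y - x))\<^sup>2 / (F.height y)\<^sup>2) \<noteq> 0" "radial r R 0 (F.height y) \<noteq> 0"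
      by (auto simp: F.gen_def)
    then have 2: "r / 2 \<le> F.height y" "F.height y < R" using radial_zero[OF r(1,2)] by (meson not_le)+
    have "(norm (y - x))\<^sup>2 / (F.height y)\<^sup>2 < 1 + c\<^sup>2" using angular_zero[OF c(1)] 1(1) by (meson not_le)
    moreover have "0 < (F.height y)\<^sup>2" using 2(1) r by simp
    ultimately have "(norm (y - x))\<^sup>2 \<le> (1 + c\<^sup>2) * (F.height y)\<^sup>2" by (simp add: divide_less_eq)
    then show False using 2 that by (simp add: K_def F.height_def)
  qed
  have flux: "F.height y * F.gen 0 1 ?d y = weight x e c r y - weight x e c R y" for y
  proof (cases "F.height y = 0")
    case True
    then show ?thesis by (simp add: weight_def F.height_def D_zero)
  next
    case False
    have 1: "F.height y * (a / F.height y ^ ?d) = a / F.height y ^ (?d - 1)" for a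
      using False unfolding pw by simp
    have 2: "radial r R 1 t = D 0 (t / r) / r - D 0 (t / R) / R" for t
      using B_1 by (simp add: radial_def)
    have 3: "weight x e c s y = angular c 0 ((norm (y - x))\<^sup>2 / (F.height y)\<^sup>2) * (D 0 (F.height y / s) / s) / F.height y ^ (?d - 1)" for s
      by (simp add: weight_def F.height_def)
    show ?thesis
      unfolding F.gen_def 1 2 3 by (simp only: right_diff_distrib diff_divide_distrib)
  qed
  define V where "V y = F.gen 0 0 ?d y *\<^sub>R (y - x)" for y
  have gen_cont: "continuous_on UNIV (F.gen 0 0 ?d)"
    using F.gen_has_derivative by (meson has_derivative_continuous continuous_at_imp_continuous_on)
  have V_meas: "(\<lambda>y. norm (V y)) \<in> borel_measurable ?\<mu>"
    unfolding meas V_def by (intro borel_measurable_continuous_onI continuous_intros gen_cont)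
  define A where "A = 4 * Kb\<^sup>2"
  have V_le: "norm (V y) \<le> A * (1 / ((y - x) \<bullet> e)) ^ (?d - 1)" if y: "y \<in> K" for y
  proof -
    let ?t = "(y - x) \<bullet> e"
    have t: "0 < ?t" using y r by (simp add: K_def)
    have "norm (V y) = \<bar>angular c 0 ((norm (y - x))\<^sup>2 / ?t\<^sup>2)\<bar> * \<bar>radial r R 0 ?t\<bar> * (norm (y - x) / ?t ^ ?d)"
      using t by (simp add: V_def F.gen_def F.height_def abs_mult)
    also have "\<dots> \<le> Kb * (2 * Kb) * (2 * ?t / ?t ^ ?d)"
      using angular_bounds[of c "(norm (y - x))\<^sup>2 / ?t\<^sup>2"] radial_bound[of r R ?t] K_norm[OF y] Kb t
      by (intro mult_mono divide_right_mono) auto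
    also have "2 * ?t / ?t ^ ?d = 2 * (1 / ?t) ^ (?d - 1)"
      using t unfolding pw by (simp add: power_divide)
    finally show ?thesis by (simp add: A_def power2_eq_square)
  qed
  have V_zero: "V y = 0" if "y \<notin> K" for y using zero[OF that] by (simp add: V_def)
  \<comment> \<open>on the dyadic shell of height about \<open>R / 2 ^ k\<close> the field has size at most \<open>b k\<close>\<close>
  define b where "b k = A * (2 ^ Suc k / R) ^ (?d - 1)" for k
  define Q where "Q k = cball x (2 * R / 2 ^ k)" for k :: nat
  have pt: "(norm (V y))\<^sup>2 \<le> (\<Sum>k\<le>N. (b k)\<^sup>2 * indicator (Q k) y)" for y
  proof (cases "y \<in> K")
    case False
    then show ?thesis by (simp add: V_zero sum_nonneg)
  next
    case True
    let ?t = "(y - x) \<bullet> e"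
    have t: "r / 2 \<le> ?t" "?t \<le> R" "0 < ?t" using True r by (auto simp: K_def)
    have "r * 2 ^ N \<le> (2 * ?t) * 2 ^ N" using t(1) by (intro mult_right_mono) auto
    with r(3) have "R \<le> (2 * ?t) * 2 ^ N" by (rule order_trans)
    also have "(2 * ?t) * 2 ^ N = ?t * 2 ^ Suc N" by simp
    finally have "R \<le> ?t * 2 ^ Suc N" .
    then have "R / 2 ^ Suc N \<le> ?t" by (simp add: divide_le_eq)
    then obtain k where k: "k \<le> N" "R / 2 ^ Suc k \<le> ?t" "?t \<le> R / 2 ^ k" using dyadic_level t(2) by blast
    have "1 / ?t \<le> 2 ^ Suc k / R" using k(2) t(3) R by (simp add: field_simps)
    then have "A * (1 / ?t) ^ (?d - 1) \<le> b k" unfolding b_def using t(3) by (intro mult_left_mono power_mono) (auto simp: A_def)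
    then have "norm (V y) \<le> b k" using V_le[OF True] by (rule order_trans[rotated])
    then have "(norm (V y))\<^sup>2 \<le> (b k)\<^sup>2" by (intro power_mono) auto
    also have "y \<in> Q k"
      using K_norm[OF True] k(3) by (auto simp: Q_def dist_norm norm_minus_commute)
    then have "(b k)\<^sup>2 = (b k)\<^sup>2 * indicator (Q k) y" by simp
    also have "\<dots> \<le> (\<Sum>k\<le>N. (b k)\<^sup>2 * indicator (Q k) y)"
      using k(1) by (intro member_le_sum) auto
    finally show ?thesis .
  qed
  have Q_int: "integrable ?\<mu> (\<lambda>y. (b k)\<^sup>2 * indicator (Q k) y)" for k
    by (intro integrable_mult_right integrable_real_indicator)
       (auto simp: sets Q_def less_top[symmetric] intro: \<mu>.emeasure_finite)
  have V2_int: "integrable ?\<mu> (\<lambda>y. (norm (V y))\<^sup>2)"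
  proof (rule Bochner_Integration.integrable_bound)
    show "integrable ?\<mu> (\<lambda>y. \<Sum>k\<le>N. (b k)\<^sup>2 * indicator (Q k) y)" using Q_int by (rule Bochner_Integration.integrable_sum)
    show "(\<lambda>y. (norm (V y))\<^sup>2) \<in> borel_measurable ?\<mu>" using V_meas by simp
    show "AE y in ?\<mu>. norm ((norm (V y))\<^sup>2) \<le> norm (\<Sum>k\<le>N. (b k)\<^sup>2 * indicator (Q k) y)"
      using pt by (auto intro!: AE_I2 order_trans[OF _ abs_ge_self])
  qed
  note Mpos = measure_lborel_pos[OF M(2,3)]
  have Q_le: "measure ?\<mu> (Q k) \<le> unit_ball_vol (real ?d) * (2 * R / 2 ^ k) ^ ?d / measure lborel M" for k
  proof -
    have "measure ?\<mu> (Q k) = measure lborel (M \<inter> Q k) / measure lborel M"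
      unfolding normalized_volume_def using M by (intro measure_uniform_measure) (auto simp: Q_def)
    also have "measure lborel (M \<inter> Q k) \<le> measure lborel (Q k)"
      using M(1) by (intro measure_mono_fmeasurable) (auto simp: Q_def intro: compact_fmeasurable)
    also have "measure lborel (Q k) = unit_ball_vol (real ?d) * (2 * R / 2 ^ k) ^ ?d"
      using R by (simp add: Q_def content_cball)
    finally show ?thesis using Mpos by (simp add: divide_right_mono)
  qed
  have "(\<integral>y. (norm (V y))\<^sup>2 \<partial>?\<mu>) \<le> (\<integral>y. (\<Sum>k\<le>N. (b k)\<^sup>2 * indicator (Q k) y) \<partial>?\<mu>)"
    by (rule integral_mono[OF V2_int _ pt]) (rule Bochner_Integration.integrable_sum[OF Q_int])
  also have "\<dots> = (\<Sum>k\<le>N. (b k)\<^sup>2 * measure ?\<mu> (Q k))"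
    using Q_int by (subst Bochner_Integration.integral_sum) (auto simp: sets Q_def)
  also have "\<dots> \<le> (\<Sum>k\<le>N. (b k)\<^sup>2 * (unit_ball_vol (real ?d) * (2 * R / 2 ^ k) ^ ?d / measure lborel M))"
    by (intro sum_mono mult_left_mono Q_le) auto
  also have "\<dots> = (\<Sum>k\<le>N. A\<^sup>2 * (4 / R\<^sup>2) ^ (?d - 1) * (unit_ball_vol (real ?d) * (2 * R) ^ ?d / measure lborel M) * (2 ^ k) ^ (?d - 2))"
  proof (rule sum.cong[OF refl])
    fix k
    define q where "q = (2::real) ^ k"
    have q: "q \<noteq> 0" by (simp add: q_def)
    have "(2 ^ Suc k / R) ^ (?d - 1) * (2 ^ Suc k / R) ^ (?d - 1) = (4 * q\<^sup>2 / R\<^sup>2) ^ (?d - 1)"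
      by (simp add: power2_eq_square q_def flip: power_mult_distrib)
    also have "\<dots> = (4 / R\<^sup>2) ^ (?d - 1) * (q\<^sup>2) ^ (?d - 1)" by (simp add: power_mult_distrib power_divide)
    finally have 1: "(b k)\<^sup>2 = A\<^sup>2 * (4 / R\<^sup>2) ^ (?d - 1) * (q\<^sup>2) ^ (?d - 1)"
      by (simp add: b_def power2_eq_square mult.assoc mult.left_commute)
    have e: "2 * (?d - 1) = ?d + (?d - 2)" using dim by simp
    have "(q\<^sup>2) ^ (?d - 1) = q ^ ?d * q ^ (?d - 2)"
      unfolding power_mult[symmetric] e power_add ..
    then have 2: "(q\<^sup>2) ^ (?d - 1) * (2 * R / q) ^ ?d = (2 * R) ^ ?d * q ^ (?d - 2)"
      using q by (simp add: power_divide)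
    show "(b k)\<^sup>2 * (unit_ball_vol (real ?d) * (2 * R / 2 ^ k) ^ ?d / measure lborel M)
       = A\<^sup>2 * (4 / R\<^sup>2) ^ (?d - 1) * (unit_ball_vol (real ?d) * (2 * R) ^ ?d / measure lborel M) * (2 ^ k) ^ (?d - 2)"
    proof -
      have rearrange: "X * Y * (u * Z / v) = X * (u / v) * (Y * Z)" "X * (u * Z / v) * W = X * (u / v) * (Z * W)"
        for X Y Z W u v :: real by simp_all
      show ?thesis unfolding 1 q_def[symmetric] rearrange 2 by (simp only: mult_ac)
    qed
  qed
  finally have V_energy: "(\<integral>y. (norm (V y))\<^sup>2 \<partial>?\<mu>) \<le>
      A\<^sup>2 * (4 / R\<^sup>2) ^ (?d - 1) * (unit_ball_vol (real ?d) * (2 * R) ^ ?d / measure lborel M) * (\<Sum>k\<le>N. (2 ^ k) ^ (?d - 2))"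
    by (simp add: sum_distrib_left)
  have G: "G \<in> borel_measurable borel" "integrable ?\<mu> (\<lambda>y. (norm (G y))\<^sup>2)"
    using g(2) by (auto simp: is_weak_gradient_def)
  have sqG: "sq_integrable ?\<mu> (\<lambda>y. norm (G y))"
    using G unfolding sq_integrable_def meas by simp
  have sqV: "sq_integrable ?\<mu> (\<lambda>y. norm (V y))" using V_meas V2_int by (simp add: sq_integrable_def)
  have sqg: "sq_integrable ?\<mu> g" using g(1) by (auto simp: sq_integrable_def L2_def meas)
  have sqw: "sq_integrable ?\<mu> (weight x e c s)" if "0 < s" for s
    using weight_bounds[OF that, of x e c] weight_measurable[of x e c s]
    by (intro \<mu>.sq_integrable_bounded[where C = "Kb * (Kb / s) * (2 / s) ^ (?d - 1)"]) (auto simp: meas)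
  have "(\<integral>y. g y * weight x e c r y \<partial>?\<mu>) - (\<integral>y. g y * weight x e c R y \<partial>?\<mu>)
      = (\<integral>y. g y * weight x e c r y - g y * weight x e c R y \<partial>?\<mu>)"
    using sq_integrable_mult[OF sqg sqw[OF r(1)]] sq_integrable_mult[OF sqg sqw[OF R]]
    by (rule Bochner_Integration.integral_diff[symmetric])
  also have "\<dots> = (\<integral>y. g y * (F.height y * F.gen 0 1 ?d y) \<partial>?\<mu>)"
    unfolding flux by (simp add: right_diff_distrib)
  also have "\<dots> = - (\<integral>y. G y \<bullet> V y \<partial>?\<mu>)"
    unfolding V_def by (rule F.weak_gradient_tested_by_field[OF M g K]) (use cone zero in \<open>auto simp: K_def\<close>)
  finally have eq: "((\<integral>y. g y * weight x e c r y \<partial>?\<mu>) - (\<integral>y. g y * weight x e c R y \<partial>?\<mu>))\<^sup>2 = \<bar>\<integral>y. G y \<bullet> V y \<partial>?\<mu>\<bar>\<^sup>2"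
    by simp
  have "\<bar>\<integral>y. G y \<bullet> V y \<partial>?\<mu>\<bar> \<le> (\<integral>y. \<bar>G y \<bullet> V y\<bar> \<partial>?\<mu>)" by (rule integral_abs_bound)
  also have "\<dots> \<le> (\<integral>y. norm (G y) * norm (V y) \<partial>?\<mu>)"
    using sq_integrable_mult[OF sqG sqV] by (intro integral_mono') (auto simp: Cauchy_Schwarz_ineq2)
  finally have "\<bar>\<integral>y. G y \<bullet> V y \<partial>?\<mu>\<bar>\<^sup>2 \<le> (\<integral>y. norm (G y) * norm (V y) \<partial>?\<mu>)\<^sup>2" by (intro power_mono) auto
  also have "\<dots> \<le> (\<integral>y. (norm (G y))\<^sup>2 \<partial>?\<mu>) * (\<integral>y. (norm (V y))\<^sup>2 \<partial>?\<mu>)"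
    by (rule cauchy_schwarz_integral[OF sqG sqV])
  also have "\<dots> \<le> (\<integral>y. (norm (G y))\<^sup>2 \<partial>?\<mu>) * (A\<^sup>2 * (4 / R\<^sup>2) ^ (?d - 1) * (unit_ball_vol (real ?d) * (2 * R) ^ ?d / measure lborel M) * (\<Sum>k\<le>N. (2 ^ k) ^ (?d - 2)))"
    by (intro mult_left_mono V_energy) simp
  finally show ?thesis unfolding eq A_def .
qed

end

section \<open>Symmetric Markov semigroups\<close>

text \<open>A midpoint concave function is compared with its increments on the grid of mesh \<open>s / m\<close>. As
  \<open>m\<close> grows, monotonicity controls the error at \<open>t\<close>, in place of continuity.\<close>

lemma average_slope_antimono:
  fixes c :: "real \<Rightarrow> real"
  assumes c0: "c 0 = 0" and mono: "\<And>s t. 0 \<le> s \<Longrightarrow> s \<le> t \<Longrightarrow> c s \<le> c t"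
    and mid: "\<And>s t. 0 \<le> s \<Longrightarrow> 0 \<le> t \<Longrightarrow> c s + c t \<le> 2 * c ((s + t) / 2)"
    and st: "0 < s" "s \<le> t"
  shows "s * c t \<le> t * c s"
proof -
  have cs: "0 \<le> c s" using mono[of 0 s] c0 st by simp
  have step: "real m * (s * c t - t * c s) \<le> s * c s" if m: "1 \<le> m" for m :: nat
  proof -
    define \<delta> where "\<delta> = s / real m"
    have \<delta>: "0 < \<delta>" "real m * \<delta> = s" using st m by (auto simp: \<delta>_def)
    define d where "d i = c (real (Suc i) * \<delta>) - c (real i * \<delta>)" for i
    have "d (Suc i) \<le> d i" for i
    proof -
      have half: "(real i * \<delta> + real (Suc (Suc i)) * \<delta>) / 2 = real (Suc i) * \<delta>" by (simp add: field_simps)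
      have "c (real i * \<delta>) + c (real (Suc (Suc i)) * \<delta>) \<le> 2 * c (real (Suc i) * \<delta>)"
        unfolding half[symmetric] by (rule mid) (use \<delta>(1) in auto)
      then show ?thesis unfolding d_def by linarith
    qed
    then have d_anti: "d j \<le> d i" if "i \<le> j" for i j by (rule lift_Suc_antimono_le[OF _ that])
    have cm: "c (real k * \<delta>) = (\<Sum>i<k. d i)" for k
    proof (induction k)
      case (Suc k)
      have "c (real (Suc k) * \<delta>) = c (real k * \<delta>) + d k" by (simp add: d_def)
      then show ?case using Suc by simp
    qed (simp add: c0)
    have grid: "real m * c (real k * \<delta>) \<le> real k * c s" if "m \<le> k" for k
      using that
    proof (induction k rule: dec_induct)
      case base
      then show ?case using \<delta>(2) by simp
    next
      case (step k)
      have "real m * d k = (\<Sum>i<m. d k)" by simp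
      also have "\<dots> \<le> (\<Sum>i<m. d i)" using step by (intro sum_mono d_anti) auto
      also have "\<dots> = c s" using cm[of m] \<delta>(2) by simp
      finally have "real m * d k \<le> c s" .
      moreover have "c (real (Suc k) * \<delta>) = c (real k * \<delta>) + d k" by (simp add: d_def)
      ultimately show ?case using step.IH by (simp add: algebra_simps)
    qed
    define k where "k = nat \<lceil>t / \<delta>\<rceil>"
    have k: "t / \<delta> \<le> real k" "real k \<le> t / \<delta> + 1" unfolding k_def using st \<delta> by (simp_all add: real_nat_ceiling_ge)
    have tk: "t \<le> real k * \<delta>" using k(1) \<delta>(1) by (simp add: divide_le_eq)
    have "real m * \<delta> \<le> real k * \<delta>" using tk \<delta>(2) st by simp
    then have "m \<le> k" using \<delta>(1) by simp
    have "real m * c t \<le> real m * c (real k * \<delta>)" using st tk by (intro mult_left_mono mono) auto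
    also have "\<dots> \<le> real k * c s" by (rule grid[OF \<open>m \<le> k\<close>])
    also have "\<dots> \<le> (t / \<delta> + 1) * c s" using k(2) cs by (rule mult_right_mono)
    also have "t / \<delta> = real m * t / s" using m st by (simp add: \<delta>_def)
    finally have "s * (real m * c t) \<le> s * ((real m * t / s + 1) * c s)" using st by (intro mult_left_mono) auto
    also have "\<dots> = real m * (t * c s) + s * c s" using st by (simp add: field_simps)
    finally show ?thesis by (simp add: algebra_simps)
  qed
  show ?thesis
  proof (rule ccontr)
    assume "\<not> ?thesis"
    then have pos: "0 < s * c t - t * c s" by simp
    obtain m :: nat where m: "s * c s / (s * c t - t * c s) < real m" using reals_Archimedean2 by blast
    have "0 \<le> s * c s / (s * c t - t * c s)" using pos cs st by simp
    then have "1 \<le> m" using m by (cases m) auto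
    from step[OF this] m pos show False by (simp add: divide_less_eq)
  qed
qed

lemma slope_limit_exists:
  fixes c :: "real \<Rightarrow> real"
  assumes anti: "\<And>s t. 0 < s \<Longrightarrow> s \<le> t \<Longrightarrow> s * c t \<le> t * c s" and bound: "\<And>t. 0 < t \<Longrightarrow> c t \<le> t * C"
  obtains L where "((\<lambda>t. c t / t) \<longlongrightarrow> L) (at_right 0)" "L \<le> C"
proof -
  let ?S = "(\<lambda>t. c t / t) ` {0<..}"
  have bdd: "bdd_above ?S" using bound by (auto intro!: bdd_aboveI[of _ C] simp: divide_le_eq mult.commute)
  have ne: "?S \<noteq> {}" by auto
  have up: "c t / t \<le> Sup ?S" if "0 < t" for t using that bdd by (intro cSup_upper) auto
  have lim: "((\<lambda>t. c t / t) \<longlongrightarrow> Sup ?S) (at_right 0)"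
  proof (rule order_tendstoI)
    fix a assume "a < Sup ?S"
    then obtain t where t: "0 < t" "a < c t / t" using less_cSup_iff[OF ne bdd] by auto
    have "a < c s / s" if "0 < s" "s < t" for s
    proof -
      have "c t / t \<le> c s / s" using anti[of s t] that t(1) by (simp add: divide_le_eq le_divide_eq mult.commute)
      then show ?thesis using t(2) by simp
    qed
    then show "\<forall>\<^sub>F x in at_right 0. a < c x / x"
      using t(1) by (auto simp: eventually_at_right[of 0 t])
  next
    fix a assume "Sup ?S < a"
    then show "\<forall>\<^sub>F x in at_right 0. c x / x < a"
      unfolding eventually_at_right_field
      by (intro exI[of _ 1] conjI allI impI) (simp, rule le_less_trans[OF up], simp)
  qed
  moreover have "Sup ?S \<le> C" using ne bound by (intro cSup_least) (auto simp: divide_le_eq mult.commute)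
  ultimately show ?thesis using that by blast
qed

locale symmetric_semigroup = prob_space \<mu> for \<mu> :: "'a measure" +
  fixes K :: "real \<Rightarrow> 'a \<Rightarrow> 'a measure"
  assumes K_meas: "0 \<le> t \<Longrightarrow> K t \<in> measurable \<mu> (subprob_algebra \<mu>)"
    and K_prob: "0 \<le> t \<Longrightarrow> x \<in> space \<mu> \<Longrightarrow> prob_space (K t x)"
    and K_0: "x \<in> space \<mu> \<Longrightarrow> K 0 x = return \<mu> x"
    and K_add: "0 \<le> s \<Longrightarrow> 0 \<le> t \<Longrightarrow> x \<in> space \<mu> \<Longrightarrow> K (s + t) x = K s x \<bind> K t"
    and K_sym: "0 \<le> t \<Longrightarrow> sq_integrable \<mu> f \<Longrightarrow> sq_integrable \<mu> g \<Longrightarrow>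
      (\<integral>x. (\<integral>y. f y \<partial>K t x) * g x \<partial>\<mu>) = (\<integral>x. f x * (\<integral>y. g y \<partial>K t x) \<partial>\<mu>)"
begin

definition Q :: "real \<Rightarrow> ('a \<Rightarrow> real) \<Rightarrow> 'a \<Rightarrow> real" where "Q t f x = (\<integral>y. f y \<partial>K t x)"

definition inner :: "('a \<Rightarrow> real) \<Rightarrow> ('a \<Rightarrow> real) \<Rightarrow> real" where "inner f g = (\<integral>x. f x * g x \<partial>\<mu>)"

text \<open>The approximating forms of the Dirichlet form are \<open>drop f t / t\<close>. They increase as \<open>t\<close> decreases, since
  \<open>drop f\<close> turns out to be increasing and concave.\<close>

definition drop :: "('a \<Rightarrow> real) \<Rightarrow> real \<Rightarrow> real" where "drop f t = inner f f - inner (Q t f) f"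

lemma K_sets: "0 \<le> t \<Longrightarrow> x \<in> space \<mu> \<Longrightarrow> sets (K t x) = sets \<mu>"
  using measurable_space[OF K_meas] by (simp add: space_subprob_algebra)

lemma K_space: "0 \<le> t \<Longrightarrow> x \<in> space \<mu> \<Longrightarrow> space (K t x) = space \<mu>"
  by (rule sets_eq_imp_space_eq[OF K_sets])

lemma K_measurable: "0 \<le> t \<Longrightarrow> x \<in> space \<mu> \<Longrightarrow> f \<in> borel_measurable \<mu> \<Longrightarrow> f \<in> borel_measurable (K t x)"
  using measurable_cong_sets[OF K_sets refl] by blast

lemma Q_measurable: "0 \<le> t \<Longrightarrow> f \<in> borel_measurable \<mu> \<Longrightarrow> Q t f \<in> borel_measurable \<mu>"
  unfolding Q_def[abs_def] by (rule measurable_compose[OF K_meas integral_measurable_subprob_algebra])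

lemma nn_measurable: "0 \<le> t \<Longrightarrow> u \<in> borel_measurable \<mu> \<Longrightarrow> (\<lambda>x. \<integral>\<^sup>+y. u y \<partial>K t x) \<in> borel_measurable \<mu>"
  by (rule measurable_compose[OF K_meas nn_integral_measurable_subprob_algebra])

lemma invariant:
  assumes t: "0 \<le> t" shows "\<mu> \<bind> K t = \<mu>"
proof (rule measure_eqI)
  show sets: "sets (\<mu> \<bind> K t) = sets \<mu>" by (rule sets_bind[OF K_sets[OF t] not_empty])
  fix A assume "A \<in> sets (\<mu> \<bind> K t)"
  then have A: "A \<in> sets \<mu>" using sets by simp
  have "emeasure (\<mu> \<bind> K t) A = (\<integral>\<^sup>+x. emeasure (K t x) A \<partial>\<mu>)"
    by (rule emeasure_bind[OF not_empty K_meas[OF t] A])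
  also have "\<dots> = (\<integral>\<^sup>+x. ennreal (measure (K t x) A) \<partial>\<mu>)"
    by (intro nn_integral_cong) (meson K_prob[OF t] finite_measure.emeasure_eq_measure prob_space.finite_measure)
  also have "\<dots> = ennreal (\<integral>x. measure (K t x) A \<partial>\<mu>)"
  proof (rule nn_integral_eq_integral)
    show "integrable \<mu> (\<lambda>x. measure (K t x) A)"
    proof (rule integrable_const_bound)
      show "(\<lambda>x. measure (K t x) A) \<in> borel_measurable \<mu>"
        using measurable_compose[OF K_meas[OF t] measurable_measure_subprob_algebra[OF A]] .
      show "AE x in \<mu>. norm (measure (K t x) A) \<le> 1"
        using prob_space.prob_le_1[OF K_prob[OF t]] by (intro AE_I2) simp
    qed
  qed simp
  also have "(\<integral>x. measure (K t x) A \<partial>\<mu>) = (\<integral>x. (\<integral>y. indicator A y \<partial>K t x) * 1 \<partial>\<mu>)"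
    by (rule Bochner_Integration.integral_cong[OF refl]) (use A K_sets[OF t] sets.sets_into_space K_space[OF t] in \<open>simp add: Int_absorb1 Int_absorb2\<close>)
  also have "\<dots> = (\<integral>x. indicator A x * (\<integral>y. 1 \<partial>K t x) \<partial>\<mu>)"
    using A by (intro K_sym[OF t]) (auto intro!: sq_integrable_const sq_integrable_bounded[where C = 1] simp: indicator_def)
  also have "\<dots> = (\<integral>x. indicator A x \<partial>\<mu>)"
    by (rule Bochner_Integration.integral_cong[OF refl]) (use prob_space.prob_space[OF K_prob[OF t]] in simp)
  also have "\<dots> = measure \<mu> A" using A sets.sets_into_space by (simp add: Int_absorb1 Int_absorb2)
  finally show "emeasure (\<mu> \<bind> K t) A = emeasure \<mu> A" by (simp add: emeasure_eq_measure)
qed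

lemma nn_invariant:
  assumes t: "0 \<le> t" and u: "u \<in> borel_measurable \<mu>"
  shows "(\<integral>\<^sup>+x. \<integral>\<^sup>+y. u y \<partial>K t x \<partial>\<mu>) = (\<integral>\<^sup>+x. u x \<partial>\<mu>)"
  using nn_integral_bind[OF u K_meas[OF t]] by (simp add: invariant[OF t])

text \<open>A square integrable function need not be integrable for every \<open>K t x\<close>. It is for almost all \<open>x\<close>,
  because \<open>\<mu>\<close> is invariant.\<close>

lemma AE_sq_integrable_K:
  assumes t: "0 \<le> t" and f: "sq_integrable \<mu> f"
  shows "AE x in \<mu>. sq_integrable (K t x) f \<and> ennreal ((Q t f x)\<^sup>2) \<le> (\<integral>\<^sup>+y. ennreal ((f y)\<^sup>2) \<partial>K t x)"
proof -
  have fm: "f \<in> borel_measurable \<mu>" "integrable \<mu> (\<lambda>x. (f x)\<^sup>2)" using f by (auto simp: sq_integrable_def)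
  let ?u = "\<lambda>y. ennreal ((f y)\<^sup>2)"
  have um: "?u \<in> borel_measurable \<mu>" using fm by simp
  have "(\<integral>\<^sup>+x. \<integral>\<^sup>+y. ?u y \<partial>K t x \<partial>\<mu>) \<noteq> \<infinity>"
    unfolding nn_invariant[OF t um] using fm(2) by (simp add: real_integrable_def)
  then have "AE x in \<mu>. (\<integral>\<^sup>+y. ?u y \<partial>K t x) \<noteq> \<infinity>"
    by (rule nn_integral_noteq_infinite[OF nn_measurable[OF t um]])
  then show ?thesis
  proof (rule AE_mp, intro AE_I2 impI)
    fix x assume x: "x \<in> space \<mu>" and fin: "(\<integral>\<^sup>+y. ?u y \<partial>K t x) \<noteq> \<infinity>"
    interpret Kx: prob_space "K t x" by (rule K_prob[OF t x])
    have fK: "f \<in> borel_measurable (K t x)" by (rule K_measurable[OF t x fm(1)])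
    have int: "integrable (K t x) (\<lambda>y. (f y)\<^sup>2)"
      using fin fK by (intro integrableI_nonneg) (auto simp: less_top)
    then have sq: "sq_integrable (K t x) f" using fK by (simp add: sq_integrable_def)
    have "(Q t f x)\<^sup>2 \<le> (\<integral>y. (f y)\<^sup>2 \<partial>K t x)"
      using cauchy_schwarz_integral[OF sq Kx.sq_integrable_const[of 1]] by (simp add: Q_def Kx.prob_space)
    also have "ennreal (\<integral>y. (f y)\<^sup>2 \<partial>K t x) = (\<integral>\<^sup>+y. ?u y \<partial>K t x)"
      by (rule nn_integral_eq_integral[OF int, symmetric]) simp
    finally show "sq_integrable (K t x) f \<and> ennreal ((Q t f x)\<^sup>2) \<le> (\<integral>\<^sup>+y. ?u y \<partial>K t x)"
      using sq ennreal_leI by (metis \<open>(Q t f x)\<^sup>2 \<le> (\<integral>y. (f y)\<^sup>2 \<partial>K t x)\<close>)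
  qed
qed

lemma Q_contraction:
  assumes t: "0 \<le> t" and f: "sq_integrable \<mu> f"
  shows "sq_integrable \<mu> (Q t f)" "inner (Q t f) (Q t f) \<le> inner f f"
proof -
  have fm: "f \<in> borel_measurable \<mu>" "integrable \<mu> (\<lambda>x. (f x)\<^sup>2)" using f by (auto simp: sq_integrable_def)
  have "(\<integral>\<^sup>+x. ennreal ((Q t f x)\<^sup>2) \<partial>\<mu>) \<le> (\<integral>\<^sup>+x. \<integral>\<^sup>+y. ennreal ((f y)\<^sup>2) \<partial>K t x \<partial>\<mu>)"
    using AE_sq_integrable_K[OF t f] by (intro nn_integral_mono_AE) auto
  also have "\<dots> = (\<integral>\<^sup>+x. ennreal ((f x)\<^sup>2) \<partial>\<mu>)" using fm by (intro nn_invariant[OF t]) simp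
  also have "\<dots> = ennreal (inner f f)"
    using nn_integral_eq_integral[OF fm(2)] by (simp add: inner_def power2_eq_square)
  finally have le: "(\<integral>\<^sup>+x. ennreal ((Q t f x)\<^sup>2) \<partial>\<mu>) \<le> ennreal (inner f f)" .
  have Qm: "Q t f \<in> borel_measurable \<mu>" by (rule Q_measurable[OF t fm(1)])
  have int: "integrable \<mu> (\<lambda>x. (Q t f x)\<^sup>2)"
    using Qm le by (intro integrableI_nonneg) (auto intro: le_less_trans)
  then show "sq_integrable \<mu> (Q t f)" using Qm by (simp add: sq_integrable_def)
  have "ennreal (inner (Q t f) (Q t f)) = (\<integral>\<^sup>+x. ennreal ((Q t f x)\<^sup>2) \<partial>\<mu>)"
    using nn_integral_eq_integral[OF int] by (simp add: inner_def power2_eq_square)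
  then have "ennreal (inner (Q t f) (Q t f)) \<le> ennreal (inner f f)" using le by simp
  moreover have "0 \<le> inner f f" by (simp add: inner_def)
  ultimately show "inner (Q t f) (Q t f) \<le> inner f f" by (simp add: ennreal_le_iff)
qed

lemma Q_add:
  assumes s: "0 \<le> s" and t: "0 \<le> t" and f: "sq_integrable \<mu> f"
  shows "AE x in \<mu>. Q (s + t) f x = Q s (Q t f) x"
proof -
  have fm: "f \<in> borel_measurable \<mu>" using f by (auto simp: sq_integrable_def)
  have st: "0 \<le> s + t" using s t by simp
  show ?thesis
    using AE_sq_integrable_K[OF st f]
  proof (rule AE_mp, intro AE_I2 impI)
    fix x assume x: "x \<in> space \<mu>"
      and sq: "sq_integrable (K (s + t) x) f \<and> ennreal ((Q (s + t) f x)\<^sup>2) \<le> (\<integral>\<^sup>+y. ennreal ((f y)\<^sup>2) \<partial>K (s + t) x)"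
    interpret Kst: prob_space "K (s + t) x" by (rule K_prob[OF st x])
    have int: "integrable (K (s + t) x) f" using sq Kst.sq_integrable_integrable by blast
    define p n where "p y = (\<integral>\<^sup>+z. ennreal (f z) \<partial>K t y)" and "n y = (\<integral>\<^sup>+z. ennreal (- f z) \<partial>K t y)" for y
    have pm: "p \<in> borel_measurable \<mu>" "n \<in> borel_measurable \<mu>"
      unfolding p_def[abs_def] n_def[abs_def] using fm by (auto intro!: nn_measurable[OF t])
    have Ks: "K t \<in> measurable (K s x) (subprob_algebra \<mu>)"
      using K_meas[OF t] measurable_cong_sets[OF K_sets[OF s x] refl] by blast
    have P: "(\<integral>\<^sup>+z. ennreal (f z) \<partial>K (s + t) x) = (\<integral>\<^sup>+y. p y \<partial>K s x)"
      unfolding K_add[OF s t x] p_def by (rule nn_integral_bind[OF _ Ks]) (use fm in simp)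
    have N: "(\<integral>\<^sup>+z. ennreal (- f z) \<partial>K (s + t) x) = (\<integral>\<^sup>+y. n y \<partial>K s x)"
      unfolding K_add[OF s t x] n_def by (rule nn_integral_bind[OF _ Ks]) (use fm in simp)
    have fin: "(\<integral>\<^sup>+y. p y \<partial>K s x) \<noteq> \<infinity>" "(\<integral>\<^sup>+y. n y \<partial>K s x) \<noteq> \<infinity>"
      using int unfolding P[symmetric] N[symmetric] by (auto simp: real_integrable_def)
    have pmK: "p \<in> borel_measurable (K s x)" "n \<in> borel_measurable (K s x)" using pm K_measurable[OF s x] by auto
    have AEp: "AE y in K s x. p y \<noteq> \<infinity>" "AE y in K s x. n y \<noteq> \<infinity>"
      using nn_integral_noteq_infinite[OF pmK(1) fin(1)] nn_integral_noteq_infinite[OF pmK(2) fin(2)] by auto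
    have real_part: "integrable (K s x) (\<lambda>y. enn2real (q y)) \<and> (\<integral>y. enn2real (q y) \<partial>K s x) = enn2real (\<integral>\<^sup>+y. q y \<partial>K s x)"
      if q: "q \<in> borel_measurable (K s x)" "(\<integral>\<^sup>+y. q y \<partial>K s x) \<noteq> \<infinity>" "AE y in K s x. q y \<noteq> \<infinity>" for q
    proof -
      have eq: "(\<integral>\<^sup>+y. ennreal (enn2real (q y)) \<partial>K s x) = (\<integral>\<^sup>+y. q y \<partial>K s x)"
        using q(3) by (intro nn_integral_cong_AE) (auto simp: less_top)
      have "integrable (K s x) (\<lambda>y. enn2real (q y))"
        using q eq by (intro integrableI_nonneg) (auto simp: less_top)
      moreover have "(\<integral>y. enn2real (q y) \<partial>K s x) = enn2real (\<integral>\<^sup>+y. ennreal (enn2real (q y)) \<partial>K s x)"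
        by (rule integral_eq_nn_integral) (use q in auto)
      ultimately show ?thesis using eq by simp
    qed
    have Qt: "AE y in K s x. Q t f y = enn2real (p y) - enn2real (n y)"
      using AE_space AEp
    proof eventually_elim
      fix y assume y: "y \<in> space (K s x)" "p y \<noteq> \<infinity>" "n y \<noteq> \<infinity>"
      then have y': "y \<in> space \<mu>" using K_space[OF s x] by simp
      have "integrable (K t y) f"
        using y(2,3) K_measurable[OF t y' fm] unfolding real_integrable_def p_def n_def by simp
      then show "Q t f y = enn2real (p y) - enn2real (n y)"
        unfolding Q_def p_def n_def by (rule real_lebesgue_integral_def)
    qed
    have "Q s (Q t f) x = (\<integral>y. enn2real (p y) - enn2real (n y) \<partial>K s x)"
      unfolding Q_def[of s] using Qt pmK K_measurable[OF s x Q_measurable[OF t fm]] by (intro integral_cong_AE) auto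
    also have "\<dots> = enn2real (\<integral>\<^sup>+y. p y \<partial>K s x) - enn2real (\<integral>\<^sup>+y. n y \<partial>K s x)"
      using real_part[OF pmK(1) fin(1) AEp(1)] real_part[OF pmK(2) fin(2) AEp(2)] by simp
    also have "\<dots> = Q (s + t) f x"
      unfolding Q_def using real_lebesgue_integral_def[OF int] by (simp add: P N)
    finally show "Q (s + t) f x = Q s (Q t f) x" by simp
  qed
qed

lemma Q_diff:
  assumes t: "0 \<le> t" and f: "sq_integrable \<mu> f" and g: "sq_integrable \<mu> g"
  shows "AE x in \<mu>. Q t (\<lambda>y. f y - g y) x = Q t f x - Q t g x"
  using AE_space AE_sq_integrable_K[OF t g] AE_sq_integrable_K[OF t f]
proof eventually_elim
  fix x assume x: "x \<in> space \<mu>"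
    and "sq_integrable (K t x) g \<and> ennreal ((Q t g x)\<^sup>2) \<le> (\<integral>\<^sup>+y. ennreal ((g y)\<^sup>2) \<partial>K t x)"
    and "sq_integrable (K t x) f \<and> ennreal ((Q t f x)\<^sup>2) \<le> (\<integral>\<^sup>+y. ennreal ((f y)\<^sup>2) \<partial>K t x)"
  then have sq: "sq_integrable (K t x) f" "sq_integrable (K t x) g" by auto
  interpret Kx: prob_space "K t x" by (rule K_prob[OF t x])
  from sq have "integrable (K t x) f" "integrable (K t x) g" using Kx.sq_integrable_integrable by auto
  then show "Q t (\<lambda>y. f y - g y) x = Q t f x - Q t g x" unfolding Q_def by (rule Bochner_Integration.integral_diff)
qed

lemma inner_commute: "inner f g = inner g f" by (simp add: inner_def mult.commute)

lemma inner_self: "inner f f = (\<integral>x. (f x)\<^sup>2 \<partial>\<mu>)" by (simp add: inner_def power2_eq_square)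

lemma inner_nonneg: "0 \<le> inner f f" by (simp add: inner_self)

lemma inner_cong: "AE x in \<mu>. f x = f' x \<Longrightarrow> AE x in \<mu>. g x = g' x \<Longrightarrow>
   f \<in> borel_measurable \<mu> \<Longrightarrow> f' \<in> borel_measurable \<mu> \<Longrightarrow> g \<in> borel_measurable \<mu> \<Longrightarrow> g' \<in> borel_measurable \<mu> \<Longrightarrow>
   inner f g = inner f' g'"
  unfolding inner_def by (rule integral_cong_AE) auto

lemma sq_measurable: "sq_integrable \<mu> f \<Longrightarrow> f \<in> borel_measurable \<mu>" by (simp add: sq_integrable_def)

lemma inner_cong_left: "AE x in \<mu>. f x = f' x \<Longrightarrow> sq_integrable \<mu> f \<Longrightarrow> sq_integrable \<mu> f' \<Longrightarrow> sq_integrable \<mu> g \<Longrightarrow>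
   inner f g = inner f' g"
  by (intro inner_cong sq_measurable) auto

lemma inner_diff:
  assumes f: "sq_integrable \<mu> f" and g: "sq_integrable \<mu> g"
  shows "inner (\<lambda>x. f x - g x) (\<lambda>x. f x - g x) = inner f f - 2 * inner f g + inner g g"
proof -
  have "inner (\<lambda>x. f x - g x) (\<lambda>x. f x - g x) = (\<integral>x. f x * f x - 2 * (f x * g x) + g x * g x \<partial>\<mu>)"
    unfolding inner_def by (rule Bochner_Integration.integral_cong) (auto simp: algebra_simps)
  also have "\<dots> = inner f f - 2 * inner f g + inner g g"
    using sq_integrable_mult[OF f f] sq_integrable_mult[OF f g] sq_integrable_mult[OF g g] by (simp add: inner_def)
  finally show ?thesis .
qed

lemma Q_symmetric:
  "0 \<le> t \<Longrightarrow> sq_integrable \<mu> f \<Longrightarrow> sq_integrable \<mu> g \<Longrightarrow> inner (Q t f) g = inner f (Q t g)"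
  unfolding inner_def Q_def by (rule K_sym)

lemma inner_Q_add:
  assumes s: "0 \<le> s" and t: "0 \<le> t" and f: "sq_integrable \<mu> f"
  shows "inner (Q (s + t) f) f = inner (Q s f) (Q t f)"
proof -
  have "inner (Q (s + t) f) f = inner (Q s (Q t f)) f"
    using Q_add[OF s t f] s t Q_contraction(1) f
    by (intro inner_cong) (auto intro!: sq_measurable)
  also have "\<dots> = inner (Q t f) (Q s f)" by (rule Q_symmetric[OF s Q_contraction(1)[OF t f] f])
  finally show ?thesis by (simp add: inner_commute)
qed

lemma Q_0: "f \<in> borel_measurable \<mu> \<Longrightarrow> x \<in> space \<mu> \<Longrightarrow> Q 0 f x = f x"
  unfolding Q_def K_0 by (rule integral_return)

lemma drop_0: "sq_integrable \<mu> f \<Longrightarrow> drop f 0 = 0"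
proof -
  assume f: "sq_integrable \<mu> f"
  have "inner (Q 0 f) f = inner f f"
    unfolding inner_def by (rule Bochner_Integration.integral_cong[OF refl]) (simp add: Q_0[OF sq_measurable[OF f]])
  then show ?thesis by (simp add: drop_def)
qed

lemma drop_mono:
  assumes f: "sq_integrable \<mu> f" and st: "0 \<le> s" "s \<le> t" shows "drop f s \<le> drop f t"
proof -
  let ?s = "s / 2" and ?r = "(t - s) / 2"
  have r: "0 \<le> ?r" "0 \<le> ?s" using st by auto
  have "inner (Q t f) f = inner (Q (t / 2) f) (Q (t / 2) f)" using inner_Q_add[of "t/2" "t/2" f] st f by simp
  also have "\<dots> = inner (Q ?r (Q ?s f)) (Q ?r (Q ?s f))"
  proof -
    have tt: "t / 2 = ?r + ?s" by (simp add: field_simps)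
    have ae: "AE x in \<mu>. Q (t / 2) f x = Q ?r (Q ?s f) x" unfolding tt by (rule Q_add[OF r f])
    show ?thesis
      using ae st f Q_contraction(1)[OF r(1) Q_contraction(1)[OF r(2) f]] Q_contraction(1)[of "t / 2" f]
      by (intro inner_cong) (auto intro!: sq_measurable)
  qed
  also have "\<dots> \<le> inner (Q ?s f) (Q ?s f)" by (rule Q_contraction(2)[OF r(1) Q_contraction(1)[OF r(2) f]])
  also have "\<dots> = inner (Q s f) f" using inner_Q_add[of ?s ?s f] st f by simp
  finally show ?thesis by (simp add: drop_def)
qed

text \<open>By symmetry this is the nonnegativity of the squared norm of \<open>Q (s / 2) f - Q (t / 2) f\<close>.\<close>

lemma drop_midpoint:
  assumes f: "sq_integrable \<mu> f" and st: "0 \<le> s" "0 \<le> t" shows "drop f s + drop f t \<le> 2 * drop f ((s + t) / 2)"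
proof -
  have sq: "sq_integrable \<mu> (Q (s / 2) f)" "sq_integrable \<mu> (Q (t / 2) f)" using st f by (auto intro!: Q_contraction)
  have "0 \<le> inner (\<lambda>x. Q (s / 2) f x - Q (t / 2) f x) (\<lambda>x. Q (s / 2) f x - Q (t / 2) f x)" by (rule inner_nonneg)
  also have "\<dots> = inner (Q (s / 2 + s / 2) f) f - 2 * inner (Q (s / 2 + t / 2) f) f + inner (Q (t / 2 + t / 2) f) f"
    using st f by (simp only: inner_diff[OF sq] inner_Q_add)
  finally show ?thesis by (simp add: drop_def add_divide_distrib)
qed

lemma drop_nonneg: "sq_integrable \<mu> f \<Longrightarrow> 0 \<le> t \<Longrightarrow> 0 \<le> drop f t"
  using drop_mono[of f 0 t] drop_0[of f] by simp

lemma drop_slope: "sq_integrable \<mu> f \<Longrightarrow> 0 < s \<Longrightarrow> s \<le> t \<Longrightarrow> s * drop f t \<le> t * drop f s"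
  by (rule average_slope_antimono[OF drop_0 drop_mono drop_midpoint])

lemma distance_le_drop:
  assumes f: "sq_integrable \<mu> f" and t: "0 \<le> t"
  shows "inner (\<lambda>x. f x - Q t f x) (\<lambda>x. f x - Q t f x) \<le> drop f t"
proof -
  have "inner (\<lambda>x. f x - Q t f x) (\<lambda>x. f x - Q t f x) = inner f f - 2 * inner (Q t f) f + inner (Q (t + t) f) f"
    unfolding inner_diff[OF f Q_contraction(1)[OF t f]] inner_Q_add[OF t t f] by (simp add: inner_commute)
  also have "\<dots> \<le> drop f t" using drop_mono[OF f t, of "t + t"] t by (simp add: drop_def)
  finally show ?thesis .
qed

text \<open>Running the semigroup for a short time regularizes without increasing the energy.\<close>

lemma drop_Q:
  assumes f: "sq_integrable \<mu> f" and h: "0 < h" and t: "0 \<le> t"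
  shows "h * drop (Q (h / 2) f) t \<le> t * drop f h"
proof -
  have h2: "0 \<le> h / 2" using h by simp
  have sq: "sq_integrable \<mu> (Q (h / 2) f)" by (rule Q_contraction(1)[OF h2 f])
  have 1: "inner (Q (h / 2) f) (Q (h / 2) f) = inner (Q h f) f" using inner_Q_add[OF h2 h2 f] by simp
  have "inner (Q t (Q (h / 2) f)) (Q (h / 2) f) = inner (Q (h / 2) (Q t (Q (h / 2) f))) f"
    by (rule Q_symmetric[OF h2 Q_contraction(1)[OF t sq] f, symmetric])
  also have "\<dots> = inner (Q (h / 2 + t) (Q (h / 2) f)) f"
    by (rule inner_cong_left[OF Q_add[OF h2 t sq], symmetric]; intro Q_contraction(1) h2 t sq f add_nonneg_nonneg)
  also have "\<dots> = inner (Q (h / 2 + t + h / 2) f) f"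
    by (rule inner_cong_left[OF Q_add[OF _ h2 f], symmetric]; intro Q_contraction(1) h2 t sq f add_nonneg_nonneg)
  also have "h / 2 + t + h / 2 = h + t" by simp
  finally have eq: "drop (Q (h / 2) f) t = drop f (h + t) - drop f h" by (simp add: drop_def 1)
  have "h * drop f (h + t) \<le> (h + t) * drop f h" using t by (intro drop_slope[OF f h]) simp
  then show ?thesis unfolding eq by (simp add: algebra_simps)
qed

end

context symmetric_semigroup
begin

definition nrm :: "('a \<Rightarrow> real) \<Rightarrow> real" where "nrm f = sqrt (inner f f)"

lemma nrm_nonneg: "0 \<le> nrm f" by (simp add: nrm_def inner_nonneg)

lemma nrm_square: "(nrm f)\<^sup>2 = inner f f" by (simp add: nrm_def inner_nonneg)

lemma inner_le_nrm: "sq_integrable \<mu> f \<Longrightarrow> sq_integrable \<mu> g \<Longrightarrow> \<bar>inner f g\<bar> \<le> nrm f * nrm g"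
  using real_sqrt_le_mono[OF cauchy_schwarz_integral[of \<mu> f g]]
  by (simp add: nrm_def inner_self) (simp add: inner_def real_sqrt_mult)

lemma nrm_diff_commute: "nrm (\<lambda>x. f x - g x) = nrm (\<lambda>x. g x - f x)"
  by (simp add: nrm_def inner_self power2_commute)

lemma nrm_triangle:
  assumes f: "sq_integrable \<mu> f" and g: "sq_integrable \<mu> g" and k: "sq_integrable \<mu> k"
  shows "nrm (\<lambda>x. f x - k x) \<le> nrm (\<lambda>x. f x - g x) + nrm (\<lambda>x. g x - k x)"
proof -
  let ?p = "\<lambda>x. f x - g x" and ?q = "\<lambda>x. k x - g x"
  have p: "sq_integrable \<mu> ?p" and q: "sq_integrable \<mu> ?q" by (intro sq_integrable_diff f g k)+
  have "(nrm (\<lambda>x. f x - k x))\<^sup>2 = inner (\<lambda>x. ?p x - ?q x) (\<lambda>x. ?p x - ?q x)" by (simp add: nrm_square)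
  also have "\<dots> = (nrm ?p)\<^sup>2 - 2 * inner ?p ?q + (nrm ?q)\<^sup>2" by (simp only: inner_diff[OF p q] nrm_square)
  also have "\<dots> \<le> (nrm ?p + nrm ?q)\<^sup>2" using inner_le_nrm[OF p q] by (simp add: power2_sum)
  finally have "nrm (\<lambda>x. f x - k x) \<le> nrm ?p + nrm ?q"
    by (rule power2_le_imp_le) (intro add_nonneg_nonneg nrm_nonneg)
  then show ?thesis by (subst nrm_diff_commute[of g k])
qed

lemma nrm_zero_AE:
  assumes f: "sq_integrable \<mu> f" and z: "nrm f = 0" shows "AE x in \<mu>. f x = 0"
proof -
  have "(\<integral>x. (f x)\<^sup>2 \<partial>\<mu>) = 0" using nrm_square[of f] z by (simp add: inner_self)
  then have "AE x in \<mu>. (f x)\<^sup>2 = 0"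
    using f by (subst (asm) integral_nonneg_eq_0_iff_AE) (auto simp: sq_integrable_def)
  then show ?thesis by simp
qed

lemma nrm_Q_diff:
  assumes t: "0 \<le> t" and f: "sq_integrable \<mu> f" and g: "sq_integrable \<mu> g"
  shows "nrm (\<lambda>x. Q t f x - Q t g x) \<le> nrm (\<lambda>x. f x - g x)"
proof -
  have d: "sq_integrable \<mu> (\<lambda>x. f x - g x)" by (intro sq_integrable_diff f g)
  have e: "sq_integrable \<mu> (\<lambda>x. Q t f x - Q t g x)" by (intro sq_integrable_diff Q_contraction t f g)
  have "inner (\<lambda>x. Q t f x - Q t g x) (\<lambda>x. Q t f x - Q t g x)
      = inner (Q t (\<lambda>x. f x - g x)) (Q t (\<lambda>x. f x - g x))"
    using Q_diff[OF t f g] by (intro inner_cong sq_measurable e Q_contraction t d) (auto elim: AE_mp)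
  then show ?thesis using Q_contraction(2)[OF t d] by (simp add: nrm_def)
qed

lemma drop_affine:
  assumes t: "0 \<le> t" and f: "sq_integrable \<mu> f"
  shows "drop (\<lambda>x. a * (f x - b)) t = a\<^sup>2 * drop f t"
proof -
  have Qf: "sq_integrable \<mu> (Q t f)" by (rule Q_contraction(1)[OF t f])
  let ?g = "\<lambda>x. a * (f x - b)"
  have g: "sq_integrable \<mu> ?g" by (intro sq_integrable_scale sq_integrable_diff f sq_integrable_const)
  have ae: "AE x in \<mu>. Q t ?g x = a * (Q t f x - b)"
    using AE_space AE_sq_integrable_K[OF t f]
  proof eventually_elim
    fix x assume x: "x \<in> space \<mu>"
      and sq: "sq_integrable (K t x) f \<and> ennreal ((Q t f x)\<^sup>2) \<le> (\<integral>\<^sup>+y. ennreal ((f y)\<^sup>2) \<partial>K t x)"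
    interpret Kx: prob_space "K t x" by (rule K_prob[OF t x])
    have "integrable (K t x) f" using sq Kx.sq_integrable_integrable by blast
    then show "Q t ?g x = a * (Q t f x - b)" by (simp add: Q_def Kx.prob_space)
  qed
  have i: "integrable \<mu> f" "integrable \<mu> (Q t f)" using f Qf sq_integrable_integrable by auto
  have ff: "integrable \<mu> (\<lambda>x. f x * f x)" "integrable \<mu> (\<lambda>x. Q t f x * f x)"
    by (intro sq_integrable_mult f Qf)+
  have "inner f (\<lambda>_. 1) = inner (Q t f) (\<lambda>_. 1)"
  proof -
    have "inner (Q t f) (\<lambda>_. 1) = inner f (Q t (\<lambda>_. 1))" by (rule Q_symmetric[OF t f sq_integrable_const])
    also have "\<dots> = inner f (\<lambda>_. 1)"
      unfolding inner_def by (rule Bochner_Integration.integral_cong[OF refl]) (simp add: Q_def prob_space.prob_space[OF K_prob[OF t]])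
    finally show ?thesis by simp
  qed
  then have mean: "(\<integral>x. Q t f x \<partial>\<mu>) = (\<integral>x. f x \<partial>\<mu>)" by (simp add: inner_def)
  have "inner (Q t ?g) ?g = inner (\<lambda>x. a * (Q t f x - b)) ?g"
    by (rule inner_cong_left[OF ae]) (intro Q_contraction(1) t g sq_integrable_scale sq_integrable_diff Qf sq_integrable_const)+
  then have "drop ?g t = inner ?g ?g - inner (\<lambda>x. a * (Q t f x - b)) ?g" by (simp add: drop_def)
  also have "inner (\<lambda>x. a * (Q t f x - b)) ?g
      = (\<integral>x. a\<^sup>2 * (Q t f x * f x) - a\<^sup>2 * b * Q t f x - a\<^sup>2 * b * f x + a\<^sup>2 * b\<^sup>2 \<partial>\<mu>)"
    unfolding inner_def by (rule Bochner_Integration.integral_cong) (auto simp: power2_eq_square algebra_simps)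
  also have "\<dots> = a\<^sup>2 * inner (Q t f) f - a\<^sup>2 * b * (\<integral>x. f x \<partial>\<mu>) - a\<^sup>2 * b * (\<integral>x. f x \<partial>\<mu>) + a\<^sup>2 * b\<^sup>2"
    using i ff by (simp add: inner_def mean prob_space)
  also have "inner ?g ?g = (\<integral>x. a\<^sup>2 * (f x * f x) - a\<^sup>2 * b * f x - a\<^sup>2 * b * f x + a\<^sup>2 * b\<^sup>2 \<partial>\<mu>)"
    unfolding inner_def by (rule Bochner_Integration.integral_cong) (auto simp: power2_eq_square algebra_simps)
  also have "\<dots> = a\<^sup>2 * inner f f - a\<^sup>2 * b * (\<integral>x. f x \<partial>\<mu>) - a\<^sup>2 * b * (\<integral>x. f x \<partial>\<mu>) + a\<^sup>2 * b\<^sup>2"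
    using i ff by (simp add: inner_def prob_space)
  finally show ?thesis by (simp add: drop_def algebra_simps)
qed

lemma variance_eq:
  assumes f: "sq_integrable \<mu> f"
  shows "inner (\<lambda>x. f x - (\<integral>y. f y \<partial>\<mu>)) (\<lambda>x. f x - (\<integral>y. f y \<partial>\<mu>)) = inner f f - (\<integral>y. f y \<partial>\<mu>)\<^sup>2"
  by (simp add: inner_diff[OF f sq_integrable_const]) (simp add: inner_def power2_eq_square prob_space)

text \<open>Otherwise there are functions of mean \<open>0\<close> and norm \<open>1\<close> that \<open>Q 1\<close> almost fixes. By compactness some of
  them converge, and the limit is a nonconstant function fixed by \<open>Q 1\<close>.\<close>

lemma compact_spectral_gap:
  assumes compact: "\<And>f. (\<forall>k. sq_integrable \<mu> (f k) \<and> inner (f k) (f k) \<le> 1) \<Longrightarrow>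
      \<exists>g r. sq_integrable \<mu> g \<and> strict_mono (r :: nat \<Rightarrow> nat) \<and>
        (\<lambda>k. inner (\<lambda>x. Q 1 (f (r k)) x - g x) (\<lambda>x. Q 1 (f (r k)) x - g x)) \<longlonglongrightarrow> 0"
    and ergodic: "\<And>g. sq_integrable \<mu> g \<Longrightarrow> (\<And>t. 0 < t \<Longrightarrow> drop g t = 0) \<Longrightarrow> \<exists>c. AE x in \<mu>. g x = c"
  shows "\<exists>C>0. \<forall>g. sq_integrable \<mu> g \<longrightarrow> inner g g - (\<integral>x. g x \<partial>\<mu>)\<^sup>2 \<le> C * drop g 1"
proof (rule ccontr)
  assume neg: "\<not> ?thesis"
  have "\<exists>u. sq_integrable \<mu> u \<and> inner u u = 1 \<and> (\<integral>x. u x \<partial>\<mu>) = 0 \<and> drop u 1 < inverse (real (Suc k))" for k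
  proof -
    have "0 < real (Suc k)" by simp
    with neg obtain g where g: "sq_integrable \<mu> g"
      and big: "real (Suc k) * drop g 1 < inner g g - (\<integral>x. g x \<partial>\<mu>)\<^sup>2"
      by (meson not_le)
    define V where "V = inner g g - (\<integral>x. g x \<partial>\<mu>)\<^sup>2"
    have "0 \<le> real (Suc k) * drop g 1" using drop_nonneg[OF g] by simp
    then have V: "0 < V" using big unfolding V_def by linarith
    define u where "u x = (1 / sqrt V) * (g x - (\<integral>x. g x \<partial>\<mu>))" for x
    have u: "sq_integrable \<mu> u"
      unfolding u_def[abs_def] by (intro sq_integrable_scale sq_integrable_diff g sq_integrable_const)
    have "inner u u = (1 / V) * V"
    proof -
      have "inner u u = (\<integral>x. (1 / V) * ((g x - (\<integral>x. g x \<partial>\<mu>)) * (g x - (\<integral>x. g x \<partial>\<mu>))) \<partial>\<mu>)"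
        unfolding inner_def u_def using V by (intro Bochner_Integration.integral_cong) auto
      then show ?thesis using variance_eq[OF g] by (simp add: inner_def V_def)
    qed
    moreover have "(\<integral>x. u x \<partial>\<mu>) = 0" using sq_integrable_integrable[OF g] by (simp add: u_def prob_space)
    moreover have "drop u 1 < inverse (real (Suc k))"
    proof -
      have du: "drop u 1 = (1 / sqrt V)\<^sup>2 * drop g 1"
        unfolding u_def[abs_def] by (rule drop_affine[OF _ g]) simp
      have "(1 / sqrt V)\<^sup>2 = 1 / V" using V by (simp add: power_divide)
      then have "real (Suc k) * drop u 1 = real (Suc k) * drop g 1 / V" by (simp add: du)
      also have "\<dots> < 1" using big V unfolding V_def[symmetric] by simp
      finally have "real (Suc k) * drop u 1 < 1" .
      then show ?thesis by (simp add: inverse_eq_divide less_divide_eq mult.commute)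
    qed
    ultimately show ?thesis using u V by (intro exI[of _ u]) simp
  qed
  then obtain u where u: "\<And>k. sq_integrable \<mu> (u k)" "\<And>k. inner (u k) (u k) = 1"
    "\<And>k. (\<integral>x. u k x \<partial>\<mu>) = 0" "\<And>k. drop (u k) 1 < inverse (real (Suc k))" by metis
  have "\<forall>k. sq_integrable \<mu> (u k) \<and> inner (u k) (u k) \<le> 1" using u by simp
  from compact[OF this] obtain g r where g: "sq_integrable \<mu> g" and r: "strict_mono (r :: nat \<Rightarrow> nat)"
    and lim: "(\<lambda>k. inner (\<lambda>x. Q 1 (u (r k)) x - g x) (\<lambda>x. Q 1 (u (r k)) x - g x)) \<longlonglongrightarrow> 0" by blast
  have Qu: "sq_integrable \<mu> (Q 1 (u k))" for k by (rule Q_contraction(1)[OF _ u(1)]) simp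
  have Qg: "sq_integrable \<mu> (Q 1 g)" by (rule Q_contraction(1)[OF _ g]) simp
  have l1: "(\<lambda>k. nrm (\<lambda>x. Q 1 (u (r k)) x - g x)) \<longlonglongrightarrow> 0"
    using tendsto_real_sqrt[OF lim] by (simp add: nrm_def)
  have "(\<lambda>k. inverse (real (Suc (r k)))) \<longlonglongrightarrow> 0"
    using LIMSEQ_subseq_LIMSEQ[OF LIMSEQ_inverse_real_of_nat r] by (simp add: o_def)
  then have l2: "(\<lambda>k. sqrt (inverse (real (Suc (r k))))) \<longlonglongrightarrow> 0" using tendsto_real_sqrt by fastforce
  have n2: "nrm (\<lambda>x. u (r k) x - Q 1 (u (r k)) x) \<le> sqrt (inverse (real (Suc (r k))))" for k
    unfolding nrm_def by (rule real_sqrt_le_mono[OF order_trans[OF distance_le_drop[OF u(1)]]]) (use u(4) in \<open>auto intro: less_imp_le\<close>)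
  have l3: "(\<lambda>k. sqrt (inverse (real (Suc (r k)))) + nrm (\<lambda>x. Q 1 (u (r k)) x - g x)) \<longlonglongrightarrow> 0"
    using tendsto_add[OF l2 l1] by simp
  have n3: "nrm (\<lambda>x. u (r k) x - g x) \<le> sqrt (inverse (real (Suc (r k)))) + nrm (\<lambda>x. Q 1 (u (r k)) x - g x)" for k
    using nrm_triangle[OF u(1)[of "r k"] Qu[of "r k"] g] n2[of k] by linarith
  have l4: "(\<lambda>k. nrm (\<lambda>x. u (r k) x - g x)) \<longlonglongrightarrow> 0"
    by (rule tendsto_sandwich[OF _ _ tendsto_const l3]) (intro always_eventually allI nrm_nonneg n3)+
  have "nrm (\<lambda>x. Q 1 g x - g x) \<le> nrm (\<lambda>x. u (r k) x - g x) + nrm (\<lambda>x. Q 1 (u (r k)) x - g x)" for k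
  proof -
    have "nrm (\<lambda>x. Q 1 g x - g x) \<le> nrm (\<lambda>x. Q 1 g x - Q 1 (u (r k)) x) + nrm (\<lambda>x. Q 1 (u (r k)) x - g x)"
      by (rule nrm_triangle[OF Qg Qu g])
    also have "nrm (\<lambda>x. Q 1 g x - Q 1 (u (r k)) x) \<le> nrm (\<lambda>x. g x - u (r k) x)" by (rule nrm_Q_diff[OF _ g u(1)]) simp
    finally show ?thesis by (simp add: nrm_diff_commute[of g])
  qed
  then have "nrm (\<lambda>x. Q 1 g x - g x) \<le> 0"
    using tendsto_add[OF l4 l1] by (intro LIMSEQ_le_const) auto
  then have "nrm (\<lambda>x. Q 1 g x - g x) = 0" using nrm_nonneg[of "\<lambda>x. Q 1 g x - g x"] by linarith
  from nrm_zero_AE[OF sq_integrable_diff[OF Qg g] this] have fix1: "AE x in \<mu>. Q 1 g x = g x" by simp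
  have "drop g 1 = 0" using inner_cong_left[OF fix1 Qg g g] by (simp add: drop_def)
  then have "drop g t = 0" if "0 < t" for t
    using drop_mono[OF g, of t 1] drop_slope[OF g, of 1 t] drop_nonneg[OF g, of t] that by (cases "t \<le> 1") auto
  from ergodic[OF g this] obtain c where c: "AE x in \<mu>. g x = c" by blast
  have ig: "(\<integral>x. g x \<partial>\<mu>) = c"
    using integral_cong_AE[OF _ _ c] sq_measurable[OF g] by (simp add: prob_space)
  have "\<bar>c\<bar> \<le> nrm (\<lambda>x. u (r k) x - g x)" for k
  proof -
    have "inner (\<lambda>x. u (r k) x - g x) (\<lambda>_. 1) = - c"
      using u(3)[of "r k"] ig sq_integrable_integrable[OF g] sq_integrable_integrable[OF u(1)] by (simp add: inner_def)
    then show ?thesis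
      using inner_le_nrm[OF sq_integrable_diff[OF u(1)[of "r k"] g] sq_integrable_const[of 1]]
      by (simp add: nrm_def[of "\<lambda>_. 1"] inner_def[of "\<lambda>_. 1"] prob_space)
  qed
  then have "\<bar>c\<bar> \<le> 0" using l4 by (intro LIMSEQ_le_const) auto
  then have "AE x in \<mu>. g x = 0" using c by simp
  then have "inner (\<lambda>x. u (r k) x - g x) (\<lambda>x. u (r k) x - g x) = inner (u (r k)) (u (r k))" for k
    by (intro inner_cong sq_measurable sq_integrable_diff u(1) g) auto
  then have "nrm (\<lambda>x. u (r k) x - g x) = 1" for k using u(2) by (simp add: nrm_def)
  then show False using l4 by (simp add: LIMSEQ_const_iff)
qed

text \<open>The hypothesis is applied to \<open>Q (h / 2) f\<close>. Its energy is at most \<open>drop f h / h\<close>, its squared norm is that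
  of \<open>f\<close> up to \<open>drop f h\<close>, and on \<open>B\<close> it is as small as its distance from \<open>f\<close>.\<close>

lemma drop_lower_bound:
  assumes B: "B \<in> sets \<mu>" and f: "sq_integrable \<mu> f" and zero: "\<And>x. x \<in> B \<Longrightarrow> f x = 0" and h: "0 < h"
    and A: "0 < A" "0 \<le> A'" "h * (1 + A') \<le> A"
    and poincare: "\<And>g E. sq_integrable \<mu> g \<Longrightarrow> (\<And>t. 0 < t \<Longrightarrow> drop g t \<le> t * E) \<Longrightarrow>
      inner g g \<le> A * E + A' * (\<integral>x. indicator B x * (g x)\<^sup>2 \<partial>\<mu>)"
  shows "h * inner f f \<le> 2 * A * drop f h"
proof -
  have h2: "0 \<le> h / 2" using h by simp
  let ?g = "Q (h / 2) f"
  have g: "sq_integrable \<mu> ?g" by (rule Q_contraction(1)[OF h2 f])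
  have "drop ?g t \<le> t * (drop f h / h)" if "0 < t" for t
    using drop_Q[OF f h, of t] that h by (simp add: field_simps)
  from poincare[OF g this] have 1: "inner ?g ?g \<le> A * (drop f h / h) + A' * (\<integral>x. indicator B x * (?g x)\<^sup>2 \<partial>\<mu>)" by simp
  have 2: "inner ?g ?g = inner f f - drop f h" using inner_Q_add[OF h2 h2 f] by (simp add: drop_def)
  have d: "sq_integrable \<mu> (\<lambda>x. f x - ?g x)" by (rule sq_integrable_diff[OF f g])
  have "(\<integral>x. indicator B x * (?g x)\<^sup>2 \<partial>\<mu>) \<le> (\<integral>x. (f x - ?g x)\<^sup>2 \<partial>\<mu>)"
  proof (rule integral_mono)
    show "integrable \<mu> (\<lambda>x. indicator B x * (?g x)\<^sup>2)"
      using g B by (auto simp: sq_integrable_def intro!: integrable_mult_indicator[where 'b = real, simplified])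
    show "integrable \<mu> (\<lambda>x. (f x - ?g x)\<^sup>2)" using d by (simp add: sq_integrable_def)
    show "indicator B x * (?g x)\<^sup>2 \<le> (f x - ?g x)\<^sup>2" for x using zero[of x] by (simp add: indicator_def)
  qed
  also have "\<dots> \<le> drop f (h / 2)" using distance_le_drop[OF f h2] by (simp add: inner_self)
  also have "\<dots> \<le> drop f h" using h by (intro drop_mono[OF f]) auto
  finally have 3: "A' * (\<integral>x. indicator B x * (?g x)\<^sup>2 \<partial>\<mu>) \<le> A' * drop f h" using A by (intro mult_left_mono)
  have "inner f f \<le> A * (drop f h / h) + (1 + A') * drop f h" using 1 2 3 by (simp add: algebra_simps)
  then have "h * inner f f \<le> h * (A * (drop f h / h) + (1 + A') * drop f h)" using h by (intro mult_left_mono) auto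
  also have "\<dots> = A * drop f h + h * (1 + A') * drop f h" using h by (simp add: field_simps)
  also have "\<dots> \<le> A * drop f h + A * drop f h" using A drop_nonneg[OF f, of h] h by (intro add_left_mono mult_right_mono) auto
  finally show ?thesis by simp
qed

text \<open>The probability that the process started at \<open>x\<close> is outside \<open>B\<close> at the times \<open>0, h, \<dots>, n * h\<close>.\<close>

primrec avoid :: "'a set \<Rightarrow> real \<Rightarrow> nat \<Rightarrow> 'a \<Rightarrow> real" where
  "avoid B h 0 x = indicator (- B) x"
| "avoid B h (Suc n) x = indicator (- B) x * Q h (avoid B h n) x"

lemma avoid_props:
  assumes B: "B \<in> sets \<mu>" and h: "0 \<le> h"
  shows "avoid B h n \<in> borel_measurable \<mu> \<and> (\<forall>x\<in>space \<mu>. 0 \<le> avoid B h n x \<and> avoid B h n x \<le> 1)"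
proof (induction n)
  case 0
  have "(\<lambda>x. 1 - indicator B x :: real) \<in> borel_measurable \<mu>" using B by measurable
  moreover have "avoid B h 0 = (\<lambda>x. 1 - indicator B x)" by (auto simp: indicator_def fun_eq_iff)
  ultimately show ?case by (auto simp: indicator_def)
next
  case (Suc n)
  have m: "Q h (avoid B h n) \<in> borel_measurable \<mu>" using Suc by (intro Q_measurable h) simp
  have "(\<lambda>x. (1 - indicator B x) * Q h (avoid B h n) x) \<in> borel_measurable \<mu>" using m B by measurable
  moreover have "avoid B h (Suc n) = (\<lambda>x. (1 - indicator B x) * Q h (avoid B h n) x)"
    by (auto simp: indicator_def fun_eq_iff)
  moreover have "0 \<le> Q h (avoid B h n) x \<and> Q h (avoid B h n) x \<le> 1" if x: "x \<in> space \<mu>" for x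
  proof -
    interpret Kx: prob_space "K h x" by (rule K_prob[OF h x])
    have b: "0 \<le> avoid B h n y \<and> avoid B h n y \<le> 1" if "y \<in> space (K h x)" for y
      using Suc that K_space[OF h x] by auto
    have "integrable (K h x) (avoid B h n)"
      by (rule Kx.integrable_const_bound[of _ 1]) (use b K_measurable[OF h x] Suc in auto)
    then have "Q h (avoid B h n) x \<le> (\<integral>y. 1 \<partial>K h x)"
      unfolding Q_def using b by (intro integral_mono) auto
    moreover have "0 \<le> Q h (avoid B h n) x" unfolding Q_def using b by (intro Bochner_Integration.integral_nonneg) auto
    ultimately show ?thesis by (simp add: Kx.prob_space)
  qed
  ultimately show ?case by (auto simp: indicator_def)
qed

lemma avoid_sq: "B \<in> sets \<mu> \<Longrightarrow> 0 \<le> h \<Longrightarrow> sq_integrable \<mu> (avoid B h n)"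
  using avoid_props[of B h n] by (intro sq_integrable_bounded[where C = 1]) auto

lemma avoid_zero: "x \<in> B \<Longrightarrow> avoid B h n x = 0"
  by (cases n) auto

lemma avoid_decay:
  assumes B: "B \<in> sets \<mu>" and h: "0 < h" and A: "0 < A" "0 \<le> A'" "2 * h * (1 + A') \<le> A"
    and poincare: "\<And>g E. sq_integrable \<mu> g \<Longrightarrow> (\<And>t. 0 < t \<Longrightarrow> drop g t \<le> t * E) \<Longrightarrow>
      inner g g \<le> A * E + A' * (\<integral>x. indicator B x * (g x)\<^sup>2 \<partial>\<mu>)"
  shows "inner (avoid B h n) (avoid B h n) \<le> exp (- (h / A) * real n)"
proof (induction n)
  case 0
  have "inner (avoid B h 0) (avoid B h 0) \<le> (\<integral>x. 1 \<partial>\<mu>)"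
    unfolding inner_def
    by (rule integral_mono[OF sq_integrable_mult[OF avoid_sq[OF B less_imp_le[OF h]] avoid_sq[OF B less_imp_le[OF h]]]])
       (auto simp: indicator_def)
  then show ?case by (simp add: prob_space del: avoid.simps)
next
  case (Suc n)
  have h0: "0 \<le> h" "0 < 2 * h" using h by auto
  let ?v = "avoid B h n"
  have v: "sq_integrable \<mu> ?v" by (rule avoid_sq[OF B h0(1)])
  have Qv: "sq_integrable \<mu> (Q h ?v)" by (rule Q_contraction(1)[OF h0(1) v])
  have "inner (avoid B h (Suc n)) (avoid B h (Suc n)) \<le> inner (Q h ?v) (Q h ?v)"
    unfolding inner_def
    by (rule integral_mono[OF sq_integrable_mult[OF avoid_sq[OF B h0(1)] avoid_sq[OF B h0(1)]] sq_integrable_mult[OF Qv Qv]])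
       (auto simp: indicator_def)
  also have "\<dots> = inner ?v ?v - drop ?v (2 * h)" using inner_Q_add[OF h0(1) h0(1) v] by (simp add: drop_def)
  also have "\<dots> \<le> (1 - h / A) * inner ?v ?v"
  proof -
    have "2 * h * inner ?v ?v \<le> 2 * A * drop ?v (2 * h)"
      by (rule drop_lower_bound[OF B v avoid_zero h0(2) A poincare]) auto
    then have "h / A * inner ?v ?v \<le> drop ?v (2 * h)" using A(1) by (simp add: field_simps)
    then show ?thesis by (simp add: algebra_simps)
  qed
  also have "\<dots> \<le> exp (- (h / A)) * inner ?v ?v"
    using exp_ge_add_one_self[of "- (h / A)"] by (intro mult_right_mono inner_nonneg) simp
  also have "\<dots> \<le> exp (- (h / A)) * exp (- (h / A) * real n)" using Suc by (intro mult_left_mono) auto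
  also have "\<dots> = exp (- (h / A) * real (Suc n))" by (simp add: exp_add[symmetric] algebra_simps)
  finally show ?case .
qed

end

section \<open>The semigroup of reflected Brownian motion\<close>

lemma L2_sq_integrable: "L2 M = {f. sq_integrable (normalized_volume M) f}"
  by (auto simp: L2_def sq_integrable_def measurable_normalized_volume)

lemma weak_gradient_is: "f \<in> H1 M \<Longrightarrow> is_weak_gradient M f (weak_gradient M f)"
  unfolding H1_def weak_gradient_def by (auto intro: someI[of "is_weak_gradient M f"])

locale reflected_process =
  fixes M :: "(real^'n) set" and N :: "'w measure" and X :: "real \<Rightarrow> 'w \<Rightarrow> real^'n" and P :: "real^'n \<Rightarrow> 'w measure"
  assumes M_borel: "M \<in> sets borel" and M_volume: "emeasure lborel M \<noteq> 0" "emeasure lborel M \<noteq> \<infinity>"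
    and rbm: "reflected_brownian_motion M N X P"
begin

abbreviation \<mu> :: "(real^'n) measure" where "\<mu> \<equiv> normalized_volume M"

text \<open>Points outside \<open>M\<close> do not move, which makes the kernel total without changing it almost everywhere.\<close>

definition kernel :: "real \<Rightarrow> real^'n \<Rightarrow> (real^'n) measure" where
  "kernel t z = (if z \<in> M then distr (P z) borel (X t) else return borel z)"

lemma hunt: "continuous_hunt_process M N X P" and symmetric: "symmetric_process M X P"
  and form: "associated_with_dirichlet_form M X P"
  using rbm by (auto simp: reflected_brownian_motion_def)

lemma X_measurable: "0 \<le> t \<Longrightarrow> X t \<in> borel_measurable N"
  and X_in: "\<omega> \<in> space N \<Longrightarrow> 0 \<le> t \<Longrightarrow> X t \<omega> \<in> M"
  and X_continuous: "\<omega> \<in> space N \<Longrightarrow> continuous_on {0..} (\<lambda>t. X t \<omega>)"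
  and P_prob: "z \<in> M \<Longrightarrow> prob_space (P z)"
  and P_sets: "z \<in> M \<Longrightarrow> sets (P z) = sets N"
  and X_start: "z \<in> M \<Longrightarrow> AE \<omega> in P z. X 0 \<omega> = z"
  and P_measurable: "0 \<le> t \<Longrightarrow> B \<in> sets borel \<Longrightarrow>
    (\<lambda>z. emeasure (P z) {\<omega> \<in> space N. X t \<omega> \<in> B}) \<in> borel_measurable (restrict_space borel M)"
  and markov: "strong_markov M N X P"
  using hunt unfolding continuous_hunt_process_def by blast+

lemma P_space: "z \<in> M \<Longrightarrow> space (P z) = space N"
  by (rule sets_eq_imp_space_eq[OF P_sets])

lemma X_measurable_P: "z \<in> M \<Longrightarrow> 0 \<le> t \<Longrightarrow> X t \<in> borel_measurable (P z)"
  using X_measurable measurable_cong_sets[OF P_sets refl] by blast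

lemma prob_mu: "prob_space \<mu>"
  by (rule prob_space_normalized_volume[OF M_volume])

lemma AE_in_M: "AE x in \<mu>. x \<in> M"
  unfolding normalized_volume_def by (rule AE_uniform_measureI) (use M_borel in auto)

lemma emeasure_kernel:
  "z \<in> M \<Longrightarrow> 0 \<le> t \<Longrightarrow> B \<in> sets borel \<Longrightarrow> emeasure (kernel t z) B = emeasure (P z) {\<omega> \<in> space N. X t \<omega> \<in> B}"
  by (simp add: kernel_def emeasure_distr[OF X_measurable_P] P_space vimage_def Int_def conj_commute)

lemma sets_kernel: "sets (kernel t z) = sets borel" by (simp add: kernel_def)

lemma kernel_prob: "0 \<le> t \<Longrightarrow> prob_space (kernel t z)"
  unfolding kernel_def by (auto intro: prob_space.prob_space_distr[OF P_prob X_measurable_P] prob_space_return)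

lemma kernel_measurable:
  assumes t: "0 \<le> t" shows "kernel t \<in> borel \<rightarrow>\<^sub>M subprob_algebra borel"
proof (rule measurable_subprob_algebra)
  show "subprob_space (kernel t z)" for z by (rule prob_space_imp_subprob_space[OF kernel_prob[OF t]])
  fix B :: "(real^'n) set" assume B: "B \<in> sets borel"
  have "(\<lambda>z. if z \<in> M then emeasure (P z) {\<omega> \<in> space N. X t \<omega> \<in> B} else indicator B z) \<in> borel_measurable borel"
    using M_borel B P_measurable[OF t B]
    by (subst measurable_If_restrict_space_iff) (auto intro: measurable_restrict_space1)
  moreover have "(\<lambda>z. emeasure (kernel t z) B)
      = (\<lambda>z. if z \<in> M then emeasure (P z) {\<omega> \<in> space N. X t \<omega> \<in> B} else indicator B z)"
    using emeasure_kernel[OF _ t B] B by (auto simp: fun_eq_iff kernel_def)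
  ultimately show "(\<lambda>z. emeasure (kernel t z) B) \<in> borel_measurable borel" by simp
qed (simp add: sets_kernel)

lemma past_subset: "A \<in> past N X s \<Longrightarrow> A \<subseteq> space N"
  unfolding past_def by (rule sigma_sets_into_sp) auto

lemma past_sets: "A \<in> past N X s \<Longrightarrow> A \<in> sets N"
  unfolding past_def using X_measurable
  by (elim sigma_sets.induct[where P = "\<lambda>A. A \<in> sets N", OF _ _ _ _ ]) (auto intro: measurable_sets)

lemma past_mono: "A \<in> past N X s \<Longrightarrow> s \<le> t \<Longrightarrow> A \<in> past N X t"
proof -
  assume A: "A \<in> past N X s" and st: "s \<le> t"
  have "past N X s \<subseteq> past N X t"
    unfolding past_def by (rule sigma_sets_mono') (use st in force)
  then show ?thesis using A by blast
qed

lemma past_space: "space N \<in> past N X s"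
  unfolding past_def by (rule sigma_sets_top)

lemma past_event:
  assumes A: "A \<in> past N X s" and s: "0 \<le> s" and B: "B \<in> sets borel"
  shows "{\<omega> \<in> A. X s \<omega> \<in> B} \<in> past N X s"
proof -
  let ?G = "{X r -` B \<inter> space N | r B. 0 \<le> r \<and> r \<le> s \<and> B \<in> sets borel}"
  have sub: "?G \<subseteq> Pow (space N)" by auto
  have "X s -` B \<inter> space N \<in> past N X s" unfolding past_def using s B by (intro sigma_sets.Basic) blast
  then have "A \<inter> (X s -` B \<inter> space N) \<in> sigma_sets (space N) ?G"
    using A sets.Int[of A "sigma (space N) ?G" "X s -` B \<inter> space N"] sets_measure_of[OF sub]
    unfolding past_def by auto
  moreover have "A \<inter> (X s -` B \<inter> space N) = {\<omega> \<in> A. X s \<omega> \<in> B}" using past_subset[OF A] by auto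
  ultimately show ?thesis by (simp add: past_def)
qed

lemma markov_emeasure:
  assumes z: "z \<in> M" and s: "0 \<le> s" and h: "0 \<le> h" and A: "A \<in> past N X s" and B: "B \<in> sets borel"
  shows "emeasure (P z) {\<omega> \<in> A. X (s + h) \<omega> \<in> B} = (\<integral>\<^sup>+\<omega>. indicator A \<omega> * emeasure (kernel h (X s \<omega>)) B \<partial>P z)"
proof -
  let ?\<tau> = "\<lambda>_ :: 'w. ereal s"
  have "optional_time N X ?\<tau>"
    unfolding optional_time_def
  proof (intro conjI ballI allI impI)
    show "0 \<le> ereal s" using s by simp
    show "{\<omega> \<in> space N. ereal s < ereal t} \<in> past N X t" for t
      using past_space by (cases "s < t") (auto simp: past_def intro: sigma_sets.Empty)
  qed
  moreover have "A \<in> past_at N X ?\<tau>"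
    unfolding past_at_def
  proof (intro CollectI conjI allI impI)
    show "A \<in> sets N" by (rule past_sets[OF A])
    show "{\<omega> \<in> A. ereal s < ereal t} \<in> past N X t" for t
      using past_mono[OF A, of t] by (cases "s < t") (auto simp: past_def intro: sigma_sets.Empty)
  qed
  ultimately have "emeasure (P z) {\<omega> \<in> A. ?\<tau> \<omega> < \<infinity> \<and> X (real_of_ereal (?\<tau> \<omega>) + h) \<omega> \<in> B} =
        (\<integral>\<^sup>+\<omega>. indicator {\<omega> \<in> A. ?\<tau> \<omega> < \<infinity>} \<omega> *
            emeasure (P (X (real_of_ereal (?\<tau> \<omega>)) \<omega>)) {\<omega>' \<in> space N. X h \<omega>' \<in> B} \<partial>P z)"
    using markov z h B unfolding strong_markov_def by blast
  also have "\<dots> = (\<integral>\<^sup>+\<omega>. indicator A \<omega> * emeasure (kernel h (X s \<omega>)) B \<partial>P z)"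
    using X_in s h B by (intro nn_integral_cong) (auto simp: P_space[OF z] emeasure_kernel)
  finally show ?thesis by simp
qed

lemma kernel_add:
  assumes s: "0 \<le> s" and t: "0 \<le> t"
  shows "kernel (s + t) z = kernel s z \<bind> kernel t"
proof (cases "z \<in> M")
  case False
  then show ?thesis using bind_return[OF kernel_measurable[OF t], of z] by (simp add: kernel_def)
next
  case True
  have km: "kernel t \<in> kernel s z \<rightarrow>\<^sub>M subprob_algebra borel"
    using kernel_measurable[OF t] measurable_cong_sets[OF sets_kernel refl] by blast
  have ne: "space (kernel s z) \<noteq> {}" using sets_eq_imp_space_eq[OF sets_kernel] by simp
  show ?thesis
  proof (rule measure_eqI)
    show "sets (kernel (s + t) z) = sets (kernel s z \<bind> kernel t)"
      by (simp add: sets_kernel sets_bind[OF sets_kernel ne])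
    fix B assume "B \<in> sets (kernel (s + t) z)"
    then have B: "B \<in> sets borel" by (simp add: sets_kernel)
    have "emeasure (kernel s z \<bind> kernel t) B = (\<integral>\<^sup>+y. emeasure (kernel t y) B \<partial>kernel s z)"
      by (rule emeasure_bind[OF ne km B])
    also have "\<dots> = (\<integral>\<^sup>+\<omega>. emeasure (kernel t (X s \<omega>)) B \<partial>P z)"
      using True measurable_compose[OF kernel_measurable[OF t] measurable_emeasure_subprob_algebra[OF B]]
      by (simp add: kernel_def[of s] nn_integral_distr[OF X_measurable_P[OF True s]] measurable_distr_eq1)
    also have "\<dots> = (\<integral>\<^sup>+\<omega>. indicator (space N) \<omega> * emeasure (kernel t (X s \<omega>)) B \<partial>P z)"
      by (intro nn_integral_cong) (simp add: P_space[OF True])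
    also have "\<dots> = emeasure (kernel (s + t) z) B"
      using markov_emeasure[OF True s t past_space B] emeasure_kernel[OF True _ B, of "s + t"] s t by simp
    finally show "emeasure (kernel (s + t) z) B = emeasure (kernel s z \<bind> kernel t) B" by simp
  qed
qed

lemma transition_op_kernel:
  assumes "z \<in> M" "0 \<le> t" "f \<in> borel_measurable borel"
  shows "transition_op M X P t f z = (\<integral>y. f y \<partial>kernel t z)"
  using assms by (simp add: transition_op_def kernel_def integral_distr[OF X_measurable_P])

end

sublocale reflected_process \<subseteq> symmetric_semigroup "normalized_volume M" kernel
proof -
  interpret prob_space \<mu> by (rule prob_mu)
  show "symmetric_semigroup \<mu> kernel"
  proof (rule symmetric_semigroup.intro[OF prob_mu symmetric_semigroup_axioms.intro])
    fix t :: real and f g assume t: "0 \<le> t" and f: "sq_integrable \<mu> f" and g: "sq_integrable \<mu> g"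
    have fm: "f \<in> borel_measurable borel" "g \<in> borel_measurable borel"
      using f g by (auto simp: sq_integrable_def measurable_normalized_volume)
    have km: "(\<lambda>x. \<integral>y. u y \<partial>kernel t x) \<in> borel_measurable borel" if "u \<in> borel_measurable borel" for u :: "real^'n \<Rightarrow> real"
      by (rule measurable_compose[OF kernel_measurable[OF t] integral_measurable_subprob_algebra[OF that]])
    have tm: "AE x in \<mu>. transition_op M X P t u x = (\<integral>y. u y \<partial>kernel t x)" if "u \<in> borel_measurable borel" for u
      using AE_in_M transition_op_kernel[OF _ t that] by auto
    have ind: "transition_op M X P t u = (\<lambda>x. indicator M x * (\<integral>y. u y \<partial>kernel t x))" if "u \<in> borel_measurable borel" for u
      using transition_op_kernel[OF _ t that] by (auto simp: fun_eq_iff transition_op_def[of _ _ _ _ _ _] indicator_def)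
    have mb: "transition_op M X P t u \<in> borel_measurable \<mu>" if "u \<in> borel_measurable borel" for u
      unfolding ind[OF that] using km[OF that] M_borel by measurable
    have "(\<integral>x. (\<integral>y. f y \<partial>kernel t x) * g x \<partial>\<mu>) = L2_inner M (transition_op M X P t f) g"
      unfolding L2_inner_def using tm[OF fm(1)] mb[OF fm(1)] km[OF fm(1)] fm by (intro integral_cong_AE) auto
    also have "\<dots> = L2_inner M f (transition_op M X P t g)"
      using symmetric t f g by (simp add: symmetric_process_def L2_sq_integrable)
    also have "\<dots> = (\<integral>x. f x * (\<integral>y. g y \<partial>kernel t x) \<partial>\<mu>)"
      unfolding L2_inner_def using tm[OF fm(2)] mb[OF fm(2)] km[OF fm(2)] fm by (intro integral_cong_AE) auto
    finally show "(\<integral>x. (\<integral>y. f y \<partial>kernel t x) * g x \<partial>\<mu>) = (\<integral>x. f x * (\<integral>y. g y \<partial>kernel t x) \<partial>\<mu>)" .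
  next
    fix x show "kernel 0 x = return \<mu> x"
    proof (cases "x \<in> M")
      case True
      interpret Px: prob_space "P x" by (rule P_prob[OF True])
      have "kernel 0 x = distr (P x) borel (\<lambda>_. x)"
        using True X_start[OF True] X_measurable_P[OF True, of 0] by (simp add: kernel_def distr_cong_AE)
      also have "\<dots> = return \<mu> x"
      proof (rule measure_eqI)
        fix A assume "A \<in> sets (distr (P x) borel (\<lambda>_. x))"
        then show "emeasure (distr (P x) borel (\<lambda>_. x)) A = emeasure (return \<mu> x) A"
          using Px.emeasure_space_1
          by (subst emeasure_distr) (auto simp: sets_normalized_volume indicator_def vimage_def)
      qed (simp add: sets_normalized_volume)
      finally show ?thesis .
    next
      case False
      then show ?thesis by (simp add: kernel_def return_cong[OF sets_normalized_volume])
    qed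
  qed (simp_all add: kernel_measurable kernel_prob kernel_add subprob_algebra_cong[OF sets_normalized_volume]
        measurable_normalized_volume)
qed

context reflected_process
begin

lemma inner_L2: "inner f g = L2_inner M f g"
  by (simp add: inner_def L2_inner_def)

lemma Q_transition_op:
  assumes t: "0 \<le> t" and f: "sq_integrable \<mu> f"
  shows "AE x in \<mu>. transition_op M X P t f x = Q t f x" "transition_op M X P t f \<in> borel_measurable \<mu>"
proof -
  have fm: "f \<in> borel_measurable borel"
    using f by (auto simp: sq_integrable_def measurable_normalized_volume)
  show "AE x in \<mu>. transition_op M X P t f x = Q t f x"
    using AE_in_M transition_op_kernel[OF _ t fm] by (auto simp: Q_def)
  have "transition_op M X P t f = (\<lambda>x. indicator M x * Q t f x)"
    using transition_op_kernel[OF _ t fm] by (auto simp: fun_eq_iff transition_op_def[of _ _ _ _ _ _] indicator_def Q_def)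
  then show "transition_op M X P t f \<in> borel_measurable \<mu>"
    using Q_measurable[OF t sq_measurable[OF f]] M_borel by simp
qed

lemma approximating_form_eq:
  assumes t: "0 < t" and f: "sq_integrable \<mu> f" and g: "sq_integrable \<mu> g"
  shows "approximating_form M X P t f g = (inner f g - inner (Q t f) g) / t"
proof -
  have t0: "0 \<le> t" using t by simp
  have Qf: "sq_integrable \<mu> (Q t f)" by (rule Q_contraction(1)[OF t0 f])
  have "L2_inner M (\<lambda>x. f x - transition_op M X P t f x) g = inner (\<lambda>x. f x - Q t f x) g"
    unfolding inner_L2[symmetric] using Q_transition_op[OF t0 f] sq_measurable[OF f] sq_measurable[OF g] sq_measurable[OF Qf]
    by (intro inner_cong) auto
  also have "\<dots> = inner f g - inner (Q t f) g"
    using sq_integrable_mult[OF f g] sq_integrable_mult[OF Qf g] by (simp add: inner_def left_diff_distrib)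
  finally show ?thesis by (simp add: approximating_form_def)
qed

lemma H1_sq_integrable: "f \<in> H1 M \<Longrightarrow> sq_integrable \<mu> f"
  by (simp add: H1_def L2_sq_integrable)

lemma drop_le_energy:
  assumes f: "f \<in> H1 M" and t: "0 < t" shows "drop f t \<le> t * dirichlet_form M f f"
proof -
  have sq: "sq_integrable \<mu> f" by (rule H1_sq_integrable[OF f])
  have lim: "((\<lambda>s. approximating_form M X P s f f) \<longlongrightarrow> dirichlet_form M f f) (at_right 0)"
    using form f by (simp add: associated_with_dirichlet_form_def)
  have "drop f t / t \<le> dirichlet_form M f f"
  proof (rule tendsto_lowerbound[OF lim])
    have "drop f t / t \<le> approximating_form M X P s f f" if "0 < s" "s < t" for s
    proof -
      have "s * drop f t \<le> t * drop f s" using that by (intro drop_slope[OF sq]) auto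
      then have "drop f t / t \<le> drop f s / s" using that t by (simp add: divide_simps mult.commute)
      then show ?thesis by (simp add: approximating_form_eq[OF that(1) sq sq] drop_def)
    qed
    then show "\<forall>\<^sub>F s in at_right 0. drop f t / t \<le> approximating_form M X P s f f"
      unfolding eventually_at_right_field using t by blast
  qed simp
  then show ?thesis using t by (simp add: divide_le_eq mult.commute)
qed

text \<open>Together with the previous lemma, \<open>drop f t \<le> t * E\<close> for all \<open>t > 0\<close> characterizes the functions in \<open>H\<^sup>1\<close>
  of energy at most \<open>E\<close>.\<close>

lemma energy_le_drop:
  assumes f: "sq_integrable \<mu> f" and le: "\<And>t. 0 < t \<Longrightarrow> drop f t \<le> t * E"
  shows "f \<in> H1 M" "dirichlet_form M f f \<le> E"
proof -
  obtain L where L: "((\<lambda>t. drop f t / t) \<longlongrightarrow> L) (at_right 0)" "L \<le> E"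
    by (rule slope_limit_exists[OF drop_slope[OF f] le])
  have ev: "\<forall>\<^sub>F t in at_right 0. drop f t / t = approximating_form M X P t f f"
    unfolding eventually_at_right_field
    by (intro exI[of _ 1]) (auto simp: approximating_form_eq[OF _ f f] drop_def)
  have lim: "((\<lambda>t. approximating_form M X P t f f) \<longlongrightarrow> L) (at_right 0)" by (rule Lim_transform_eventually[OF L(1) ev])
  then show f1: "f \<in> H1 M" using form f by (auto simp: associated_with_dirichlet_form_def L2_sq_integrable)
  have "((\<lambda>t. approximating_form M X P t f f) \<longlongrightarrow> dirichlet_form M f f) (at_right 0)"
    using form f1 by (simp add: associated_with_dirichlet_form_def)
  then have "dirichlet_form M f f = L" using lim by (intro tendsto_unique) auto
  then show "dirichlet_form M f f \<le> E" using L(2) by simp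
qed

lemma drop_zero_constant:
  assumes gap: "positive_spectral_gap M" and g: "sq_integrable \<mu> g" and zero: "\<And>t. 0 < t \<Longrightarrow> drop g t = 0"
  shows "\<exists>c. AE x in \<mu>. g x = c"
proof -
  have g1: "g \<in> H1 M" by (rule energy_le_drop[OF g, of 0]) (simp add: zero)
  have "dirichlet_form M g v = 0" if v: "v \<in> H1 M" for v
  proof -
    have "approximating_form M X P t g v = 0" if t: "0 < t" for t
    proof -
      have t0: "0 \<le> t" using t by simp
      have d: "sq_integrable \<mu> (\<lambda>x. g x - Q t g x)" by (intro sq_integrable_diff g Q_contraction t0)
      have "inner (\<lambda>x. g x - Q t g x) (\<lambda>x. g x - Q t g x) \<le> 0" using distance_le_drop[OF g t0] zero[OF t] by simp
      then have "nrm (\<lambda>x. g x - Q t g x) = 0" using inner_nonneg by (simp add: nrm_def antisym)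
      from nrm_zero_AE[OF d this] have "inner g v = inner (Q t g) v"
        by (intro inner_cong_left[OF _ g Q_contraction(1)[OF t0 g] H1_sq_integrable[OF v]]) auto
      then show ?thesis by (simp add: approximating_form_eq[OF t g H1_sq_integrable[OF v]])
    qed
    then have "\<forall>\<^sub>F t in at_right 0. approximating_form M X P t g v = 0"
      unfolding eventually_at_right_field by (intro exI[of _ 1]) auto
    then have "((\<lambda>t. approximating_form M X P t g v) \<longlongrightarrow> 0) (at_right 0)" by (rule tendsto_eventually)
    moreover have "((\<lambda>t. approximating_form M X P t g v) \<longlongrightarrow> dirichlet_form M g v) (at_right 0)"
      using form g1 v by (simp add: associated_with_dirichlet_form_def)
    ultimately show ?thesis by (intro tendsto_unique) auto
  qed
  then have "g \<in> neumann_eigenfunctions M 0"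
    using g1 by (simp add: neumann_eigenfunctions_def resolvent_equation_def L2_inner_def)
  then show ?thesis using gap by (simp add: positive_spectral_gap_def)
qed

lemma poincare_if_compact:
  assumes gap: "positive_spectral_gap M" and compact: "compact_on_L2 M (transition_op M X P 1)"
  shows "\<exists>C>0. \<forall>g\<in>H1 M. L2_inner M g g - (\<integral>x. g x \<partial>\<mu>)\<^sup>2 \<le> C * dirichlet_form M g g"
proof -
  have "\<exists>C>0. \<forall>g. sq_integrable \<mu> g \<longrightarrow> inner g g - (\<integral>x. g x \<partial>\<mu>)\<^sup>2 \<le> C * drop g 1"
  proof (rule compact_spectral_gap[OF _ drop_zero_constant[OF gap]])
    fix f :: "nat \<Rightarrow> real^'n \<Rightarrow> real" assume f: "\<forall>k. sq_integrable \<mu> (f k) \<and> inner (f k) (f k) \<le> 1"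
    then have "\<forall>k. f k \<in> L2 M \<and> L2_inner M (f k) (f k) \<le> 1" by (simp add: L2_sq_integrable inner_L2)
    from mp[OF spec[OF compact[unfolded compact_on_L2_def]] this] obtain g r where g: "g \<in> L2 M" and r: "strict_mono (r :: nat \<Rightarrow> nat)"
      and lim: "(\<lambda>k. L2_inner M (\<lambda>x. transition_op M X P 1 (f (r k)) x - g x)
        (\<lambda>x. transition_op M X P 1 (f (r k)) x - g x)) \<longlonglongrightarrow> 0"
      by (elim bexE exE conjE)
    have g': "sq_integrable \<mu> g" using g by (simp add: L2_sq_integrable)
    have "L2_inner M (\<lambda>x. transition_op M X P 1 (f (r k)) x - g x) (\<lambda>x. transition_op M X P 1 (f (r k)) x - g x)
      = inner (\<lambda>x. Q 1 (f (r k)) x - g x) (\<lambda>x. Q 1 (f (r k)) x - g x)" for k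
    proof -
      have fk: "sq_integrable \<mu> (f (r k))" using f by simp
      have ae: "AE x in \<mu>. transition_op M X P 1 (f (r k)) x - g x = Q 1 (f (r k)) x - g x"
        using Q_transition_op(1)[of 1, OF _ fk] by simp
      have m: "(\<lambda>x. transition_op M X P 1 (f (r k)) x - g x) \<in> borel_measurable \<mu>"
        using Q_transition_op(2)[of 1, OF _ fk] sq_measurable[OF g'] by simp
      have m': "(\<lambda>x. Q 1 (f (r k)) x - g x) \<in> borel_measurable \<mu>"
        using Q_measurable[of 1, OF _ sq_measurable[OF fk]] sq_measurable[OF g'] by simp
      show ?thesis unfolding inner_L2[symmetric] by (rule inner_cong[OF ae ae m m' m m'])
    qed
    then have "(\<lambda>k. inner (\<lambda>x. Q 1 (f (r k)) x - g x) (\<lambda>x. Q 1 (f (r k)) x - g x)) \<longlonglongrightarrow> 0" using lim by simp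
    then show "\<exists>g r. sq_integrable \<mu> g \<and> strict_mono (r :: nat \<Rightarrow> nat) \<and>
        (\<lambda>k. inner (\<lambda>x. Q 1 (f (r k)) x - g x) (\<lambda>x. Q 1 (f (r k)) x - g x)) \<longlonglongrightarrow> 0" using g' r by blast
  qed
  then obtain C where C: "0 < C" "\<And>g. sq_integrable \<mu> g \<Longrightarrow> inner g g - (\<integral>x. g x \<partial>\<mu>)\<^sup>2 \<le> C * drop g 1" by blast
  have "L2_inner M g g - (\<integral>x. g x \<partial>\<mu>)\<^sup>2 \<le> C * dirichlet_form M g g" if g: "g \<in> H1 M" for g
  proof -
    have "C * drop g 1 \<le> C * dirichlet_form M g g"
      using drop_le_energy[OF g, of 1] C(1) by (intro mult_left_mono) auto
    then show ?thesis using C(2)[OF H1_sq_integrable[OF g]] unfolding inner_L2 by linarith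
  qed
  then show ?thesis using C(1) by blast
qed

end

text \<open>The inequality concerns \<open>M\<close> only, so it suffices to have one reflected Brownian motion with
  a compact semigroup.\<close>

lemma neumann_poincare:
  fixes M :: "(real^'n) set"
  assumes "M \<in> sets borel" "emeasure lborel M \<noteq> 0" "emeasure lborel M \<noteq> \<infinity>" and adm: "admissible_reflecting_domain M \<rho> L"
  shows "\<exists>C>0. \<forall>g\<in>H1 M. L2_inner M g g - (\<integral>x. g x \<partial>normalized_volume M)\<^sup>2 \<le> C * dirichlet_form M g g"
proof -
  obtain N :: "(real \<Rightarrow> real^'n) measure" and X P where rbm: "reflected_brownian_motion M N X P"
    and compact: "\<forall>t>0. compact_on_L2 M (transition_op M X P t)" and gap: "positive_spectral_gap M"
    using adm unfolding admissible_reflecting_domain_def by blast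
  interpret reflected_process M N X P using assms rbm by unfold_locales auto
  show ?thesis using compact by (intro poincare_if_compact[OF gap]) simp
qed

section \<open>A Poincare inequality with a small ball\<close>

text \<open>The component of \<open>y - x\<close> orthogonal to the axis has at most \<open>c\<close> times the length of the axial one.\<close>

abbreviation axis_cone :: "real^'n \<Rightarrow> real^'n \<Rightarrow> real \<Rightarrow> real \<Rightarrow> (real^'n) set" where
  "axis_cone x e c R \<equiv> {y. 0 < (y - x) \<bullet> e \<and> (y - x) \<bullet> e \<le> R \<and> (norm (y - x))\<^sup>2 \<le> (1 + c\<^sup>2) * ((y - x) \<bullet> e)\<^sup>2}"

text \<open>The ball about \<open>w\<close> is replaced by a smaller one whose centre is at a definite distance from \<open>x\<close>, so that
  the cone over it contains one with a unit vector as axis.\<close>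

lemma axis_cones:
  fixes M :: "(real^'n) set"
  assumes \<epsilon>r: "0 < \<epsilon>" "0 < r"
    and cones: "\<And>x. x \<in> M \<Longrightarrow> \<exists>w\<in>cball x \<epsilon>. \<forall>s. 0 < s \<longrightarrow> s \<le> 1 \<longrightarrow> cball (x + s *\<^sub>R (w - x)) (s * r) \<subseteq> M"
  obtains R c where "0 < R" "0 < c" "c \<le> 1"
    "\<And>x. x \<in> M \<Longrightarrow> \<exists>e. norm e = 1 \<and> axis_cone x e c R \<subseteq> interior M"
proof -
  define c where "c = min 1 (r / (8 * (\<epsilon> + r)))"
  have c: "0 < c" "c \<le> 1" using \<epsilon>r by (auto simp: c_def)
  have "c \<le> r / (8 * (\<epsilon> + r))" by (simp add: c_def)
  then have c_small: "c * (\<epsilon> + r) \<le> r / 8" using \<epsilon>r by (simp add: field_simps)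
  have "\<exists>e. norm e = 1 \<and> axis_cone x e c (r / 4) \<subseteq> interior M" if x: "x \<in> M" for x
  proof -
    obtain w where w: "w \<in> cball x \<epsilon>" and ball: "\<And>s. 0 < s \<Longrightarrow> s \<le> 1 \<Longrightarrow> cball (x + s *\<^sub>R (w - x)) (s * r) \<subseteq> M"
      using cones[OF x] by blast
    \<comment> \<open>The axis is moved away from \<open>x\<close> if necessary.\<close>
    obtain v where v: "r / 4 \<le> norm v" "norm v \<le> \<epsilon> + r" "norm (v - (w - x)) \<le> r / 2"
    proof (cases "r / 4 \<le> norm (w - x)")
      case True
      show ?thesis
        by (rule that[of "w - x"]) (use True w \<epsilon>r in \<open>auto simp: dist_norm norm_minus_commute\<close>)
    next
      case False
      obtain b :: "real^'n" where b: "norm b = r / 2" using vector_choose_size[of "r / 2"] \<epsilon>r by auto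
      have "r / 2 \<le> norm (w - x + b) + norm (w - x)" using norm_triangle_ineq4[of "w - x + b" "w - x"] b by simp
      moreover have "norm (w - x + b) \<le> norm (w - x) + r / 2" using norm_triangle_ineq[of "w - x" b] b by simp
      ultimately show ?thesis using False b \<epsilon>r by (intro that[of "w - x + b"]) auto
    qed
    define e where "e = v /\<^sub>R norm v"
    have nv: "0 < norm v" using v \<epsilon>r by linarith
    have ne: "norm e = 1" using nv by (simp add: e_def)
    have ve: "v = norm v *\<^sub>R e" using nv by (simp add: e_def)
    have "y \<in> interior M"
      if y: "0 < (y - x) \<bullet> e" "(y - x) \<bullet> e \<le> r / 4" "(norm (y - x))\<^sup>2 \<le> (1 + c\<^sup>2) * ((y - x) \<bullet> e)\<^sup>2" for y
    proof -
      define t s where "t = (y - x) \<bullet> e" and "s = t / norm v"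
      have s: "0 < s" "s \<le> 1" using y v nv by (auto simp: s_def t_def divide_le_eq)
      have sv: "s *\<^sub>R v = t *\<^sub>R e" using nv by (subst ve) (simp add: s_def)
      have "(norm (y - x - s *\<^sub>R v))\<^sup>2 = (norm (y - x))\<^sup>2 - t\<^sup>2"
        unfolding sv power2_norm_eq_inner using ne
        by (simp add: inner_diff_left inner_diff_right inner_commute t_def power2_eq_square norm_eq_1 algebra_simps)
      also have "\<dots> \<le> (c * t)\<^sup>2" using y(3) by (simp add: t_def[symmetric] power_mult_distrib distrib_right)
      finally have "norm (y - x - s *\<^sub>R v) \<le> c * t" by (rule power2_le_imp_le) (use c y in \<open>simp add: t_def\<close>)
      also have "c * t = s * (c * norm v)" using nv by (simp add: s_def)
      also have "\<dots> \<le> s * (r / 8)" using s c order_trans[OF mult_left_mono[OF v(2), of c] c_small] by (intro mult_left_mono) auto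
      finally have d: "norm (y - x - s *\<^sub>R v) < s * r / 4" using mult_pos_pos[OF s(1) \<epsilon>r(2)] by simp
      have "ball (x + s *\<^sub>R v) (s * r / 4) \<subseteq> M"
      proof
        fix z assume z: "z \<in> ball (x + s *\<^sub>R v) (s * r / 4)"
        have "norm (s *\<^sub>R (v - (w - x))) \<le> s * (r / 2)" using s v(3) by (simp add: mult_left_mono)
        moreover have "dist (x + s *\<^sub>R (w - x)) z \<le> dist (x + s *\<^sub>R (w - x)) (x + s *\<^sub>R v) + dist (x + s *\<^sub>R v) z"
          by (rule dist_triangle)
        moreover have "dist (x + s *\<^sub>R (w - x)) (x + s *\<^sub>R v) = norm (s *\<^sub>R (v - (w - x)))"
          by (simp add: dist_norm norm_minus_commute scaleR_diff_right)
        moreover have "dist (x + s *\<^sub>R v) z < s * r / 4" "0 < s * r" using z s \<epsilon>r by auto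
        ultimately have "dist (x + s *\<^sub>R (w - x)) z \<le> s * r" by linarith
        then show "z \<in> M" using ball[OF s] by auto
      qed
      moreover have "y \<in> ball (x + s *\<^sub>R v) (s * r / 4)"
        using d by (simp add: dist_norm norm_minus_commute algebra_simps)
      ultimately show ?thesis by (intro interiorI[OF open_ball])
    qed
    then show ?thesis using ne by (intro exI[of _ e]) auto
  qed
  then show ?thesis using \<epsilon>r c by (intro that[of "r / 4" c]) auto
qed

text \<open>Here \<open>kappa\<close> comes in: the sum has about \<open>ln (1 / \<epsilon>)\<close> terms equal to \<open>1\<close> for \<open>d = 2\<close> and is geometric
  for \<open>d \<ge> 3\<close>.\<close>

lemma dyadic_sum:
  fixes R :: real
  assumes R: "0 < R" and d: "2 \<le> d"
  obtains C where "0 < C" "\<And>\<epsilon>. 0 < \<epsilon> \<Longrightarrow> \<epsilon> < exp (- 1) \<Longrightarrow> \<epsilon> \<le> 2 * R \<Longrightarrow>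
     \<exists>N. R \<le> \<epsilon> / 2 * 2 ^ N \<and> (\<Sum>k\<le>N. (2 ^ k) ^ (d - 2)) \<le> C / kappa d \<epsilon>"
proof -
  define C where "C = (\<bar>ln (8 * R)\<bar> + 1) / ln 2 + 2 * (4 * R) ^ (d - 2)"
  have C: "0 < C" using R by (auto simp: C_def intro!: add_nonneg_pos)
  have "\<exists>N. R \<le> \<epsilon> / 2 * 2 ^ N \<and> (\<Sum>k\<le>N. (2 ^ k) ^ (d - 2)) \<le> C / kappa d \<epsilon>"
    if \<epsilon>: "0 < \<epsilon>" "\<epsilon> < exp (- 1)" "\<epsilon> \<le> 2 * R" for \<epsilon>
  proof -
    define L where "L = log 2 (2 * R / \<epsilon>)"
    have L0: "0 \<le> L" using \<epsilon> R by (simp add: L_def)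
    define N where "N = nat \<lceil>L\<rceil>"
    have N: "L \<le> real N" "real N \<le> L + 1" using L0 unfolding N_def by (simp_all add: real_nat_ceiling_ge)
    have PL: "2 powr L = 2 * R / \<epsilon>" using \<epsilon> R by (simp add: L_def)
    have "2 * R / \<epsilon> \<le> 2 powr real N" using N(1) by (simp add: PL[symmetric])
    then have lo: "2 * R / \<epsilon> \<le> 2 ^ N" by (simp add: powr_realpow)
    have "2 powr real N \<le> 2 powr (L + 1)" using N(2) by simp
    then have hi: "2 ^ N \<le> 4 * R / \<epsilon>" by (simp add: powr_realpow powr_add PL)
    have "(\<Sum>k\<le>N. (2 ^ k) ^ (d - 2)) \<le> C / kappa d \<epsilon>"
    proof (cases "d = 2")
      case True
      have le1: "1 \<le> ln (inverse \<epsilon>)" using \<epsilon> ln_le_cancel_iff[of \<epsilon> "exp (- 1)"] by (simp add: ln_inverse)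
      have "real N + 1 \<le> log 2 (2 * R / \<epsilon>) + 2" using N(2) by (simp add: L_def)
      also have "log 2 (2 * R / \<epsilon>) + 2 = (ln (8 * R) + ln (inverse \<epsilon>)) / ln 2"
      proof -
        have "ln (8 * R) = ln (2 * R) + 2 * ln 2" using R ln_mult[of "2 * R" 4] ln_realpow[of 2 2] by simp
        then show ?thesis using \<epsilon> R by (simp add: log_def ln_div ln_inverse field_simps)
      qed
      also have "\<dots> \<le> (\<bar>ln (8 * R)\<bar> * ln (inverse \<epsilon>) + ln (inverse \<epsilon>)) / ln 2"
        using le1 mult_left_mono[OF le1, of "\<bar>ln (8 * R)\<bar>"] by (intro divide_right_mono) auto
      also have "\<dots> = (\<bar>ln (8 * R)\<bar> + 1) / ln 2 * ln (inverse \<epsilon>)" by (simp add: algebra_simps)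
      also have "\<dots> \<le> C * ln (inverse \<epsilon>)" using le1 R by (intro mult_right_mono) (auto simp: C_def)
      finally show ?thesis using True by (simp add: kappa_def divide_inverse)
    next
      case False
      then have d3: "d - 2 = Suc (d - 3)" using d by simp
      have "(\<Sum>k\<le>N. (2 ^ k) ^ (d - 2)) \<le> 2 * (2 ^ N :: real) ^ (d - 2)" for N
      proof (induction N)
        case (Suc N)
        have "2 * (2 ^ N :: real) ^ (d - 2) \<le> 2 ^ (d - 2) * (2 ^ N) ^ (d - 2)"
          unfolding d3 by (intro mult_right_mono) auto
        also have "\<dots> = (2 ^ Suc N) ^ (d - 2)" by (simp add: power_mult_distrib)
        finally show ?case using Suc unfolding sum.atMost_Suc by linarith
      qed simp
      also have "2 * (2 ^ N :: real) ^ (d - 2) \<le> 2 * (4 * R / \<epsilon>) ^ (d - 2)" using hi by (intro mult_left_mono power_mono) auto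
      also have "\<dots> = 2 * (4 * R) ^ (d - 2) / \<epsilon> ^ (d - 2)" by (simp add: power_divide)
      also have "\<dots> \<le> C / \<epsilon> ^ (d - 2)" using \<epsilon> by (intro divide_right_mono) (auto simp: C_def)
      finally show ?thesis using False by (simp add: kappa_def)
    qed
    moreover have "R \<le> \<epsilon> / 2 * 2 ^ N" using lo \<epsilon> by (simp add: field_simps)
    ultimately show ?thesis by blast
  qed
  then show ?thesis using C that by blast
qed

lemma kappa_bounds: "0 < \<epsilon> \<Longrightarrow> \<epsilon> < exp (- 1) \<Longrightarrow> 0 < kappa d \<epsilon> \<and> kappa d \<epsilon> \<le> 1"
proof -
  assume \<epsilon>: "0 < \<epsilon>" "\<epsilon> < exp (- 1)"
  have "1 \<le> ln (inverse \<epsilon>)" using \<epsilon> ln_le_cancel_iff[of \<epsilon> "exp (- 1)"] by (simp add: ln_inverse)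
  moreover have \<epsilon>1: "\<epsilon> < 1" using \<epsilon> exp_le_one_iff[of "- 1 :: real"] by linarith
  moreover have "1 < inverse \<epsilon>" using \<epsilon>(1) \<epsilon>1 by (rule one_less_inverse)
  ultimately show ?thesis using \<epsilon> by (simp add: kappa_def inverse_le_1_iff power_le_one)
qed

context bump_step
begin

text \<open>On the ball of radius \<open>c * R / 20\<close> about the point of the axis at height \<open>3 * R / 4\<close> both cutoffs are
  bounded below, whatever \<open>x\<close> and \<open>e\<close> are.\<close>

lemma weight_mass:
  fixes M :: "(real^'n) set"
  assumes c: "0 < c" "c \<le> 1" and R: "0 < R" and M: "M \<in> sets borel" "emeasure lborel M \<noteq> 0" "emeasure lborel M \<noteq> \<infinity>"
  obtains m0 where "0 < m0" "\<And>x e. norm e = 1 \<Longrightarrow> axis_cone x e c R \<subseteq> M \<Longrightarrow>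
      m0 \<le> (\<integral>y. weight x e c R y \<partial>normalized_volume M)"
proof -
  let ?\<mu> = "normalized_volume M"
  interpret \<mu>: prob_space ?\<mu>
    by (rule prob_space_normalized_volume[OF M(2,3)])
  have "continuous_on {7/10..9/10} (D 0)"
    using D unfolding derivative_sequence_def by (blast intro: DERIV_isCont continuous_at_imp_continuous_on)
  then obtain t0 where t0: "t0 \<in> {7/10..9/10}" "\<forall>t\<in>{7/10..9/10}. D 0 t0 \<le> D 0 t"
    using continuous_attains_inf[of "{7/10..9/10 :: real}" "D 0"] by auto
  define k where "k = D 0 t0"
  have k: "0 < k" using D_pos[of t0] t0 by (simp add: k_def)
  define \<kappa> where "\<kappa> = c / 20"
  have \<kappa>: "0 < \<kappa>" "\<kappa> \<le> 1/20" using c by (auto simp: \<kappa>_def)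
  define vol where "vol = measure lborel (ball (0::real^'n) (\<kappa> * R))"
  have vol: "0 < vol" using \<kappa> R by (simp add: vol_def content_ball)
  note M_pos = measure_lborel_pos[OF M(2,3)]
  define m0 where "m0 = k * (k / R) / R ^ (CARD('n) - 1) * (vol / measure lborel M)"
  have "m0 \<le> (\<integral>y. weight x e c R y \<partial>?\<mu>)"
    if e: "norm e = 1" and cone: "axis_cone x e c R \<subseteq> M" for x e
  proof -
    let ?B = "ball (x + (3/4 * R) *\<^sub>R e) (\<kappa> * R)"
    have *: "7/10 * R \<le> (y - x) \<bullet> e \<and> (y - x) \<bullet> e \<le> 8/10 * R \<and>
        1 \<le> (norm (y - x))\<^sup>2 / ((y - x) \<bullet> e)\<^sup>2 \<and> (norm (y - x))\<^sup>2 / ((y - x) \<bullet> e)\<^sup>2 \<le> 1 + c\<^sup>2 / 2" if y: "y \<in> ?B" for y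
    proof -
      define z where "z = y - x - (3/4 * R) *\<^sub>R e"
      have z: "norm z < \<kappa> * R" using y by (simp add: z_def dist_norm norm_minus_commute algebra_simps)
      have ee: "e \<bullet> e = 1" using e by (simp add: norm_eq_1)
      have yz: "y - x = (3/4 * R) *\<^sub>R e + z" by (simp add: z_def)
      have t: "(y - x) \<bullet> e = 3/4 * R + z \<bullet> e" by (simp add: yz inner_add_left ee)
      have ze: "\<bar>z \<bullet> e\<bar> \<le> norm z" using Cauchy_Schwarz_ineq2[of z e] e by simp
      have \<kappa>R: "\<kappa> * R \<le> 1/20 * R" using \<kappa> R by (intro mult_right_mono) auto
      have t_bounds: "7/10 * R \<le> (y - x) \<bullet> e" "(y - x) \<bullet> e \<le> 8/10 * R" using t ze z \<kappa>R by linarith+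
      have tp: "0 < (y - x) \<bullet> e" using t_bounds R by simp
      have n: "(norm (y - x))\<^sup>2 = ((y - x) \<bullet> e)\<^sup>2 + ((norm z)\<^sup>2 - (z \<bullet> e)\<^sup>2)"
        unfolding t unfolding yz power2_norm_eq_inner
        by (simp add: inner_add_left inner_add_right ee inner_commute[of e z] power2_eq_square algebra_simps)
      have "(z \<bullet> e)\<^sup>2 \<le> (norm z)\<^sup>2" using power_mono[OF ze, of 2] by simp
      then have "1 * ((y - x) \<bullet> e)\<^sup>2 \<le> (norm (y - x))\<^sup>2" using n by simp
      then have lo: "1 \<le> (norm (y - x))\<^sup>2 / ((y - x) \<bullet> e)\<^sup>2" using tp by (simp add: le_divide_eq)
      have "(norm z)\<^sup>2 \<le> (\<kappa> * R)\<^sup>2" using z by (intro power_mono) auto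
      also have "\<dots> \<le> c\<^sup>2 / 2 * (7/10 * R)\<^sup>2" using R by (simp add: \<kappa>_def power_mult_distrib power_divide)
      also have "\<dots> \<le> c\<^sup>2 / 2 * ((y - x) \<bullet> e)\<^sup>2" using t_bounds R by (intro mult_left_mono power_mono) auto
      finally have "(norm (y - x))\<^sup>2 \<le> 1 * ((y - x) \<bullet> e)\<^sup>2 + c\<^sup>2 / 2 * ((y - x) \<bullet> e)\<^sup>2"
        using n zero_le_power2[of "z \<bullet> e"] by linarith
      then have "(norm (y - x))\<^sup>2 \<le> (1 + c\<^sup>2 / 2) * ((y - x) \<bullet> e)\<^sup>2" by (simp only: distrib_right)
      then have "(norm (y - x))\<^sup>2 / ((y - x) \<bullet> e)\<^sup>2 \<le> 1 + c\<^sup>2 / 2" using tp by (simp add: divide_le_eq)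
      then show ?thesis using lo t_bounds by blast
    qed
    have lower: "k * (k / R) / R ^ (CARD('n) - 1) * indicator ?B y \<le> weight x e c R y" for y
    proof (cases "y \<in> ?B")
      case True
      let ?t = "(y - x) \<bullet> e" and ?u = "(norm (y - x))\<^sup>2 / ((y - x) \<bullet> e)\<^sup>2"
      have t: "7/10 \<le> ?t / R" "?t / R \<le> 9/10" "0 < ?t" "?t \<le> R" using *[OF True] R by (auto simp: field_simps)
      have "1 / (4 * c\<^sup>2) * ?u + (3/4 - 1 / (4 * c\<^sup>2)) = 3/4 + (?u - 1) / (4 * c\<^sup>2)" by (simp add: diff_divide_distrib)
      moreover have "(?u - 1) / (4 * c\<^sup>2) \<le> (c\<^sup>2 / 2) / (4 * c\<^sup>2)"
      proof (rule divide_right_mono)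
        show "?u - 1 \<le> c\<^sup>2 / 2" using *[OF True] by linarith
      qed simp
      moreover have "(c\<^sup>2 / 2) / (4 * c\<^sup>2) = 1/8" using c by simp
      moreover have "0 \<le> (?u - 1) / (4 * c\<^sup>2)" using *[OF True] by simp
      ultimately have a: "1 / (4 * c\<^sup>2) * ?u + (3/4 - 1 / (4 * c\<^sup>2)) \<in> {7/10..9/10}" by simp
      have "k * (k / R) / R ^ (CARD('n) - 1) \<le> angular c 0 ?u * (D 0 (?t / R) / R) / ?t ^ (CARD('n) - 1)"
      proof (intro frac_le mult_mono power_mono divide_right_mono)
        have "k \<le> D 0 (1 / (4 * c\<^sup>2) * ?u + (3/4 - 1 / (4 * c\<^sup>2)))" unfolding k_def by (rule t0(2)[rule_format, OF a])
        then show "k \<le> angular c 0 ?u" by (simp add: angular_def)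
        show "k \<le> D 0 (?t / R)" unfolding k_def using t by (intro t0(2)[rule_format]) auto
        show "0 \<le> angular c 0 ?u" by (rule angular_bounds)
        then show "0 \<le> angular c 0 ?u * (D 0 (?t / R) / R)" using D_nonneg R by simp
      qed (use t k R D_nonneg in auto)
      then show ?thesis using True by (simp add: weight_def)
    next
      case False
      then show ?thesis using weight_bounds(1)[OF R] by simp
    qed
    have B_sub: "?B \<subseteq> M"
    proof
      fix y assume y: "y \<in> ?B"
      have "0 < (y - x) \<bullet> e" "(y - x) \<bullet> e \<le> R" using *[OF y] R by linarith+
      moreover have "(norm (y - x))\<^sup>2 \<le> (1 + c\<^sup>2 / 2) * ((y - x) \<bullet> e)\<^sup>2"
        using *[OF y] calculation(1) by (simp add: divide_le_eq)
      moreover have "(1 + c\<^sup>2 / 2) * ((y - x) \<bullet> e)\<^sup>2 \<le> (1 + c\<^sup>2) * ((y - x) \<bullet> e)\<^sup>2" by (intro mult_right_mono) auto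
      ultimately have "y \<in> axis_cone x e c R"
        by (intro CollectI conjI) linarith+
      then show "y \<in> M" using cone by (rule subsetD[rotated])
    qed
    have "measure ?\<mu> ?B = measure lborel (M \<inter> ?B) / measure lborel M"
      unfolding normalized_volume_def using M by (intro measure_uniform_measure) auto
    also have "M \<inter> ?B = ?B" using B_sub by blast
    also have "measure lborel ?B = vol" using \<kappa> R by (simp add: vol_def content_ball)
    finally have "m0 = (\<integral>y. k * (k / R) / R ^ (CARD('n) - 1) * indicator ?B y \<partial>?\<mu>)"
      by (simp add: m0_def normalized_volume_def)
    also have "\<dots> \<le> (\<integral>y. weight x e c R y \<partial>?\<mu>)"
    proof (rule integral_mono)
      show "integrable ?\<mu> (weight x e c R)"
        using weight_bounds[OF R, of x e c] weight_measurable[of x e c R]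
        by (intro \<mu>.integrable_const_bound[of _ "Kb * (Kb / R) * (2 / R) ^ (CARD('n) - 1)"])
           (auto simp: measurable_normalized_volume)
      show "integrable ?\<mu> (\<lambda>y. k * (k / R) / R ^ (CARD('n) - 1) * indicator ?B y)"
        by (intro integrable_mult_right integrable_real_indicator) (auto simp: sets_normalized_volume \<mu>.emeasure_eq_measure)
    qed (rule lower)
    finally show ?thesis .
  qed
  moreover have "0 < m0" using k R vol M_pos by (simp add: m0_def)
  ultimately show ?thesis using that by blast
qed

end

text \<open>The weighted mean of \<open>g\<close> at the fixed scale \<open>R\<close> is compared with the mean over \<open>M\<close> by the Neumann
  Poincare inequality and with the mean at scale \<open>\<epsilon> / 2\<close> along a cone. The latter involves only values
  on the ball. The constant \<open>A'\<close> may depend on \<open>\<epsilon>\<close> and \<open>x\<close>, as it will only limit the time step.\<close>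

theorem poincare_with_ball:
  fixes M :: "(real^'n) set"
  assumes dim: "2 \<le> CARD('n)" and M: "M \<in> sets borel" "emeasure lborel M \<noteq> 0" "emeasure lborel M \<noteq> \<infinity>"
    and CP: "0 < CP" "\<And>g. g \<in> H1 M \<Longrightarrow> L2_inner M g g - (\<integral>x. g x \<partial>normalized_volume M)\<^sup>2 \<le> CP * dirichlet_form M g g"
    and R: "0 < R" "0 < c" "c \<le> 1"
    and cones: "\<And>x. x \<in> M \<Longrightarrow> \<exists>e. norm e = 1 \<and> axis_cone x e c R \<subseteq> interior M"
  obtains A \<epsilon>0 where "0 < A" "0 < \<epsilon>0" "\<epsilon>0 \<le> exp (- 1)"
    "\<And>\<epsilon> x. 0 < \<epsilon> \<Longrightarrow> \<epsilon> < \<epsilon>0 \<Longrightarrow> x \<in> M \<Longrightarrow> \<exists>A'\<ge>0. \<forall>g\<in>H1 M. L2_inner M g g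
      \<le> A / kappa CARD('n) \<epsilon> * dirichlet_form M g g + A' * (\<integral>y. indicator (ball x \<epsilon>) y * (g y)\<^sup>2 \<partial>normalized_volume M)"
proof -
  let ?\<mu> = "normalized_volume M" and ?d = "CARD('n)"
  interpret \<mu>: prob_space ?\<mu>
    by (rule prob_space_normalized_volume[OF M(2,3)])
  obtain D B m Kb where "bump_step D B m Kb" using bump_step_exists by blast
  then interpret bump_step D B m Kb .
  define W where "W r = (Kb * (Kb / r) * (2 / r) ^ (?d - 1))\<^sup>2" for r
  have w_sq: "sq_integrable ?\<mu> (weight x e c r)" and w_le: "(\<integral>y. (weight x e c r y)\<^sup>2 \<partial>?\<mu>) \<le> W r"
    if r: "0 < r" for x e :: "real^'n" and r
  proof -
    have wm: "weight x e c r \<in> borel_measurable ?\<mu>"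
      using weight_measurable by (simp add: measurable_normalized_volume)
    show sq: "sq_integrable ?\<mu> (weight x e c r)"
      by (rule \<mu>.sq_integrable_bounded[OF wm]) (use weight_bounds[OF r, of x e c] in auto)
    have "(\<integral>y. (weight x e c r y)\<^sup>2 \<partial>?\<mu>) \<le> (\<integral>y. W r \<partial>?\<mu>)"
    proof (rule integral_mono)
      show "integrable ?\<mu> (\<lambda>y. (weight x e c r y)\<^sup>2)" using sq by (simp add: sq_integrable_def)
      show "(weight x e c r y)\<^sup>2 \<le> W r" for y unfolding W_def using weight_bounds[OF r, of x e c] by (intro power_mono)
    qed simp
    then show "(\<integral>y. (weight x e c r y)\<^sup>2 \<partial>?\<mu>) \<le> W r" by (simp add: \<mu>.prob_space)
  qed
  obtain m0 where m0: "0 < m0" "\<And>x e. norm e = 1 \<Longrightarrow> axis_cone x e c R \<subseteq> M \<Longrightarrow>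
      m0 \<le> (\<integral>y. weight x e c R y \<partial>?\<mu>)"
    using weight_mass[OF R(2,3,1) M] by blast
  obtain CD where CD: "0 < CD" "\<And>\<epsilon>. 0 < \<epsilon> \<Longrightarrow> \<epsilon> < exp (- 1) \<Longrightarrow> \<epsilon> \<le> 2 * R \<Longrightarrow>
     \<exists>N. R \<le> \<epsilon> / 2 * 2 ^ N \<and> (\<Sum>k\<le>N. (2 ^ k) ^ (?d - 2)) \<le> CD / kappa ?d \<epsilon>"
    using dyadic_sum[OF R(1) dim] by blast
  define Z where "Z = (4 * Kb\<^sup>2)\<^sup>2 * (4 / R\<^sup>2) ^ (?d - 1) * (unit_ball_vol (real ?d) * (2 * R) ^ ?d / measure lborel M)"
  have Z: "0 \<le> Z" unfolding Z_def using R Kb by (intro mult_nonneg_nonneg divide_nonneg_nonneg zero_le_power) auto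
  have W: "0 \<le> W r" for r by (simp add: W_def)
  define A where "A = CP + 3 / m0\<^sup>2 * (2 * Z * CD + W R * CP)"
  define \<epsilon>0 where "\<epsilon>0 = min (exp (- 1)) (2 * R)"
  have A: "0 < A" unfolding A_def using CP(1) m0(1) Z W[of R] CD(1)
    by (intro add_pos_nonneg mult_nonneg_nonneg add_nonneg_nonneg) auto
  have "\<exists>A'\<ge>0. \<forall>g\<in>H1 M. L2_inner M g g \<le> A / kappa ?d \<epsilon> * dirichlet_form M g g
      + A' * (\<integral>y. indicator (ball x \<epsilon>) y * (g y)\<^sup>2 \<partial>?\<mu>)"
    if \<epsilon>: "0 < \<epsilon>" "\<epsilon> < \<epsilon>0" and x: "x \<in> M" for \<epsilon> x
  proof -
    obtain e where e: "norm e = 1" and cone: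
      "axis_cone x e c R \<subseteq> interior M"
      using cones[OF x] by blast
    define r where "r = \<epsilon> / 2"
    have r: "0 < r" "r \<le> R" using \<epsilon> by (auto simp: r_def \<epsilon>0_def)
    have \<epsilon>e: "\<epsilon> < exp (- 1)" "\<epsilon> \<le> 2 * R" using \<epsilon> by (auto simp: \<epsilon>0_def)
    obtain N where N: "R \<le> r * 2 ^ N" "(\<Sum>k\<le>N. (2 ^ k) ^ (?d - 2)) \<le> CD / kappa ?d \<epsilon>"
      using CD(2)[OF \<epsilon>(1) \<epsilon>e] unfolding r_def by blast
    have \<kappa>: "0 < kappa ?d \<epsilon>" "kappa ?d \<epsilon> \<le> 1" using kappa_bounds[OF \<epsilon>(1) \<epsilon>e(1)] by auto
    have cone_r: "{y. r / 2 \<le> (y - x) \<bullet> e \<and> (y - x) \<bullet> e \<le> R \<and> (norm (y - x))\<^sup>2 \<le> (1 + c\<^sup>2) * ((y - x) \<bullet> e)\<^sup>2} \<subseteq> interior M"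
      using cone r by auto
    define w v where "w = weight x e c r" and "v = weight x e c R"
    have wsq: "sq_integrable ?\<mu> w" "sq_integrable ?\<mu> v" using w_sq r R by (auto simp: w_def v_def)
    define mm where "mm = (\<integral>y. v y \<partial>?\<mu>)"
    have mm: "m0 \<le> mm" unfolding mm_def v_def by (rule m0(2)[OF e order_trans[OF cone interior_subset]])
    let ?A' = "3 / m0\<^sup>2 * W r"
    have "L2_inner M g g \<le> A / kappa ?d \<epsilon> * dirichlet_form M g g + ?A' * (\<integral>y. indicator (ball x \<epsilon>) y * (g y)\<^sup>2 \<partial>?\<mu>)"
      if g: "g \<in> H1 M" for g
    proof -
      define S E I a where "S = L2_inner M g g" and "E = dirichlet_form M g g"
        and "I = (\<integral>y. indicator (ball x \<epsilon>) y * (g y)\<^sup>2 \<partial>?\<mu>)" and "a = (\<integral>y. g y \<partial>?\<mu>)"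
      have gsq: "sq_integrable ?\<mu> g" using g by (simp add: H1_def L2_sq_integrable)
      have gL: "g \<in> L2 M" using g by (simp add: H1_def)
      have E: "(\<integral>y. (norm (weak_gradient M g y))\<^sup>2 \<partial>?\<mu>) = 2 * E"
        by (simp add: E_def dirichlet_form_def power2_norm_eq_inner)
      have E0: "0 \<le> E" using E Bochner_Integration.integral_nonneg[of ?\<mu> "\<lambda>y. (norm (weak_gradient M g y))\<^sup>2"] by simp
      have var: "S - a\<^sup>2 \<le> CP * E" unfolding S_def a_def E_def by (rule CP(2)[OF g])
      define p q s where "p = (\<integral>y. g y * w y \<partial>?\<mu>)" and "q = (\<integral>y. g y * v y \<partial>?\<mu>) - (\<integral>y. g y * w y \<partial>?\<mu>)"
        and "s = - (\<integral>y. (g y - a) * v y \<partial>?\<mu>)"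
      have "mm * a = p + q + s"
      proof -
        have "(\<integral>y. (g y - a) * v y \<partial>?\<mu>) = (\<integral>y. g y * v y \<partial>?\<mu>) - a * mm"
          using sq_integrable_mult[OF gsq wsq(2)] \<mu>.sq_integrable_integrable[OF wsq(2)] by (simp add: left_diff_distrib mm_def)
        then show ?thesis by (simp add: p_def q_def s_def)
      qed
      moreover have "(p + q + s)\<^sup>2 \<le> 3 * (p\<^sup>2 + q\<^sup>2 + s\<^sup>2)"
        using sum_squares_ge_zero[of "p - q" "q - s"] zero_le_power2[of "p - s"] by (simp add: power2_eq_square algebra_simps)
      moreover have "p\<^sup>2 \<le> W r * I"
      proof -
        have isq: "sq_integrable ?\<mu> (\<lambda>y. indicator (ball x \<epsilon>) y * g y)"
        proof -
          have gm: "g \<in> borel_measurable ?\<mu>" "integrable ?\<mu> (\<lambda>y. (g y)\<^sup>2)" using gsq by (auto simp: sq_integrable_def)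
          have b: "ball x \<epsilon> \<in> sets ?\<mu>" by (simp add: sets_normalized_volume)
          have "integrable ?\<mu> (\<lambda>y. indicator (ball x \<epsilon>) y *\<^sub>R (g y)\<^sup>2)" by (rule integrable_mult_indicator[OF b gm(2)])
          moreover have "(\<lambda>y. indicator (ball x \<epsilon>) y *\<^sub>R (g y)\<^sup>2) = (\<lambda>y. (indicator (ball x \<epsilon>) y * g y)\<^sup>2)"
            by (auto simp: fun_eq_iff indicator_def)
          ultimately show ?thesis
            using borel_measurable_times[OF borel_measurable_indicator[OF b] gm(1)] by (simp add: sq_integrable_def)
        qed
        have near: "w y \<noteq> 0 \<Longrightarrow> y \<in> ball x \<epsilon>" for y
        proof -
          assume "w y \<noteq> 0"
          from weight_support[OF R(2) r(1) this[unfolded w_def]]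
          have t: "r / 2 < (y - x) \<bullet> e" "(y - x) \<bullet> e < r" "(norm (y - x))\<^sup>2 < (1 + c\<^sup>2) * ((y - x) \<bullet> e)\<^sup>2" .
          have "(1 + c\<^sup>2) * ((y - x) \<bullet> e)\<^sup>2 \<le> 2 * r\<^sup>2"
            using t r R power_le_one[of c 2] by (intro mult_mono power_mono) auto
          moreover have "2 * r\<^sup>2 \<le> \<epsilon>\<^sup>2" by (simp add: r_def power_divide)
          ultimately have "(norm (y - x))\<^sup>2 < \<epsilon>\<^sup>2" using t(3) by linarith
          then have "norm (y - x) < \<epsilon>" by (rule power2_less_imp_less) (use \<epsilon>(1) in simp)
          then show "y \<in> ball x \<epsilon>" by (simp add: dist_norm norm_minus_commute)
        qed
        have "p = (\<integral>y. w y * (indicator (ball x \<epsilon>) y * g y) \<partial>?\<mu>)"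
          unfolding p_def by (rule Bochner_Integration.integral_cong) (use near in \<open>auto simp: indicator_def\<close>)
        then have "p\<^sup>2 \<le> (\<integral>y. (w y)\<^sup>2 \<partial>?\<mu>) * (\<integral>y. (indicator (ball x \<epsilon>) y * g y)\<^sup>2 \<partial>?\<mu>)"
          using cauchy_schwarz_integral[OF wsq(1) isq] by simp
        also have "(\<integral>y. (indicator (ball x \<epsilon>) y * g y)\<^sup>2 \<partial>?\<mu>) = I"
          unfolding I_def by (rule Bochner_Integration.integral_cong) (auto simp: indicator_def)
        also have "(\<integral>y. (w y)\<^sup>2 \<partial>?\<mu>) * I \<le> W r * I"
          using w_le[OF r(1), of x e] by (intro mult_right_mono) (auto simp: I_def w_def)
        finally show ?thesis .
      qed
      moreover have "q\<^sup>2 \<le> 2 * Z * CD / kappa ?d \<epsilon> * E"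
      proof -
        have "q\<^sup>2 = (p - (\<integral>y. g y * v y \<partial>?\<mu>))\<^sup>2" by (simp add: q_def p_def power2_commute)
        also have "\<dots> \<le> 2 * E * (Z * (\<Sum>k\<le>N. (2 ^ k) ^ (?d - 2)))"
          using weighted_means_difference[OF dim M R(2,3) r N(1) cone_r gL weak_gradient_is[OF g]]
          unfolding E p_def w_def v_def Z_def .
        also have "\<dots> \<le> 2 * E * (Z * (CD / kappa ?d \<epsilon>))" using N(2) Z E0 by (intro mult_left_mono) auto
        finally show ?thesis by (simp add: algebra_simps)
      qed
      moreover have "s\<^sup>2 \<le> W R * (CP * E)"
      proof -
        have gd: "sq_integrable ?\<mu> (\<lambda>y. g y - a)" by (intro sq_integrable_diff gsq \<mu>.sq_integrable_const)
        have "s\<^sup>2 \<le> (\<integral>y. (g y - a)\<^sup>2 \<partial>?\<mu>) * (\<integral>y. (v y)\<^sup>2 \<partial>?\<mu>)"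
          using cauchy_schwarz_integral[OF gd wsq(2)] by (simp add: s_def)
        also have "(\<integral>y. (g y - a)\<^sup>2 \<partial>?\<mu>) = S - a\<^sup>2"
        proof -
          have "(\<integral>y. (g y - a)\<^sup>2 \<partial>?\<mu>) = (\<integral>y. (g y)\<^sup>2 - 2 * a * g y + a\<^sup>2 \<partial>?\<mu>)"
            by (rule Bochner_Integration.integral_cong) (auto simp: power2_diff)
          also have "\<dots> = (\<integral>y. (g y)\<^sup>2 \<partial>?\<mu>) - 2 * a * a + a\<^sup>2"
            using gsq \<mu>.sq_integrable_integrable[OF gsq] by (simp add: sq_integrable_def a_def \<mu>.prob_space)
          finally show ?thesis by (simp add: S_def L2_inner_def power2_eq_square)
        qed
        also have "(S - a\<^sup>2) * (\<integral>y. (v y)\<^sup>2 \<partial>?\<mu>) \<le> (CP * E) * W R"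
          using var w_le[OF R(1), of x e] CP(1) E0 by (intro mult_mono) (auto simp: v_def)
        finally show ?thesis by (simp add: mult.commute)
      qed
      moreover have "m0\<^sup>2 * a\<^sup>2 \<le> (mm * a)\<^sup>2"
        using mm m0(1) by (simp add: power_mult_distrib mult_right_mono power_mono)
      ultimately have "m0\<^sup>2 * a\<^sup>2 \<le> 3 * (W r * I + 2 * Z * CD / kappa ?d \<epsilon> * E + W R * (CP * E))" by simp
      then have "a\<^sup>2 \<le> 3 * (W r * I + 2 * Z * CD / kappa ?d \<epsilon> * E + W R * (CP * E)) / m0\<^sup>2"
        using m0(1) by (simp add: le_divide_eq mult.commute)
      also have "\<dots> = ?A' * I + 3 / m0\<^sup>2 * (2 * Z * CD) / kappa ?d \<epsilon> * E + 3 / m0\<^sup>2 * (W R * CP) * E"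
        using m0(1) \<kappa> by (simp add: field_simps)
      finally have "S \<le> ?A' * I + 3 / m0\<^sup>2 * (2 * Z * CD) / kappa ?d \<epsilon> * E + (CP + 3 / m0\<^sup>2 * (W R * CP)) * E"
        using var by (simp add: distrib_right)
      moreover have "(CP + 3 / m0\<^sup>2 * (W R * CP)) * E \<le> (CP + 3 / m0\<^sup>2 * (W R * CP)) / kappa ?d \<epsilon> * E"
      proof (rule mult_right_mono[OF _ E0])
        have "0 \<le> CP + 3 / m0\<^sup>2 * (W R * CP)" using CP(1) W[of R] by (intro add_nonneg_nonneg mult_nonneg_nonneg) auto
        then show "CP + 3 / m0\<^sup>2 * (W R * CP) \<le> (CP + 3 / m0\<^sup>2 * (W R * CP)) / kappa ?d \<epsilon>"
          using \<kappa> mult_left_mono[OF \<kappa>(2), of "CP + 3 / m0\<^sup>2 * (W R * CP)"] by (simp add: le_divide_eq)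
      qed
      moreover have "3 / m0\<^sup>2 * (2 * Z * CD) / kappa ?d \<epsilon> * E + (CP + 3 / m0\<^sup>2 * (W R * CP)) / kappa ?d \<epsilon> * E = A / kappa ?d \<epsilon> * E"
        using m0(1) \<kappa>(1) by (simp add: A_def field_simps)
      ultimately show ?thesis unfolding S_def[symmetric] E_def[symmetric] I_def[symmetric] by linarith
    qed
    then show ?thesis using W[of r] by (intro exI[of _ ?A']) auto
  qed
  moreover have "0 < \<epsilon>0" "\<epsilon>0 \<le> exp (- 1)" using R(1) by (auto simp: \<epsilon>0_def)
  ultimately show ?thesis using A that by blast
qed

section \<open>Hitting small balls\<close>

context reflected_process
begin

lemma markov_nn_integral:
  assumes z: "z \<in> M" and s: "0 \<le> s" and h: "0 \<le> h" and A: "A \<in> past N X s" and u: "u \<in> borel_measurable borel"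
  shows "(\<integral>\<^sup>+\<omega>. indicator A \<omega> * u (X (s + h) \<omega>) \<partial>P z) = (\<integral>\<^sup>+\<omega>. indicator A \<omega> * (\<integral>\<^sup>+y. u y \<partial>kernel h (X s \<omega>)) \<partial>P z)"
proof -
  have AP: "A \<in> sets (P z)" using past_sets[OF A] P_sets[OF z] by simp
  have iA: "indicator A \<in> borel_measurable (P z)" using AP by simp
  have sh: "0 \<le> s + h" using s h by simp
  note Xm = X_measurable_P[OF z]
  let ?Q = "density (P z) (indicator A)"
  have Xq: "X t \<in> borel_measurable ?Q" if "0 \<le> t" for t using Xm[OF that] by simp
  let ?D = "distr ?Q borel (X s)"
  have km: "kernel h \<in> ?D \<rightarrow>\<^sub>M subprob_algebra borel" using kernel_measurable[OF h] by (simp add: measurable_distr_eq1)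
  have eq: "distr ?Q borel (X (s + h)) = ?D \<bind> kernel h"
  proof (rule measure_eqI)
    have sb: "sets (?D \<bind> kernel h) = sets borel" by (rule sets_bind[OF sets_kernel]) simp
    then show "sets (distr ?Q borel (X (s + h))) = sets (?D \<bind> kernel h)" by simp
    fix B assume "B \<in> sets (distr ?Q borel (X (s + h)))"
    then have B: "B \<in> sets borel" by simp
    have Xsh: "X (s + h) -` B \<inter> space (P z) \<in> sets (P z)" by (rule measurable_sets[OF Xm[OF sh] B])
    have em: "(\<lambda>y. emeasure (kernel h y) B) \<in> borel_measurable borel"
      by (rule measurable_compose[OF kernel_measurable[OF h] measurable_emeasure_subprob_algebra[OF B]])
    have "emeasure (distr ?Q borel (X (s + h))) B = emeasure ?Q (X (s + h) -` B \<inter> space (P z))"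
      using B Xq[OF sh] by (simp add: emeasure_distr)
    also have "\<dots> = (\<integral>\<^sup>+\<omega>. indicator {\<omega> \<in> A. X (s + h) \<omega> \<in> B} \<omega> \<partial>P z)"
      unfolding emeasure_density[OF iA Xsh] by (intro nn_integral_cong) (auto simp: indicator_def)
    also have "\<dots> = emeasure (P z) {\<omega> \<in> A. X (s + h) \<omega> \<in> B}"
    proof (rule nn_integral_indicator)
      have "{\<omega> \<in> A. X (s + h) \<omega> \<in> B} = A \<inter> (X (s + h) -` B \<inter> space (P z))"
        using sets.sets_into_space[OF AP] by blast
      then show "{\<omega> \<in> A. X (s + h) \<omega> \<in> B} \<in> sets (P z)" using AP Xsh by simp
    qed
    also have "\<dots> = (\<integral>\<^sup>+\<omega>. indicator A \<omega> * emeasure (kernel h (X s \<omega>)) B \<partial>P z)"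
      by (rule markov_emeasure[OF z s h A B])
    also have "\<dots> = (\<integral>\<^sup>+\<omega>. emeasure (kernel h (X s \<omega>)) B \<partial>?Q)"
      by (rule nn_integral_density[OF iA, symmetric]) (rule measurable_compose[OF Xm[OF s] em])
    also have "\<dots> = (\<integral>\<^sup>+y. emeasure (kernel h y) B \<partial>?D)"
      by (rule nn_integral_distr[OF Xq[OF s], symmetric]) (use em in simp)
    also have "\<dots> = emeasure (?D \<bind> kernel h) B" by (rule emeasure_bind[OF _ km B, symmetric]) simp
    finally show "emeasure (distr ?Q borel (X (s + h))) B = emeasure (?D \<bind> kernel h) B" .
  qed
  have um: "(\<lambda>y. \<integral>\<^sup>+w. u w \<partial>kernel h y) \<in> borel_measurable borel"
    by (rule measurable_compose[OF kernel_measurable[OF h] nn_integral_measurable_subprob_algebra[OF u]])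
  have "(\<integral>\<^sup>+\<omega>. indicator A \<omega> * u (X (s + h) \<omega>) \<partial>P z) = (\<integral>\<^sup>+\<omega>. u (X (s + h) \<omega>) \<partial>?Q)"
    by (rule nn_integral_density[OF iA, symmetric]) (rule measurable_compose[OF Xm[OF sh] u])
  also have "\<dots> = (\<integral>\<^sup>+y. u y \<partial>distr ?Q borel (X (s + h)))"
    by (rule nn_integral_distr[OF Xq[OF sh], symmetric]) (use u in simp)
  also have "\<dots> = (\<integral>\<^sup>+y. \<integral>\<^sup>+w. u w \<partial>kernel h y \<partial>?D)" unfolding eq by (rule nn_integral_bind[OF u km])
  also have "\<dots> = (\<integral>\<^sup>+\<omega>. (\<integral>\<^sup>+w. u w \<partial>kernel h (X s \<omega>)) \<partial>?Q)"
    by (rule nn_integral_distr[OF Xq[OF s]]) (use um in simp)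
  also have "\<dots> = (\<integral>\<^sup>+\<omega>. indicator A \<omega> * (\<integral>\<^sup>+y. u y \<partial>kernel h (X s \<omega>)) \<partial>P z)"
    by (rule nn_integral_density[OF iA]) (rule measurable_compose[OF Xm[OF s] um])
  finally show ?thesis .
qed

lemma avoid_borel: "B \<in> sets borel \<Longrightarrow> 0 \<le> h \<Longrightarrow> avoid B h n \<in> borel_measurable borel"
  and avoid_range: "B \<in> sets borel \<Longrightarrow> 0 \<le> h \<Longrightarrow> 0 \<le> avoid B h n x \<and> avoid B h n x \<le> 1"
  using avoid_props[of B h n] by (auto simp: sets_normalized_volume space_normalized_volume measurable_normalized_volume)

lemma avoid_probability:
  assumes z: "z \<in> M" and B: "B \<in> sets borel" and h: "0 \<le> h"
  shows "0 \<le> s \<Longrightarrow> A \<in> past N X s \<Longrightarrow> (\<integral>\<^sup>+\<omega>. indicator A \<omega> * ennreal (avoid B h n (X s \<omega>)) \<partial>P z)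
     = emeasure (P z) {\<omega> \<in> A. \<forall>k\<le>n. X (s + real k * h) \<omega> \<notin> B}"
proof (induction n arbitrary: s A)
  case 0
  have CB: "- B \<in> sets borel" using B by (simp add: borel_comp)
  have "(\<integral>\<^sup>+\<omega>. indicator A \<omega> * ennreal (avoid B h 0 (X s \<omega>)) \<partial>P z) = (\<integral>\<^sup>+\<omega>. indicator {\<omega> \<in> A. X s \<omega> \<in> - B} \<omega> \<partial>P z)"
    by (intro nn_integral_cong) (auto simp: indicator_def)
  also have "\<dots> = emeasure (P z) {\<omega> \<in> A. X s \<omega> \<in> - B}"
    using past_sets[OF past_event[OF 0(2,1) CB]] by (intro nn_integral_indicator) (simp add: P_sets[OF z])
  finally show ?case by simp
next
  case (Suc n)
  have CB: "- B \<in> sets borel" using B by (simp add: borel_comp)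
  let ?A = "{\<omega> \<in> A. X s \<omega> \<in> - B}"
  have A': "?A \<in> past N X s" by (rule past_event[OF Suc.prems(2,1) CB])
  have sh: "0 \<le> s + h" using Suc.prems h by simp
  have bm: "avoid B h n \<in> borel_measurable (kernel h y)" for y
    using avoid_borel[OF B h] measurable_cong_sets[OF sets_kernel refl] by blast
  have q: "ennreal (Q h (avoid B h n) y) = (\<integral>\<^sup>+w. ennreal (avoid B h n w) \<partial>kernel h y)" for y
  proof -
    interpret K: prob_space "kernel h y" by (rule kernel_prob[OF h])
    have "integrable (kernel h y) (avoid B h n)"
      by (rule K.integrable_const_bound[OF _ bm, of 1]) (use avoid_range[OF B h] in simp)
    then show ?thesis unfolding Q_def using avoid_range[OF B h] by (intro nn_integral_eq_integral[symmetric]) auto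
  qed
  have "(\<integral>\<^sup>+\<omega>. indicator A \<omega> * ennreal (avoid B h (Suc n) (X s \<omega>)) \<partial>P z)
      = (\<integral>\<^sup>+\<omega>. indicator ?A \<omega> * (\<integral>\<^sup>+w. ennreal (avoid B h n w) \<partial>kernel h (X s \<omega>)) \<partial>P z)"
    unfolding q[symmetric] by (intro nn_integral_cong) (auto simp: indicator_def)
  also have "\<dots> = (\<integral>\<^sup>+\<omega>. indicator ?A \<omega> * ennreal (avoid B h n (X (s + h) \<omega>)) \<partial>P z)"
    using avoid_borel[OF B h] by (intro markov_nn_integral[symmetric, OF z Suc.prems(1) h A']) simp
  also have "\<dots> = emeasure (P z) {\<omega> \<in> ?A. \<forall>k\<le>n. X (s + h + real k * h) \<omega> \<notin> B}"
    using h by (intro Suc.IH[OF sh past_mono[OF A']]) simp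
  also have "{\<omega> \<in> ?A. \<forall>k\<le>n. X (s + h + real k * h) \<omega> \<notin> B} = {\<omega> \<in> A. \<forall>k\<le>Suc n. X (s + real k * h) \<omega> \<notin> B}"
  proof -
    have shift: "s + real (Suc k) * h = s + h + real k * h" for k by (simp add: algebra_simps)
    have "(\<forall>k\<le>Suc n. X (s + real k * h) \<omega> \<notin> B) \<longleftrightarrow> X s \<omega> \<notin> B \<and> (\<forall>k\<le>n. X (s + h + real k * h) \<omega> \<notin> B)" for \<omega>
      unfolding shift[symmetric] less_Suc_eq_le[symmetric] by (subst All_less_Suc2) simp
    then show ?thesis by (simp add: conj_assoc)
  qed
  finally show ?case .
qed

text \<open>At time \<open>s\<close> the law of the process is bounded by \<open>a\<close> times the invariant measure; from then on the
  process is observed in steps of length \<open>h\<close>, which is chosen small in terms of \<open>A'\<close>. The decay of the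
  squared \<open>L\<^sup>2\<close> norm at rate \<open>1 / A\<close> gives the rate \<open>1 / (2 * A)\<close> for the mean.\<close>

lemma miss_probability:
  assumes z: "z \<in> M" and B: "B \<in> sets borel" and s: "0 < s" and T: "2 * s \<le> T"
    and dens: "\<And>C. C \<in> sets borel \<Longrightarrow> emeasure (P z) {\<omega> \<in> space N. X s \<omega> \<in> C} \<le> ennreal a * emeasure \<mu> C" and a: "0 \<le> a"
    and A: "0 < A" "0 \<le> A'"
    and poincare: "\<And>g. g \<in> H1 M \<Longrightarrow> L2_inner M g g \<le> A * dirichlet_form M g g + A' * (\<integral>y. indicator B y * (g y)\<^sup>2 \<partial>\<mu>)"
  obtains E where "E \<in> sets N" "\<And>\<omega>. \<omega> \<in> space N \<Longrightarrow> \<omega> \<notin> E \<Longrightarrow> \<exists>t\<in>{0..T}. X t \<omega> \<in> B"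
    "emeasure (P z) E \<le> ennreal (a * exp (- (T - 2 * s) / (2 * A)))"
proof -
  define h where "h = min s (A / (2 * (1 + A')))"
  have h: "0 < h" "h \<le> s" using s A by (auto simp: h_def)
  have "h \<le> A / (2 * (1 + A'))" by (simp add: h_def)
  then have hA: "2 * h * (1 + A') \<le> A" using A by (simp add: field_simps)
  define n where "n = nat \<lfloor>(T - s) / h\<rfloor>"
  have "0 \<le> (T - s) / h" using T s h by simp
  then have n: "real n \<le> (T - s) / h" "(T - s) / h < real n + 1" unfolding n_def by linarith+
  have nT: "real n * h \<le> T - s" "T - s < real n * h + h" using n h by (auto simp: field_simps)
  have h0: "0 \<le> h" using h by simp
  let ?E = "{\<omega> \<in> space N. \<forall>k\<le>n. X (s + real k * h) \<omega> \<notin> B}"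
  let ?v = "avoid B h n"
  have B\<mu>: "B \<in> sets \<mu>" using B by (simp add: sets_normalized_volume)
  have sets: "?E \<in> sets N"
  proof -
    have "X (s + real k * h) -` (- B) \<inter> space N \<in> sets N" for k
      using s h0 B by (intro measurable_sets[OF X_measurable]) (auto simp: borel_comp)
    then have "(\<Inter>k\<in>{..n}. X (s + real k * h) -` (- B) \<inter> space N) \<in> sets N" by (intro sets.finite_INT) auto
    also have "(\<Inter>k\<in>{..n}. X (s + real k * h) -` (- B) \<inter> space N) = ?E" by auto
    finally show ?thesis .
  qed
  have hit: "\<exists>t\<in>{0..T}. X t \<omega> \<in> B" if "\<omega> \<in> space N" "\<omega> \<notin> ?E" for \<omega>
  proof -
    from that obtain k where k: "k \<le> n" "X (s + real k * h) \<omega> \<in> B" by auto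
    have "real k * h \<le> real n * h" using k(1) h0 by (intro mult_right_mono) auto
    then have "s + real k * h \<in> {0..T}" using nT(1) s h0 by auto
    then show ?thesis by (rule bexI[where x = "s + real k * h", rotated]) (rule k(2))
  qed
  have vm: "?v \<in> borel_measurable borel" by (rule avoid_borel[OF B h0])
  have vsq: "sq_integrable \<mu> ?v" by (rule avoid_sq[OF B\<mu> h0])
  let ?D = "distr (P z) borel (X s)"
  have s0: "0 \<le> s" using s by simp
  have "emeasure (P z) ?E = (\<integral>\<^sup>+\<omega>. indicator (space N) \<omega> * ennreal (?v (X s \<omega>)) \<partial>P z)"
    by (rule avoid_probability[OF z B h0 s0 past_space, symmetric])
  also have "\<dots> = (\<integral>\<^sup>+\<omega>. ennreal (?v (X s \<omega>)) \<partial>P z)"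
    by (intro nn_integral_cong) (simp add: P_space[OF z])
  also have "\<dots> = (\<integral>\<^sup>+y. ennreal (?v y) \<partial>?D)"
    by (rule nn_integral_distr[OF X_measurable_P[OF z s0], symmetric]) (use vm in simp)
  also have "\<dots> \<le> (\<integral>\<^sup>+y. ennreal (?v y) \<partial>density \<mu> (\<lambda>_. ennreal a))"
  proof (rule nn_integral_mono_measure)
    show "?D \<le> density \<mu> (\<lambda>_. ennreal a)"
    proof (subst le_measure)
      show "sets ?D = sets (density \<mu> (\<lambda>_. ennreal a))" by (simp add: sets_normalized_volume)
      show "\<forall>C\<in>sets ?D. emeasure ?D C \<le> emeasure (density \<mu> (\<lambda>_. ennreal a)) C"
      proof
        fix C assume "C \<in> sets ?D"
        then have C: "C \<in> sets borel" by simp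
        have "emeasure ?D C = emeasure (P z) {\<omega> \<in> space N. X s \<omega> \<in> C}"
          using emeasure_kernel[OF z s0 C] z by (simp add: kernel_def)
        also have "\<dots> \<le> ennreal a * emeasure \<mu> C" by (rule dens[OF C])
        also have "\<dots> = emeasure (density \<mu> (\<lambda>_. ennreal a)) C"
          using C by (simp add: emeasure_density_const sets_normalized_volume)
        finally show "emeasure ?D C \<le> emeasure (density \<mu> (\<lambda>_. ennreal a)) C" .
      qed
    qed
  qed (simp add: sets_normalized_volume)
  also have "\<dots> = ennreal a * (\<integral>\<^sup>+y. ennreal (?v y) \<partial>\<mu>)"
    using sq_measurable[OF vsq] by (simp add: nn_integral_density nn_integral_cmult)
  also have "(\<integral>\<^sup>+y. ennreal (?v y) \<partial>\<mu>) = ennreal (\<integral>y. ?v y \<partial>\<mu>)"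
    using sq_integrable_integrable[OF vsq] avoid_range[OF B h0] by (intro nn_integral_eq_integral) auto
  also have "ennreal a * ennreal (\<integral>y. ?v y \<partial>\<mu>) = ennreal (a * (\<integral>y. ?v y \<partial>\<mu>))"
    using a avoid_range[OF B h0] by (intro ennreal_mult[symmetric]) auto
  also have "\<dots> \<le> ennreal (a * exp (- (T - 2 * s) / (2 * A)))"
  proof (intro ennreal_leI mult_left_mono a)
    have "inner ?v ?v \<le> exp (- (h / A) * real n)"
    proof (rule avoid_decay[OF B\<mu> h(1) A hA])
      fix g E assume g: "sq_integrable \<mu> g" and le: "\<And>t. 0 < t \<Longrightarrow> drop g t \<le> t * E"
      have "L2_inner M g g \<le> A * dirichlet_form M g g + A' * (\<integral>y. indicator B y * (g y)\<^sup>2 \<partial>\<mu>)"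
        by (rule poincare[OF energy_le_drop(1)[OF g le]])
      also have "\<dots> \<le> A * E + A' * (\<integral>y. indicator B y * (g y)\<^sup>2 \<partial>\<mu>)"
        using energy_le_drop(2)[OF g le] A(1) by (intro add_right_mono mult_left_mono) auto
      finally show "inner g g \<le> A * E + A' * (\<integral>x. indicator B x * (g x)\<^sup>2 \<partial>\<mu>)" by (simp add: inner_L2)
    qed
    also have "\<dots> \<le> exp (- (T - 2 * s) / A)"
    proof -
      have "T - 2 * s \<le> h * real n" using nT(2) h(2) by (simp add: mult.commute)
      then have "(T - 2 * s) / A \<le> h * real n / A" using A(1) by (intro divide_right_mono) auto
      moreover have "- (h / A) * real n = - (h * real n / A)" "- (T - 2 * s) / A = - ((T - 2 * s) / A)"
        by (simp, rule minus_divide_left[symmetric])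
      ultimately show ?thesis unfolding exp_le_cancel_iff by linarith
    qed
    also have "\<dots> = (exp (- (T - 2 * s) / (2 * A)))\<^sup>2"
      using A(1) by (simp add: power2_eq_square exp_add[symmetric] field_simps)
    finally have "nrm ?v \<le> exp (- (T - 2 * s) / (2 * A))"
      unfolding nrm_def by (intro real_le_lsqrt) simp_all
    moreover have "(\<integral>y. ?v y \<partial>\<mu>) \<le> nrm ?v"
      using inner_le_nrm[OF vsq sq_integrable_const[of 1]] by (simp add: nrm_def[of "\<lambda>_. 1"] inner_def[of _ "\<lambda>_. 1"] prob_space)
    ultimately show "(\<integral>y. ?v y \<partial>\<mu>) \<le> exp (- (T - 2 * s) / (2 * A))" by simp
  qed
  finally show ?thesis by (intro that[of ?E] sets hit)
qed

end

section \<open>Covering numbers and intrinsic balls\<close>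

lemma dist_le_curve_length: "ennreal (dist (\<gamma> 0) (\<gamma> 1)) \<le> curve_length \<gamma>"
proof -
  have "ennreal (\<Sum>i<length [0, 1 :: real] - 1. dist (\<gamma> ([0, 1] ! i)) (\<gamma> ([0, 1] ! Suc i))) \<le> curve_length \<gamma>"
    unfolding curve_length_def by (rule SUP_upper) auto
  then show ?thesis by simp
qed

lemma intrinsic_ball_subset: "intrinsic_ball M x \<epsilon> \<subseteq> ball x \<epsilon>"
proof
  fix y assume "y \<in> intrinsic_ball M x \<epsilon>"
  then obtain \<gamma> where "pathstart \<gamma> = x" "pathfinish \<gamma> = y" "curve_length \<gamma> < ennreal \<epsilon>"
    unfolding intrinsic_ball_def intrinsic_dist_def by (auto simp: Inf_less_iff)
  then have "ennreal (dist x y) < ennreal \<epsilon>"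
    using dist_le_curve_length[of \<gamma>] by (simp add: pathstart_def pathfinish_def)
  then show "y \<in> ball x \<epsilon>" by (simp add: ennreal_less_iff)
qed

lemma covering_number_attained:
  fixes M :: "'a::metric_space set"
  assumes M: "compact M" and c: "0 < c" "0 < \<rho>" and \<epsilon>: "0 < \<epsilon>"
    and intrinsic: "\<And>x y. x \<in> M \<Longrightarrow> y \<in> M \<Longrightarrow> dist x y < \<rho> \<Longrightarrow> intrinsic_dist M x y \<le> ennreal (c * dist x y)"
  obtains x :: "nat \<Rightarrow> 'a" where "\<And>i. i < covering_number M \<epsilon> \<Longrightarrow> x i \<in> M"
    "M \<subseteq> (\<Union>i<covering_number M \<epsilon>. intrinsic_ball M (x i) \<epsilon>)"
proof -
  define \<delta> where "\<delta> = min \<rho> (\<epsilon> / c)"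
  have \<delta>: "0 < \<delta>" using c \<epsilon> by (simp add: \<delta>_def)
  have small: "M \<inter> ball x \<delta> \<subseteq> intrinsic_ball M x \<epsilon>" if "x \<in> M" for x
  proof
    fix y assume y: "y \<in> M \<inter> ball x \<delta>"
    have "dist x y < \<rho>" "dist x y < \<epsilon> / c" using y by (auto simp: \<delta>_def)
    then have "c * dist x y < \<epsilon>" using c by (simp add: less_divide_eq mult.commute)
    then have "ennreal (c * dist x y) < ennreal \<epsilon>" using c by (intro ennreal_lessI) (auto intro: le_less_trans[of 0 "c * dist x y"])
    moreover have "intrinsic_dist M x y \<le> ennreal (c * dist x y)" using y that \<open>dist x y < \<rho>\<close> by (intro intrinsic) auto
    ultimately show "y \<in> intrinsic_ball M x \<epsilon>" using y by (auto simp: intrinsic_ball_def)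
  qed
  obtain F where F: "F \<subseteq> M" "finite F" "M \<subseteq> (\<Union>x\<in>F. ball x \<delta>)"
    using compactE_image[OF M, of M "\<lambda>x. ball x \<delta>"] \<delta> by (metis (no_types, lifting) UN_I centre_in_ball open_ball subsetI)
  obtain n and f :: "nat \<Rightarrow> 'a" where f: "F = f ` {i. i < n}"
    using finite_imp_nat_seg_image_inj_on[OF F(2)] by auto
  have "\<exists>x. (\<forall>i<n. x i \<in> M) \<and> M \<subseteq> (\<Union>i<n. intrinsic_ball M (x i) \<epsilon>)"
  proof (intro exI[of _ f] conjI subsetI)
    show "\<forall>i<n. f i \<in> M" using F(1) f by auto
    fix y assume y: "y \<in> M"
    then obtain x where "x \<in> F" "y \<in> ball x \<delta>" using F(3) by blast
    then obtain i where i: "i < n" "y \<in> ball (f i) \<delta>" using f by auto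
    have "f i \<in> M" using i(1) F(1) f by auto
    then have "y \<in> intrinsic_ball M (f i) \<epsilon>" using subsetD[OF small] i(2) y by blast
    then show "y \<in> (\<Union>i<n. intrinsic_ball M (f i) \<epsilon>)" using i(1) by blast
  qed
  from LeastI[where P = "\<lambda>n. \<exists>x. (\<forall>i<n. x i \<in> M) \<and> M \<subseteq> (\<Union>i<n. intrinsic_ball M (x i) \<epsilon>)", OF this]
  show ?thesis unfolding covering_number_def[symmetric] using that by auto
qed

text \<open>One intrinsic ball of small radius has too little volume to cover \<open>M\<close>. A constant
  factor in front of the number of balls is then absorbed by a multiple of its logarithm.\<close>

lemma two_le_covering_number:
  fixes M :: "(real^'n) set" and x :: "nat \<Rightarrow> real^'n"
  assumes M: "M \<in> sets borel" "emeasure lborel M \<noteq> 0" "emeasure lborel M \<noteq> \<infinity>"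
    and cover: "\<And>i. i < n \<Longrightarrow> x i \<in> M" "M \<subseteq> (\<Union>i<n. intrinsic_ball M (x i) \<epsilon>)"
    and small: "\<And>x. x \<in> M \<Longrightarrow> measure (normalized_volume M) (intrinsic_ball M x \<epsilon>) < 1"
  shows "2 \<le> n"
proof (rule ccontr)
  assume "\<not> 2 \<le> n"
  then consider "n = 0" | "n = 1" by linarith
  then show False
  proof cases
    case 1
    then show ?thesis using cover M by auto
  next
    case 2
    then have "intrinsic_ball M (x 0) \<epsilon> = M" using cover by (auto simp: intrinsic_ball_def)
    moreover have "measure (normalized_volume M) M = 1"
    proof -
      have "emeasure (normalized_volume M) M = 1"
        unfolding normalized_volume_def using M by (subst emeasure_uniform_measure) (auto simp: less_top intro!: ennreal_divide_self)
      then show ?thesis by (simp add: measure_def)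
    qed
    ultimately show ?thesis using small[of "x 0"] cover(1)[of 0] 2 by simp
  qed
qed

text \<open>The positive lower bound makes the intrinsic ball measurable, as the measure of other sets is \<open>0\<close>.\<close>

lemma volume_in_balls:
  fixes M :: "(real^'n) set"
  assumes M: "M \<in> sets borel" "emeasure lborel M \<noteq> 0" "emeasure lborel M \<noteq> \<infinity>"
    and v: "0 < v" "v \<le> measure (normalized_volume M) (intrinsic_ball M x \<epsilon>)"
  shows "v * measure lborel M \<le> measure lborel (M \<inter> cball x \<epsilon>)"
proof -
  let ?\<mu> = "normalized_volume M"
  interpret \<mu>: prob_space ?\<mu>
    by (rule prob_space_normalized_volume[OF M(2,3)])
  have "intrinsic_ball M x \<epsilon> \<in> sets ?\<mu>" using v measure_notin_sets[of "intrinsic_ball M x \<epsilon>" ?\<mu>] by fastforce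
  then have "measure ?\<mu> (intrinsic_ball M x \<epsilon>) \<le> measure ?\<mu> (cball x \<epsilon>)"
    using intrinsic_ball_subset[of M x \<epsilon>] by (intro \<mu>.finite_measure_mono) (auto simp: sets_normalized_volume)
  also have "\<dots> = measure lborel (M \<inter> cball x \<epsilon>) / measure lborel M"
    unfolding normalized_volume_def using M by (intro measure_uniform_measure) auto
  finally have "v \<le> measure lborel (M \<inter> cball x \<epsilon>) / measure lborel M" using v by simp
  then show ?thesis using measure_lborel_pos[OF M(2,3)] by (simp add: le_divide_eq)
qed

lemma positive_reach_unique_nearest:
  assumes "0 < reach M"
  obtains \<rho> where "0 < \<rho>" "\<And>z. 0 < infdist z M \<Longrightarrow> infdist z M < \<rho> \<Longrightarrow> \<exists>!y. y \<in> M \<and> dist z y = infdist z M"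
proof -
  from assms obtain r where "0 < ereal r" "\<forall>z. 0 < infdist z M \<and> infdist z M < r \<longrightarrow> (\<exists>!y. y \<in> M \<and> dist z y = infdist z M)"
    unfolding reach_def less_Sup_iff by auto
  then show ?thesis using that by auto
qed

section \<open>Measurability of diagram events\<close>

context reflected_process
begin

lemma meets_open_measurable:
  assumes "open S" shows "{\<omega> \<in> space N. \<exists>t\<in>{0..T}. X t \<omega> \<in> S} \<in> sets N"
proof -
  have meas: "{\<omega> \<in> space N. X q \<omega> \<in> S} \<in> sets N" if "0 \<le> q" for q
  proof -
    have "X q -` S \<inter> space N \<in> sets N" using assms by (intro measurable_sets[OF X_measurable[OF that]]) simp
    also have "X q -` S \<inter> space N = {\<omega> \<in> space N. X q \<omega> \<in> S}" by auto
    finally show ?thesis .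
  qed
  have rational: "\<exists>q\<in>\<rat> \<inter> {0..T}. X q \<omega> \<in> S" if \<omega>: "\<omega> \<in> space N" and t: "t \<in> {0..T}" "X t \<omega> \<in> S" for \<omega> t
  proof (cases "t = 0")
    case True
    then show ?thesis using t by (intro bexI[of _ 0]) auto
  next
    case False
    then have t0: "0 < t" using t by simp
    obtain e where e: "0 < e" "ball (X t \<omega>) e \<subseteq> S" using assms t(2) open_contains_ball by blast
    have "t \<in> {0..}" using t by simp
    from X_continuous[OF \<omega>, unfolded continuous_on_iff, rule_format, OF this e(1)]
    obtain d where d: "0 < d" "\<And>s. s \<in> {0..} \<Longrightarrow> dist s t < d \<Longrightarrow> dist (X s \<omega>) (X t \<omega>) < e" by auto
    obtain q where q: "q \<in> \<rat>" "max 0 (t - d) < q" "q < t" using Rats_dense_in_real[of "max 0 (t - d)" t] t0 d(1) by auto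
    have "dist (X q \<omega>) (X t \<omega>) < e" using q d(2)[of q] by (auto simp: dist_real_def)
    then have "X q \<omega> \<in> S" using e(2) by (auto simp: dist_commute)
    then show ?thesis using q t by (intro bexI[of _ q]) auto
  qed
  have "(\<Union>q\<in>\<rat> \<inter> {0..T}. {\<omega> \<in> space N. X q \<omega> \<in> S}) \<in> sets N"
    using meas by (intro sets.countable_UN'') (auto intro: countable_subset[OF _ countable_rat])
  also have "(\<Union>q\<in>\<rat> \<inter> {0..T}. {\<omega> \<in> space N. X q \<omega> \<in> S}) = {\<omega> \<in> space N. \<exists>t\<in>{0..T}. X t \<omega> \<in> S}"
  proof (intro equalityI subsetI)
    fix \<omega> assume "\<omega> \<in> {\<omega> \<in> space N. \<exists>t\<in>{0..T}. X t \<omega> \<in> S}"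
    then obtain t where t: "\<omega> \<in> space N" "t \<in> {0..T}" "X t \<omega> \<in> S" by auto
    from rational[OF this] t(1) show "\<omega> \<in> (\<Union>q\<in>\<rat> \<inter> {0..T}. {\<omega> \<in> space N. X q \<omega> \<in> S})" by auto
  qed auto
  finally show ?thesis .
qed

lemma stays_closed_measurable:
  assumes "closed S" shows "{\<omega> \<in> space N. \<forall>t\<in>{0..T}. X t \<omega> \<in> S} \<in> sets N"
proof -
  have "space N - {\<omega> \<in> space N. \<exists>t\<in>{0..T}. X t \<omega> \<in> - S} \<in> sets N"
    using assms by (intro sets.compl_sets meets_open_measurable) (simp add: open_Compl)
  also have "space N - {\<omega> \<in> space N. \<exists>t\<in>{0..T}. X t \<omega> \<in> - S} = {\<omega> \<in> space N. \<forall>t\<in>{0..T}. X t \<omega> \<in> S}" by auto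
  finally show ?thesis .
qed

end

definition close_sets :: "real \<Rightarrow> 'a::metric_space set \<Rightarrow> 'a set \<Rightarrow> bool" where
  "close_sets \<eta> A B \<longleftrightarrow> (\<forall>x\<in>A. \<exists>y\<in>B. dist x y \<le> \<eta>) \<and> (\<forall>y\<in>B. \<exists>x\<in>A. dist y x \<le> \<eta>)"

lemma close_sets_trans:
  assumes "close_sets \<eta> A B" "close_sets \<eta>' B D" shows "close_sets (\<eta> + \<eta>') A D"
  unfolding close_sets_def
proof (intro conjI ballI)
  fix x assume "x \<in> A"
  then obtain y where y: "y \<in> B" "dist x y \<le> \<eta>" using assms(1) unfolding close_sets_def by blast
  then obtain w where w: "w \<in> D" "dist y w \<le> \<eta>'" using assms(2) unfolding close_sets_def by blast
  then show "\<exists>w\<in>D. dist x w \<le> \<eta> + \<eta>'" using y dist_triangle[of x w y] by (intro bexI[OF _ w(1)]) linarith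
next
  fix w assume "w \<in> D"
  then obtain y where y: "y \<in> B" "dist w y \<le> \<eta>'" using assms(2) unfolding close_sets_def by blast
  then obtain x where x: "x \<in> A" "dist y x \<le> \<eta>" using assms(1) unfolding close_sets_def by blast
  then show "\<exists>x\<in>A. dist w x \<le> \<eta> + \<eta>'" using y dist_triangle[of w x y] by (intro bexI[OF _ x(1)]) linarith
qed

lemma close_sets_matching:
  fixes K L :: "'a::euclidean_space set"
  assumes "compact K" "K \<noteq> {}" "compact L" "L \<noteq> {}" "0 \<le> \<eta>" and close: "close_sets \<eta> K L"
  shows "diagram_matching \<eta> (persistence_diagram k q K) (persistence_diagram k q L)"
proof (rule diagram_matching_offsets[OF assms(1-5)])
  show "infdist x L \<le> \<eta>" if x: "x \<in> K" for x
  proof -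
    obtain y where "y \<in> L" "dist x y \<le> \<eta>" using close x unfolding close_sets_def by blast
    then show ?thesis by (rule infdist_le2)
  qed
  show "infdist x K \<le> \<eta>" if x: "x \<in> L" for x
  proof -
    obtain y where "y \<in> K" "dist x y \<le> \<eta>" using close x unfolding close_sets_def by blast
    then show ?thesis by (rule infdist_le2)
  qed
qed

context reflected_process
begin

lemma trace_compact:
  assumes "\<omega> \<in> space N" "0 \<le> T"
  shows "compact ((\<lambda>t. X t \<omega>) ` {0..T})" "(\<lambda>t. X t \<omega>) ` {0..T} \<noteq> {}"
  using assms by (auto intro!: compact_continuous_image continuous_on_subset[OF X_continuous])

text \<open>The trace satisfies the bound iff at every tolerance it is close to a finite subset of a countable
  dense set that is in turn close to some compact set satisfying the bound: by stability the bound then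
  holds up to twice the tolerance. For a fixed finite set the closeness is an event, because it can
  be checked at rational times.\<close>

lemma diagram_event_measurable:
  assumes T: "0 \<le> T"
  shows "{\<omega> \<in> space N. \<forall>q. bottleneck_dist (persistence_diagram TYPE('k::field) q ((\<lambda>t. X t \<omega>) ` {0..T})) (D q) \<le> ereal c} \<in> sets N"
proof -
  define good where "good L \<longleftrightarrow> compact L \<and> L \<noteq> {} \<and> (\<forall>q. bottleneck_dist (persistence_diagram TYPE('k) q L) (D q) \<le> ereal c)"
    for L :: "(real^'n) set"
  define \<Gamma> where "\<Gamma> \<omega> = (\<lambda>t. X t \<omega>) ` {0..T}" for \<omega>
  define \<eta> where "\<eta> n = inverse (real (Suc n))" for n
  have \<eta>: "0 < \<eta> n" for n by (simp add: \<eta>_def)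
  obtain Q0 :: "(real^'n) set" where Q0: "countable Q0" "\<And>S. open S \<Longrightarrow> S \<noteq> {} \<Longrightarrow> \<exists>d\<in>Q0. d \<in> S"
    using countable_dense_exists by blast
  define FF where "FF n = {F. finite F \<and> F \<subseteq> Q0 \<and> F \<noteq> {} \<and> (\<exists>L. good L \<and> close_sets (\<eta> n) F L)}" for n
  have FF_countable: "countable (FF n)" for n
    by (rule countable_subset[OF _ countable_Collect_finite_subset[OF Q0(1)]]) (auto simp: FF_def)
  define H where "H F n = {\<omega> \<in> space N. \<forall>t\<in>{0..T}. X t \<omega> \<in> (\<Union>y\<in>F. cball y (\<eta> n))}
      \<inter> (\<Inter>y\<in>F. {\<omega> \<in> space N. \<exists>t\<in>{0..T}. X t \<omega> \<in> ball y (\<eta> n)})" for F n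
  have H_sets: "H F n \<in> sets N" if "F \<in> FF n" for F n
    unfolding H_def using that
    by (intro sets.Int stays_closed_measurable sets.finite_INT meets_open_measurable closed_UN) (auto simp: FF_def)
  have H_close: "close_sets (\<eta> n) (\<Gamma> \<omega>) F" if w: "\<omega> \<in> H F n" for \<omega> F n
    unfolding close_sets_def \<Gamma>_def
  proof (intro conjI ballI)
    fix x assume "x \<in> (\<lambda>t. X t \<omega>) ` {0..T}"
    then show "\<exists>y\<in>F. dist x y \<le> \<eta> n" using that by (fastforce simp: H_def dist_commute)
  next
    fix y assume "y \<in> F"
    then obtain t where "t \<in> {0..T}" "X t \<omega> \<in> ball y (\<eta> n)" using w unfolding H_def by blast
    then show "\<exists>x\<in>(\<lambda>t. X t \<omega>) ` {0..T}. dist y x \<le> \<eta> n" by (auto intro!: bexI[of _ t])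
  qed
  have "{\<omega> \<in> space N. good (\<Gamma> \<omega>)} = (\<Inter>n. \<Union>F\<in>FF n. H F n)"
  proof (intro equalityI subsetI)
    fix \<omega> assume "\<omega> \<in> {\<omega> \<in> space N. good (\<Gamma> \<omega>)}"
    then have \<omega>: "\<omega> \<in> space N" "good (\<Gamma> \<omega>)" by auto
    have "\<exists>F\<in>FF n. \<omega> \<in> H F n" for n
    proof -
      have comp: "compact (\<Gamma> \<omega>)" unfolding \<Gamma>_def by (rule trace_compact[OF \<omega>(1) T])
      have sub: "\<Gamma> \<omega> \<subseteq> (\<Union>y\<in>Q0. ball y (\<eta> n))"
      proof
        fix x assume "x \<in> \<Gamma> \<omega>"
        obtain d where "d \<in> Q0" "d \<in> ball x (\<eta> n)" using Q0(2)[of "ball x (\<eta> n)"] \<eta>[of n] by auto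
        then show "x \<in> (\<Union>y\<in>Q0. ball y (\<eta> n))" by (auto simp: dist_commute)
      qed
      obtain F0 where F0: "F0 \<subseteq> Q0" "finite F0" "\<Gamma> \<omega> \<subseteq> (\<Union>y\<in>F0. ball y (\<eta> n))"
        by (rule compactE_image[OF comp _ sub]) auto
      define F where "F = {y \<in> F0. ball y (\<eta> n) \<inter> \<Gamma> \<omega> \<noteq> {}}"
      have cover: "\<exists>y\<in>F. x \<in> ball y (\<eta> n)" if x: "x \<in> \<Gamma> \<omega>" for x
      proof -
        obtain y where "y \<in> F0" "x \<in> ball y (\<eta> n)" using F0(3) x by blast
        then show ?thesis using x by (intro bexI[of _ y]) (auto simp: F_def)
      qed
      have inH: "\<omega> \<in> H F n"
        unfolding H_def
      proof (intro IntI CollectI conjI \<omega>(1) ballI INT_I)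
        fix t assume "t \<in> {0..T}"
        then obtain y where "y \<in> F" "X t \<omega> \<in> ball y (\<eta> n)" using cover[of "X t \<omega>"] by (auto simp: \<Gamma>_def)
        then show "X t \<omega> \<in> (\<Union>y\<in>F. cball y (\<eta> n))" by (intro UN_I[of y]) auto
      next
        fix y assume "y \<in> F"
        then show "\<exists>t\<in>{0..T}. X t \<omega> \<in> ball y (\<eta> n)" by (auto simp: F_def \<Gamma>_def)
      qed
      have "X 0 \<omega> \<in> \<Gamma> \<omega>" using T by (simp add: \<Gamma>_def)
      then have "F \<noteq> {}" using cover by blast
      moreover have "close_sets (\<eta> n) F (\<Gamma> \<omega>)" using H_close[OF inH] by (simp add: close_sets_def)
      ultimately have "F \<in> FF n" using F0 \<omega>(2) by (auto simp: FF_def F_def)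
      then show ?thesis using inH by blast
    qed
    then show "\<omega> \<in> (\<Inter>n. \<Union>F\<in>FF n. H F n)" by blast
  next
    fix \<omega> assume a: "\<omega> \<in> (\<Inter>n. \<Union>F\<in>FF n. H F n)"
    have \<omega>: "\<omega> \<in> space N" using a by (auto simp: H_def)
    have comp: "compact (\<Gamma> \<omega>)" "\<Gamma> \<omega> \<noteq> {}" using trace_compact[OF \<omega> T] by (simp_all add: \<Gamma>_def)
    have "bottleneck_dist (persistence_diagram TYPE('k) q (\<Gamma> \<omega>)) (D q) \<le> ereal c" for q
    proof (rule ereal_le_epsilon2)
      fix e :: real assume "0 < e"
      then obtain n where n: "\<eta> n < e / 2" using reals_Archimedean[of "e / 2"] by (auto simp: \<eta>_def)
      obtain F where F: "F \<in> FF n" "\<omega> \<in> H F n" using a by blast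
      then obtain L where L: "good L" "close_sets (\<eta> n) F L" by (auto simp: FF_def)
      have m: "diagram_matching (\<eta> n + \<eta> n) (persistence_diagram TYPE('k) q (\<Gamma> \<omega>)) (persistence_diagram TYPE('k) q L)"
        using L(1) comp \<eta>[of n] by (intro close_sets_matching close_sets_trans[OF H_close[OF F(2)] L(2)]) (auto simp: good_def)
      have "bottleneck_dist (persistence_diagram TYPE('k) q (\<Gamma> \<omega>)) (D q)
          \<le> ereal (\<eta> n + \<eta> n) + bottleneck_dist (persistence_diagram TYPE('k) q L) (D q)"
        by (rule bottleneck_dist_matching[OF m]) (use \<eta>[of n] in simp)
      also have "\<dots> \<le> ereal e + ereal c" using n L(1) by (intro add_mono) (auto simp: good_def)
      also have "\<dots> = ereal c + ereal e" by simp
      finally show "bottleneck_dist (persistence_diagram TYPE('k) q (\<Gamma> \<omega>)) (D q) \<le> ereal c + ereal e" .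
    qed
    then show "\<omega> \<in> {\<omega> \<in> space N. good (\<Gamma> \<omega>)}" using \<omega> comp by (simp add: good_def)
  qed
  moreover have "(\<Inter>n. \<Union>F\<in>FF n. H F n) \<in> sets N"
    using FF_countable H_sets by (intro sets.countable_INT sets.countable_UN'') (auto intro!: sets.countable_UN'')
  moreover have "{\<omega> \<in> space N. good (\<Gamma> \<omega>)} = {\<omega> \<in> space N. \<forall>q. bottleneck_dist (persistence_diagram TYPE('k) q ((\<lambda>t. X t \<omega>) ` {0..T})) (D q) \<le> ereal c}"
    using trace_compact T by (auto simp: good_def \<Gamma>_def)
  ultimately show ?thesis by simp
qed

end

text \<open>The summand \<open>2\<close> in the constant pays for the time \<open>2 * s\<close> before the decay sets in, and \<open>ln a / ln 2\<close>
  pays for the factor \<open>a\<close> because \<open>ln 2 \<le> ln n\<close>.\<close>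

lemma exp_rate_bound:
  fixes a :: real
  assumes A: "0 < A" and \<kappa>: "0 < \<kappa>" and a: "1 \<le> a" and n: "2 \<le> n" and \<delta>: "0 < \<delta>" "\<delta> < 1" and s: "0 < s"
    and T: "(2 + 2 * A * (1 + ln a / ln 2)) * (s + inverse \<kappa> * (ln (real n) + ln (1 / \<delta>))) \<le> T"
  shows "2 * s \<le> T" "a * exp (- (T - 2 * s) / (2 * (A / \<kappa>))) \<le> \<delta> / real n"
proof -
  define L where "L = ln (real n) + ln (1 / \<delta>)"
  have ln2: "0 < ln (2::real)" "ln 2 \<le> ln (real n)" using n by auto
  have l\<delta>: "0 \<le> ln (1 / \<delta>)" using \<delta> by simp
  have L: "ln 2 \<le> L" "0 < L" using ln2 l\<delta> unfolding L_def by linarith+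
  have la: "0 \<le> ln a" using a by simp
  define c where "c = 2 * A * (1 + ln a / ln 2)"
  have c: "0 < c" using A la ln2 by (auto simp: c_def intro!: mult_pos_pos add_pos_nonneg)
  have "2 * s + c * (inverse \<kappa> * L) \<le> (2 + c) * (s + inverse \<kappa> * L)"
    using c s L \<kappa> by (simp add: algebra_simps)
  also have "\<dots> \<le> T" using T by (simp add: c_def L_def)
  finally have T': "2 * s + c * (inverse \<kappa> * L) \<le> T" .
  have "0 \<le> c * (inverse \<kappa> * L)" using c L \<kappa> by simp
  then show "2 * s \<le> T" using T' by simp
  have "ln a = ln a / ln 2 * ln 2" using ln2 by simp
  also have "\<dots> \<le> ln a / ln 2 * L" using L la ln2 by (intro mult_left_mono) auto
  finally have "L + ln a \<le> (1 + ln a / ln 2) * L" by (simp add: algebra_simps)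
  also have "\<dots> = c * (inverse \<kappa> * L) / (2 * (A / \<kappa>))" using A \<kappa> by (simp add: c_def field_simps)
  also have "\<dots> \<le> (T - 2 * s) / (2 * (A / \<kappa>))" using T' A \<kappa> by (intro divide_right_mono) auto
  finally have "- (T - 2 * s) / (2 * (A / \<kappa>)) \<le> - (L + ln a)" unfolding minus_divide_left[symmetric] by linarith
  then have "a * exp (- (T - 2 * s) / (2 * (A / \<kappa>))) \<le> a * exp (- (L + ln a))" using a by (intro mult_left_mono) auto
  also have "\<dots> = a * (exp (- L) * inverse a)" using a by (simp add: exp_diff exp_minus divide_inverse)
  also have "\<dots> = exp (- L)" using a by simp
  also have "exp (- L) = \<delta> / real n"
    using n \<delta> by (simp add: L_def exp_diff exp_add exp_minus ln_div field_simps)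
  finally show "a * exp (- (T - 2 * s) / (2 * (A / \<kappa>))) \<le> \<delta> / real n" .
qed

theorem corollary8p1:
  fixes M U :: "(real^'n) set"
    and c_ie \<rho>_ie c_vol C_vol \<rho>_vol \<rho>_ch L_ch s\<^sub>0 a_hk :: real
  assumes dimension: "2 \<le> CARD('n)"
    and domain: "open U" "connected U" "bounded U" "M = closure U"
    and positive_reach: "0 < reach M"
    and intrinsic: "1 \<le> c_ie" "0 < \<rho>_ie"
      "\<And>x y. x \<in> M \<Longrightarrow> y \<in> M \<Longrightarrow> dist x y < \<rho>_ie \<Longrightarrow> intrinsic_dist M x y \<le> ennreal (c_ie * dist x y)"
    and volume: "0 < c_vol" "0 < C_vol" "0 < \<rho>_vol"
      "\<And>x \<epsilon>. x \<in> M \<Longrightarrow> 0 < \<epsilon> \<Longrightarrow> \<epsilon> < \<rho>_vol \<Longrightarrow>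
         c_vol * \<epsilon> ^ CARD('n) \<le> measure (normalized_volume M) (intrinsic_ball M x \<epsilon>) \<and>
         measure (normalized_volume M) (intrinsic_ball M x \<epsilon>) \<le> C_vol * \<epsilon> ^ CARD('n)"
    and admissible: "0 < \<rho>_ch" "1 \<le> L_ch" "admissible_reflecting_domain M \<rho>_ch L_ch"
    and domination: "0 < s\<^sub>0" "1 \<le> a_hk"
  shows "\<exists>C>0. \<exists>\<epsilon>\<^sub>0>0.
    \<forall>(N :: 'w measure) (X :: real \<Rightarrow> 'w \<Rightarrow> real^'n) (P :: real^'n \<Rightarrow> 'w measure) p.
      reflected_brownian_motion M N X P \<and> heat_kernel M N X P p \<and>
      (\<forall>t\<ge>s\<^sub>0. \<forall>x\<in>M. \<forall>y\<in>M. p t x y \<le> a_hk) \<longrightarrow>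
      (\<forall>\<epsilon> \<delta> z T.
         0 < \<epsilon> \<and> \<epsilon> < \<epsilon>\<^sub>0 \<and> 0 < \<delta> \<and> \<delta> < 1 \<and> z \<in> M \<and>
         C * (s\<^sub>0 + inverse (kappa CARD('n) \<epsilon>) * (ln (real (covering_number M \<epsilon>)) + ln (1 / \<delta>))) \<le> T \<longrightarrow>
         1 - \<delta> \<le> measure (P z) {\<omega> \<in> space (P z). \<forall>q.
           bottleneck_dist (persistence_diagram TYPE('k::field) q ((\<lambda>t. X t \<omega>) ` {0..T}))
                           (persistence_diagram TYPE('k) q M) \<le> ereal (C * \<epsilon>)})"
proof (cases "M = {}")
  case True
  then show ?thesis by (intro exI[of _ 1] conjI) auto
next
  case False
  have compact: "compact M" using domain by (simp add: compact_closure)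
  have M: "M \<in> sets borel" "emeasure lborel M \<noteq> \<infinity>"
    using borel_compact[OF compact] emeasure_compact_finite[OF compact] by auto
  have M0: "emeasure lborel M \<noteq> 0"
  proof
    assume "emeasure lborel M = 0"
    moreover have "U \<subseteq> M" using domain(4) closure_subset by blast
    ultimately have "emeasure lborel U = 0" using M(1) emeasure_mono[of U M lborel] by simp
    then have "U \<in> null_sets lborel" using domain(1) by (intro null_setsI) auto
    then have "negligible U" unfolding negligible_iff_null_sets by (rule null_sets_completionI)
    then have "U = {}" using open_not_negligible[OF domain(1)] by blast
    then show False using False domain(4) by simp
  qed
  note vol = M(1) M0 M(2)
  note M_pos = measure_lborel_pos[OF M0 M(2)]
  obtain \<rho> where \<rho>: "0 < \<rho>" "\<And>z. 0 < infdist z M \<Longrightarrow> infdist z M < \<rho> \<Longrightarrow> \<exists>!y. y \<in> M \<and> dist z y = infdist z M"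
    using positive_reach_unique_nearest[OF positive_reach] by blast
  have vol_balls: "c_vol * measure lborel M * \<epsilon> ^ DIM(real^'n) \<le> measure lborel (M \<inter> cball x \<epsilon>)"
    if "x \<in> M" "0 < \<epsilon>" "\<epsilon> < \<rho>_vol" for x \<epsilon>
    using volume_in_balls[OF vol _ conjunct1[OF volume(4)[OF that]]] volume(1) that(2) by (simp add: mult.commute mult.left_commute)
  obtain \<epsilon>' r' where er: "0 < \<epsilon>'" "0 < r'"
    "\<And>x. x \<in> M \<Longrightarrow> \<exists>w\<in>cball x \<epsilon>'. \<forall>s. 0 < s \<longrightarrow> s \<le> 1 \<longrightarrow> cball (x + s *\<^sub>R (w - x)) (s * r') \<subseteq> M"
    using uniform_interior_cones[OF compact \<rho>(1) mult_pos_pos[OF volume(1) M_pos] volume(3) \<rho>(2) vol_balls] by blast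
  obtain R c where Rc: "0 < R" "0 < c" "c \<le> 1"
    "\<And>x. x \<in> M \<Longrightarrow> \<exists>e. norm e = 1 \<and> axis_cone x e c R \<subseteq> interior M"
    using axis_cones[OF er] by blast
  obtain CP where CP: "0 < CP"
    "\<And>g. g \<in> H1 M \<Longrightarrow> L2_inner M g g - (\<integral>x. g x \<partial>normalized_volume M)\<^sup>2 \<le> CP * dirichlet_form M g g"
    using neumann_poincare[OF vol admissible(3)] by blast
  obtain A \<epsilon>1 where A: "0 < A" "0 < \<epsilon>1" "\<epsilon>1 \<le> exp (- 1)"
    "\<And>\<epsilon> x. 0 < \<epsilon> \<Longrightarrow> \<epsilon> < \<epsilon>1 \<Longrightarrow> x \<in> M \<Longrightarrow> \<exists>A'\<ge>0. \<forall>g\<in>H1 M. L2_inner M g g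
      \<le> A / kappa CARD('n) \<epsilon> * dirichlet_form M g g + A' * (\<integral>y. indicator (ball x \<epsilon>) y * (g y)\<^sup>2 \<partial>normalized_volume M)"
    using poincare_with_ball[OF dimension vol CP Rc] by blast
  define C where "C = 2 + 2 * A * (1 + ln a_hk / ln 2)"
  have "0 \<le> ln a_hk / ln 2" using domination(2) by (intro divide_nonneg_nonneg) auto
  then have C2: "2 \<le> C" using A(1) by (auto simp: C_def)
  \<comment> \<open>the bound \<open>1 / C_vol\<close> makes the volume of an intrinsic ball less than that of \<open>M\<close>\<close>
  define \<epsilon>\<^sub>0 where "\<epsilon>\<^sub>0 = min (min \<epsilon>1 \<rho>_vol) (min 1 (1 / C_vol))"
  have \<epsilon>0: "0 < \<epsilon>\<^sub>0" using A(2) volume by (simp add: \<epsilon>\<^sub>0_def)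
  have main: "1 - \<delta> \<le> measure (P z) {\<omega> \<in> space (P z). \<forall>q.
      bottleneck_dist (persistence_diagram TYPE('k) q ((\<lambda>t. X t \<omega>) ` {0..T})) (persistence_diagram TYPE('k) q M) \<le> ereal (C * \<epsilon>)}"
    if rbm: "reflected_brownian_motion M N X P" and hk: "heat_kernel M N X P p"
      and dom: "\<forall>t\<ge>s\<^sub>0. \<forall>x\<in>M. \<forall>y\<in>M. p t x y \<le> a_hk"
      and \<epsilon>: "0 < \<epsilon>" "\<epsilon> < \<epsilon>\<^sub>0" and \<delta>: "0 < \<delta>" "\<delta> < 1" and z: "z \<in> M"
      and T: "C * (s\<^sub>0 + inverse (kappa CARD('n) \<epsilon>) * (ln (real (covering_number M \<epsilon>)) + ln (1 / \<delta>))) \<le> T"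
    for N :: "'w measure" and X P p \<epsilon> \<delta> z T
  proof -
    interpret reflected_process M N X P using vol rbm by unfold_locales
    interpret Pz: prob_space "P z" by (rule P_prob[OF z])
    define n where "n = covering_number M \<epsilon>"
    have \<epsilon>b: "\<epsilon> < \<epsilon>1" "\<epsilon> < \<rho>_vol" "\<epsilon> < 1" "\<epsilon> < 1 / C_vol" using \<epsilon> by (auto simp: \<epsilon>\<^sub>0_def)
    have \<kappa>: "0 < kappa CARD('n) \<epsilon>" using kappa_bounds[OF \<epsilon>(1), of "CARD('n)"] \<epsilon>b(1) A(3) by simp
    obtain x where x: "\<And>i. i < n \<Longrightarrow> x i \<in> M" "M \<subseteq> (\<Union>i<n. intrinsic_ball M (x i) \<epsilon>)"
      unfolding n_def using covering_number_attained[OF compact _ intrinsic(2) \<epsilon>(1) intrinsic(3)] intrinsic(1)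
      by (metis less_le_trans zero_less_one)
    have n2: "2 \<le> n"
    proof (rule two_le_covering_number[OF vol x])
      fix y assume y: "y \<in> M"
      have "measure (normalized_volume M) (intrinsic_ball M y \<epsilon>) \<le> C_vol * \<epsilon> ^ CARD('n)"
        using volume(4)[OF y \<epsilon>(1) \<epsilon>b(2)] by simp
      also have "\<epsilon> ^ CARD('n) \<le> \<epsilon> ^ 1" using \<epsilon> \<epsilon>b dimension by (intro power_decreasing) auto
      then have "C_vol * \<epsilon> ^ CARD('n) \<le> C_vol * \<epsilon>" using volume(2) by simp
      also have "C_vol * \<epsilon> < 1" using \<epsilon>b(4) volume(2) by (simp add: less_divide_eq mult.commute)
      finally show "measure (normalized_volume M) (intrinsic_ball M y \<epsilon>) < 1" .
    qed
    have rate: "2 * s\<^sub>0 \<le> T" "a_hk * exp (- (T - 2 * s\<^sub>0) / (2 * (A / kappa CARD('n) \<epsilon>))) \<le> \<delta> / real n"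
      using exp_rate_bound[OF A(1) \<kappa> domination(2) n2 \<delta> domination(1), of T] T by (auto simp: C_def n_def)
    have T0: "0 \<le> T" using rate(1) domination(1) by simp
    have dens: "emeasure (P z) {\<omega> \<in> space N. X s\<^sub>0 \<omega> \<in> B} \<le> ennreal a_hk * emeasure (normalized_volume M) B"
      if B: "B \<in> sets borel" for B
    proof -
      have "emeasure (P z) {\<omega> \<in> space N. X s\<^sub>0 \<omega> \<in> B}
          = (\<integral>\<^sup>+y. indicator (M \<inter> B) y * ennreal (p s\<^sub>0 z y) \<partial>normalized_volume M)"
        using hk domination(1) z B unfolding heat_kernel_def by blast
      also have "\<dots> \<le> (\<integral>\<^sup>+y. ennreal a_hk * indicator B y \<partial>normalized_volume M)"
        using dom z by (intro nn_integral_mono) (auto simp: indicator_def intro!: ennreal_leI)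
      also have "\<dots> = ennreal a_hk * emeasure (normalized_volume M) B"
        using B by (intro nn_integral_cmult_indicator) (simp add: sets_normalized_volume)
      finally show ?thesis .
    qed
    have "\<exists>E. E \<in> sets N \<and> (\<forall>\<omega>. \<omega> \<in> space N \<longrightarrow> \<omega> \<notin> E \<longrightarrow> (\<exists>t\<in>{0..T}. X t \<omega> \<in> ball (x i) \<epsilon>)) \<and>
        emeasure (P z) E \<le> ennreal (\<delta> / real n)" if i: "i < n" for i
    proof -
      obtain A' where A': "0 \<le> A'" "\<And>g. g \<in> H1 M \<Longrightarrow> L2_inner M g g \<le> A / kappa CARD('n) \<epsilon> * dirichlet_form M g g
          + A' * (\<integral>y. indicator (ball (x i) \<epsilon>) y * (g y)\<^sup>2 \<partial>normalized_volume M)"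
        using A(4)[OF \<epsilon>(1) \<epsilon>b(1) x(1)[OF i]] by blast
      have pos: "0 < A / kappa CARD('n) \<epsilon>" "0 \<le> a_hk" "ball (x i) \<epsilon> \<in> sets borel"
        using A(1) \<kappa> domination(2) by auto
      obtain E where E: "E \<in> sets N" "\<And>\<omega>. \<omega> \<in> space N \<Longrightarrow> \<omega> \<notin> E \<Longrightarrow> \<exists>t\<in>{0..T}. X t \<omega> \<in> ball (x i) \<epsilon>"
        "emeasure (P z) E \<le> ennreal (a_hk * exp (- (T - 2 * s\<^sub>0) / (2 * (A / kappa CARD('n) \<epsilon>))))"
        using miss_probability[OF z pos(3) domination(1) rate(1) dens pos(2,1) A'] by blast
      have "emeasure (P z) E \<le> ennreal (\<delta> / real n)" by (rule order_trans[OF E(3) ennreal_leI[OF rate(2)]])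
      then show ?thesis using E(1,2) by (intro exI[of _ E]) simp
    qed
    then obtain E where E: "\<And>i. i < n \<Longrightarrow> E i \<in> sets N"
      "\<And>i \<omega>. i < n \<Longrightarrow> \<omega> \<in> space N \<Longrightarrow> \<omega> \<notin> E i \<Longrightarrow> \<exists>t\<in>{0..T}. X t \<omega> \<in> ball (x i) \<epsilon>"
      "\<And>i. i < n \<Longrightarrow> emeasure (P z) (E i) \<le> ennreal (\<delta> / real n)"
      by metis
    let ?bad = "\<Union>i<n. E i"
    let ?good = "{\<omega> \<in> space N. \<forall>q. bottleneck_dist (persistence_diagram TYPE('k) q ((\<lambda>t. X t \<omega>) ` {0..T}))
      (persistence_diagram TYPE('k) q M) \<le> ereal (C * \<epsilon>)}"
    have EP: "E i \<in> sets (P z)" if "i < n" for i using E(1)[OF that] P_sets[OF z] by simp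
    have badP: "?bad \<in> sets (P z)" using EP by auto
    have "measure (P z) ?bad \<le> (\<Sum>i<n. measure (P z) (E i))"
      using EP by (intro Pz.finite_measure_subadditive_finite) auto
    also have "\<dots> \<le> (\<Sum>i<n. \<delta> / real n)"
    proof (rule sum_mono)
      fix i assume "i \<in> {..<n}"
      then have "ennreal (measure (P z) (E i)) \<le> ennreal (\<delta> / real n)" using E(3) by (simp add: Pz.emeasure_eq_measure)
      then show "measure (P z) (E i) \<le> \<delta> / real n" using \<delta> by (simp add: ennreal_le_iff)
    qed
    also have "\<dots> = \<delta>" using n2 by simp
    finally have bad: "measure (P z) ?bad \<le> \<delta>" .
    have sub: "space (P z) - ?bad \<subseteq> ?good"
    proof
      fix \<omega> assume \<omega>: "\<omega> \<in> space (P z) - ?bad"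
      then have \<omega>N: "\<omega> \<in> space N" using P_space[OF z] by simp
      define \<Gamma> where "\<Gamma> = (\<lambda>t. X t \<omega>) ` {0..T}"
      have \<Gamma>: "compact \<Gamma>" "\<Gamma> \<noteq> {}" using trace_compact[OF \<omega>N T0] by (simp_all add: \<Gamma>_def)
      have "bottleneck_dist (persistence_diagram TYPE('k) q \<Gamma>) (persistence_diagram TYPE('k) q M) \<le> ereal (C * \<epsilon>)" for q
      proof -
        have "diagram_matching (2 * \<epsilon>) (persistence_diagram TYPE('k) q \<Gamma>) (persistence_diagram TYPE('k) q M)"
        proof (rule diagram_matching_offsets[OF \<Gamma> compact False])
          fix y assume "y \<in> \<Gamma>"
          then have "y \<in> M" using X_in[OF \<omega>N] by (auto simp: \<Gamma>_def)
          then show "infdist y M \<le> 2 * \<epsilon>" using \<epsilon>(1) by simp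
        next
          fix y assume "y \<in> M"
          then obtain i where i: "i < n" "y \<in> intrinsic_ball M (x i) \<epsilon>" using x(2) by blast
          have "\<omega> \<notin> E i" using \<omega> i(1) by blast
          then obtain t where t: "t \<in> {0..T}" "X t \<omega> \<in> ball (x i) \<epsilon>" using E(2)[OF i(1) \<omega>N] by blast
          have "dist y (X t \<omega>) \<le> dist (x i) y + dist (x i) (X t \<omega>)" by (rule dist_triangle3)
          also have "\<dots> \<le> 2 * \<epsilon>" using t(2) i(2) intrinsic_ball_subset[of M "x i" \<epsilon>] by auto
          finally show "infdist y \<Gamma> \<le> 2 * \<epsilon>" using t(1) by (intro infdist_le2[of "X t \<omega>"]) (auto simp: \<Gamma>_def)
        qed (use \<epsilon>(1) in simp)
        then have "bottleneck_dist (persistence_diagram TYPE('k) q \<Gamma>) (persistence_diagram TYPE('k) q M) \<le> ereal (2 * \<epsilon>)"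
          by (rule bottleneck_dist_le) (use \<epsilon>(1) in simp)
        also have "\<dots> \<le> ereal (C * \<epsilon>)" using C2 \<epsilon>(1) by simp
        finally show ?thesis .
      qed
      then show "\<omega> \<in> ?good" using \<omega>N by (simp add: \<Gamma>_def)
    qed
    have goodP: "?good \<in> sets (P z)" using diagram_event_measurable[OF T0] P_sets[OF z] by simp
    have "1 - \<delta> \<le> 1 - measure (P z) ?bad" using bad by simp
    also have "\<dots> = measure (P z) (space (P z) - ?bad)" using Pz.prob_compl[OF badP] by simp
    also have "\<dots> \<le> measure (P z) ?good" by (rule Pz.finite_measure_mono[OF sub goodP])
    finally show ?thesis by (simp add: P_space[OF z])
  qed
  show ?thesis
    by (rule exI[of _ C], rule conjI, use C2 in simp, rule exI[of _ \<epsilon>\<^sub>0], rule conjI[OF \<epsilon>0], intro allI impI, elim conjE, rule main)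
qed

end
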